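(* Let $\mathcal{H}$ be a quasitriangular Hopf algebra over $k$ with universal R-matrix $\mathcal{R}$ and let $\mathcal{L}$ be an $\mathcal{H}$-commutative module algebra. Let $\mathcal{M}'_{\mathcal{H}}$ be the full subcategory of the category of left $\mathcal{H}$-modules consisting of those $X$ such that $$\mathcal{R}^+_1\triangleright x\otimes\mathcal{R}^+_2\triangleright\lambda=\mathcal{R}^-_1\triangleright x\otimes\mathcal{R}^-_2\triangleright\lambda\quad\text{for all }x\otimes\lambda\in X\otimes\mathcal{L},$$ and let $\overline{\mathcal{M}}'_{\mathcal{H},\mathcal{L}}$ be the full subcategory of the dynamical category $\overline{\mathcal{M}}_{\mathcal{H},\mathcal{L}}$ whose objects belong to $\mathcal{M}'_{\mathcal{H}}$. Then $\overline{\mathcal{M}}'_{\mathcal{H},\mathcal{L}}$ is a braided monoidal category. It is naturally isomorphic to the category $\mathrm{Mod}_0\,\mathcal{H}_{\mathcal{L}}$, the full subcategory of $\mathcal{H}_{\mathcal{L}}$-modules of the form $X\otimes\mathcal{L}$ with $X\in\mathcal{M}'_{\mathcal{H}}$, which itself is a full subcategory in $\mathrm{Mod}\,\mathcal{L}\rtimes\mathcal{H}$.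
   Context: $k$ is a field of characteristic zero (or a ring of formal power series over such a field); algebras are associative unital $k$-algebras, $\otimes=\otimes_k$; modules are left; Hopf algebras have invertible antipode. $\mathcal{R}$ satisfies $(\Delta\otimes\mathrm{id})(\mathcal{R})=\mathcal{R}_{13}\mathcal{R}_{23}$, $(\mathrm{id}\otimes\Delta)(\mathcal{R})=\mathcal{R}_{13}\mathcal{R}_{12}$, $\mathcal{R}\Delta(h)=\Delta^{op}(h)\mathcal{R}$; $\mathcal{R}^+=\mathcal{R}$, $\mathcal{R}^-=\mathcal{R}_{21}^{-1}$. $\mathcal{L}$ is $\mathcal{H}$-commutative if $\lambda\mu=(\mathcal{R}_2\triangleright\mu)(\mathcal{R}_1\triangleright\lambda)$. $\mathcal{L}$ is regarded as the base algebra $\mathcal{L}_+$, with $\mathcal{H}$-coaction $\delta^+(\lambda)=\lambda^{(1)}\otimes\lambda^{[2]}=\mathcal{R}^{-1}_1\otimes\mathcal{R}^{-1}_2\triangleright\lambda$. **Dynamical category.** $\overline{\mathcal{M}}_{\mathcal{H},\mathcal{L}}$ has left $\mathcal{H}$-modules as objects; $\mathrm{Hom}(X,Y)$ is the set of $\mathcal{H}$-equivariant linear maps $X\to Y\otimes\mathcal{L}$; the composition of $\phi\in\mathrm{Hom}(X,Y)$, $\psi\in\mathrm{Hom}(Y,Z)$ is $X\xrightarrow{\phi}Y\otimes\mathcal{L}\xrightarrow{\psi\otimes\mathrm{id}}Z\otimes\mathcal{L}\otimes\mathcal{L}\xrightarrow{\mathrm{id}\otimes m_{\mathcal{L}}}Z\otimes\mathcal{L}$;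 the tensor product of objects is that of $\mathcal{H}$-modules; the tensor product of $\phi\in\mathrm{Hom}(X,X')$, $\psi\in\mathrm{Hom}(Y,Y')$ is $X\otimes Y\xrightarrow{\phi\otimes\psi}X'\otimes\mathcal{L}\otimes Y'\otimes\mathcal{L}\xrightarrow{\tau}X'\otimes Y'\otimes\mathcal{L}\otimes\mathcal{L}\xrightarrow{m_{\mathcal{L}}}X'\otimes Y'\otimes\mathcal{L}$ with $\tau(\lambda\otimes y)=\lambda^{(1)}\triangleright y\otimes\lambda^{[2]}$. **Bialgebroids.** $\mathcal{L}\rtimes\mathcal{H}$ is the smash product algebra, $(\lambda\otimes f)(\mu\otimes g)=\lambda(f^{(1)}\triangleright\mu)\otimes f^{(2)}g$, with the $\mathcal{L}$-bialgebroid structure given by source $s(\lambda)=\lambda\otimes1$, target $t^+(\lambda)=\mathcal{R}_2\triangleright\lambda\otimes\mathcal{R}_1$, coproduct $\Delta(\lambda\otimes h)=(\lambda\otimes h^{(1)})\otimes_{\mathcal{L}}(1\otimes h^{(2)})$, counit $\varepsilon(\lambda\otimes h)=\lambda\varepsilon(h)$; here the $\mathcal{L}$-bimodule structure on modules is given by $\lambda\cdot m=s(\lambda)m$, $m\cdot\lambda=t^+(\lambda)m$, and modules form a monoidal category under $\otimes_{\mathcal{L}}$ via $\Delta$. $\mathcal{H}_{\mathcal{L}}$ is the quotient bialgebroid of $\mathcal{L}\rtimes\mathcal{H}$ by the two-sided ideal (a biideal) generated by $t^+(\lambda)-t^-(\lambda)$, $\lambda\in\mathcal{L}$, where $t^-(\lambda)=\mathcal{R}^-_2\triangleright\lambda\otimes\mathcal{R}^-_1$.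 **Module structure on $X\otimes\mathcal{L}$ and the functor.** $\mathcal{L}\rtimes\mathcal{H}$ acts on $X\otimes\mathcal{L}$ by $\lambda\cdot(x\otimes\mu)=\lambda^{(1)}\triangleright x\otimes\lambda^{[2]}\mu$ and $h\cdot(x\otimes\mu)=h^{(1)}\triangleright x\otimes h^{(2)}\triangleright\mu$. The natural isomorphism is the restriction of the monoidal functor $\Xi$, $X\mapsto X\otimes\mathcal{L}$, sending $\psi:X\to Y\otimes\mathcal{L}$ to the composition $X\otimes\mathcal{L}\xrightarrow{\psi\otimes\mathrm{id}}Y\otimes\mathcal{L}\otimes\mathcal{L}\xrightarrow{\mathrm{id}\otimes m_{\mathcal{L}}}Y\otimes\mathcal{L}$. *)

theory Defs
  imports "HOL-Algebra.QuotRing" "HOL-Algebra.Module"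
begin

section \<open>Categories\<close>

text \<open>Hom-sets of different pairs of objects need not be disjoint, so identities and composites
  carry the objects involved: \<open>Cmp C X Y Z g f\<close> is the composite of \<open>f : X \<rightarrow> Y\<close> and \<open>g : Y \<rightarrow> Z\<close>, and
  \<open>TenM C X X' Y Y' f g\<close> is the tensor product of \<open>f : X \<rightarrow> X'\<close> and \<open>g : Y \<rightarrow> Y'\<close>.\<close>

record ('o, 'm) cat =
  Ob :: "'o set"
  Hom :: "'o \<Rightarrow> 'o \<Rightarrow> 'm set"
  Idt :: "'o \<Rightarrow> 'm"
  Cmp :: "'o \<Rightarrow> 'o \<Rightarrow> 'o \<Rightarrow> 'm \<Rightarrow> 'm \<Rightarrow> 'm"

record ('o, 'm) moncat = "('o, 'm) cat" +
  TenO :: "'o \<Rightarrow> 'o \<Rightarrow> 'o"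
  TenM :: "'o \<Rightarrow> 'o \<Rightarrow> 'o \<Rightarrow> 'o \<Rightarrow> 'm \<Rightarrow> 'm \<Rightarrow> 'm"
  Unt :: "'o"
  Assoc :: "'o \<Rightarrow> 'o \<Rightarrow> 'o \<Rightarrow> 'm"
  LUnit :: "'o \<Rightarrow> 'm"
  RUnit :: "'o \<Rightarrow> 'm"

locale category =
  fixes C :: "('o, 'm, 'z) cat_scheme"
  assumes Idt_Hom: "X \<in> Ob C \<Longrightarrow> Idt C X \<in> Hom C X X"
    and Cmp_Hom: "\<lbrakk>X \<in> Ob C; Y \<in> Ob C; Z \<in> Ob C; f \<in> Hom C X Y; g \<in> Hom C Y Z\<rbrakk>
      \<Longrightarrow> Cmp C X Y Z g f \<in> Hom C X Z"
    and Cmp_Idt_right: "\<lbrakk>X \<in> Ob C; Y \<in> Ob C; f \<in> Hom C X Y\<rbrakk> \<Longrightarrow> Cmp C X X Y f (Idt C X) = f"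
    and Cmp_Idt_left: "\<lbrakk>X \<in> Ob C; Y \<in> Ob C; f \<in> Hom C X Y\<rbrakk> \<Longrightarrow> Cmp C X Y Y (Idt C Y) f = f"
    and Cmp_assoc: "\<lbrakk>W \<in> Ob C; X \<in> Ob C; Y \<in> Ob C; Z \<in> Ob C;
        f \<in> Hom C W X; g \<in> Hom C X Y; h \<in> Hom C Y Z\<rbrakk>
      \<Longrightarrow> Cmp C W Y Z h (Cmp C W X Y g f) = Cmp C W X Z (Cmp C X Y Z h g) f"

definition inverses_in :: "('o, 'm, 'z) cat_scheme \<Rightarrow> 'o \<Rightarrow> 'o \<Rightarrow> 'm \<Rightarrow> 'm \<Rightarrow> bool" where
  "inverses_in C X Y f g \<longleftrightarrow> f \<in> Hom C X Y \<and> g \<in> Hom C Y X \<and>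
     Cmp C X Y X g f = Idt C X \<and> Cmp C Y X Y f g = Idt C Y"

definition iso_in :: "('o, 'm, 'z) cat_scheme \<Rightarrow> 'o \<Rightarrow> 'o \<Rightarrow> 'm \<Rightarrow> bool" where
  "iso_in C X Y f \<longleftrightarrow> X \<in> Ob C \<and> Y \<in> Ob C \<and> (\<exists>g. inverses_in C X Y f g)"

definition inv_in :: "('o, 'm, 'z) cat_scheme \<Rightarrow> 'o \<Rightarrow> 'o \<Rightarrow> 'm \<Rightarrow> 'm" where
  "inv_in C X Y f = (THE g. inverses_in C X Y f g)"

locale monoidal_category = category C for C :: "('o, 'm, 'z) moncat_scheme" +
  assumes TenO_Ob: "\<lbrakk>X \<in> Ob C; Y \<in> Ob C\<rbrakk> \<Longrightarrow> TenO C X Y \<in> Ob C"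
    and Unt_Ob: "Unt C \<in> Ob C"
    and TenM_Hom: "\<lbrakk>X \<in> Ob C; X' \<in> Ob C; Y \<in> Ob C; Y' \<in> Ob C; f \<in> Hom C X X'; g \<in> Hom C Y Y'\<rbrakk>
      \<Longrightarrow> TenM C X X' Y Y' f g \<in> Hom C (TenO C X Y) (TenO C X' Y')"
    and TenM_Idt: "\<lbrakk>X \<in> Ob C; Y \<in> Ob C\<rbrakk>
      \<Longrightarrow> TenM C X X Y Y (Idt C X) (Idt C Y) = Idt C (TenO C X Y)"
    and TenM_Cmp: "\<lbrakk>X \<in> Ob C; X' \<in> Ob C; X'' \<in> Ob C; Y \<in> Ob C; Y' \<in> Ob C; Y'' \<in> Ob C;
        f \<in> Hom C X X'; f' \<in> Hom C X' X''; g \<in> Hom C Y Y'; g' \<in> Hom C Y' Y''\<rbrakk>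
      \<Longrightarrow> TenM C X X'' Y Y'' (Cmp C X X' X'' f' f) (Cmp C Y Y' Y'' g' g) =
          Cmp C (TenO C X Y) (TenO C X' Y') (TenO C X'' Y'')
            (TenM C X' X'' Y' Y'' f' g') (TenM C X X' Y Y' f g)"
    and Assoc_iso: "\<lbrakk>X \<in> Ob C; Y \<in> Ob C; Z \<in> Ob C\<rbrakk>
      \<Longrightarrow> iso_in C (TenO C (TenO C X Y) Z) (TenO C X (TenO C Y Z)) (Assoc C X Y Z)"
    and LUnit_iso: "X \<in> Ob C \<Longrightarrow> iso_in C (TenO C (Unt C) X) X (LUnit C X)"
    and RUnit_iso: "X \<in> Ob C \<Longrightarrow> iso_in C (TenO C X (Unt C)) X (RUnit C X)"
    and Assoc_natural: "\<lbrakk>X \<in> Ob C; X' \<in> Ob C; Y \<in> Ob C; Y' \<in> Ob C; Z \<in> Ob C; Z' \<in> Ob C;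
        f \<in> Hom C X X'; g \<in> Hom C Y Y'; h \<in> Hom C Z Z'\<rbrakk>
      \<Longrightarrow> Cmp C (TenO C (TenO C X Y) Z) (TenO C (TenO C X' Y') Z') (TenO C X' (TenO C Y' Z'))
            (Assoc C X' Y' Z')
            (TenM C (TenO C X Y) (TenO C X' Y') Z Z' (TenM C X X' Y Y' f g) h) =
          Cmp C (TenO C (TenO C X Y) Z) (TenO C X (TenO C Y Z)) (TenO C X' (TenO C Y' Z'))
            (TenM C X X' (TenO C Y Z) (TenO C Y' Z') f (TenM C Y Y' Z Z' g h))
            (Assoc C X Y Z)"
    and LUnit_natural: "\<lbrakk>X \<in> Ob C; Y \<in> Ob C; f \<in> Hom C X Y\<rbrakk>
      \<Longrightarrow> Cmp C (TenO C (Unt C) X) (TenO C (Unt C) Y) Y (LUnit C Y)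
            (TenM C (Unt C) (Unt C) X Y (Idt C (Unt C)) f) =
          Cmp C (TenO C (Unt C) X) X Y f (LUnit C X)"
    and RUnit_natural: "\<lbrakk>X \<in> Ob C; Y \<in> Ob C; f \<in> Hom C X Y\<rbrakk>
      \<Longrightarrow> Cmp C (TenO C X (Unt C)) (TenO C Y (Unt C)) Y (RUnit C Y)
            (TenM C X Y (Unt C) (Unt C) f (Idt C (Unt C))) =
          Cmp C (TenO C X (Unt C)) X Y f (RUnit C X)"
    and pentagon: "\<lbrakk>W \<in> Ob C; X \<in> Ob C; Y \<in> Ob C; Z \<in> Ob C\<rbrakk>
      \<Longrightarrow> Cmp C (TenO C (TenO C (TenO C W X) Y) Z) (TenO C (TenO C W X) (TenO C Y Z))
            (TenO C W (TenO C X (TenO C Y Z)))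
            (Assoc C W X (TenO C Y Z)) (Assoc C (TenO C W X) Y Z) =
          Cmp C (TenO C (TenO C (TenO C W X) Y) Z) (TenO C W (TenO C (TenO C X Y) Z))
            (TenO C W (TenO C X (TenO C Y Z)))
            (TenM C W W (TenO C (TenO C X Y) Z) (TenO C X (TenO C Y Z)) (Idt C W) (Assoc C X Y Z))
            (Cmp C (TenO C (TenO C (TenO C W X) Y) Z) (TenO C (TenO C W (TenO C X Y)) Z)
              (TenO C W (TenO C (TenO C X Y) Z))
              (Assoc C W (TenO C X Y) Z)
              (TenM C (TenO C (TenO C W X) Y) (TenO C W (TenO C X Y)) Z Z
                (Assoc C W X Y) (Idt C Z)))"
    and triangle: "\<lbrakk>X \<in> Ob C; Y \<in> Ob C\<rbrakk>
      \<Longrightarrow> Cmp C (TenO C (TenO C X (Unt C)) Y) (TenO C X (TenO C (Unt C) Y)) (TenO C X Y)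
            (TenM C X X (TenO C (Unt C) Y) Y (Idt C X) (LUnit C Y)) (Assoc C X (Unt C) Y) =
          TenM C (TenO C X (Unt C)) X Y Y (RUnit C X) (Idt C Y)"

locale braided_monoidal_category = monoidal_category C for C :: "('o, 'm, 'z) moncat_scheme" +
  fixes \<beta> :: "'o \<Rightarrow> 'o \<Rightarrow> 'm"
  assumes braid_iso: "\<lbrakk>X \<in> Ob C; Y \<in> Ob C\<rbrakk> \<Longrightarrow> iso_in C (TenO C X Y) (TenO C Y X) (\<beta> X Y)"
    and braid_natural: "\<lbrakk>X \<in> Ob C; X' \<in> Ob C; Y \<in> Ob C; Y' \<in> Ob C;
        f \<in> Hom C X X'; g \<in> Hom C Y Y'\<rbrakk>
      \<Longrightarrow> Cmp C (TenO C X Y) (TenO C X' Y') (TenO C Y' X') (\<beta> X' Y') (TenM C X X' Y Y' f g) =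
          Cmp C (TenO C X Y) (TenO C Y X) (TenO C Y' X') (TenM C Y Y' X X' g f) (\<beta> X Y)"
    and hexagon1: "\<lbrakk>X \<in> Ob C; Y \<in> Ob C; Z \<in> Ob C\<rbrakk>
      \<Longrightarrow> Cmp C (TenO C (TenO C X Y) Z) (TenO C (TenO C Y Z) X) (TenO C Y (TenO C Z X))
            (Assoc C Y Z X)
            (Cmp C (TenO C (TenO C X Y) Z) (TenO C X (TenO C Y Z)) (TenO C (TenO C Y Z) X)
              (\<beta> X (TenO C Y Z)) (Assoc C X Y Z)) =
          Cmp C (TenO C (TenO C X Y) Z) (TenO C Y (TenO C X Z)) (TenO C Y (TenO C Z X))
            (TenM C Y Y (TenO C X Z) (TenO C Z X) (Idt C Y) (\<beta> X Z))
            (Cmp C (TenO C (TenO C X Y) Z) (TenO C (TenO C Y X) Z) (TenO C Y (TenO C X Z))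
              (Assoc C Y X Z)
              (TenM C (TenO C X Y) (TenO C Y X) Z Z (\<beta> X Y) (Idt C Z)))"
    and hexagon2: "\<lbrakk>X \<in> Ob C; Y \<in> Ob C; Z \<in> Ob C\<rbrakk>
      \<Longrightarrow> Cmp C (TenO C X (TenO C Y Z)) (TenO C Z (TenO C X Y)) (TenO C (TenO C Z X) Y)
            (inv_in C (TenO C (TenO C Z X) Y) (TenO C Z (TenO C X Y)) (Assoc C Z X Y))
            (Cmp C (TenO C X (TenO C Y Z)) (TenO C (TenO C X Y) Z) (TenO C Z (TenO C X Y))
              (\<beta> (TenO C X Y) Z)
              (inv_in C (TenO C (TenO C X Y) Z) (TenO C X (TenO C Y Z)) (Assoc C X Y Z))) =
          Cmp C (TenO C X (TenO C Y Z)) (TenO C (TenO C X Z) Y) (TenO C (TenO C Z X) Y)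
            (TenM C (TenO C X Z) (TenO C Z X) Y Y (\<beta> X Z) (Idt C Y))
            (Cmp C (TenO C X (TenO C Y Z)) (TenO C X (TenO C Z Y)) (TenO C (TenO C X Z) Y)
              (inv_in C (TenO C (TenO C X Z) Y) (TenO C X (TenO C Z Y)) (Assoc C X Z Y))
              (TenM C X X (TenO C Y Z) (TenO C Z Y) (Idt C X) (\<beta> Y Z)))"

locale cat_functor = C: category C + D: category D
  for C :: "('o, 'm, 'z) cat_scheme" and D :: "('p, 'n, 'w) cat_scheme" +
  fixes F :: "'o \<Rightarrow> 'p" and Fm :: "'o \<Rightarrow> 'o \<Rightarrow> 'm \<Rightarrow> 'n"
  assumes F_Ob: "X \<in> Ob C \<Longrightarrow> F X \<in> Ob D"
    and F_Hom: "\<lbrakk>X \<in> Ob C; Y \<in> Ob C; f \<in> Hom C X Y\<rbrakk> \<Longrightarrow> Fm X Y f \<in> Hom D (F X) (F Y)"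
    and F_Idt: "X \<in> Ob C \<Longrightarrow> Fm X X (Idt C X) = Idt D (F X)"
    and F_Cmp: "\<lbrakk>X \<in> Ob C; Y \<in> Ob C; Z \<in> Ob C; f \<in> Hom C X Y; g \<in> Hom C Y Z\<rbrakk>
      \<Longrightarrow> Fm X Z (Cmp C X Y Z g f) = Cmp D (F X) (F Y) (F Z) (Fm Y Z g) (Fm X Y f)"

locale fully_faithful_functor = cat_functor +
  assumes F_bij_Hom: "\<lbrakk>X \<in> Ob C; Y \<in> Ob C\<rbrakk>
      \<Longrightarrow> bij_betw (Fm X Y) (Hom C X Y) (Hom D (F X) (F Y))"

locale category_isomorphism = fully_faithful_functor +
  assumes F_bij_Ob: "bij_betw F (Ob C) (Ob D)"

text \<open>\<open>F\<close> identifies \<open>C\<close> with a full subcategory of \<open>D\<close>.\<close>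

locale full_embedding = fully_faithful_functor +
  assumes F_inj_Ob: "inj_on F (Ob C)"

text \<open>A strong monoidal functor, with structure isomorphisms
  \<open>J X Y : F X \<otimes> F Y \<rightarrow> F (X \<otimes> Y)\<close> and \<open>u : 1 \<rightarrow> F 1\<close>.\<close>

locale monoidal_functor = cat_functor C D F Fm
  for C :: "('o, 'm, 'z) moncat_scheme" and D :: "('p, 'n, 'w) moncat_scheme" and F and Fm +
  fixes J :: "'o \<Rightarrow> 'o \<Rightarrow> 'n" and u :: 'n
  assumes J_iso: "\<lbrakk>X \<in> Ob C; Y \<in> Ob C\<rbrakk> \<Longrightarrow> iso_in D (TenO D (F X) (F Y)) (F (TenO C X Y)) (J X Y)"
    and u_iso: "iso_in D (Unt D) (F (Unt C)) u"
    and J_natural: "\<lbrakk>X \<in> Ob C; X' \<in> Ob C; Y \<in> Ob C; Y' \<in> Ob C;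
        f \<in> Hom C X X'; g \<in> Hom C Y Y'\<rbrakk>
      \<Longrightarrow> Cmp D (TenO D (F X) (F Y)) (TenO D (F X') (F Y')) (F (TenO C X' Y'))
            (J X' Y') (TenM D (F X) (F X') (F Y) (F Y') (Fm X X' f) (Fm Y Y' g)) =
          Cmp D (TenO D (F X) (F Y)) (F (TenO C X Y)) (F (TenO C X' Y'))
            (Fm (TenO C X Y) (TenO C X' Y') (TenM C X X' Y Y' f g)) (J X Y)"
    and J_assoc: "\<lbrakk>X \<in> Ob C; Y \<in> Ob C; Z \<in> Ob C\<rbrakk>
      \<Longrightarrow> Cmp D (TenO D (TenO D (F X) (F Y)) (F Z)) (F (TenO C (TenO C X Y) Z))
            (F (TenO C X (TenO C Y Z)))
            (Fm (TenO C (TenO C X Y) Z) (TenO C X (TenO C Y Z)) (Assoc C X Y Z))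
            (Cmp D (TenO D (TenO D (F X) (F Y)) (F Z)) (TenO D (F (TenO C X Y)) (F Z))
              (F (TenO C (TenO C X Y) Z))
              (J (TenO C X Y) Z)
              (TenM D (TenO D (F X) (F Y)) (F (TenO C X Y)) (F Z) (F Z) (J X Y) (Idt D (F Z)))) =
          Cmp D (TenO D (TenO D (F X) (F Y)) (F Z)) (TenO D (F X) (F (TenO C Y Z)))
            (F (TenO C X (TenO C Y Z)))
            (J X (TenO C Y Z))
            (Cmp D (TenO D (TenO D (F X) (F Y)) (F Z)) (TenO D (F X) (TenO D (F Y) (F Z)))
              (TenO D (F X) (F (TenO C Y Z)))
              (TenM D (F X) (F X) (TenO D (F Y) (F Z)) (F (TenO C Y Z)) (Idt D (F X)) (J Y Z))
              (Assoc D (F X) (F Y) (F Z)))"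
    and J_LUnit: "X \<in> Ob C
      \<Longrightarrow> Cmp D (TenO D (Unt D) (F X)) (F (TenO C (Unt C) X)) (F X)
            (Fm (TenO C (Unt C) X) X (LUnit C X))
            (Cmp D (TenO D (Unt D) (F X)) (TenO D (F (Unt C)) (F X)) (F (TenO C (Unt C) X))
              (J (Unt C) X)
              (TenM D (Unt D) (F (Unt C)) (F X) (F X) u (Idt D (F X)))) =
          LUnit D (F X)"
    and J_RUnit: "X \<in> Ob C
      \<Longrightarrow> Cmp D (TenO D (F X) (Unt D)) (F (TenO C X (Unt C))) (F X)
            (Fm (TenO C X (Unt C)) X (RUnit C X))
            (Cmp D (TenO D (F X) (Unt D)) (TenO D (F X) (F (Unt C))) (F (TenO C X (Unt C)))
              (J X (Unt C))
              (TenM D (F X) (F X) (Unt D) (F (Unt C)) (Idt D (F X)) u)) =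
          RUnit D (F X)"

definition full_subcat :: "('o, 'm, 'z) cat_scheme \<Rightarrow> 'o set \<Rightarrow> ('o, 'm, 'z) cat_scheme" where
  "full_subcat C S = C\<lparr>Ob := Ob C \<inter> S\<rparr>"

text \<open>The full subcategory of \<open>D\<close> on the objects of the form \<open>F X\<close> with \<open>X \<in> S\<close>, where the form is
  part of the data: an object is an object \<open>M\<close> of \<open>D\<close> together with an \<open>X \<in> S\<close> such that \<open>M = F X\<close>.\<close>

definition full_subcat_of_form ::
  "('p, 'n, 'w) cat_scheme \<Rightarrow> 'o set \<Rightarrow> ('o \<Rightarrow> 'p) \<Rightarrow> ('o \<times> 'p, 'n) cat" where
  "full_subcat_of_form D S F =
    \<lparr>Ob = {(X, M). X \<in> S \<and> M \<in> Ob D \<and> M = F X},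
     Hom = (\<lambda>P Q. Hom D (snd P) (snd Q)),
     Idt = (\<lambda>P. Idt D (snd P)),
     Cmp = (\<lambda>P Q T. Cmp D (snd P) (snd Q) (snd T))\<rparr>"


section \<open>Tensor products\<close>

text \<open>A universe closed under tensor products, so that the modules with carrier in it form a
  monoidal category. A module over any type \<open>'a\<close> occurs in it via \<open>Atom\<close>. An element of a tensor
  product is \<open>Tensor l\<close>, where the list \<open>l = [(m\<^sub>1, n\<^sub>1), \<dots>]\<close> stands for the formal sum of the
  \<open>m\<^sub>i \<otimes> n\<^sub>i\<close> and is the chosen representative of its class.\<close>

datatype 'a univ = Atom 'a | Tensor "('a univ \<times> 'a univ) list"

primrec summands :: "'a univ \<Rightarrow> ('a univ \<times> 'a univ) list" where
  "summands (Atom a) = []"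
| "summands (Tensor l) = l"

text \<open>Equality of formal sums in the tensor product of \<open>M\<close> and \<open>N\<close> balanced over a set \<open>S\<close> acting on
  \<open>M\<close> from the right by \<open>ra\<close> and on \<open>N\<close> from the left by \<open>la\<close>. Additive inverses come from the
  first factor, through \<open>add_left\<close> and \<open>zero\<close>.\<close>

inductive bal_eq :: "'s set \<Rightarrow> ('m \<Rightarrow> 's \<Rightarrow> 'm) \<Rightarrow> ('s \<Rightarrow> 'n \<Rightarrow> 'n) \<Rightarrow> ('k, 'm, 'x) module_scheme \<Rightarrow>
    ('k, 'n, 'y) module_scheme \<Rightarrow> ('m \<times> 'n) list \<Rightarrow> ('m \<times> 'n) list \<Rightarrow> bool"
  for S :: "'s set" and ra :: "'m \<Rightarrow> 's \<Rightarrow> 'm" and la :: "'s \<Rightarrow> 'n \<Rightarrow> 'n"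
    and M :: "('k, 'm, 'x) module_scheme" and N :: "('k, 'n, 'y) module_scheme" where
  refl: "set p \<subseteq> carrier M \<times> carrier N \<Longrightarrow> bal_eq S ra la M N p p"
| sym: "bal_eq S ra la M N p q \<Longrightarrow> bal_eq S ra la M N q p"
| trans: "bal_eq S ra la M N p q \<Longrightarrow> bal_eq S ra la M N q r \<Longrightarrow> bal_eq S ra la M N p r"
| append: "bal_eq S ra la M N p p' \<Longrightarrow> bal_eq S ra la M N q q' \<Longrightarrow>
    bal_eq S ra la M N (p @ q) (p' @ q')"
| comm: "set p \<subseteq> carrier M \<times> carrier N \<Longrightarrow> set q \<subseteq> carrier M \<times> carrier N \<Longrightarrow>
    bal_eq S ra la M N (p @ q) (q @ p)"
| zero: "n \<in> carrier N \<Longrightarrow> bal_eq S ra la M N [(\<zero>\<^bsub>M\<^esub>, n)] []"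
| add_left: "m \<in> carrier M \<Longrightarrow> m' \<in> carrier M \<Longrightarrow> n \<in> carrier N \<Longrightarrow>
    bal_eq S ra la M N [(m \<oplus>\<^bsub>M\<^esub> m', n)] [(m, n), (m', n)]"
| add_right: "m \<in> carrier M \<Longrightarrow> n \<in> carrier N \<Longrightarrow> n' \<in> carrier N \<Longrightarrow>
    bal_eq S ra la M N [(m, n \<oplus>\<^bsub>N\<^esub> n')] [(m, n), (m, n')]"
| balance: "m \<in> carrier M \<Longrightarrow> s \<in> S \<Longrightarrow> n \<in> carrier N \<Longrightarrow>
    bal_eq S ra la M N [(ra m s, n)] [(m, la s n)]"

definition bal_class :: "'s set \<Rightarrow> ('a univ \<Rightarrow> 's \<Rightarrow> 'a univ) \<Rightarrow> ('s \<Rightarrow> 'a univ \<Rightarrow> 'a univ) \<Rightarrow>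
    ('k, 'a univ, 'x) module_scheme \<Rightarrow> ('k, 'a univ, 'y) module_scheme \<Rightarrow>
    ('a univ \<times> 'a univ) list \<Rightarrow> 'a univ" where
  "bal_class S ra la M N p = Tensor (SOME q. bal_eq S ra la M N p q)"

text \<open>The fields \<open>mult\<close> and \<open>one\<close> give the tensor product of algebras, and are meaningful only for
  the tensor product over \<open>k\<close> of two \<open>k\<close>-algebras. As usual for \<^const>\<open>module\<close>, they are ignored
  when a record is considered as a module.\<close>

definition bal_tensor :: "'s set \<Rightarrow> ('a univ \<Rightarrow> 's \<Rightarrow> 'a univ) \<Rightarrow> ('s \<Rightarrow> 'a univ \<Rightarrow> 'a univ) \<Rightarrow>
    ('k, 'a univ, 'x) module_scheme \<Rightarrow> ('k, 'a univ, 'y) module_scheme \<Rightarrow>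
    ('k, 'a univ) module" where
  "bal_tensor S ra la M N =
    \<lparr>carrier = {bal_class S ra la M N p | p. set p \<subseteq> carrier M \<times> carrier N},
     mult = (\<lambda>t t'. bal_class S ra la M N
       [(m \<otimes>\<^bsub>M\<^esub> m', n \<otimes>\<^bsub>N\<^esub> n'). (m, n) \<leftarrow> summands t, (m', n') \<leftarrow> summands t']),
     one = bal_class S ra la M N [(\<one>\<^bsub>M\<^esub>, \<one>\<^bsub>N\<^esub>)],
     zero = bal_class S ra la M N [],
     add = (\<lambda>t t'. bal_class S ra la M N (summands t @ summands t')),
     smult = (\<lambda>r t. bal_class S ra la M N [(r \<odot>\<^bsub>M\<^esub> m, n). (m, n) \<leftarrow> summands t])\<rparr>"

text \<open>The additive map out of a tensor product into \<open>P\<close> that is induced by a balanced map \<open>f\<close>: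
  \<open>tlift P (\<lambda>a b. \<dots>) t\<close> renders Sweedler-type sums over \<open>t = t\<^sub>1 \<otimes> t\<^sub>2\<close>.\<close>

definition tlift :: "('p, 'z) ring_scheme \<Rightarrow> ('a univ \<Rightarrow> 'a univ \<Rightarrow> 'p) \<Rightarrow> 'a univ \<Rightarrow> 'p" where
  "tlift P f t = foldr (\<lambda>(m, n) s. f m n \<oplus>\<^bsub>P\<^esub> s) (summands t) \<zero>\<^bsub>P\<^esub>"

definition tensor :: "('k, 'r) ring_scheme \<Rightarrow> ('k, 'a univ, 'x) module_scheme \<Rightarrow>
    ('k, 'a univ, 'y) module_scheme \<Rightarrow> ('k, 'a univ) module" where
  "tensor k M N = bal_tensor (carrier k) (\<lambda>m r. r \<odot>\<^bsub>M\<^esub> m) (\<lambda>r n. r \<odot>\<^bsub>N\<^esub> n) M N"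

definition ten :: "('k, 'r) ring_scheme \<Rightarrow> ('k, 'a univ, 'x) module_scheme \<Rightarrow>
    ('k, 'a univ, 'y) module_scheme \<Rightarrow> 'a univ \<Rightarrow> 'a univ \<Rightarrow> 'a univ" where
  "ten k M N m n = bal_class (carrier k) (\<lambda>m r. r \<odot>\<^bsub>M\<^esub> m) (\<lambda>r n. r \<odot>\<^bsub>N\<^esub> n) M N [(m, n)]"

text \<open>\<open>f \<otimes> g\<close>, with values in \<open>M \<otimes> N\<close>.\<close>

definition tmap :: "('k, 'r) ring_scheme \<Rightarrow> ('k, 'a univ, 'x) module_scheme \<Rightarrow>
    ('k, 'a univ, 'y) module_scheme \<Rightarrow> ('a univ \<Rightarrow> 'a univ) \<Rightarrow> ('a univ \<Rightarrow> 'a univ) \<Rightarrow>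
    'a univ \<Rightarrow> 'a univ" where
  "tmap k M N f g = tlift (tensor k M N) (\<lambda>a b. ten k M N (f a) (g b))"

definition flip :: "('k, 'r) ring_scheme \<Rightarrow> ('k, 'a univ, 'x) module_scheme \<Rightarrow>
    ('k, 'a univ, 'y) module_scheme \<Rightarrow> 'a univ \<Rightarrow> 'a univ" where
  "flip k M N = tlift (tensor k N M) (\<lambda>m n. ten k N M n m)"

definition assoc :: "('k, 'r) ring_scheme \<Rightarrow> ('k, 'a univ, 'x) module_scheme \<Rightarrow>
    ('k, 'a univ, 'y) module_scheme \<Rightarrow> ('k, 'a univ, 'z) module_scheme \<Rightarrow>
    'a univ \<Rightarrow> 'a univ" where
  "assoc k M N P = tlift (tensor k M (tensor k N P))
     (\<lambda>t p. tlift (tensor k M (tensor k N P))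
       (\<lambda>m n. ten k M (tensor k N P) m (ten k N P n p)) t)"


section \<open>Base rings, algebras and quasitriangular Hopf algebras\<close>

definition char_zero :: "('k, 'r) ring_scheme \<Rightarrow> bool" where
  "char_zero F \<longleftrightarrow> (\<forall>n::nat. n > 0 \<longrightarrow> [n] \<cdot>\<^bsub>F\<^esub> \<one>\<^bsub>F\<^esub> \<noteq> \<zero>\<^bsub>F\<^esub>)"

definition power_series_ring :: "('f, 'r) ring_scheme \<Rightarrow> (nat \<Rightarrow> 'f) ring" where
  "power_series_ring F =
    \<lparr>carrier = UNIV \<rightarrow> carrier F,
     mult = (\<lambda>a b n. \<Oplus>\<^bsub>F\<^esub>i\<in>{..n}. a i \<otimes>\<^bsub>F\<^esub> b (n - i)),
     one = (\<lambda>n. if n = 0 then \<one>\<^bsub>F\<^esub> else \<zero>\<^bsub>F\<^esub>),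
     zero = (\<lambda>n. \<zero>\<^bsub>F\<^esub>),
     add = (\<lambda>a b n. a n \<oplus>\<^bsub>F\<^esub> b n)\<rparr>"

text \<open>A field of characteristic zero or a ring of formal power series over such a field. It is no
  restriction to take the latter field on the same type, since it embeds in \<open>k\<close>.\<close>

definition base_ring :: "'k ring \<Rightarrow> bool" where
  "base_ring k \<longleftrightarrow> cring k \<and>
     (field k \<and> char_zero k \<or>
      (\<exists>F :: 'k ring. field F \<and> char_zero F \<and> power_series_ring F \<simeq> k))"

definition lin_map :: "('k, 'r) ring_scheme \<Rightarrow> ('k, 'u, 'x) module_scheme \<Rightarrow>
    ('k, 'v, 'y) module_scheme \<Rightarrow> ('u \<Rightarrow> 'v) \<Rightarrow> bool" where
  "lin_map k M N f \<longleftrightarrow> f \<in> carrier M \<rightarrow> carrier N \<and>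
     (\<forall>x\<in>carrier M. \<forall>y\<in>carrier M. f (x \<oplus>\<^bsub>M\<^esub> y) = f x \<oplus>\<^bsub>N\<^esub> f y) \<and>
     (\<forall>r\<in>carrier k. \<forall>x\<in>carrier M. f (r \<odot>\<^bsub>M\<^esub> x) = r \<odot>\<^bsub>N\<^esub> f x)"

definition base_module :: "('k, 'r) ring_scheme \<Rightarrow> ('k, 'k) module" where
  "base_module k = \<lparr>carrier = carrier k, mult = mult k, one = one k, zero = zero k, add = add k,
     smult = mult k\<rparr>"

text \<open>Unlike \<^locale>\<open>algebra\<close>, not necessarily commutative.\<close>

locale assoc_algebra = M: module k A + A: ring A
  for k :: "('k, 'r) ring_scheme" and A :: "('k, 'u, 'x) module_scheme" +
  assumes smult_mult_left: "\<lbrakk>r \<in> carrier k; a \<in> carrier A; b \<in> carrier A\<rbrakk>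
      \<Longrightarrow> (r \<odot>\<^bsub>A\<^esub> a) \<otimes>\<^bsub>A\<^esub> b = r \<odot>\<^bsub>A\<^esub> (a \<otimes>\<^bsub>A\<^esub> b)"
    and smult_mult_right: "\<lbrakk>r \<in> carrier k; a \<in> carrier A; b \<in> carrier A\<rbrakk>
      \<Longrightarrow> a \<otimes>\<^bsub>A\<^esub> (r \<odot>\<^bsub>A\<^esub> b) = r \<odot>\<^bsub>A\<^esub> (a \<otimes>\<^bsub>A\<^esub> b)"

record ('k, 'u) hopf = "('k, 'u) module" +
  comul :: "'u \<Rightarrow> 'u"
  counit :: "'u \<Rightarrow> 'k"
  antipode :: "'u \<Rightarrow> 'u"

locale hopf_algebra = assoc_algebra k H
  for k :: "('k, 'r) ring_scheme" and H :: "('k, 'a univ) hopf" +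
  assumes comul_lin: "lin_map k H (tensor k H H) (comul H)"
    and comul_mult: "\<lbrakk>a \<in> carrier H; b \<in> carrier H\<rbrakk>
      \<Longrightarrow> comul H (a \<otimes>\<^bsub>H\<^esub> b) = comul H a \<otimes>\<^bsub>tensor k H H\<^esub> comul H b"
    and comul_one: "comul H \<one>\<^bsub>H\<^esub> = \<one>\<^bsub>tensor k H H\<^esub>"
    and counit_lin: "lin_map k H (base_module k) (counit H)"
    and counit_mult: "\<lbrakk>a \<in> carrier H; b \<in> carrier H\<rbrakk>
      \<Longrightarrow> counit H (a \<otimes>\<^bsub>H\<^esub> b) = counit H a \<otimes>\<^bsub>k\<^esub> counit H b"
    and counit_one: "counit H \<one>\<^bsub>H\<^esub> = \<one>\<^bsub>k\<^esub>"
    and coassoc: "h \<in> carrier H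
      \<Longrightarrow> assoc k H H H (tmap k (tensor k H H) H (comul H) id (comul H h)) =
          tmap k H (tensor k H H) id (comul H) (comul H h)"
    and counit_left: "h \<in> carrier H \<Longrightarrow> tlift H (\<lambda>a b. counit H a \<odot>\<^bsub>H\<^esub> b) (comul H h) = h"
    and counit_right: "h \<in> carrier H \<Longrightarrow> tlift H (\<lambda>a b. counit H b \<odot>\<^bsub>H\<^esub> a) (comul H h) = h"
    and antipode_lin: "lin_map k H H (antipode H)"
    and antipode_left: "h \<in> carrier H
      \<Longrightarrow> tlift H (\<lambda>a b. antipode H a \<otimes>\<^bsub>H\<^esub> b) (comul H h) = counit H h \<odot>\<^bsub>H\<^esub> \<one>\<^bsub>H\<^esub>"
    and antipode_right: "h \<in> carrier H
      \<Longrightarrow> tlift H (\<lambda>a b. a \<otimes>\<^bsub>H\<^esub> antipode H b) (comul H h) = counit H h \<odot>\<^bsub>H\<^esub> \<one>\<^bsub>H\<^esub>"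
    and antipode_bij: "bij_betw (antipode H) (carrier H) (carrier H)"

text \<open>\<open>R\<^sub>1\<^sub>2\<close>, \<open>R\<^sub>1\<^sub>3\<close> and \<open>R\<^sub>2\<^sub>3\<close> live in \<open>(H \<otimes> H) \<otimes> H\<close>.\<close>

definition tensor3 :: "('k, 'r) ring_scheme \<Rightarrow> ('k, 'a univ) hopf \<Rightarrow> ('k, 'a univ) module" where
  "tensor3 k H = tensor k (tensor k H H) H"

definition leg12 :: "('k, 'r) ring_scheme \<Rightarrow> ('k, 'a univ) hopf \<Rightarrow> 'a univ \<Rightarrow> 'a univ" where
  "leg12 k H R = ten k (tensor k H H) H R \<one>\<^bsub>H\<^esub>"

definition leg13 :: "('k, 'r) ring_scheme \<Rightarrow> ('k, 'a univ) hopf \<Rightarrow> 'a univ \<Rightarrow> 'a univ" where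
  "leg13 k H R = tlift (tensor3 k H) (\<lambda>a b. ten k (tensor k H H) H (ten k H H a \<one>\<^bsub>H\<^esub>) b) R"

definition leg23 :: "('k, 'r) ring_scheme \<Rightarrow> ('k, 'a univ) hopf \<Rightarrow> 'a univ \<Rightarrow> 'a univ" where
  "leg23 k H R = tlift (tensor3 k H) (\<lambda>a b. ten k (tensor k H H) H (ten k H H \<one>\<^bsub>H\<^esub> a) b) R"

locale quasitriangular_hopf_algebra = hopf_algebra k H
  for k :: "('k, 'r) ring_scheme" and H :: "('k, 'a univ) hopf" +
  fixes R :: "'a univ"
  assumes R_unit: "R \<in> Units (tensor k H H)"
    and R_comul_left: "tmap k (tensor k H H) H (comul H) id R =
      leg13 k H R \<otimes>\<^bsub>tensor3 k H\<^esub> leg23 k H R"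
    and R_comul_right: "tmap k H (tensor k H H) id (comul H) R =
      assoc k H H H (leg13 k H R \<otimes>\<^bsub>tensor3 k H\<^esub> leg12 k H R)"
    and R_comul: "h \<in> carrier H \<Longrightarrow>
      R \<otimes>\<^bsub>tensor k H H\<^esub> comul H h = flip k H H (comul H h) \<otimes>\<^bsub>tensor k H H\<^esub> R"

definition R_minus :: "('k, 'r) ring_scheme \<Rightarrow> ('k, 'a univ) hopf \<Rightarrow> 'a univ \<Rightarrow> 'a univ" where
  "R_minus k H R = inv\<^bsub>tensor k H H\<^esub> (flip k H H R)"


section \<open>Modules and module algebras\<close>

record ('k, 'h, 'u) amod = "('k, 'u) module" +
  act :: "'h \<Rightarrow> 'u \<Rightarrow> 'u"

locale amodule = M: module k X
  for k :: "('k, 'r) ring_scheme" and A :: "('k, 'h, 'x) module_scheme" and X :: "('k, 'h, 'u) amod" +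
  assumes act_lin: "a \<in> carrier A \<Longrightarrow> lin_map k X X (act X a)"
    and act_add: "\<lbrakk>a \<in> carrier A; b \<in> carrier A; x \<in> carrier X\<rbrakk>
      \<Longrightarrow> act X (a \<oplus>\<^bsub>A\<^esub> b) x = act X a x \<oplus>\<^bsub>X\<^esub> act X b x"
    and act_smult: "\<lbrakk>r \<in> carrier k; a \<in> carrier A; x \<in> carrier X\<rbrakk>
      \<Longrightarrow> act X (r \<odot>\<^bsub>A\<^esub> a) x = r \<odot>\<^bsub>X\<^esub> act X a x"
    and act_mult: "\<lbrakk>a \<in> carrier A; b \<in> carrier A; x \<in> carrier X\<rbrakk>
      \<Longrightarrow> act X (a \<otimes>\<^bsub>A\<^esub> b) x = act X a (act X b x)"
    and act_one: "x \<in> carrier X \<Longrightarrow> act X \<one>\<^bsub>A\<^esub> x = x"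

text \<open>Homomorphisms are extensional, so that they are equal iff they agree on the carrier.\<close>

definition ahom :: "('k, 'r) ring_scheme \<Rightarrow> ('k, 'h, 'x) module_scheme \<Rightarrow> ('k, 'h, 'u) amod \<Rightarrow>
    ('k, 'h, 'v) amod \<Rightarrow> ('u \<Rightarrow> 'v) set" where
  "ahom k A M N = {f \<in> carrier M \<rightarrow>\<^sub>E carrier N. lin_map k M N f \<and>
     (\<forall>a\<in>carrier A. \<forall>x\<in>carrier M. f (act M a x) = act N a (f x))}"

definition with_act :: "('k, 'u, 'x) module_scheme \<Rightarrow> ('h \<Rightarrow> 'u \<Rightarrow> 'u) \<Rightarrow> ('k, 'h, 'u) amod" where
  "with_act M f = \<lparr>carrier = carrier M, mult = mult M, one = one M, zero = zero M, add = add M,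
     smult = smult M, act = f\<rparr>"

text \<open>The action on \<open>X \<otimes> Y\<close> of an element \<open>r\<close> of \<open>H \<otimes> H\<close>.\<close>

definition act2 :: "('k, 'r) ring_scheme \<Rightarrow> ('k, 'a univ, 'a univ) amod \<Rightarrow>
    ('k, 'a univ, 'a univ) amod \<Rightarrow> 'a univ \<Rightarrow> 'a univ \<Rightarrow> 'a univ" where
  "act2 k X Y r t = tlift (tensor k X Y) (\<lambda>a b. tmap k X Y (act X a) (act Y b) t) r"

definition htensor :: "('k, 'r) ring_scheme \<Rightarrow> ('k, 'a univ) hopf \<Rightarrow> ('k, 'a univ, 'a univ) amod \<Rightarrow>
    ('k, 'a univ, 'a univ) amod \<Rightarrow> ('k, 'a univ, 'a univ) amod" where
  "htensor k H X Y = with_act (tensor k X Y) (\<lambda>h. act2 k X Y (comul H h))"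

definition hunit :: "'a univ ring \<Rightarrow> ('a univ, 'a univ) hopf \<Rightarrow>
    ('a univ, 'a univ, 'a univ) amod" where
  "hunit k H = with_act (base_module k) (\<lambda>h r. counit H h \<otimes>\<^bsub>k\<^esub> r)"

locale module_algebra = assoc_algebra k L + amodule k H L
  for k :: "('k, 'r) ring_scheme" and H :: "('k, 'a univ) hopf"
    and L :: "('k, 'a univ, 'a univ) amod" +
  assumes act_mult_L: "\<lbrakk>h \<in> carrier H; l \<in> carrier L; m \<in> carrier L\<rbrakk>
      \<Longrightarrow> act L h (l \<otimes>\<^bsub>L\<^esub> m) = tlift L (\<lambda>a b. act L a l \<otimes>\<^bsub>L\<^esub> act L b m) (comul H h)"
    and act_one_L: "h \<in> carrier H \<Longrightarrow> act L h \<one>\<^bsub>L\<^esub> = counit H h \<odot>\<^bsub>L\<^esub> \<one>\<^bsub>L\<^esub>"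

definition H_commutative :: "'a univ \<Rightarrow> ('k, 'a univ, 'a univ) amod \<Rightarrow> bool" where
  "H_commutative R L \<longleftrightarrow> (\<forall>l\<in>carrier L. \<forall>m\<in>carrier L.
     l \<otimes>\<^bsub>L\<^esub> m = tlift L (\<lambda>a b. act L b m \<otimes>\<^bsub>L\<^esub> act L a l) R)"


section \<open>The dynamical category\<close>

context
  fixes k :: "'a univ ring" and H :: "('a univ, 'a univ) hopf" and R :: "'a univ"
    and L :: "('a univ, 'a univ, 'a univ) amod"
begin

definition coact :: "'a univ \<Rightarrow> 'a univ" where
  "coact l = tlift (tensor k H L) (\<lambda>a b. ten k H L a (act L b l)) (inv\<^bsub>tensor k H H\<^esub> R)"

text \<open>\<open>id \<otimes> m\<^sub>L : (Y \<otimes> L) \<otimes> L \<rightarrow> Y \<otimes> L\<close>\<close>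

definition mult_L :: "('a univ, 'a univ, 'a univ) amod \<Rightarrow> 'a univ \<Rightarrow> 'a univ" where
  "mult_L Y = tlift (tensor k Y L)
     (\<lambda>t m. tlift (tensor k Y L) (\<lambda>y l. ten k Y L y (l \<otimes>\<^bsub>L\<^esub> m)) t)"

definition Xi_mor :: "('a univ, 'a univ, 'a univ) amod \<Rightarrow> ('a univ, 'a univ, 'a univ) amod \<Rightarrow>
    ('a univ \<Rightarrow> 'a univ) \<Rightarrow> 'a univ \<Rightarrow> 'a univ" where
  "Xi_mor X Y \<psi> = restrict (mult_L Y \<circ> tmap k (tensor k Y L) L \<psi> id) (carrier (tensor k X L))"

definition dyn_tau :: "('a univ, 'a univ, 'a univ) amod \<Rightarrow> 'a univ \<Rightarrow> 'a univ \<Rightarrow> 'a univ" where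
  "dyn_tau Y l y = tlift (tensor k Y L) (\<lambda>a m. ten k Y L (act Y a y) m) (coact l)"

text \<open>\<open>(X \<otimes> L) \<otimes> (Y \<otimes> L) \<rightarrow> (X \<otimes> Y) \<otimes> L\<close>, by \<open>dyn_tau\<close> followed by \<open>m\<^sub>L\<close>.\<close>

definition dyn_merge :: "('a univ, 'a univ, 'a univ) amod \<Rightarrow> ('a univ, 'a univ, 'a univ) amod \<Rightarrow>
    'a univ \<Rightarrow> 'a univ" where
  "dyn_merge X Y =
    (let XYL = tensor k (tensor k X Y) L in
     tlift XYL (\<lambda>s t. tlift XYL (\<lambda>x l. tlift XYL (\<lambda>y m.
       tlift XYL (\<lambda>y' l'. ten k (tensor k X Y) L (ten k X Y x y') (l' \<otimes>\<^bsub>L\<^esub> m)) (dyn_tau Y l y)) t) s))"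

text \<open>A homomorphism of \<open>H\<close>-modules \<open>f : X \<rightarrow> Y\<close> as the morphism \<open>f \<otimes> 1 : X \<rightarrow> Y \<otimes> L\<close>. The
  associativity and unit constraints of the dynamical category are those of \<open>H\<close>-modules.\<close>

definition dyn_of_hom :: "('a univ, 'a univ, 'a univ) amod \<Rightarrow> ('a univ, 'a univ, 'a univ) amod \<Rightarrow>
    ('a univ \<Rightarrow> 'a univ) \<Rightarrow> 'a univ \<Rightarrow> 'a univ" where
  "dyn_of_hom X Y f = (\<lambda>x\<in>carrier X. ten k Y L (f x) \<one>\<^bsub>L\<^esub>)"

definition dyn_cat :: "(('a univ, 'a univ, 'a univ) amod, 'a univ \<Rightarrow> 'a univ) moncat" where
  "dyn_cat =
    \<lparr>Ob = {X. amodule k H X},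
     Hom = (\<lambda>X Y. ahom k H X (htensor k H Y L)),
     Idt = (\<lambda>X. dyn_of_hom X X id),
     Cmp = (\<lambda>X Y Z \<psi> \<phi>. restrict (mult_L Z \<circ> tmap k (tensor k Z L) L \<psi> id \<circ> \<phi>) (carrier X)),
     TenO = htensor k H,
     TenM = (\<lambda>X X' Y Y' \<phi> \<psi>. restrict
       (dyn_merge X' Y' \<circ> tmap k (tensor k X' L) (tensor k Y' L) \<phi> \<psi>) (carrier (tensor k X Y))),
     Unt = hunit k H,
     Assoc = (\<lambda>X Y Z. dyn_of_hom (htensor k H (htensor k H X Y) Z) (htensor k H X (htensor k H Y Z))
       (assoc k X Y Z)),
     LUnit = (\<lambda>X. dyn_of_hom (htensor k H (hunit k H) X) X (tlift X (\<lambda>r x. r \<odot>\<^bsub>X\<^esub> x))),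
     RUnit = (\<lambda>X. dyn_of_hom (htensor k H X (hunit k H)) X (tlift X (\<lambda>x r. r \<odot>\<^bsub>X\<^esub> x)))\<rparr>"

definition M_prime :: "('a univ, 'a univ, 'a univ) amod set" where
  "M_prime = {X. amodule k H X \<and> (\<forall>x\<in>carrier X. \<forall>l\<in>carrier L.
     act2 k X L R (ten k X L x l) = act2 k X L (R_minus k H R) (ten k X L x l))}"

definition dyn_cat_prime ::
  "(('a univ, 'a univ, 'a univ) amod, 'a univ \<Rightarrow> 'a univ) moncat" where
  "dyn_cat_prime = full_subcat dyn_cat M_prime"

text \<open>The braiding \<open>x \<otimes> y \<mapsto> R\<^sub>2 y \<otimes> R\<^sub>1 x\<close> of \<open>H\<close>-modules, as a dynamical morphism.\<close>

definition dyn_braiding :: "('a univ, 'a univ, 'a univ) amod \<Rightarrow>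
    ('a univ, 'a univ, 'a univ) amod \<Rightarrow> 'a univ \<Rightarrow> 'a univ" where
  "dyn_braiding X Y = dyn_of_hom (htensor k H X Y) (htensor k H Y X)
     (\<lambda>t. flip k X Y (act2 k X Y R t))"


section \<open>The bialgebroids\<close>

definition smash :: "('a univ, 'a univ) module" where
  "smash = (tensor k L H)\<lparr>mult := (\<lambda>t t'.
     tlift (tensor k L H) (\<lambda>l f. tlift (tensor k L H) (\<lambda>m g.
       tlift (tensor k L H) (\<lambda>f1 f2. ten k L H (l \<otimes>\<^bsub>L\<^esub> act L f1 m) (f2 \<otimes>\<^bsub>H\<^esub> g)) (comul H f))
       t') t)\<rparr>"

definition src :: "'a univ \<Rightarrow> 'a univ" where
  "src l = ten k L H l \<one>\<^bsub>H\<^esub>"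

definition tgt :: "'a univ \<Rightarrow> 'a univ \<Rightarrow> 'a univ" where
  "tgt r l = tlift (tensor k L H) (\<lambda>a b. ten k L H (act L b l) a) r"

definition tgt_plus :: "'a univ \<Rightarrow> 'a univ" where
  "tgt_plus = tgt R"

definition tgt_minus :: "'a univ \<Rightarrow> 'a univ" where
  "tgt_minus = tgt (R_minus k H R)"

text \<open>The coproduct \<open>smash \<rightarrow> smash \<otimes>\<^sub>L smash\<close>, where \<open>L\<close> acts by \<open>a \<cdot> l = t\<^sup>+(l) a\<close> and
  \<open>l \<cdot> a = s(l) a\<close>.\<close>

definition bcomul :: "'a univ \<Rightarrow> 'a univ" where
  "bcomul = (let ra = (\<lambda>a l. tgt_plus l \<otimes>\<^bsub>smash\<^esub> a); la = (\<lambda>l a. src l \<otimes>\<^bsub>smash\<^esub> a);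
       BB = bal_tensor (carrier L) ra la smash smash in
     tlift BB (\<lambda>l h. tlift BB (\<lambda>h1 h2.
       bal_class (carrier L) ra la smash smash [(ten k L H l h1, ten k L H \<one>\<^bsub>L\<^esub> h2)])
       (comul H h)))"

definition bcounit :: "'a univ \<Rightarrow> 'a univ" where
  "bcounit = tlift L (\<lambda>l h. counit H h \<odot>\<^bsub>L\<^esub> l)"

definition bideal :: "'a univ set" where
  "bideal = Idl\<^bsub>smash\<^esub> {tgt_plus l \<ominus>\<^bsub>smash\<^esub> tgt_minus l | l. l \<in> carrier L}"

definition HL :: "('a univ, 'a univ set) module" where
  "HL = ring.extend (smash Quot bideal)
     (module.fields (\<lambda>r c. \<Union>a\<in>c. bideal +>\<^bsub>smash\<^esub> (r \<odot>\<^bsub>smash\<^esub> a)))"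

text \<open>Actions are required to be extensional, so that a module over the quotient \<open>HL\<close> is determined
  by its restriction to \<open>smash\<close>.\<close>

definition mod_cat :: "('a univ, 'h) module \<Rightarrow>
    (('a univ, 'h, 'a univ) amod, 'a univ \<Rightarrow> 'a univ) cat" where
  "mod_cat A =
    \<lparr>Ob = {M. amodule k A M \<and> act M \<in> extensional (carrier A) \<and>
       (\<forall>a\<in>carrier A. act M a \<in> extensional (carrier M))},
     Hom = ahom k A,
     Idt = (\<lambda>M. restrict id (carrier M)),
     Cmp = (\<lambda>M N P g f. compose (carrier M) g f)\<rparr>"

definition smash_act :: "('a univ, 'a univ) module \<Rightarrow> ('a univ \<Rightarrow> 'a univ \<Rightarrow> 'a univ) \<Rightarrow>
    ('a univ, 'a univ, 'a univ) amod" where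
  "smash_act M f = with_act M (\<lambda>a\<in>carrier smash. restrict (f a) (carrier M))"

text \<open>Restriction of modules along the projection \<open>smash \<rightarrow> HL\<close>, and conversely the \<open>HL\<close>-module
  given by a \<open>smash\<close>-module annihilated by the ideal.\<close>

definition restr :: "('a univ, 'a univ set, 'a univ) amod \<Rightarrow>
    ('a univ, 'a univ, 'a univ) amod" where
  "restr M = with_act M (\<lambda>a\<in>carrier smash. act M (bideal +>\<^bsub>smash\<^esub> a))"

definition descend :: "('a univ, 'a univ, 'a univ) amod \<Rightarrow>
    ('a univ, 'a univ set, 'a univ) amod" where
  "descend M = with_act M (\<lambda>c\<in>carrier HL. act M (SOME a. a \<in> c))"

text \<open>The tensor product over \<open>L\<close> of modules over \<open>smash\<close>, with \<open>m \<cdot> l = t\<^sup>+(l) m\<close> and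
  \<open>l \<cdot> n = s(l) n\<close>.\<close>

definition ltensor :: "('a univ, 'a univ, 'a univ) amod \<Rightarrow> ('a univ, 'a univ, 'a univ) amod \<Rightarrow>
    ('a univ, 'a univ) module" where
  "ltensor M N = bal_tensor (carrier L) (\<lambda>m l. act M (tgt_plus l) m) (\<lambda>l n. act N (src l) n) M N"

definition lten :: "('a univ, 'a univ, 'a univ) amod \<Rightarrow> ('a univ, 'a univ, 'a univ) amod \<Rightarrow>
    'a univ \<Rightarrow> 'a univ \<Rightarrow> 'a univ" where
  "lten M N m n =
     bal_class (carrier L) (\<lambda>m l. act M (tgt_plus l) m) (\<lambda>l n. act N (src l) n) M N [(m, n)]"

definition ltensor_mod :: "('a univ, 'a univ, 'a univ) amod \<Rightarrow>
    ('a univ, 'a univ, 'a univ) amod \<Rightarrow> ('a univ, 'a univ, 'a univ) amod" where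
  "ltensor_mod M N = smash_act (ltensor M N)
     (\<lambda>a t. tlift (ltensor M N)
       (\<lambda>a1 a2. tlift (ltensor M N) (\<lambda>m n. lten M N (act M a1 m) (act N a2 n)) t) (bcomul a))"

definition lunit_mod :: "('a univ, 'a univ, 'a univ) amod" where
  "lunit_mod = smash_act (module.truncate L) (\<lambda>a m. bcounit (a \<otimes>\<^bsub>smash\<^esub> src m))"

text \<open>Modules over the quotient bialgebroid: its coproduct and counit are induced by those of
  \<open>smash\<close>, so tensor product and unit are computed over \<open>smash\<close>.\<close>

definition Mod_HL :: "(('a univ, 'a univ set, 'a univ) amod, 'a univ \<Rightarrow> 'a univ) moncat" where
  "Mod_HL = cat.extend (mod_cat HL) (moncat.fields
     (\<lambda>M N. descend (ltensor_mod (restr M) (restr N)))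
     (\<lambda>M M' N N' f g. restrict
       (tlift (ltensor (restr M') (restr N')) (\<lambda>m n. lten (restr M') (restr N') (f m) (g n)))
       (carrier (ltensor (restr M) (restr N))))
     (descend lunit_mod)
     (\<lambda>M' N' P'. let M = restr M'; N = restr N'; P = restr P';
         MN = ltensor_mod M N; NP = ltensor_mod N P in
       restrict (tlift (ltensor M NP)
         (\<lambda>t p. tlift (ltensor M NP) (\<lambda>m n. lten M NP m (lten N P n p)) t))
       (carrier (ltensor MN P)))
     (\<lambda>M. restrict (tlift M (\<lambda>l m. act (restr M) (src l) m))
       (carrier (ltensor lunit_mod (restr M))))
     (\<lambda>M. restrict (tlift M (\<lambda>m l. act (restr M) (tgt_plus l) m))
       (carrier (ltensor (restr M) lunit_mod))))"


section \<open>The functor \<open>\<Xi>\<close>\<close>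

definition lact :: "('a univ, 'a univ, 'a univ) amod \<Rightarrow> 'a univ \<Rightarrow> 'a univ \<Rightarrow> 'a univ" where
  "lact X l = tlift (tensor k X L)
     (\<lambda>x m. tlift (tensor k X L) (\<lambda>a l'. ten k X L (act X a x) (l' \<otimes>\<^bsub>L\<^esub> m)) (coact l))"

definition Xi :: "('a univ, 'a univ, 'a univ) amod \<Rightarrow> ('a univ, 'a univ, 'a univ) amod" where
  "Xi X = smash_act (tensor k X L)
     (\<lambda>a t. tlift (tensor k X L) (\<lambda>l h. lact X l (act (htensor k H X L) h t)) a)"

definition Xi_HL :: "('a univ, 'a univ, 'a univ) amod \<Rightarrow>
    ('a univ, 'a univ set, 'a univ) amod" where
  "Xi_HL X = descend (Xi X)"

definition Mod0_HL :: "(('a univ, 'a univ, 'a univ) amod \<times> ('a univ, 'a univ set, 'a univ) amod,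
    'a univ \<Rightarrow> 'a univ) cat" where
  "Mod0_HL = full_subcat_of_form Mod_HL M_prime Xi_HL"

end

end

theory Submission
  imports Defs
begin

text \<open>The free right \<open>L\<close>-module \<open>X \<otimes> L\<close> on an \<open>H\<close>-module \<open>X\<close> has a left action of \<open>L\<close>, given by the coaction, and
  a dynamical morphism \<open>X \<rightarrow> Y \<otimes> L\<close> extends uniquely to a map \<open>X \<otimes> L \<rightarrow> Y \<otimes> L\<close> (\<open>kl\<close> below) that is linear over
  the smash product. This makes \<open>\<Xi>\<close> fully faithful. As \<open>L\<close> is \<open>H\<close>-commutative, \<open>t\<^sup>+(l)\<close> acts on \<open>X \<otimes> L\<close> by right
  multiplication; if \<open>X\<close> is in \<open>M'\<close> then so does \<open>t\<^sup>-(l)\<close>, and \<open>X \<otimes> L\<close> is a module over the quotient.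

  The tensor product of dynamical morphisms is the composition of \<open>\<phi> \<otimes> \<psi>\<close> with
  \<open>(x \<otimes> l, y \<otimes> m) \<mapsto> x \<otimes> l \<cdot> (y \<otimes> m)\<close> (\<open>jj\<close> below). This map is balanced over \<open>L\<close>, associative, linear over the smash
  product and natural for dynamical morphisms. It thus gives both the monoidal structure of the
  dynamical category and the isomorphism \<open>\<Xi> X \<otimes>\<^sub>L \<Xi> Y \<simeq> \<Xi> (X \<otimes> Y)\<close>. On \<open>M'\<close> the coaction of \<open>L\<close> agrees with the
  braiding of \<open>H\<close>-modules, so that the latter is natural not only for \<open>H\<close>-linear maps but also for
  dynamical morphisms.\<close>

section \<open>Balanced tensor products\<close>

text \<open>An element of a tensor product is a chosen list of pairs, so no formula may be read off
  from it before the summand is known to be balanced. The Sweedler calculations are therefore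
  carried out through \<open>tlift\<close> with values in an arbitrary module: the identities for
  \<open>R\<close>, the coproduct and the braiding have a multilinear map as a parameter, apply
  under further sums, and are proved on pure tensors.

  The coaction of \<open>L\<close> is the inverse braiding in disguise (\<open>dyn_tau\<close>).
  That it defines an action of \<open>L\<close> on free modules, compatible with tensor products,
  thus comes down to the hexagons. Commutativity of \<open>L\<close> says that its multiplication
  absorbs the braiding of \<open>L\<close> with itself, and also the inverse one. It enters wherever
  an element of \<open>L\<close> has to pass another: in the linearity of \<open>kl\<close>, in the
  formulas for the target maps and in the naturality of the braiding.

  The module laws for the tensor product over \<open>L\<close> of two free modules are not derived
  from bialgebroid axioms. They are transported from \<Xi> (X \<otimes> Y), for which the inverse of
  the comparison map is written down explicitly (\<open>EL\<close>).\<close>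

definition lsum :: "('p, 'z) ring_scheme \<Rightarrow> ('m \<Rightarrow> 'n \<Rightarrow> 'p) \<Rightarrow> ('m \<times> 'n) list \<Rightarrow> 'p" where
  "lsum P f p = foldr (\<lambda>(m, n) s. f m n \<oplus>\<^bsub>P\<^esub> s) p \<zero>\<^bsub>P\<^esub>"

lemma lsum_simps [simp]:
  "lsum P f [] = \<zero>\<^bsub>P\<^esub>" "lsum P f ((m, n) # p) = f m n \<oplus>\<^bsub>P\<^esub> lsum P f p"
  by (simp_all add: lsum_def)

lemma tlift_lsum: "tlift P f t = lsum P f (summands t)"
  by (simp add: tlift_def lsum_def)

lemma lsum_closed:
  assumes "abelian_group P" "set p \<subseteq> A \<times> B" "\<And>m n. m \<in> A \<Longrightarrow> n \<in> B \<Longrightarrow> f m n \<in> carrier P"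
  shows "lsum P f p \<in> carrier P"
proof -
  interpret P: abelian_group P by fact
  show ?thesis using assms(2,3) by (induction p) auto
qed

lemma lsum_append:
  assumes "abelian_group P" "set p \<subseteq> A \<times> B" "set q \<subseteq> A \<times> B"
    "\<And>m n. m \<in> A \<Longrightarrow> n \<in> B \<Longrightarrow> f m n \<in> carrier P"
  shows "lsum P f (p @ q) = lsum P f p \<oplus>\<^bsub>P\<^esub> lsum P f q"
proof -
  interpret P: abelian_group P by fact
  show ?thesis using assms(2-)
    by (induction p) (auto simp: P.a_assoc lsum_closed[OF assms(1)])
qed

lemma lsum_cong:
  assumes "set p \<subseteq> A \<times> B" "\<And>m n. m \<in> A \<Longrightarrow> n \<in> B \<Longrightarrow> f m n = g m n"
  shows "lsum P f p = lsum P g p"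
  using assms by (induction p) auto

lemma lsum_zero: "abelian_group P \<Longrightarrow> lsum P (\<lambda>a b. \<zero>\<^bsub>P\<^esub>) p = \<zero>\<^bsub>P\<^esub>"
proof -
  assume "abelian_group P"
  then interpret P: abelian_group P .
  show ?thesis by (induction p) auto
qed

lemma lsum_add:
  assumes "abelian_group P" "set p \<subseteq> A \<times> B"
    "\<And>m n. m \<in> A \<Longrightarrow> n \<in> B \<Longrightarrow> f m n \<in> carrier P" "\<And>m n. m \<in> A \<Longrightarrow> n \<in> B \<Longrightarrow> g m n \<in> carrier P"
  shows "lsum P (\<lambda>m n. f m n \<oplus>\<^bsub>P\<^esub> g m n) p = lsum P f p \<oplus>\<^bsub>P\<^esub> lsum P g p"
proof -
  interpret P: abelian_group P by fact
  show ?thesis using assms(2-)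
  proof (induction p)
    case (Cons x p)
    obtain m n where "x = (m, n)" by (cases x)
    moreover have "lsum P f p \<in> carrier P" "lsum P g p \<in> carrier P"
      using Cons.prems lsum_closed[OF assms(1), of p A B] by auto
    ultimately show ?case using Cons by (auto simp: P.a_ac)
  qed auto
qed

lemma lsum_hom:
  assumes "abelian_group P" "abelian_group Q" "set p \<subseteq> A \<times> B"
    "\<And>m n. m \<in> A \<Longrightarrow> n \<in> B \<Longrightarrow> f m n \<in> carrier P"
    "h \<zero>\<^bsub>P\<^esub> = \<zero>\<^bsub>Q\<^esub>" "\<And>x y. x \<in> carrier P \<Longrightarrow> y \<in> carrier P \<Longrightarrow> h (x \<oplus>\<^bsub>P\<^esub> y) = h x \<oplus>\<^bsub>Q\<^esub> h y"
  shows "h (lsum P f p) = lsum Q (\<lambda>a b. h (f a b)) p"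
  using assms(3-) by (induction p) (auto simp: lsum_closed[OF assms(1)])

lemma lsum_swap:
  assumes "abelian_group P" "set p \<subseteq> A \<times> B" "set q \<subseteq> C \<times> D"
    "\<And>a b c d. a \<in> A \<Longrightarrow> b \<in> B \<Longrightarrow> c \<in> C \<Longrightarrow> d \<in> D \<Longrightarrow> f a b c d \<in> carrier P"
  shows "lsum P (\<lambda>a b. lsum P (f a b) q) p = lsum P (\<lambda>c d. lsum P (\<lambda>a b. f a b c d) p) q"
  using assms(2,4)
proof (induction p)
  case Nil
  then show ?case by (simp add: lsum_zero assms(1))
next
  case (Cons x p)
  obtain a b where x: "x = (a, b)" by (cases x)
  have "lsum P (\<lambda>c d. f a b c d \<oplus>\<^bsub>P\<^esub> lsum P (\<lambda>a b. f a b c d) p) q =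
      lsum P (f a b) q \<oplus>\<^bsub>P\<^esub> lsum P (\<lambda>c d. lsum P (\<lambda>a b. f a b c d) p) q"
    by (rule lsum_add[OF assms(1,3)]) (use Cons.prems x in \<open>auto intro!: lsum_closed[OF assms(1), of p A B]\<close>)
  then show ?case using Cons x by auto
qed

section \<open>Formal sums modulo the balancing relations\<close>

lemma bal_eq_carrier:
  assumes "bal_eq S ra la M N p q" "abelian_group M" "abelian_group N"
    "\<And>m s. m \<in> carrier M \<Longrightarrow> s \<in> S \<Longrightarrow> ra m s \<in> carrier M"
    "\<And>n s. n \<in> carrier N \<Longrightarrow> s \<in> S \<Longrightarrow> la s n \<in> carrier N"
  shows "set p \<subseteq> carrier M \<times> carrier N \<and> set q \<subseteq> carrier M \<times> carrier N"
proof -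
  interpret M: abelian_group M by fact
  interpret N: abelian_group N by fact
  show ?thesis using assms(1) by induction (use assms(4,5) in auto)
qed

text \<open>The relation sees only carriers and additive structure. With \<open>ra\<close> and
  \<open>la\<close> fixed, a module and the same module with another action therefore have literally
  equal tensor products, which lets \<open>with_act\<close> be simplified away later on.\<close>

lemma bal_eq_cong:
  assumes "bal_eq S ra la M N p q"
    "carrier M' = carrier M" "zero M' = zero M" "add M' = add M"
    "carrier N' = carrier N" "add N' = add N"
  shows "bal_eq S ra la M' N' p q"
  using assms(1)
proof induction
  case (trans p q r) then show ?case by (metis bal_eq.trans)
next
  case (zero n) then show ?case using bal_eq.zero[of n N' S ra la M'] assms by simp
next
  case (add_left m m' n) then show ?case using bal_eq.add_left[of m M' m' n N' S ra la] assms by simp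
next
  case (add_right m n n') then show ?case using bal_eq.add_right[of m M' n N' n' S ra la] assms by simp
next
  case (refl p) then show ?case by (intro bal_eq.refl) (simp add: assms)
next
  case (comm p q) then show ?case by (intro bal_eq.comm) (simp_all add: assms)
qed (auto intro: bal_eq.intros simp: assms)

text \<open>These are the conditions that make a map into an abelian group constant on the classes
  of \<open>bal_eq\<close>. The relation \<open>zero\<close> has no clause of its own, as it follows
  from additivity.\<close>

definition balmap :: "'s set \<Rightarrow> ('m \<Rightarrow> 's \<Rightarrow> 'm) \<Rightarrow> ('s \<Rightarrow> 'n \<Rightarrow> 'n) \<Rightarrow> ('k, 'm, 'x) module_scheme \<Rightarrow>
    ('k, 'n, 'y) module_scheme \<Rightarrow> ('p, 'z) ring_scheme \<Rightarrow> ('m \<Rightarrow> 'n \<Rightarrow> 'p) \<Rightarrow> bool" where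
  "balmap S ra la M N P f \<longleftrightarrow>
    (\<forall>m\<in>carrier M. \<forall>n\<in>carrier N. f m n \<in> carrier P) \<and>
    (\<forall>m\<in>carrier M. \<forall>m'\<in>carrier M. \<forall>n\<in>carrier N. f (m \<oplus>\<^bsub>M\<^esub> m') n = f m n \<oplus>\<^bsub>P\<^esub> f m' n) \<and>
    (\<forall>m\<in>carrier M. \<forall>n\<in>carrier N. \<forall>n'\<in>carrier N. f m (n \<oplus>\<^bsub>N\<^esub> n') = f m n \<oplus>\<^bsub>P\<^esub> f m n') \<and>
    (\<forall>m\<in>carrier M. \<forall>s\<in>S. \<forall>n\<in>carrier N. f (ra m s) n = f m (la s n))"

text \<open>Scalars multiply the first factor of a pair; \<open>ra_smult\<close> is what makes this
  compatible with the balancing relation.\<close>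

locale balanced =
  fixes k :: "('k, 'r) ring_scheme" and S :: "'s set"
    and ra :: "'a univ \<Rightarrow> 's \<Rightarrow> 'a univ" and la :: "'s \<Rightarrow> 'a univ \<Rightarrow> 'a univ"
    and M :: "('k, 'a univ, 'x) module_scheme" and N :: "('k, 'a univ, 'y) module_scheme"
  assumes M: "module k M" and N: "module k N"
    and ra_closed: "\<And>m s. m \<in> carrier M \<Longrightarrow> s \<in> S \<Longrightarrow> ra m s \<in> carrier M"
    and la_closed: "\<And>n s. n \<in> carrier N \<Longrightarrow> s \<in> S \<Longrightarrow> la s n \<in> carrier N"
    and ra_smult: "\<And>r m s. r \<in> carrier k \<Longrightarrow> m \<in> carrier M \<Longrightarrow> s \<in> S \<Longrightarrow>
      ra (r \<odot>\<^bsub>M\<^esub> m) s = r \<odot>\<^bsub>M\<^esub> ra m s"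
begin

sublocale M: module k M by (rule M)
sublocale N: module k N by (rule N)

abbreviation "eqv \<equiv> bal_eq S ra la M N"
abbreviation "cls \<equiv> bal_class S ra la M N"
abbreviation "BT \<equiv> bal_tensor S ra la M N"
abbreviation "prs p \<equiv> set p \<subseteq> carrier M \<times> carrier N"

lemma eqv_prs: "eqv p q \<Longrightarrow> prs p \<and> prs q"
  by (rule bal_eq_carrier[OF _ M.abelian_group_axioms N.abelian_group_axioms ra_closed la_closed])

lemma cls_eqI: "eqv p q \<Longrightarrow> cls p = cls q"
proof -
  assume "eqv p q"
  then have "eqv p r \<longleftrightarrow> eqv q r" for r by (blast intro: bal_eq.trans bal_eq.sym)
  then show ?thesis by (simp add: bal_class_def)
qed

text \<open>The choice in \<open>bal_class\<close> is made from a nonempty set because the relation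
  is reflexive. Hence a chosen representative may be traded for the list that it came from.\<close>

lemma eqv_summands: "prs p \<Longrightarrow> eqv p (summands (cls p))"
  unfolding bal_class_def summands.simps by (rule someI) (rule bal_eq.refl)

lemma prs_summands: "prs p \<Longrightarrow> prs (summands (cls p))"
  using eqv_prs eqv_summands by blast

lemma carrier_BT: "carrier BT = {cls p | p. prs p}"
  by (simp add: bal_tensor_def)

lemma cls_closed: "prs p \<Longrightarrow> cls p \<in> carrier BT"
  by (auto simp: carrier_BT)

lemma BT_prs: "t \<in> carrier BT \<Longrightarrow> prs (summands t)"
  using prs_summands by (force simp: carrier_BT)

lemma zero_BT: "\<zero>\<^bsub>BT\<^esub> = cls []"
  by (simp add: bal_tensor_def)

lemma add_cls: "prs p \<Longrightarrow> prs q \<Longrightarrow> cls p \<oplus>\<^bsub>BT\<^esub> cls q = cls (p @ q)"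
  unfolding bal_tensor_def by simp (metis bal_eq.append bal_eq.sym cls_eqI eqv_summands)

abbreviation smp where "smp r \<equiv> map (\<lambda>(m, n). (r \<odot>\<^bsub>M\<^esub> m, n))"

lemma smp_prs: "prs p \<Longrightarrow> r \<in> carrier k \<Longrightarrow> prs (smp r p)"
  by auto

lemma eqv_smp: "eqv p q \<Longrightarrow> r \<in> carrier k \<Longrightarrow> eqv (smp r p) (smp r q)"
proof (induction rule: bal_eq.induct)
  case (refl p)
  then show ?case by (intro bal_eq.refl) (auto dest!: subsetD)
next
  case (trans p q r)
  then show ?case by (metis bal_eq.trans)
next
  case (comm p q)
  then show ?case by (auto intro!: bal_eq.comm simp del: set_map) (auto dest!: subsetD)
next
  case (balance m s n)
  then show ?case using bal_eq.balance[of "r \<odot>\<^bsub>M\<^esub> m" M s S n N ra la] by (simp add: ra_smult)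
qed (auto intro: bal_eq.intros simp: M.smult_r_distr)

lemma smult_cls: "prs p \<Longrightarrow> r \<in> carrier k \<Longrightarrow> r \<odot>\<^bsub>BT\<^esub> cls p = cls (smp r p)"
  unfolding bal_tensor_def by simp (metis bal_eq.sym cls_eqI eqv_smp eqv_summands)

lemma eqv_add_smp:
  assumes "prs p" "a \<in> carrier k" "b \<in> carrier k"
  shows "eqv (smp (a \<oplus>\<^bsub>k\<^esub> b) p) (smp a p @ smp b p)"
  using assms(1)
proof (induction p)
  case (Cons x p)
  obtain m n where x: "x = (m, n)" "m \<in> carrier M" "n \<in> carrier N" using Cons.prems by auto
  let ?A = "(a \<odot>\<^bsub>M\<^esub> m, n)" and ?B = "(b \<odot>\<^bsub>M\<^esub> m, n)"
  have "eqv ([((a \<oplus>\<^bsub>k\<^esub> b) \<odot>\<^bsub>M\<^esub> m, n)] @ smp (a \<oplus>\<^bsub>k\<^esub> b) p) ([?A, ?B] @ (smp a p @ smp b p))"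
    using x Cons assms by (intro bal_eq.append) (auto simp: M.smult_l_distr intro: bal_eq.add_left)
  \<comment> \<open>The two sums come out interleaved: \<open>?B\<close> has to pass the block
    \<open>smp a p\<close>.\<close>
  moreover have "eqv ([?A] @ (([?B] @ smp a p) @ smp b p)) ([?A] @ ((smp a p @ [?B]) @ smp b p))"
    using x Cons.prems assms by (intro bal_eq.append bal_eq.comm bal_eq.refl) auto
  ultimately show ?case using x(1) by (auto intro: bal_eq.trans)
qed (simp add: bal_eq.refl)

text \<open>Inverses are taken in the first factor: there -m and m add up to zero, and
  \<open>0 \<otimes> n\<close> is equivalent to the empty sum.\<close>

lemma eqv_neg: "prs p \<Longrightarrow> eqv (map (\<lambda>(m, n). (\<ominus>\<^bsub>M\<^esub> m, n)) p @ p) []"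
proof (induction p)
  case (Cons x p)
  let ?n = "map (\<lambda>(m, n). (\<ominus>\<^bsub>M\<^esub> m, n))"
  obtain m n where x: "x = (m, n)" "m \<in> carrier M" "n \<in> carrier N" using Cons.prems by auto
  have p: "prs p" "prs (?n p)" using Cons.prems by auto
  have "eqv ([(\<ominus>\<^bsub>M\<^esub> m \<oplus>\<^bsub>M\<^esub> m, n)] @ []) ([(\<ominus>\<^bsub>M\<^esub> m, n), (m, n)] @ (?n p @ p))"
    using x Cons.IH p by (intro bal_eq.append bal_eq.add_left) (auto intro: bal_eq.sym)
  moreover have "eqv ([(\<ominus>\<^bsub>M\<^esub> m, n)] @ (([(m, n)] @ ?n p) @ p))
      ([(\<ominus>\<^bsub>M\<^esub> m, n)] @ ((?n p @ [(m, n)]) @ p))"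
    using x p by (intro bal_eq.append bal_eq.comm bal_eq.refl) auto
  moreover have "eqv [(\<ominus>\<^bsub>M\<^esub> m \<oplus>\<^bsub>M\<^esub> m, n)] []"
    using x bal_eq.zero[of n N S ra la M] by (simp add: M.l_neg)
  ultimately have "eqv (((\<ominus>\<^bsub>M\<^esub> m, n) # ?n p @ (m, n) # p)) []"
    by simp (meson bal_eq.trans bal_eq.sym)
  then show ?case using x(1) by simp
qed (simp add: bal_eq.refl)

lemma BT_obtain:
  assumes "t \<in> carrier BT" obtains p where "t = cls p" "prs p"
  using assms by (auto simp: carrier_BT)

lemma abelian_group_BT: "abelian_group BT"
proof (rule abelian_groupI)
  fix x y assume "x \<in> carrier BT" "y \<in> carrier BT"
  then obtain p q where "x = cls p" "prs p" "y = cls q" "prs q" by (metis BT_obtain)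
  then show "x \<oplus>\<^bsub>BT\<^esub> y \<in> carrier BT" "x \<oplus>\<^bsub>BT\<^esub> y = y \<oplus>\<^bsub>BT\<^esub> x"
    by (auto simp: add_cls intro!: cls_closed cls_eqI bal_eq.comm)
next
  fix x y z assume "x \<in> carrier BT" "y \<in> carrier BT" "z \<in> carrier BT"
  then obtain p q r where "x = cls p" "prs p" "y = cls q" "prs q" "z = cls r" "prs r"
    by (metis BT_obtain)
  then show "x \<oplus>\<^bsub>BT\<^esub> y \<oplus>\<^bsub>BT\<^esub> z = x \<oplus>\<^bsub>BT\<^esub> (y \<oplus>\<^bsub>BT\<^esub> z)" by (simp add: add_cls)
next
  show "\<zero>\<^bsub>BT\<^esub> \<in> carrier BT" by (simp add: zero_BT cls_closed)
next
  fix x assume "x \<in> carrier BT"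
  then obtain p where p: "x = cls p" "prs p" by (metis BT_obtain)
  then show "\<zero>\<^bsub>BT\<^esub> \<oplus>\<^bsub>BT\<^esub> x = x" by (simp add: zero_BT add_cls)
  have q: "prs (map (\<lambda>(m, n). (\<ominus>\<^bsub>M\<^esub> m, n)) p)" using p by auto
  then show "\<exists>y\<in>carrier BT. y \<oplus>\<^bsub>BT\<^esub> x = \<zero>\<^bsub>BT\<^esub>"
    using p by (intro bexI[OF _ cls_closed[OF q]]) (auto simp: add_cls zero_BT intro!: cls_eqI eqv_neg)
qed

lemma module_BT: "module k BT"
proof (rule moduleI[OF M.R.cring_axioms abelian_group_BT])
  fix a x assume "a \<in> carrier k" "x \<in> carrier BT"
  then show "a \<odot>\<^bsub>BT\<^esub> x \<in> carrier BT"
    by (elim BT_obtain) (simp add: smult_cls cls_closed smp_prs del: set_map)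
next
  fix a b x assume ab: "a \<in> carrier k" "b \<in> carrier k" and "x \<in> carrier BT"
  then obtain p where p: "x = cls p" "prs p" by (metis BT_obtain)
  then show "(a \<oplus>\<^bsub>k\<^esub> b) \<odot>\<^bsub>BT\<^esub> x = a \<odot>\<^bsub>BT\<^esub> x \<oplus>\<^bsub>BT\<^esub> b \<odot>\<^bsub>BT\<^esub> x"
    using ab smp_prs[OF p(2)] by (auto simp: smult_cls add_cls intro!: cls_eqI eqv_add_smp)
  have "smp (a \<otimes>\<^bsub>k\<^esub> b) p = smp a (smp b p)" using p ab by (auto simp: M.smult_assoc1)
  then show "(a \<otimes>\<^bsub>k\<^esub> b) \<odot>\<^bsub>BT\<^esub> x = a \<odot>\<^bsub>BT\<^esub> (b \<odot>\<^bsub>BT\<^esub> x)"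
    using p ab smult_cls smp_prs[OF p(2)] by (metis M.R.m_closed)
next
  fix a x y assume a: "a \<in> carrier k" and "x \<in> carrier BT" "y \<in> carrier BT"
  then obtain p q where p: "x = cls p" "prs p" "y = cls q" "prs q" by (metis BT_obtain)
  then show "a \<odot>\<^bsub>BT\<^esub> (x \<oplus>\<^bsub>BT\<^esub> y) = a \<odot>\<^bsub>BT\<^esub> x \<oplus>\<^bsub>BT\<^esub> a \<odot>\<^bsub>BT\<^esub> y"
    using a smp_prs[OF p(2)] smp_prs[OF p(4)] by (simp add: smult_cls add_cls)
next
  fix x assume "x \<in> carrier BT"
  then obtain p where p: "x = cls p" "prs p" by (metis BT_obtain)
  moreover have "smp \<one>\<^bsub>k\<^esub> p = p" using p(2) by (induction p) auto
  ultimately show "\<one>\<^bsub>k\<^esub> \<odot>\<^bsub>BT\<^esub> x = x" by (simp add: smult_cls)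
qed

text \<open>Induction over the generating relations. This is the well-definedness of
  \<open>tlift\<close>: it may be computed from any list in the class.\<close>

lemma lsum_eqv:
  assumes P: "abelian_group P" and f: "balmap S ra la M N P f" and "eqv p q"
  shows "lsum P f p = lsum P f q"
proof -
  interpret P: abelian_group P by fact
  have f0: "f m n \<in> carrier P" if "m \<in> carrier M" "n \<in> carrier N" for m n
    using f that by (auto simp: balmap_def)
  have app: "lsum P f (p @ q) = lsum P f p \<oplus>\<^bsub>P\<^esub> lsum P f q" if "prs p" "prs q" for p q
    by (rule lsum_append[OF P that]) (rule f0)
  have cl: "lsum P f p \<in> carrier P" if "prs p" for p
    by (rule lsum_closed[OF P that]) (rule f0)
  show ?thesis using assms(3)
  proof induction
    case (append p p' q q')
    then show ?case using eqv_prs[OF append(1)] eqv_prs[OF append(2)] by (simp add: app)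
  next
    case (comm p q)
    then show ?case by (simp add: app cl P.a_comm)
  next
    case (zero n)
    \<comment> \<open>The value at zero equals its own double and therefore vanishes.\<close>
    have "f (\<zero>\<^bsub>M\<^esub> \<oplus>\<^bsub>M\<^esub> \<zero>\<^bsub>M\<^esub>) n = f \<zero>\<^bsub>M\<^esub> n \<oplus>\<^bsub>P\<^esub> f \<zero>\<^bsub>M\<^esub> n"
      using f zero M.zero_closed unfolding balmap_def by blast
    then show ?case using f0[of "\<zero>\<^bsub>M\<^esub>" n] zero by simp
  next
    case (balance m s n)
    then show ?case using f by (auto simp: balmap_def f0 ra_closed la_closed)
  qed (use f in \<open>auto simp: balmap_def f0 P.a_assoc\<close>)
qed

lemma tlift_cls:
  assumes "abelian_group P" "balmap S ra la M N P f" "prs p"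
  shows "tlift P f (cls p) = lsum P f p"
  using lsum_eqv[OF assms(1,2) eqv_summands[OF assms(3)]] by (simp add: tlift_lsum)

lemma tlift_cls1:
  assumes "abelian_group P" "balmap S ra la M N P f" "m \<in> carrier M" "n \<in> carrier N"
  shows "tlift P f (cls [(m, n)]) = f m n"
proof -
  interpret P: abelian_group P by fact
  have "f m n \<in> carrier P" using assms by (auto simp: balmap_def)
  then show ?thesis using tlift_cls[OF assms(1,2), of "[(m, n)]"] assms(3,4) by simp
qed

lemma tlift_add:
  assumes "abelian_group P" "balmap S ra la M N P f" "s \<in> carrier BT" "t \<in> carrier BT"
  shows "tlift P f (s \<oplus>\<^bsub>BT\<^esub> t) = tlift P f s \<oplus>\<^bsub>P\<^esub> tlift P f t"
proof -
  obtain p q where "s = cls p" "prs p" "t = cls q" "prs q" using assms by (metis BT_obtain)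
  moreover have "\<And>m n. m \<in> carrier M \<Longrightarrow> n \<in> carrier N \<Longrightarrow> f m n \<in> carrier P"
    using assms(2) by (auto simp: balmap_def)
  ultimately show ?thesis
    by (simp add: add_cls tlift_cls[OF assms(1,2)] lsum_append[OF assms(1), of p "carrier M" "carrier N"])
qed

lemma tlift_lin:
  assumes "module k P" "balmap S ra la M N P f"
    "\<And>r m n. r \<in> carrier k \<Longrightarrow> m \<in> carrier M \<Longrightarrow> n \<in> carrier N \<Longrightarrow> f (r \<odot>\<^bsub>M\<^esub> m) n = r \<odot>\<^bsub>P\<^esub> f m n"
  shows "lin_map k BT P (tlift P f)"
proof -
  interpret P: module k P by fact
  note P = P.abelian_group_axioms
  have f0: "\<And>m n. m \<in> carrier M \<Longrightarrow> n \<in> carrier N \<Longrightarrow> f m n \<in> carrier P"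
    using assms(2) by (auto simp: balmap_def)
  show ?thesis unfolding lin_map_def
  proof (intro conjI ballI funcsetI)
    fix t assume "t \<in> carrier BT"
    then show "tlift P f t \<in> carrier P"
      by (auto simp: tlift_lsum intro!: lsum_closed[OF P BT_prs f0])
  next
    fix s t assume "s \<in> carrier BT" "t \<in> carrier BT"
    then show "tlift P f (s \<oplus>\<^bsub>BT\<^esub> t) = tlift P f s \<oplus>\<^bsub>P\<^esub> tlift P f t" by (rule tlift_add[OF P assms(2)])
  next
    fix r t assume r: "r \<in> carrier k" and "t \<in> carrier BT"
    then obtain p where p: "t = cls p" "prs p" by (metis BT_obtain)
    have "lsum P f (smp r p) = r \<odot>\<^bsub>P\<^esub> lsum P f p" using p(2)
    proof (induction p)
      case (Cons x p)
      then show ?case using r assms(3) f0 lsum_closed[OF P _ f0, of p]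
        by (auto simp: P.smult_r_distr)
    qed (simp add: r P.smult_r_null)
    then show "tlift P f (r \<odot>\<^bsub>BT\<^esub> t) = r \<odot>\<^bsub>P\<^esub> tlift P f t"
      using p r smp_prs by (simp add: smult_cls tlift_cls[OF P assms(2)])
  qed
qed

lemma BT_induct [consumes 1, case_names zero pure add]:
  assumes "t \<in> carrier BT" "Q \<zero>\<^bsub>BT\<^esub>"
    "\<And>m n. m \<in> carrier M \<Longrightarrow> n \<in> carrier N \<Longrightarrow> Q (cls [(m, n)])"
    "\<And>s t. s \<in> carrier BT \<Longrightarrow> t \<in> carrier BT \<Longrightarrow> Q s \<Longrightarrow> Q t \<Longrightarrow> Q (s \<oplus>\<^bsub>BT\<^esub> t)"
  shows "Q t"
proof -
  obtain p where p: "t = cls p" "prs p" using assms(1) by (metis BT_obtain)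
  have "Q (cls p)" using p(2)
  proof (induction p)
    case Nil
    then show ?case using assms(2) by (simp add: zero_BT)
  next
    case (Cons x p)
    obtain m n where x: "x = (m, n)" "m \<in> carrier M" "n \<in> carrier N" using Cons.prems by auto
    have "Q (cls [(m, n)] \<oplus>\<^bsub>BT\<^esub> cls p)"
      using x Cons by (intro assms(3,4) cls_closed) auto
    then show ?case using x Cons.prems by (simp add: add_cls)
  qed
  then show ?thesis using p(1) by simp
qed

end

section \<open>Tensor products of modules and multilinear maps\<close>

definition bil :: "('k, 'r) ring_scheme \<Rightarrow> ('k, 'u, 'x) module_scheme \<Rightarrow> ('k, 'v, 'y) module_scheme \<Rightarrow>
    ('k, 'w, 'z) module_scheme \<Rightarrow> ('u \<Rightarrow> 'v \<Rightarrow> 'w) \<Rightarrow> bool" where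
  "bil k M N P f \<longleftrightarrow> (\<forall>m\<in>carrier M. lin_map k N P (\<lambda>n. f m n)) \<and>
    (\<forall>n\<in>carrier N. lin_map k M P (\<lambda>m. f m n))"

text \<open>Linearity of a term in one of its variables and membership in carriers are proved by
  \<open>(rule mlin | assumption)+\<close>: the rules follow the syntax of the term.\<close>

named_theorems mlin

lemma bilI [mlin]:
  assumes "\<And>m. m \<in> carrier M \<Longrightarrow> lin_map k N P (\<lambda>n. f m n)"
    "\<And>n. n \<in> carrier N \<Longrightarrow> lin_map k M P (\<lambda>m. f m n)"
  shows "bil k M N P f"
  using assms by (simp add: bil_def)

lemma lin_mapI:
  assumes "\<And>x. x \<in> carrier M \<Longrightarrow> f x \<in> carrier N"
    "\<And>x y. x \<in> carrier M \<Longrightarrow> y \<in> carrier M \<Longrightarrow> f (x \<oplus>\<^bsub>M\<^esub> y) = f x \<oplus>\<^bsub>N\<^esub> f y"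
    "\<And>r x. r \<in> carrier k \<Longrightarrow> x \<in> carrier M \<Longrightarrow> f (r \<odot>\<^bsub>M\<^esub> x) = r \<odot>\<^bsub>N\<^esub> f x"
  shows "lin_map k M N f"
  using assms by (auto simp: lin_map_def)

lemma lin_map_closed: "lin_map k M N f \<Longrightarrow> x \<in> carrier M \<Longrightarrow> f x \<in> carrier N"
  by (auto simp: lin_map_def)

lemma lin_map_add:
  "lin_map k M N f \<Longrightarrow> x \<in> carrier M \<Longrightarrow> y \<in> carrier M \<Longrightarrow> f (x \<oplus>\<^bsub>M\<^esub> y) = f x \<oplus>\<^bsub>N\<^esub> f y"
  by (auto simp: lin_map_def)

lemma lin_map_smult:
  "lin_map k M N f \<Longrightarrow> r \<in> carrier k \<Longrightarrow> x \<in> carrier M \<Longrightarrow> f (r \<odot>\<^bsub>M\<^esub> x) = r \<odot>\<^bsub>N\<^esub> f x"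
  by (auto simp: lin_map_def)

lemma lin_map_zero:
  assumes "lin_map k M N f" "module k M" "module k N"
  shows "f \<zero>\<^bsub>M\<^esub> = \<zero>\<^bsub>N\<^esub>"
proof -
  interpret M: module k M by fact
  interpret N: module k N by fact
  have "f (\<zero>\<^bsub>M\<^esub> \<oplus>\<^bsub>M\<^esub> \<zero>\<^bsub>M\<^esub>) = f \<zero>\<^bsub>M\<^esub> \<oplus>\<^bsub>N\<^esub> f \<zero>\<^bsub>M\<^esub>"
    by (rule lin_map_add[OF assms(1)]) auto
  then show ?thesis using lin_map_closed[OF assms(1), of "\<zero>\<^bsub>M\<^esub>"] by simp
qed

lemma lin_map_comp: "lin_map k M N f \<Longrightarrow> lin_map k N P g \<Longrightarrow> lin_map k M P (\<lambda>x. g (f x))"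
  by (rule lin_mapI) (simp_all add: lin_map_closed lin_map_add lin_map_smult)

lemma lin_map_cong:
  assumes "lin_map k M N f" "module k M" "\<And>x. x \<in> carrier M \<Longrightarrow> f x = g x"
  shows "lin_map k M N g"
proof -
  interpret M: module k M by fact
  show ?thesis using assms(1,3) by (auto simp: lin_map_def Pi_def)
qed

lemma lin_id [mlin]: "lin_map k M M (\<lambda>x. x)"
  by (auto simp: lin_map_def)

lemma bil_closed: "bil k M N P f \<Longrightarrow> m \<in> carrier M \<Longrightarrow> n \<in> carrier N \<Longrightarrow> f m n \<in> carrier P"
  by (auto simp: bil_def lin_map_def)

lemma bil_left: "bil k M N P f \<Longrightarrow> lin_map k Q M g \<Longrightarrow> n \<in> carrier N \<Longrightarrow> lin_map k Q P (\<lambda>x. f (g x) n)"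
  by (auto simp: bil_def intro: lin_map_comp)

lemma bil_right: "bil k M N P f \<Longrightarrow> lin_map k Q N g \<Longrightarrow> m \<in> carrier M \<Longrightarrow> lin_map k Q P (\<lambda>x. f m (g x))"
  by (auto simp: bil_def intro: lin_map_comp)

lemma base_module_simps [simp]:
  "carrier (base_module k) = carrier k" "zero (base_module k) = zero k"
  "add (base_module k) = add k" "smult (base_module k) = mult k"
  by (simp_all add: base_module_def)

lemma with_act_simps [simp]:
  "carrier (with_act M f) = carrier M" "zero (with_act M f) = zero M"
  "add (with_act M f) = add M" "smult (with_act M f) = smult M"
  "mult (with_act M f) = mult M" "one (with_act M f) = one M" "act (with_act M f) = f"
  by (simp_all add: with_act_def)

lemma module_cong:
  assumes "module k M" "carrier M' = carrier M" "zero M' = zero M" "add M' = add M" "smult M' = smult M"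
  shows "module k M'"
proof -
  interpret M: module k M by fact
  have "abelian_group M'"
    by (rule abelian_groupI) (use M.l_neg M.a_inv_closed in \<open>force simp: assms M.a_ac\<close>)+
  then show ?thesis
    by (intro moduleI M.R.cring_axioms)
      (auto simp: assms M.smult_l_distr M.smult_r_distr M.smult_assoc1)
qed

lemma bal_class_cong:
  assumes "carrier M' = carrier M" "zero M' = zero M" "add M' = add M"
    "carrier N' = carrier N" "add N' = add N"
  shows "bal_class S ra la M' N' p = bal_class S ra la M N p"
proof -
  have "bal_eq S ra la M' N' p q \<longleftrightarrow> bal_eq S ra la M N p q" for q
    using bal_eq_cong[of S ra la M N p q M' N'] bal_eq_cong[of S ra la M' N' p q M N] assms by auto
  then show ?thesis by (simp add: bal_class_def)
qed

lemma tensor_with_act [simp]: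
  "tensor k (with_act M f) N = tensor k M N" "tensor k M (with_act N g) = tensor k M N"
  unfolding tensor_def bal_tensor_def
  by (simp_all add: bal_class_cong[of "with_act M f" M N N] bal_class_cong[of M M "with_act N g" N])

lemma ten_with_act [simp]:
  "ten k (with_act M f) N = ten k M N" "ten k M (with_act N g) = ten k M N"
  unfolding ten_def
  by (simp_all add: bal_class_cong[of "with_act M f" M N N] bal_class_cong[of M M "with_act N g" N])

lemma lin_map_with_act [simp]:
  "lin_map k (with_act M f) N = lin_map k M N" "lin_map k N (with_act M f) = lin_map k N M"
  by (simp_all add: lin_map_def fun_eq_iff)

lemma tlift_with_act [simp]: "tlift (with_act M f) = tlift M"
  by (simp add: tlift_def fun_eq_iff)

lemma tmap_with_act [simp]:
  "tmap k (with_act M h) N f g = tmap k M N f g" "tmap k M (with_act N h) f g = tmap k M N f g"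
  by (simp_all add: tmap_def)

lemma flip_with_act [simp]: "flip k (with_act M f) N = flip k M N" "flip k M (with_act N f) = flip k M N"
  by (simp_all add: flip_def)

lemma assoc_with_act [simp]:
  "assoc k (with_act M f) N P = assoc k M N P" "assoc k M (with_act N f) P = assoc k M N P"
  "assoc k M N (with_act P f) = assoc k M N P"
  by (simp_all add: assoc_def)

lemma module_with_act [mlin]: "module k M \<Longrightarrow> module k (with_act M f)"
  by (rule module_cong[of k M]) simp_all

section \<open>Tensor products over the base ring and linearity of Sweedler-type sums\<close>

locale base =
  fixes k :: "('k, 'r) ring_scheme"
  assumes cring_k: "cring k"
begin

abbreviation tens (infixl "\<otimes>\<^sub>k" 75) where "M \<otimes>\<^sub>k N \<equiv> tensor k M N"
abbreviation "tn \<equiv> ten k"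
abbreviation "lin \<equiv> lin_map k"
abbreviation "kmod \<equiv> module k"

lemma base_module_mod [mlin]: "kmod (base_module k)"
proof -
  interpret k: cring k by (rule cring_k)
  have "abelian_group (base_module k)"
    by (rule abelian_groupI) (use k.l_neg k.a_inv_closed in \<open>force simp: k.a_ac\<close>)+
  then show ?thesis
    by (intro moduleI k.cring_axioms) (auto simp: k.l_distr k.r_distr k.m_assoc)
qed

lemma balanced_k:
  "kmod M \<Longrightarrow> kmod N \<Longrightarrow> balanced k (carrier k) (\<lambda>m r. r \<odot>\<^bsub>M\<^esub> m) (\<lambda>r n. r \<odot>\<^bsub>N\<^esub> n) M N"
proof -
  assume "kmod M" "kmod N"
  then interpret M: module k M + N: module k N by simp_all
  show ?thesis by unfold_locales (auto simp: M.smult_assoc1[symmetric] M.R.m_comm)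
qed

lemma tensor_mod [mlin]: "kmod M \<Longrightarrow> kmod N \<Longrightarrow> kmod (M \<otimes>\<^sub>k N)"
  unfolding tensor_def by (rule balanced.module_BT[OF balanced_k])

lemma bil_balmap:
  assumes "kmod M" "kmod N" "bil k M N P f"
  shows "balmap (carrier k) (\<lambda>m r. r \<odot>\<^bsub>M\<^esub> m) (\<lambda>r n. r \<odot>\<^bsub>N\<^esub> n) M N P f"
  using assms(3) by (auto simp: balmap_def bil_def lin_map_def)

lemma mod_ab: "kmod P \<Longrightarrow> abelian_group P"
  by (simp add: module_def)

lemma ten_closed [mlin]: "m \<in> carrier M \<Longrightarrow> n \<in> carrier N \<Longrightarrow> tn M N m n \<in> carrier (M \<otimes>\<^sub>k N)"
  unfolding ten_def tensor_def bal_tensor_def by auto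

lemma tlift_ten:
  assumes "bil k M N P f" "m \<in> carrier M" "n \<in> carrier N" "kmod M" "kmod N" "kmod P"
  shows "tlift P f (tn M N m n) = f m n"
  unfolding ten_def
  by (rule balanced.tlift_cls1[OF balanced_k mod_ab bil_balmap]) (use assms in simp_all)

lemma tlift_lin0:
  assumes "bil k M N P f" "kmod M" "kmod N" "kmod P"
  shows "lin (M \<otimes>\<^sub>k N) P (tlift P f)"
  unfolding tensor_def
  by (rule balanced.tlift_lin[OF balanced_k _ bil_balmap])
    (use assms in \<open>auto simp: bil_def lin_map_def\<close>)

text \<open>A variable can enter a sum over a tensor in two places. This rule covers the tensor
  itself and asks for a bilinear summand; \<open>tlift_lin_fun\<close> covers the summand.\<close>

lemma tlift_lin_arg [mlin]:
  assumes "lin Q (M \<otimes>\<^sub>k N) g" "kmod M" "kmod N" "kmod P" "bil k M N P f"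
  shows "lin Q P (\<lambda>x. tlift P f (g x))"
  by (rule lin_map_comp[OF assms(1) tlift_lin0]) fact+

lemma tensor_induct [consumes 3, case_names zero pure add]:
  assumes "t \<in> carrier (M \<otimes>\<^sub>k N)" "kmod M" "kmod N" "Q \<zero>\<^bsub>M \<otimes>\<^sub>k N\<^esub>"
    "\<And>m n. m \<in> carrier M \<Longrightarrow> n \<in> carrier N \<Longrightarrow> Q (tn M N m n)"
    "\<And>s t. s \<in> carrier (M \<otimes>\<^sub>k N) \<Longrightarrow> t \<in> carrier (M \<otimes>\<^sub>k N) \<Longrightarrow> Q s \<Longrightarrow> Q t \<Longrightarrow>
      Q (s \<oplus>\<^bsub>M \<otimes>\<^sub>k N\<^esub> t)"
  shows "Q t"
  by (rule balanced.BT_induct[OF balanced_k[OF assms(2,3)]])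
    (use assms(1,4-) in \<open>simp_all add: tensor_def ten_def\<close>)

lemma tensor_ext:
  assumes "t \<in> carrier (M \<otimes>\<^sub>k N)" "kmod M" "kmod N" "kmod P"
    "lin (M \<otimes>\<^sub>k N) P f" "lin (M \<otimes>\<^sub>k N) P g"
    "\<And>m n. m \<in> carrier M \<Longrightarrow> n \<in> carrier N \<Longrightarrow> f (tn M N m n) = g (tn M N m n)"
  shows "f t = g t"
  using assms(1-3)
proof (induction rule: tensor_induct)
  case zero
  then show ?case
    using lin_map_zero[OF assms(5)] lin_map_zero[OF assms(6)] assms by (simp add: tensor_mod)
next
  case (add s t)
  then show ?case using lin_map_add[OF assms(5)] lin_map_add[OF assms(6)] by simp
qed (use assms in auto)

lemma prs_summands:
  "t \<in> carrier (M \<otimes>\<^sub>k N) \<Longrightarrow> kmod M \<Longrightarrow> kmod N \<Longrightarrow> set (summands t) \<subseteq> carrier M \<times> carrier N"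
  by (rule balanced.BT_prs[OF balanced_k]) (simp_all add: tensor_def)

lemma tlift_closed [mlin]:
  assumes "t \<in> carrier (M \<otimes>\<^sub>k N)" "kmod M" "kmod N" "kmod P"
    "\<And>m n. m \<in> carrier M \<Longrightarrow> n \<in> carrier N \<Longrightarrow> f m n \<in> carrier P"
  shows "tlift P f t \<in> carrier P"
  unfolding tlift_lsum
  by (rule lsum_closed[OF mod_ab[OF assms(4)] prs_summands[OF assms(1-3)] assms(5)])

lemma tlift_cong:
  assumes "t \<in> carrier (M \<otimes>\<^sub>k N)" "kmod M" "kmod N"
    "\<And>m n. m \<in> carrier M \<Longrightarrow> n \<in> carrier N \<Longrightarrow> f m n = g m n"
  shows "tlift P f t = tlift P g t"
  unfolding tlift_lsum
  by (rule lsum_cong[OF prs_summands[OF assms(1-3)] assms(4)])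

text \<open>Both sides are sums over the same chosen list, so additivity of \<open>h\<close>
  suffices and the summand need not be bilinear. For the same reason \<open>tlift_swap\<close> is an
  interchange of finite sums.\<close>

lemma tlift_hom:
  assumes "lin P Q h" "t \<in> carrier (M \<otimes>\<^sub>k N)" "kmod M" "kmod N" "kmod P" "kmod Q"
    "\<And>m n. m \<in> carrier M \<Longrightarrow> n \<in> carrier N \<Longrightarrow> f m n \<in> carrier P"
  shows "h (tlift P f t) = tlift Q (\<lambda>m n. h (f m n)) t"
  unfolding tlift_lsum
  by (rule lsum_hom[OF mod_ab[OF assms(5)] mod_ab[OF assms(6)] prs_summands[OF assms(2-4)]])
    (use assms in \<open>auto intro: lin_map_zero lin_map_add\<close>)

lemma tlift_swap:
  assumes "s \<in> carrier (A \<otimes>\<^sub>k B)" "t \<in> carrier (C \<otimes>\<^sub>k D)" "kmod A" "kmod B" "kmod C" "kmod D" "kmod P"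
    "\<And>a b c d. a \<in> carrier A \<Longrightarrow> b \<in> carrier B \<Longrightarrow> c \<in> carrier C \<Longrightarrow> d \<in> carrier D \<Longrightarrow>
      f a b c d \<in> carrier P"
  shows "tlift P (\<lambda>a b. tlift P (f a b) t) s = tlift P (\<lambda>c d. tlift P (\<lambda>a b. f a b c d) s) t"
  unfolding tlift_lsum
  by (rule lsum_swap[OF mod_ab[OF assms(7)] prs_summands[OF assms(1,3,4)]
        prs_summands[OF assms(2,5,6)] assms(8)])

lemma lin_add:
  assumes "kmod P" "lin M P f" "lin M P g"
  shows "lin M P (\<lambda>x. f x \<oplus>\<^bsub>P\<^esub> g x)"
proof -
  interpret P: module k P by fact
  show ?thesis
    using lin_map_closed[OF assms(2)] lin_map_closed[OF assms(3)] assms(2,3)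
    by (auto simp: lin_map_def P.a_ac P.smult_r_distr)
qed

lemma lin_lsum:
  assumes "kmod P" "kmod M" "set p \<subseteq> A \<times> B" "\<And>a b. a \<in> A \<Longrightarrow> b \<in> B \<Longrightarrow> lin M P (\<lambda>x. F x a b)"
  shows "lin M P (\<lambda>x. lsum P (F x) p)"
  using assms(3)
proof (induction p)
  case Nil
  interpret P: module k P by fact
  show ?case by (auto simp: lin_map_def P.smult_r_null)
next
  case (Cons x p)
  then show ?case using assms by (cases x) (auto intro!: lin_add)
qed

text \<open>The tensor, and with it the list, is fixed while the variable moves, so this is a finite
  sum of linear maps.\<close>

lemma tlift_lin_fun [mlin]:
  assumes "t \<in> carrier (A \<otimes>\<^sub>k B)" "kmod A" "kmod B" "kmod M" "kmod P"
    "\<And>a b. a \<in> carrier A \<Longrightarrow> b \<in> carrier B \<Longrightarrow> lin M P (\<lambda>x. F x a b)"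
  shows "lin M P (\<lambda>x. tlift P (\<lambda>a b. F x a b) t)"
  unfolding tlift_lsum
  by (rule lin_lsum[OF assms(5,4) prs_summands[OF assms(1-3)] assms(6)])

lemma ten_bil: "kmod M \<Longrightarrow> kmod N \<Longrightarrow> bil k M N (M \<otimes>\<^sub>k N) (tn M N)"
proof -
  assume MN: "kmod M" "kmod N"
  interpret b: balanced k "carrier k" "\<lambda>m r. r \<odot>\<^bsub>M\<^esub> m" "\<lambda>r n. r \<odot>\<^bsub>N\<^esub> n" M N by (rule balanced_k[OF MN])
  have s: "r \<odot>\<^bsub>M \<otimes>\<^sub>k N\<^esub> tn M N m n = tn M N (r \<odot>\<^bsub>M\<^esub> m) n" "tn M N (r \<odot>\<^bsub>M\<^esub> m) n = tn M N m (r \<odot>\<^bsub>N\<^esub> n)"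
    if "r \<in> carrier k" "m \<in> carrier M" "n \<in> carrier N" for r m n
    using that b.smult_cls[of "[(m, n)]" r] b.cls_eqI[OF bal_eq.balance[of m M r "carrier k" n N]]
    by (simp_all add: tensor_def ten_def)
  have a: "tn M N (m \<oplus>\<^bsub>M\<^esub> m') n = tn M N m n \<oplus>\<^bsub>M \<otimes>\<^sub>k N\<^esub> tn M N m' n"
    if "m \<in> carrier M" "m' \<in> carrier M" "n \<in> carrier N" for m m' n
    using that b.add_cls[of "[(m, n)]" "[(m', n)]"] b.cls_eqI[OF bal_eq.add_left[of m M m' n N]]
    by (simp add: tensor_def ten_def)
  have a': "tn M N m (n \<oplus>\<^bsub>N\<^esub> n') = tn M N m n \<oplus>\<^bsub>M \<otimes>\<^sub>k N\<^esub> tn M N m n'"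
    if "m \<in> carrier M" "n \<in> carrier N" "n' \<in> carrier N" for m n n'
    using that b.add_cls[of "[(m, n)]" "[(m, n')]"] b.cls_eqI[OF bal_eq.add_right[of m M n N n']]
    by (simp add: tensor_def ten_def)
  show ?thesis
    unfolding bil_def by (auto intro!: lin_mapI simp: ten_closed a a' s)
qed

lemma ten_lin_left [mlin]:
  "lin Q M f \<Longrightarrow> n \<in> carrier N \<Longrightarrow> kmod M \<Longrightarrow> kmod N \<Longrightarrow> lin Q (M \<otimes>\<^sub>k N) (\<lambda>x. tn M N (f x) n)"
  by (rule bil_left[OF ten_bil])

lemma ten_lin_right [mlin]:
  "m \<in> carrier M \<Longrightarrow> lin Q N f \<Longrightarrow> kmod M \<Longrightarrow> kmod N \<Longrightarrow> lin Q (M \<otimes>\<^sub>k N) (\<lambda>x. tn M N m (f x))"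
  by (rule bil_right[OF ten_bil])

lemma ten_smult:
  assumes "kmod M" "kmod N" "r \<in> carrier k" "m \<in> carrier M" "n \<in> carrier N"
  shows "tn M N (r \<odot>\<^bsub>M\<^esub> m) n = r \<odot>\<^bsub>M \<otimes>\<^sub>k N\<^esub> tn M N m n" "tn M N m (r \<odot>\<^bsub>N\<^esub> n) = r \<odot>\<^bsub>M \<otimes>\<^sub>k N\<^esub> tn M N m n"
  using ten_bil[OF assms(1,2)] assms(3-) by (auto simp: bil_def lin_map_def)

lemma tlift_self:
  assumes "t \<in> carrier (M \<otimes>\<^sub>k N)" "kmod M" "kmod N"
  shows "tlift (M \<otimes>\<^sub>k N) (tn M N) t = t"
  by (rule tensor_ext[OF assms(1-3), of "M \<otimes>\<^sub>k N"])
    ((rule mlin assms | assumption)+, simp add: tlift_ten[OF ten_bil] tensor_mod assms)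

lemma smult_lin_right [mlin]: "kmod P \<Longrightarrow> r \<in> carrier k \<Longrightarrow> lin M P f \<Longrightarrow> lin M P (\<lambda>x. r \<odot>\<^bsub>P\<^esub> f x)"
proof -
  assume *: "kmod P" "r \<in> carrier k" "lin M P f"
  interpret P: module k P by fact
  show ?thesis using *(2) lin_map_closed[OF *(3)]
    by (intro lin_mapI) (simp_all add: lin_map_add[OF *(3)] lin_map_smult[OF *(3)] P.smult_r_distr
      P.smult_assoc1[symmetric] P.R.m_comm)
qed

lemma smult_lin_left [mlin]:
  "kmod P \<Longrightarrow> lin M (base_module k) f \<Longrightarrow> x \<in> carrier P \<Longrightarrow> lin M P (\<lambda>a. f a \<odot>\<^bsub>P\<^esub> x)"
proof -
  assume *: "kmod P" "lin M (base_module k) f" "x \<in> carrier P"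
  interpret P: module k P by fact
  show ?thesis using * by (auto simp: lin_map_def P.smult_l_distr P.smult_assoc1 Pi_def)
qed

lemma smult_closed [mlin]: "kmod P \<Longrightarrow> r \<in> carrier k \<Longrightarrow> x \<in> carrier P \<Longrightarrow> r \<odot>\<^bsub>P\<^esub> x \<in> carrier P"
  by (simp add: module.smult_closed)

subsection \<open>Maps between tensor products\<close>

lemma tmap_ten:
  assumes "lin A M f" "lin B N g" "a \<in> carrier A" "b \<in> carrier B" "kmod A" "kmod B" "kmod M" "kmod N"
  shows "tmap k M N f g (tn A B a b) = tn M N (f a) (g b)"
  unfolding tmap_def
  by (rule tlift_ten) (rule mlin assms lin_map_closed[OF assms(1)] lin_map_closed[OF assms(2)] | assumption)+

lemma tmap_lin [mlin]:
  assumes "lin Q (A \<otimes>\<^sub>k B) h" "lin A M f" "lin B N g" "kmod A" "kmod B" "kmod M" "kmod N"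
  shows "lin Q (M \<otimes>\<^sub>k N) (\<lambda>x. tmap k M N f g (h x))"
  unfolding tmap_def
  by (rule mlin assms lin_map_closed[OF assms(2)] lin_map_closed[OF assms(3)] | assumption)+

lemma tmap_closed [mlin]:
  assumes "t \<in> carrier (A \<otimes>\<^sub>k B)" "lin A M f" "lin B N g" "kmod A" "kmod B" "kmod M" "kmod N"
  shows "tmap k M N f g t \<in> carrier (M \<otimes>\<^sub>k N)"
  by (rule lin_map_closed[OF tmap_lin[OF lin_id assms(2-)] assms(1)])

lemma tlift_tmap:
  assumes "bil k M N P F" "t \<in> carrier (A \<otimes>\<^sub>k B)" "lin A M f" "lin B N g"
    "kmod A" "kmod B" "kmod M" "kmod N" "kmod P"
  shows "tlift P F (tmap k M N f g t) = tlift P (\<lambda>a b. F (f a) (g b)) t"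
proof -
  note c = lin_map_closed[OF assms(3)] lin_map_closed[OF assms(4)]
  have "tlift P F (tmap k M N f g t) = tlift P (\<lambda>a b. tlift P F (tn M N (f a) (g b))) t"
    unfolding tmap_def by (rule tlift_hom) (rule mlin assms c | assumption)+
  also have "\<dots> = tlift P (\<lambda>a b. F (f a) (g b)) t"
    by (rule tlift_cong) (rule mlin tlift_ten assms c | assumption)+
  finally show ?thesis .
qed

lemma flip_ten:
  assumes "m \<in> carrier M" "n \<in> carrier N" "kmod M" "kmod N"
  shows "flip k M N (tn M N m n) = tn N M n m"
  unfolding flip_def by (rule tlift_ten) (rule mlin assms | assumption)+

lemma flip_lin [mlin]:
  assumes "lin Q (M \<otimes>\<^sub>k N) h" "kmod M" "kmod N"
  shows "lin Q (N \<otimes>\<^sub>k M) (\<lambda>x. flip k M N (h x))"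
  unfolding flip_def by (rule mlin assms | assumption)+

lemma flip_closed [mlin]:
  "t \<in> carrier (M \<otimes>\<^sub>k N) \<Longrightarrow> kmod M \<Longrightarrow> kmod N \<Longrightarrow> flip k M N t \<in> carrier (N \<otimes>\<^sub>k M)"
  by (rule lin_map_closed[OF flip_lin[OF lin_id]])

lemma tlift_flip:
  assumes "t \<in> carrier (M \<otimes>\<^sub>k N)" "kmod M" "kmod N" "kmod P" "bil k N M P F"
  shows "tlift P F (flip k M N t) = tlift P (\<lambda>m n. F n m) t"
proof -
  have b: "bil k M N P (\<lambda>m n. F n m)" using assms(5) by (simp add: bil_def)
  show ?thesis
    by (rule tensor_ext[OF assms(1-4)])
      ((rule mlin assms b | assumption)+,
       simp add: flip_ten assms tlift_ten[OF assms(5)] tlift_ten[OF b])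
qed

lemma flip_flip:
  assumes "t \<in> carrier (M \<otimes>\<^sub>k N)" "kmod M" "kmod N"
  shows "flip k N M (flip k M N t) = t"
  by (rule tensor_ext[OF assms(1-3) tensor_mod[OF assms(2,3)]])
    ((rule mlin assms | assumption)+, simp add: flip_ten assms)

lemma assoc_ten:
  assumes "m \<in> carrier M" "n \<in> carrier N" "p \<in> carrier P" "kmod M" "kmod N" "kmod P"
  shows "assoc k M N P (tn (M \<otimes>\<^sub>k N) P (tn M N m n) p) = tn M (N \<otimes>\<^sub>k P) m (tn N P n p)"
  unfolding assoc_def
  by (subst tlift_ten, (rule mlin assms | assumption)+, rule tlift_ten) (rule mlin assms | assumption)+

lemma assoc_lin [mlin]:
  assumes "lin Q (M \<otimes>\<^sub>k N \<otimes>\<^sub>k P) h" "kmod M" "kmod N" "kmod P"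
  shows "lin Q (M \<otimes>\<^sub>k (N \<otimes>\<^sub>k P)) (\<lambda>x. assoc k M N P (h x))"
  unfolding assoc_def by (rule mlin assms | assumption)+

text \<open>The two-sided inverse of \<open>assoc\<close>, written out because the second hexagon is
  formulated with inverse associativity constraints.\<close>

definition assoc' where
  "assoc' M N P = tlift (M \<otimes>\<^sub>k N \<otimes>\<^sub>k P)
     (\<lambda>m t. tlift (M \<otimes>\<^sub>k N \<otimes>\<^sub>k P) (\<lambda>n p. tn (M \<otimes>\<^sub>k N) P (tn M N m n) p) t)"

lemma assoc'_ten:
  assumes "m \<in> carrier M" "n \<in> carrier N" "p \<in> carrier P" "kmod M" "kmod N" "kmod P"
  shows "assoc' M N P (tn M (N \<otimes>\<^sub>k P) m (tn N P n p)) = tn (M \<otimes>\<^sub>k N) P (tn M N m n) p"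
  unfolding assoc'_def
  by (subst tlift_ten, (rule mlin assms | assumption)+, rule tlift_ten) (rule mlin assms | assumption)+

lemma assoc'_lin [mlin]:
  assumes "lin Q (M \<otimes>\<^sub>k (N \<otimes>\<^sub>k P)) h" "kmod M" "kmod N" "kmod P"
  shows "lin Q (M \<otimes>\<^sub>k N \<otimes>\<^sub>k P) (\<lambda>x. assoc' M N P (h x))"
  unfolding assoc'_def by (rule mlin assms | assumption)+

lemma assoc'_closed [mlin]:
  "t \<in> carrier (M \<otimes>\<^sub>k (N \<otimes>\<^sub>k P)) \<Longrightarrow> kmod M \<Longrightarrow> kmod N \<Longrightarrow> kmod P \<Longrightarrow>
    assoc' M N P t \<in> carrier (M \<otimes>\<^sub>k N \<otimes>\<^sub>k P)"
  by (rule lin_map_closed[OF assoc'_lin[OF lin_id]])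

lemma tensor_ext3:
  assumes "t \<in> carrier (A \<otimes>\<^sub>k B \<otimes>\<^sub>k C)" "kmod A" "kmod B" "kmod C" "kmod P"
    "lin (A \<otimes>\<^sub>k B \<otimes>\<^sub>k C) P f" "lin (A \<otimes>\<^sub>k B \<otimes>\<^sub>k C) P g"
    "\<And>a b c. a \<in> carrier A \<Longrightarrow> b \<in> carrier B \<Longrightarrow> c \<in> carrier C \<Longrightarrow>
      f (tn (A \<otimes>\<^sub>k B) C (tn A B a b) c) = g (tn (A \<otimes>\<^sub>k B) C (tn A B a b) c)"
  shows "f t = g t"
proof (rule tensor_ext[OF assms(1) tensor_mod[OF assms(2,3)] assms(4-7)])
  fix u c assume u: "u \<in> carrier (A \<otimes>\<^sub>k B)" and c: "c \<in> carrier C"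
  have *: "lin (A \<otimes>\<^sub>k B) P (\<lambda>u. h (tn (A \<otimes>\<^sub>k B) C u c))" if "lin (A \<otimes>\<^sub>k B \<otimes>\<^sub>k C) P h" for h
    by (rule lin_map_comp[OF _ that]) (rule mlin assms c | assumption)+
  show "f (tn (A \<otimes>\<^sub>k B) C u c) = g (tn (A \<otimes>\<^sub>k B) C u c)"
    by (rule tensor_ext[OF u assms(2,3,5) *[OF assms(6)] *[OF assms(7)]]) (rule assms(8) c | assumption)+
qed

lemma assoc'_assoc:
  assumes "t \<in> carrier (M \<otimes>\<^sub>k N \<otimes>\<^sub>k P)" "kmod M" "kmod N" "kmod P"
  shows "assoc' M N P (assoc k M N P t) = t"
  by (rule tensor_ext3[OF assms, of "M \<otimes>\<^sub>k N \<otimes>\<^sub>k P"])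
    ((rule mlin assms | assumption)+, simp add: assoc_ten assoc'_ten assms)

lemma tensor_ext3':
  assumes "t \<in> carrier (A \<otimes>\<^sub>k (B \<otimes>\<^sub>k C))" "kmod A" "kmod B" "kmod C" "kmod P"
    "lin (A \<otimes>\<^sub>k (B \<otimes>\<^sub>k C)) P f" "lin (A \<otimes>\<^sub>k (B \<otimes>\<^sub>k C)) P g"
    "\<And>a b c. a \<in> carrier A \<Longrightarrow> b \<in> carrier B \<Longrightarrow> c \<in> carrier C \<Longrightarrow>
      f (tn A (B \<otimes>\<^sub>k C) a (tn B C b c)) = g (tn A (B \<otimes>\<^sub>k C) a (tn B C b c))"
  shows "f t = g t"
proof (rule tensor_ext[OF assms(1,2) tensor_mod[OF assms(3,4)] assms(5-7)])
  fix u a assume u: "u \<in> carrier (B \<otimes>\<^sub>k C)" and a: "a \<in> carrier A"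
  have *: "lin (B \<otimes>\<^sub>k C) P (\<lambda>u. h (tn A (B \<otimes>\<^sub>k C) a u))" if "lin (A \<otimes>\<^sub>k (B \<otimes>\<^sub>k C)) P h" for h
    by (rule lin_map_comp[OF _ that]) (rule mlin assms a | assumption)+
  show "f (tn A (B \<otimes>\<^sub>k C) a u) = g (tn A (B \<otimes>\<^sub>k C) a u)"
    by (rule tensor_ext[OF u assms(3-5) *[OF assms(6)] *[OF assms(7)]]) (rule assms(8) a | assumption)+
qed

lemma assoc_assoc':
  assumes "t \<in> carrier (M \<otimes>\<^sub>k (N \<otimes>\<^sub>k P))" "kmod M" "kmod N" "kmod P"
  shows "assoc k M N P (assoc' M N P t) = t"
  by (rule tensor_ext3'[OF assms, of "M \<otimes>\<^sub>k (N \<otimes>\<^sub>k P)"])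
    ((rule mlin assms | assumption)+, simp add: assoc_ten assoc'_ten assms)

text \<open>Turns an equation stated through \<open>assoc\<close>, such as coassociativity, into a
  regrouping of iterated sums under a trilinear map.\<close>

lemma tlift_assoc:
  assumes "t \<in> carrier (A \<otimes>\<^sub>k B \<otimes>\<^sub>k C)" "kmod A" "kmod B" "kmod C" "kmod P"
    "\<And>a b. a \<in> carrier A \<Longrightarrow> b \<in> carrier B \<Longrightarrow> lin C P (\<lambda>c. f a b c)"
    "\<And>a c. a \<in> carrier A \<Longrightarrow> c \<in> carrier C \<Longrightarrow> lin B P (\<lambda>b. f a b c)"
    "\<And>b c. b \<in> carrier B \<Longrightarrow> c \<in> carrier C \<Longrightarrow> lin A P (\<lambda>a. f a b c)"
  shows "tlift P (\<lambda>a u. tlift P (\<lambda>b c. f a b c) u) (assoc k A B C t) =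
    tlift P (\<lambda>u c. tlift P (\<lambda>a b. f a b c) u) t"
proof (rule tensor_ext3[OF assms(1-5)])
  fix a b c assume abc: "a \<in> carrier A" "b \<in> carrier B" "c \<in> carrier C"
  have "tlift P (\<lambda>a u. tlift P (\<lambda>b c. f a b c) u) (tn A (B \<otimes>\<^sub>k C) a (tn B C b c)) = f a b c"
    by (subst tlift_ten, (rule mlin assms abc | assumption)+, rule tlift_ten) (rule mlin assms abc | assumption)+
  moreover have "tlift P (\<lambda>u c. tlift P (\<lambda>a b. f a b c) u) (tn (A \<otimes>\<^sub>k B) C (tn A B a b) c) = f a b c"
    by (subst tlift_ten, (rule mlin assms abc | assumption)+, rule tlift_ten) (rule mlin assms abc | assumption)+
  ultimately show "tlift P (\<lambda>a u. tlift P (\<lambda>b c. f a b c) u)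
      (assoc k A B C (tn (A \<otimes>\<^sub>k B) C (tn A B a b) c)) =
    tlift P (\<lambda>u c. tlift P (\<lambda>a b. f a b c) u) (tn (A \<otimes>\<^sub>k B) C (tn A B a b) c)"
    by (simp add: assoc_ten abc assms)
qed (rule mlin assms | assumption)+

end

context base
begin

subsection \<open>Algebras and modules over them\<close>

lemma alg_mod: "assoc_algebra k A \<Longrightarrow> kmod A"
  by (rule assoc_algebra.axioms)

lemma mult_closed [mlin]:
  "assoc_algebra k A \<Longrightarrow> a \<in> carrier A \<Longrightarrow> b \<in> carrier A \<Longrightarrow> a \<otimes>\<^bsub>A\<^esub> b \<in> carrier A"
  by (meson assoc_algebra.axioms(2) monoid.m_closed ring.is_monoid)

lemma one_closed [mlin]: "assoc_algebra k A \<Longrightarrow> \<one>\<^bsub>A\<^esub> \<in> carrier A"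
  by (meson assoc_algebra.axioms(2) monoid.one_closed ring.is_monoid)

lemma mult_bil: "assoc_algebra k A \<Longrightarrow> bil k A A A (\<lambda>a b. a \<otimes>\<^bsub>A\<^esub> b)"
proof -
  assume "assoc_algebra k A"
  then interpret A: assoc_algebra k A .
  show ?thesis
    unfolding bil_def
    by (auto intro!: lin_mapI simp: A.A.r_distr A.A.l_distr A.smult_mult_left A.smult_mult_right)
qed

lemma mult_lin_left [mlin]:
  "assoc_algebra k A \<Longrightarrow> lin M A f \<Longrightarrow> b \<in> carrier A \<Longrightarrow> lin M A (\<lambda>x. f x \<otimes>\<^bsub>A\<^esub> b)"
  by (rule bil_left[OF mult_bil])

lemma mult_lin_right [mlin]:
  "assoc_algebra k A \<Longrightarrow> a \<in> carrier A \<Longrightarrow> lin M A f \<Longrightarrow> lin M A (\<lambda>x. a \<otimes>\<^bsub>A\<^esub> f x)"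
  by (rule bil_right[OF mult_bil])

lemma (in balanced) cls_lsum: "prs p \<Longrightarrow> cls p = lsum BT (\<lambda>m n. cls [(m, n)]) p"
proof (induction p)
  case (Cons x p)
  obtain m n where x: "x = (m, n)" "m \<in> carrier M" "n \<in> carrier N" using Cons.prems by auto
  then have "cls (x # p) = cls [(m, n)] \<oplus>\<^bsub>BT\<^esub> cls p" using Cons.prems by (simp add: add_cls)
  then show ?case using Cons x by simp
qed (simp add: zero_BT)

lemma lsum_map: "lsum P f (map (\<lambda>(m, n). (g m n, h m n)) q) = lsum P (\<lambda>m n. f (g m n) (h m n)) q"
  by (induction q) auto

text \<open>The product is defined by multiplying representatives pair by pair. The class of a list
  is the sum of the classes of its entries (\<open>cls_lsum\<close>), which turns this into an
  iterated sum and makes bilinearity accessible.\<close>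

lemma tensor_mult:
  assumes "assoc_algebra k A" "assoc_algebra k B" "s \<in> carrier (A \<otimes>\<^sub>k B)" "t \<in> carrier (A \<otimes>\<^sub>k B)"
  shows "s \<otimes>\<^bsub>A \<otimes>\<^sub>k B\<^esub> t = tlift (A \<otimes>\<^sub>k B) (\<lambda>a b. tlift (A \<otimes>\<^sub>k B)
    (\<lambda>a' b'. tn A B (a \<otimes>\<^bsub>A\<^esub> a') (b \<otimes>\<^bsub>B\<^esub> b')) t) s"
proof -
  note m = alg_mod[OF assms(1)] alg_mod[OF assms(2)]
  interpret b: balanced k "carrier k" "\<lambda>m r. r \<odot>\<^bsub>A\<^esub> m" "\<lambda>r n. r \<odot>\<^bsub>B\<^esub> n" A B by (rule balanced_k[OF m])
  let ?l = "\<lambda>p q. concat (map (\<lambda>(m, n). map (\<lambda>(m', n'). (m \<otimes>\<^bsub>A\<^esub> m', n \<otimes>\<^bsub>B\<^esub> n')) q) p)"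
  note c = mult_closed[OF assms(1)] mult_closed[OF assms(2)] ten_closed
  have q: "b.prs (summands t)" using prs_summands[OF assms(4) m] .
  have "b.prs (?l p (summands t)) \<and> lsum (A \<otimes>\<^sub>k B) (tn A B) (?l p (summands t)) =
    lsum (A \<otimes>\<^sub>k B) (\<lambda>a b. lsum (A \<otimes>\<^sub>k B)
      (\<lambda>a' b'. tn A B (a \<otimes>\<^bsub>A\<^esub> a') (b \<otimes>\<^bsub>B\<^esub> b')) (summands t)) p" if "b.prs p" for p
    using that
  proof (induction p)
    case (Cons x p)
    obtain a b where x: "x = (a, b)" "a \<in> carrier A" "b \<in> carrier B" using Cons.prems by auto
    have pr: "b.prs (map (\<lambda>(m', n'). (a \<otimes>\<^bsub>A\<^esub> m', b \<otimes>\<^bsub>B\<^esub> n')) (summands t))"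
      using q x by (auto intro!: c)
    have IH: "b.prs (?l p (summands t))" using Cons by auto
    show ?case
      using Cons x pr IH lsum_append[OF mod_ab[OF tensor_mod[OF m]] pr IH, of "tn A B"]
      by (simp add: lsum_map c del: set_map set_concat)
  qed simp
  note * = this[OF prs_summands[OF assms(3) m]]
  have "s \<otimes>\<^bsub>A \<otimes>\<^sub>k B\<^esub> t = b.cls (?l (summands s) (summands t))"
    by (simp add: tensor_def bal_tensor_def)
  also have "\<dots> = lsum (A \<otimes>\<^sub>k B) (tn A B) (?l (summands s) (summands t))"
    using b.cls_lsum[OF *[THEN conjunct1]] by (simp only: tensor_def ten_def[abs_def])
  finally show ?thesis using * by (simp only: tlift_lsum)
qed

lemma tensor_mult_ten:
  assumes "assoc_algebra k A" "assoc_algebra k B"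
    "a \<in> carrier A" "b \<in> carrier B" "a' \<in> carrier A" "b' \<in> carrier B"
  shows "tn A B a b \<otimes>\<^bsub>A \<otimes>\<^sub>k B\<^esub> tn A B a' b' = tn A B (a \<otimes>\<^bsub>A\<^esub> a') (b \<otimes>\<^bsub>B\<^esub> b')"
proof -
  note m = alg_mod[OF assms(1)] alg_mod[OF assms(2)]
  show ?thesis
    by (subst tensor_mult, (rule mlin assms | assumption)+, subst tlift_ten, (rule mlin m assms | assumption)+,
      rule tlift_ten) (rule mlin m assms | assumption)+
qed

lemma tensor_one: "\<one>\<^bsub>A \<otimes>\<^sub>k B\<^esub> = tn A B \<one>\<^bsub>A\<^esub> \<one>\<^bsub>B\<^esub>"
  by (simp add: tensor_def bal_tensor_def ten_def)

lemma tensor_mult_bil: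
  assumes "assoc_algebra k A" "assoc_algebra k B"
  shows "bil k (A \<otimes>\<^sub>k B) (A \<otimes>\<^sub>k B) (A \<otimes>\<^sub>k B) (\<lambda>s t. s \<otimes>\<^bsub>A \<otimes>\<^sub>k B\<^esub> t)"
proof -
  note m = alg_mod[OF assms(1)] alg_mod[OF assms(2)]
  show ?thesis
  proof (rule bilI)
    fix s assume s: "s \<in> carrier (A \<otimes>\<^sub>k B)"
    show "lin (A \<otimes>\<^sub>k B) (A \<otimes>\<^sub>k B) (\<lambda>t. s \<otimes>\<^bsub>A \<otimes>\<^sub>k B\<^esub> t)"
      by (rule lin_map_cong[rotated 2], rule tensor_mult[symmetric, OF assms s], assumption)
        (rule mlin assms m s | assumption)+
  next
    fix t assume t: "t \<in> carrier (A \<otimes>\<^sub>k B)"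
    show "lin (A \<otimes>\<^sub>k B) (A \<otimes>\<^sub>k B) (\<lambda>s. s \<otimes>\<^bsub>A \<otimes>\<^sub>k B\<^esub> t)"
      by (rule lin_map_cong[rotated 2], rule tensor_mult[symmetric, OF assms _ t], assumption)
        (rule mlin assms m t | assumption)+
  qed
qed

lemma tensor_algebra [mlin]:
  assumes "assoc_algebra k A" "assoc_algebra k B"
  shows "assoc_algebra k (A \<otimes>\<^sub>k B)"
proof -
  interpret A: assoc_algebra k A by fact
  interpret B: assoc_algebra k B by fact
  note m = alg_mod[OF assms(1)] alg_mod[OF assms(2)]
  interpret T: module k "A \<otimes>\<^sub>k B" by (rule tensor_mod[OF m])
  note bl = tensor_mult_bil[OF assms]
  note bll = bil_left[OF bl] and blr = bil_right[OF bl] and blc = bil_closed[OF bl]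
  note mt = tensor_mult_ten[OF assms]
  have one: "\<one>\<^bsub>A \<otimes>\<^sub>k B\<^esub> \<in> carrier (A \<otimes>\<^sub>k B)"
    unfolding tensor_one by (rule mlin assms)+
  have l1: "\<one>\<^bsub>A \<otimes>\<^sub>k B\<^esub> \<otimes>\<^bsub>A \<otimes>\<^sub>k B\<^esub> x = x" if "x \<in> carrier (A \<otimes>\<^sub>k B)" for x
    by (rule tensor_ext[OF that m tensor_mod[OF m]])
      ((rule mlin bll blr one assms | assumption)+, simp add: tensor_one mt)
  have r1: "x \<otimes>\<^bsub>A \<otimes>\<^sub>k B\<^esub> \<one>\<^bsub>A \<otimes>\<^sub>k B\<^esub> = x" if "x \<in> carrier (A \<otimes>\<^sub>k B)" for x
    by (rule tensor_ext[OF that m tensor_mod[OF m]])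
      ((rule mlin bll blr one assms | assumption)+, simp add: tensor_one mt)
  have as: "x \<otimes>\<^bsub>A \<otimes>\<^sub>k B\<^esub> y \<otimes>\<^bsub>A \<otimes>\<^sub>k B\<^esub> z = x \<otimes>\<^bsub>A \<otimes>\<^sub>k B\<^esub> (y \<otimes>\<^bsub>A \<otimes>\<^sub>k B\<^esub> z)"
    if x: "x \<in> carrier (A \<otimes>\<^sub>k B)" and y: "y \<in> carrier (A \<otimes>\<^sub>k B)" and z: "z \<in> carrier (A \<otimes>\<^sub>k B)" for x y z
  proof (rule tensor_ext[OF x m tensor_mod[OF m]])
    fix a b assume ab: "a \<in> carrier A" "b \<in> carrier B"
    show "tn A B a b \<otimes>\<^bsub>A \<otimes>\<^sub>k B\<^esub> y \<otimes>\<^bsub>A \<otimes>\<^sub>k B\<^esub> z = tn A B a b \<otimes>\<^bsub>A \<otimes>\<^sub>k B\<^esub> (y \<otimes>\<^bsub>A \<otimes>\<^sub>k B\<^esub> z)"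
    proof (rule tensor_ext[OF y m tensor_mod[OF m]])
      fix a' b' assume ab': "a' \<in> carrier A" "b' \<in> carrier B"
      show "tn A B a b \<otimes>\<^bsub>A \<otimes>\<^sub>k B\<^esub> tn A B a' b' \<otimes>\<^bsub>A \<otimes>\<^sub>k B\<^esub> z =
          tn A B a b \<otimes>\<^bsub>A \<otimes>\<^sub>k B\<^esub> (tn A B a' b' \<otimes>\<^bsub>A \<otimes>\<^sub>k B\<^esub> z)"
        by (rule tensor_ext[OF z m tensor_mod[OF m]])
          ((rule bll blr blc one mlin ab ab' assms | assumption)+, simp add: mt ab ab' A.A.m_assoc B.A.m_assoc)
    qed (rule bll blr blc mlin ab z | assumption)+
  qed (rule bll blr blc mlin y z | assumption)+
  show ?thesis
  proof (intro assoc_algebra.intro tensor_mod m assoc_algebra_axioms.intro ringI T.abelian_group_axioms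
      monoidI as one l1 r1 blc; (assumption)?)
    fix x y z assume xyz: "x \<in> carrier (A \<otimes>\<^sub>k B)" "y \<in> carrier (A \<otimes>\<^sub>k B)" "z \<in> carrier (A \<otimes>\<^sub>k B)"
    show "(x \<oplus>\<^bsub>A \<otimes>\<^sub>k B\<^esub> y) \<otimes>\<^bsub>A \<otimes>\<^sub>k B\<^esub> z = x \<otimes>\<^bsub>A \<otimes>\<^sub>k B\<^esub> z \<oplus>\<^bsub>A \<otimes>\<^sub>k B\<^esub> y \<otimes>\<^bsub>A \<otimes>\<^sub>k B\<^esub> z"
      "z \<otimes>\<^bsub>A \<otimes>\<^sub>k B\<^esub> (x \<oplus>\<^bsub>A \<otimes>\<^sub>k B\<^esub> y) = z \<otimes>\<^bsub>A \<otimes>\<^sub>k B\<^esub> x \<oplus>\<^bsub>A \<otimes>\<^sub>k B\<^esub> z \<otimes>\<^bsub>A \<otimes>\<^sub>k B\<^esub> y"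
      using bl xyz by (auto simp: bil_def lin_map_def)
  next
    fix r x y assume "r \<in> carrier k" "x \<in> carrier (A \<otimes>\<^sub>k B)" "y \<in> carrier (A \<otimes>\<^sub>k B)"
    then show "(r \<odot>\<^bsub>A \<otimes>\<^sub>k B\<^esub> x) \<otimes>\<^bsub>A \<otimes>\<^sub>k B\<^esub> y = r \<odot>\<^bsub>A \<otimes>\<^sub>k B\<^esub> (x \<otimes>\<^bsub>A \<otimes>\<^sub>k B\<^esub> y)"
      "x \<otimes>\<^bsub>A \<otimes>\<^sub>k B\<^esub> (r \<odot>\<^bsub>A \<otimes>\<^sub>k B\<^esub> y) = r \<odot>\<^bsub>A \<otimes>\<^sub>k B\<^esub> (x \<otimes>\<^bsub>A \<otimes>\<^sub>k B\<^esub> y)"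
      using bl by (auto simp: bil_def lin_map_def)
  qed
qed

text \<open>Converts equations between products in a tensor product of algebras, such as those for
  \<open>R\<close> and its inverse, into equations between double sums.\<close>

lemma tlift_mult:
  assumes "assoc_algebra k A" "assoc_algebra k B" "s \<in> carrier (A \<otimes>\<^sub>k B)" "t \<in> carrier (A \<otimes>\<^sub>k B)"
    "kmod P" "bil k A B P F"
  shows "tlift P F (s \<otimes>\<^bsub>A \<otimes>\<^sub>k B\<^esub> t) =
    tlift P (\<lambda>a b. tlift P (\<lambda>a' b'. F (a \<otimes>\<^bsub>A\<^esub> a') (b \<otimes>\<^bsub>B\<^esub> b')) t) s"
proof -
  note [mlin] = assms alg_mod[OF assms(1)] alg_mod[OF assms(2)] bil_left[OF assms(6)]
    bil_right[OF assms(6)] bil_closed[OF assms(6)]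
  show ?thesis
  proof (rule tensor_ext[OF assms(3), of P])
    fix a b assume [mlin]: "a \<in> carrier A" "b \<in> carrier B"
    have "tlift P F (tn A B a b \<otimes>\<^bsub>A \<otimes>\<^sub>k B\<^esub> t) = tlift P (\<lambda>a' b'. F (a \<otimes>\<^bsub>A\<^esub> a') (b \<otimes>\<^bsub>B\<^esub> b')) t"
    proof (rule tensor_ext[OF assms(4), of P])
      fix a' b' assume [mlin]: "a' \<in> carrier A" "b' \<in> carrier B"
      have "tlift P F (tn A B a b \<otimes>\<^bsub>A \<otimes>\<^sub>k B\<^esub> tn A B a' b') = F (a \<otimes>\<^bsub>A\<^esub> a') (b \<otimes>\<^bsub>B\<^esub> b')"
        by (subst tensor_mult_ten, (rule mlin)+, rule tlift_ten) (rule mlin | assumption)+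
      also have "\<dots> = tlift P (\<lambda>a' b'. F (a \<otimes>\<^bsub>A\<^esub> a') (b \<otimes>\<^bsub>B\<^esub> b')) (tn A B a' b')"
        by (rule tlift_ten[symmetric]) (rule mlin | assumption)+
      finally show "tlift P F (tn A B a b \<otimes>\<^bsub>A \<otimes>\<^sub>k B\<^esub> tn A B a' b') = \<dots>" .
    qed (rule mlin | assumption)+
    also have "\<dots> = tlift P (\<lambda>a b. tlift P (\<lambda>a' b'. F (a \<otimes>\<^bsub>A\<^esub> a') (b \<otimes>\<^bsub>B\<^esub> b')) t) (tn A B a b)"
      by (rule tlift_ten[symmetric]) (rule mlin | assumption)+
    finally show "tlift P F (tn A B a b \<otimes>\<^bsub>A \<otimes>\<^sub>k B\<^esub> t) = \<dots>" .
  qed (rule mlin | assumption)+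
qed

lemma amodule_mod: "amodule k A X \<Longrightarrow> kmod X"
  by (rule amodule.axioms)

lemma act_bil: "amodule k A X \<Longrightarrow> bil k A X X (act X)"
  unfolding bil_def
  by (auto intro!: lin_mapI amodule.act_add amodule.act_smult amodule.act_lin
    dest: amodule.act_lin[THEN lin_map_closed])

lemma act_closed [mlin]: "amodule k A X \<Longrightarrow> a \<in> carrier A \<Longrightarrow> x \<in> carrier X \<Longrightarrow> act X a x \<in> carrier X"
  by (rule bil_closed[OF act_bil])

lemma act_lin_left [mlin]:
  "amodule k A X \<Longrightarrow> lin M A f \<Longrightarrow> x \<in> carrier X \<Longrightarrow> lin M X (\<lambda>a. act X (f a) x)"
  by (rule bil_left[OF act_bil])

lemma act_lin_right [mlin]:
  "amodule k A X \<Longrightarrow> a \<in> carrier A \<Longrightarrow> lin M X f \<Longrightarrow> lin M X (\<lambda>x. act X a (f x))"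
  by (rule bil_right[OF act_bil])

lemma amoduleI:
  assumes "kmod X" "bil k A X X (act X)"
    "\<And>a b x. a \<in> carrier A \<Longrightarrow> b \<in> carrier A \<Longrightarrow> x \<in> carrier X \<Longrightarrow>
      act X (a \<otimes>\<^bsub>A\<^esub> b) x = act X a (act X b x)"
    "\<And>x. x \<in> carrier X \<Longrightarrow> act X \<one>\<^bsub>A\<^esub> x = x"
  shows "amodule k A X"
  using assms by (auto simp: bil_def lin_map_def intro!: amodule.intro amodule_axioms.intro)

end

section \<open>The action of a tensor product of algebras on a tensor product of modules\<close>

locale two_modules = base k for k :: "('k, 'r) ring_scheme" +
  fixes A :: "('k, 'a univ, 'x) module_scheme" and B :: "('k, 'a univ, 'y) module_scheme"
    and X Y :: "('k, 'a univ, 'a univ) amod"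
  assumes AB [mlin]: "assoc_algebra k A" "assoc_algebra k B" "amodule k A X" "amodule k B Y"
begin

lemma mods [mlin]: "kmod A" "kmod B" "kmod X" "kmod Y"
  using AB by (auto intro: alg_mod amodule_mod)

lemma act2_pure:
  assumes [mlin]: "r \<in> carrier (A \<otimes>\<^sub>k B)" "x \<in> carrier X" "y \<in> carrier Y"
  shows "act2 k X Y r (tn X Y x y) = tlift (X \<otimes>\<^sub>k Y) (\<lambda>a b. tn X Y (act X a x) (act Y b y)) r"
  unfolding act2_def
  by (rule tlift_cong[of _ A B], (rule mlin)+, rule tmap_ten) (rule mlin | assumption)+

lemma act2_bil: "bil k (A \<otimes>\<^sub>k B) (X \<otimes>\<^sub>k Y) (X \<otimes>\<^sub>k Y) (act2 k X Y)"
  unfolding act2_def tmap_def by (rule mlin | assumption)+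

lemmas act2_lin = bil_left[OF act2_bil] bil_right[OF act2_bil]

lemma act2_ten:
  assumes [mlin]: "a \<in> carrier A" "b \<in> carrier B" "x \<in> carrier X" "y \<in> carrier Y"
  shows "act2 k X Y (tn A B a b) (tn X Y x y) = tn X Y (act X a x) (act Y b y)"
  by (subst act2_pure, (rule mlin)+, rule tlift_ten) (rule mlin | assumption)+

lemma act2_amodule: "amodule k (A \<otimes>\<^sub>k B) (with_act (X \<otimes>\<^sub>k Y) (act2 k X Y))"
proof (rule amoduleI; (simp only: with_act_simps)?)
  show "bil k (A \<otimes>\<^sub>k B) (with_act (X \<otimes>\<^sub>k Y) (act2 k X Y)) (with_act (X \<otimes>\<^sub>k Y) (act2 k X Y)) (act2 k X Y)"
    using act2_bil by (simp add: bil_def)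
  fix t assume t: "t \<in> carrier (X \<otimes>\<^sub>k Y)"
  show "act2 k X Y \<one>\<^bsub>A \<otimes>\<^sub>k B\<^esub> t = t"
    by (rule tensor_ext[OF t, of "X \<otimes>\<^sub>k Y"])
      ((rule mlin act2_lin | assumption)+,
        simp add: tensor_one act2_ten one_closed AB amodule.act_one[OF AB(3)] amodule.act_one[OF AB(4)])
  fix r s assume r: "r \<in> carrier (A \<otimes>\<^sub>k B)" and s: "s \<in> carrier (A \<otimes>\<^sub>k B)"
  note [mlin] = act2_lin bil_closed[OF act2_bil]
  show "act2 k X Y (r \<otimes>\<^bsub>A \<otimes>\<^sub>k B\<^esub> s) t = act2 k X Y r (act2 k X Y s t)"
  proof (rule tensor_ext[OF r, of "X \<otimes>\<^sub>k Y"])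
    fix a b assume [mlin]: "a \<in> carrier A" "b \<in> carrier B"
    show "act2 k X Y (tn A B a b \<otimes>\<^bsub>A \<otimes>\<^sub>k B\<^esub> s) t = act2 k X Y (tn A B a b) (act2 k X Y s t)"
    proof (rule tensor_ext[OF s, of "X \<otimes>\<^sub>k Y"])
      fix a' b' assume [mlin]: "a' \<in> carrier A" "b' \<in> carrier B"
      show "act2 k X Y (tn A B a b \<otimes>\<^bsub>A \<otimes>\<^sub>k B\<^esub> tn A B a' b') t =
          act2 k X Y (tn A B a b) (act2 k X Y (tn A B a' b') t)"
      proof (rule tensor_ext[OF t, of "X \<otimes>\<^sub>k Y"])
        fix x y assume [mlin]: "x \<in> carrier X" "y \<in> carrier Y"
        have c: "a \<in> carrier A" "b \<in> carrier B" "a' \<in> carrier A" "b' \<in> carrier B"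
          "x \<in> carrier X" "y \<in> carrier Y" by (rule mlin)+
        show "act2 k X Y (tn A B a b \<otimes>\<^bsub>A \<otimes>\<^sub>k B\<^esub> tn A B a' b') (tn X Y x y) =
          act2 k X Y (tn A B a b) (act2 k X Y (tn A B a' b') (tn X Y x y))"
          using c by (simp add: tensor_mult_ten[OF AB(1,2)] act2_ten mult_closed[OF AB(1)]
            mult_closed[OF AB(2)] act_closed[OF AB(3)] act_closed[OF AB(4)]
            amodule.act_mult[OF AB(3)] amodule.act_mult[OF AB(4)])
      qed (rule mlin | assumption)+
    qed (rule mlin t | assumption)+
  qed (rule mlin s t | assumption)+
qed (rule mlin)+

end

section \<open>Quasitriangular Hopf algebras\<close>

locale qt_hopf = base k for k :: "('k, 'r) ring_scheme" +
  fixes H :: "('k, 'a univ) hopf" and R :: "'a univ"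
  assumes qt: "quasitriangular_hopf_algebra k H R"
begin

abbreviation "hmod \<equiv> amodule k H"
abbreviation "\<Delta> \<equiv> comul H"
abbreviation "HH \<equiv> H \<otimes>\<^sub>k H"
abbreviation "Ri \<equiv> inv\<^bsub>HH\<^esub> R"
abbreviation "\<epsilon> \<equiv> counit H"
abbreviation "htens \<equiv> htensor k H"

lemma hopf: "hopf_algebra k H"
  using qt by (rule quasitriangular_hopf_algebra.axioms)

lemma H_alg [mlin]: "assoc_algebra k H"
  using hopf by (rule hopf_algebra.axioms)

lemma H_mod [mlin]: "kmod H"
  by (rule alg_mod[OF H_alg])

lemma hmod_mod [mlin]: "hmod X \<Longrightarrow> kmod X"
  by (rule amodule_mod)

lemma comul_lin [mlin]: "lin M H f \<Longrightarrow> lin M HH (\<lambda>x. \<Delta> (f x))"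
  by (rule lin_map_comp[OF _ hopf_algebra.comul_lin[OF hopf]])

lemma comul_closed [mlin]: "h \<in> carrier H \<Longrightarrow> \<Delta> h \<in> carrier HH"
  by (rule lin_map_closed[OF comul_lin[OF lin_id]])

lemma counit_lin [mlin]: "lin M H f \<Longrightarrow> lin M (base_module k) (\<lambda>x. \<epsilon> (f x))"
  by (rule lin_map_comp[OF _ hopf_algebra.counit_lin[OF hopf]])

lemma counit_closed [mlin]: "h \<in> carrier H \<Longrightarrow> \<epsilon> h \<in> carrier k"
  using lin_map_closed[OF counit_lin[OF lin_id]] by simp

lemma R_Units: "R \<in> Units HH"
  using quasitriangular_hopf_algebra.R_unit[OF qt] .

lemma HH_monoid: "monoid HH"
  by (meson tensor_algebra H_alg assoc_algebra.axioms(2) ring.is_monoid)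

lemma R_closed [mlin]: "R \<in> carrier HH"
  by (rule monoid.Units_closed[OF HH_monoid R_Units])

lemma Ri_closed [mlin]: "Ri \<in> carrier HH"
  by (rule monoid.Units_inv_closed[OF HH_monoid R_Units])

lemma R_Ri: "R \<otimes>\<^bsub>HH\<^esub> Ri = \<one>\<^bsub>HH\<^esub>" "Ri \<otimes>\<^bsub>HH\<^esub> R = \<one>\<^bsub>HH\<^esub>"
  using monoid.Units_r_inv[OF HH_monoid R_Units] monoid.Units_l_inv[OF HH_monoid R_Units] by auto

definition tri where
  "tri A B C P f \<longleftrightarrow> (\<forall>a\<in>carrier A. \<forall>b\<in>carrier B. lin C P (\<lambda>c. f a b c)) \<and>
    (\<forall>a\<in>carrier A. \<forall>c\<in>carrier C. lin B P (\<lambda>b. f a b c)) \<and>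
    (\<forall>b\<in>carrier B. \<forall>c\<in>carrier C. lin A P (\<lambda>a. f a b c))"

lemma triI [mlin]:
  assumes "\<And>a b. a \<in> carrier A \<Longrightarrow> b \<in> carrier B \<Longrightarrow> lin C P (\<lambda>c. f a b c)"
    "\<And>a c. a \<in> carrier A \<Longrightarrow> c \<in> carrier C \<Longrightarrow> lin B P (\<lambda>b. f a b c)"
    "\<And>b c. b \<in> carrier B \<Longrightarrow> c \<in> carrier C \<Longrightarrow> lin A P (\<lambda>a. f a b c)"
  shows "tri A B C P f"
  using assms by (simp add: tri_def)

lemma tri_lin:
  assumes "tri A B C P f"
  shows "lin M C g \<Longrightarrow> a \<in> carrier A \<Longrightarrow> b \<in> carrier B \<Longrightarrow> lin M P (\<lambda>c. f a b (g c))"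
    "lin M B g \<Longrightarrow> a \<in> carrier A \<Longrightarrow> c \<in> carrier C \<Longrightarrow> lin M P (\<lambda>b. f a (g b) c)"
    "lin M A g \<Longrightarrow> b \<in> carrier B \<Longrightarrow> c \<in> carrier C \<Longrightarrow> lin M P (\<lambda>a. f (g a) b c)"
  using assms by (auto simp: tri_def intro: lin_map_comp)

text \<open>Apply the map induced by \<open>f\<close> to both sides of \<open>coassoc\<close>. In
  Sweedler notation, h1 \<otimes> h2 \<otimes> h3 needs no brackets under a trilinear map.\<close>

lemma tlift_comul_assoc:
  assumes [mlin]: "h \<in> carrier H" "kmod P" and f: "tri H H H P f"
  shows "tlift P (\<lambda>a b. tlift P (\<lambda>a1 a2. f a1 a2 b) (\<Delta> a)) (\<Delta> h) =
    tlift P (\<lambda>a b. tlift P (\<lambda>b1 b2. f a b1 b2) (\<Delta> b)) (\<Delta> h)"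
proof -
  note [mlin] = tri_lin[OF f]
  have id: "lin H H id" by (simp add: id_def lin_id)
  note [mlin] = id comul_lin[OF lin_id]
  have "tlift P (\<lambda>a b. tlift P (\<lambda>a1 a2. f a1 a2 b) (\<Delta> a)) (\<Delta> h) =
      tlift P (\<lambda>u c. tlift P (\<lambda>a b. f a b c) u) (tmap k HH H \<Delta> id (\<Delta> h))"
    by (subst tlift_tmap[of HH H P _ _ H H]) (rule mlin | assumption | simp)+
  also have "\<dots> = tlift P (\<lambda>a u. tlift P (\<lambda>b c. f a b c) u) (assoc k H H H (tmap k HH H \<Delta> id (\<Delta> h)))"
    by (rule tlift_assoc[symmetric]) (rule mlin | assumption)+
  also have "\<dots> = tlift P (\<lambda>a u. tlift P (\<lambda>b c. f a b c) u) (tmap k H HH id \<Delta> (\<Delta> h))"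
    by (simp add: hopf_algebra.coassoc[OF hopf assms(1)])
  also have "\<dots> = tlift P (\<lambda>a b. tlift P (\<lambda>b1 b2. f a b1 b2) (\<Delta> b)) (\<Delta> h)"
    by (subst tlift_tmap[of H HH P _ _ H H]) (rule mlin | assumption | simp)+
  finally show ?thesis .
qed

lemma tlift_counit_left:
  assumes [mlin]: "h \<in> carrier H" "kmod P" and f: "lin H P f"
  shows "tlift P (\<lambda>a b. \<epsilon> a \<odot>\<^bsub>P\<^esub> f b) (\<Delta> h) = f h"
proof -
  have "f (tlift H (\<lambda>a b. \<epsilon> a \<odot>\<^bsub>H\<^esub> b) (\<Delta> h)) = tlift P (\<lambda>a b. f (\<epsilon> a \<odot>\<^bsub>H\<^esub> b)) (\<Delta> h)"
    by (rule tlift_hom[OF f]) (rule mlin | assumption)+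
  also have "\<dots> = tlift P (\<lambda>a b. \<epsilon> a \<odot>\<^bsub>P\<^esub> f b) (\<Delta> h)"
    by (rule tlift_cong, (rule mlin)+, rule lin_map_smult[OF f]) (rule mlin | assumption)+
  finally show ?thesis by (simp add: hopf_algebra.counit_left[OF hopf assms(1)])
qed

lemma tlift_counit_right:
  assumes [mlin]: "h \<in> carrier H" "kmod P" and f: "lin H P f"
  shows "tlift P (\<lambda>a b. \<epsilon> b \<odot>\<^bsub>P\<^esub> f a) (\<Delta> h) = f h"
proof -
  have "f (tlift H (\<lambda>a b. \<epsilon> b \<odot>\<^bsub>H\<^esub> a) (\<Delta> h)) = tlift P (\<lambda>a b. f (\<epsilon> b \<odot>\<^bsub>H\<^esub> a)) (\<Delta> h)"
    by (rule tlift_hom[OF f]) (rule mlin | assumption)+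
  also have "\<dots> = tlift P (\<lambda>a b. \<epsilon> b \<odot>\<^bsub>P\<^esub> f a) (\<Delta> h)"
    by (rule tlift_cong, (rule mlin)+, rule lin_map_smult[OF f]) (rule mlin | assumption)+
  finally show ?thesis by (simp add: hopf_algebra.counit_right[OF hopf assms(1)])
qed

abbreviation "T3 \<equiv> HH \<otimes>\<^sub>k H"

lemma tlift_T3_mult:
  assumes [mlin]: "s \<in> carrier HH" "t \<in> carrier HH" "bil k H H T3 U" "bil k H H T3 V"
  shows "tlift T3 U s \<otimes>\<^bsub>T3\<^esub> tlift T3 V t =
    tlift T3 (\<lambda>a b. tlift T3 (\<lambda>a' b'. U a b \<otimes>\<^bsub>T3\<^esub> V a' b') t) s"
proof -
  note [mlin] = bil_left[OF assms(3)] bil_right[OF assms(3)] bil_closed[OF assms(3)]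
    bil_left[OF assms(4)] bil_right[OF assms(4)] bil_closed[OF assms(4)]
  have "tlift T3 U s \<otimes>\<^bsub>T3\<^esub> tlift T3 V t = tlift T3 (\<lambda>a b. U a b \<otimes>\<^bsub>T3\<^esub> tlift T3 V t) s"
    by (rule tlift_hom[where h = "\<lambda>u. u \<otimes>\<^bsub>T3\<^esub> tlift T3 V t"]) (rule mlin | assumption)+
  also have "\<dots> = tlift T3 (\<lambda>a b. tlift T3 (\<lambda>a' b'. U a b \<otimes>\<^bsub>T3\<^esub> V a' b') t) s"
    by (rule tlift_cong[of _ H H], (rule mlin)+, rule tlift_hom[where P = T3]) (rule mlin | assumption)+
  finally show ?thesis .
qed

lemma tlift_T3:
  assumes [mlin]: "s \<in> carrier HH" "kmod P" and f: "tri H H H P f" and U: "bil k H H T3 U"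
  shows "tlift P (\<lambda>u c. tlift P (\<lambda>a b. f a b c) u) (tlift T3 U s) =
    tlift P (\<lambda>a b. tlift P (\<lambda>u c. tlift P (\<lambda>a b. f a b c) u) (U a b)) s"
proof -
  note [mlin] = tri_lin[OF f] bil_left[OF U] bil_right[OF U] bil_closed[OF U]
  show ?thesis
    by (rule tlift_hom[of T3 P]) (rule mlin | assumption)+
qed

lemma tlift_T3_ten:
  assumes [mlin]: "a \<in> carrier H" "b \<in> carrier H" "c \<in> carrier H" "kmod P" and f: "tri H H H P f"
  shows "tlift P (\<lambda>u c. tlift P (\<lambda>a b. f a b c) u) (tn HH H (tn H H a b) c) = f a b c"
proof -
  note [mlin] = tri_lin[OF f]
  show ?thesis
    by (subst tlift_ten, (rule mlin | assumption)+, rule tlift_ten) (rule mlin | assumption)+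
qed

text \<open>This leg is defined by tensoring \<open>R\<close> as a whole with 1. As a sum over
  \<open>R\<close> it has the shape of the other two legs, which is what \<open>tlift_legs\<close>
  multiplies.\<close>

lemma leg12: "leg12 k H R = tlift T3 (\<lambda>a b. tn HH H (tn H H a b) \<one>\<^bsub>H\<^esub>) R"
proof -
  have "leg12 k H R = tn HH H (tlift HH (tn H H) R) \<one>\<^bsub>H\<^esub>"
    by (simp add: leg12_def tlift_self R_closed H_mod)
  also have "\<dots> = tlift T3 (\<lambda>a b. tn HH H (tn H H a b) \<one>\<^bsub>H\<^esub>) R"
    by (rule tlift_hom[where h = "\<lambda>u. tn HH H u \<one>\<^bsub>H\<^esub>"]) (rule mlin | assumption)+
  finally show ?thesis .
qed

text \<open>The calculation common to the two axioms on the coproduct of \<open>R\<close>: a product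
  of two legs is a double sum over two copies of \<open>R\<close>, and \<open>W\<close> records the
  value of the trilinear map on a product of pure legs.\<close>

lemma tlift_legs:
  assumes [mlin]: "kmod P" and f: "tri H H H P f"
    and U: "bil k H H T3 U" and V: "bil k H H T3 V"
    and W: "\<And>a b a' b'. a \<in> carrier H \<Longrightarrow> b \<in> carrier H \<Longrightarrow> a' \<in> carrier H \<Longrightarrow> b' \<in> carrier H \<Longrightarrow>
      tlift P (\<lambda>u c. tlift P (\<lambda>a b. f a b c) u) (U a b \<otimes>\<^bsub>T3\<^esub> V a' b') = W a b a' b'"
  shows "tlift P (\<lambda>u c. tlift P (\<lambda>a b. f a b c) u) (tlift T3 U R \<otimes>\<^bsub>T3\<^esub> tlift T3 V R) =
    tlift P (\<lambda>a b. tlift P (\<lambda>a' b'. W a b a' b') R) R"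
proof -
  note [mlin] = tri_lin[OF f] bil_left[OF U] bil_right[OF U] bil_closed[OF U]
    bil_left[OF V] bil_right[OF V] bil_closed[OF V]
  let ?G = "\<lambda>t. tlift P (\<lambda>u c. tlift P (\<lambda>a b. f a b c) u) t"
  have "?G (tlift T3 U R \<otimes>\<^bsub>T3\<^esub> tlift T3 V R) =
      ?G (tlift T3 (\<lambda>a b. tlift T3 (\<lambda>a' b'. U a b \<otimes>\<^bsub>T3\<^esub> V a' b') R) R)"
    by (simp only: tlift_T3_mult[OF R_closed R_closed U V])
  also have "\<dots> = tlift P (\<lambda>a b. ?G (tlift T3 (\<lambda>a' b'. U a b \<otimes>\<^bsub>T3\<^esub> V a' b') R)) R"
    by (rule tlift_T3[OF _ _ f]) (rule mlin | assumption)+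
  also have "\<dots> = tlift P (\<lambda>a b. tlift P (\<lambda>a' b'. ?G (U a b \<otimes>\<^bsub>T3\<^esub> V a' b')) R) R"
    by (rule tlift_cong[of _ H H], (rule mlin)+, rule tlift_T3[OF _ _ f]) (rule mlin | assumption)+
  also have "\<dots> = tlift P (\<lambda>a b. tlift P (\<lambda>a' b'. W a b a' b') R) R"
    by (rule tlift_cong[of _ H H], (rule mlin)+, rule tlift_cong[of _ H H], (rule mlin)+, rule W) (assumption+)
  finally show ?thesis .
qed

text \<open>R13 R23 consists of the products (a \<otimes> 1 \<otimes> b) (1 \<otimes> a' \<otimes>
  b'), so the two components in the last leg are multiplied.\<close>

lemma tlift_R_left:
  assumes [mlin]: "kmod P" and f: "tri H H H P f"
  shows "tlift P (\<lambda>a b. tlift P (\<lambda>a1 a2. f a1 a2 b) (\<Delta> a)) R =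
    tlift P (\<lambda>a b. tlift P (\<lambda>a' b'. f a a' (b \<otimes>\<^bsub>H\<^esub> b')) R) R"
proof -
  note [mlin] = tri_lin[OF f]
  have id: "lin H H id" by (simp add: id_def lin_id)
  note [mlin] = id comul_lin[OF lin_id]
  interpret H: assoc_algebra k H by (rule H_alg)
  have "tlift P (\<lambda>a b. tlift P (\<lambda>a1 a2. f a1 a2 b) (\<Delta> a)) R =
      tlift P (\<lambda>u c. tlift P (\<lambda>a b. f a b c) u) (tmap k HH H \<Delta> id R)"
    by (subst tlift_tmap[of HH H P _ _ H H]) (rule mlin | assumption | simp)+
  also have "\<dots> = tlift P (\<lambda>u c. tlift P (\<lambda>a b. f a b c) u) (leg13 k H R \<otimes>\<^bsub>T3\<^esub> leg23 k H R)"
    by (simp add: quasitriangular_hopf_algebra.R_comul_left[OF qt] tensor3_def)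
  also have "\<dots> = tlift P (\<lambda>a b. tlift P (\<lambda>a' b'. f a a' (b \<otimes>\<^bsub>H\<^esub> b')) R) R"
    unfolding leg13_def leg23_def tensor3_def
    by (rule tlift_legs[OF _ f])
      (rule mlin | assumption |
       simp add: tensor_mult_ten tensor_algebra H_alg ten_closed mult_closed one_closed tlift_T3_ten[OF _ _ _ assms(1) f])+
  finally show ?thesis .
qed

text \<open>R13 R12 consists of the products (a \<otimes> 1 \<otimes> b) (a' \<otimes> b' \<otimes>
  1). The leg 13 comes first in the product, hence the order b', b of the last two
  arguments.\<close>

lemma tlift_R_right:
  assumes [mlin]: "kmod P" and f: "tri H H H P f"
  shows "tlift P (\<lambda>a b. tlift P (\<lambda>b1 b2. f a b1 b2) (\<Delta> b)) R =
    tlift P (\<lambda>a b. tlift P (\<lambda>a' b'. f (a \<otimes>\<^bsub>H\<^esub> a') b' b) R) R"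
proof -
  note [mlin] = tri_lin[OF f]
  have id: "lin H H id" by (simp add: id_def lin_id)
  note [mlin] = id comul_lin[OF lin_id]
  interpret H: assoc_algebra k H by (rule H_alg)
  have lc: "leg13 k H R \<in> carrier T3" "leg12 k H R \<in> carrier T3"
    unfolding leg12 leg13_def tensor3_def by (rule mlin | assumption)+
  have "tlift P (\<lambda>a b. tlift P (\<lambda>b1 b2. f a b1 b2) (\<Delta> b)) R =
      tlift P (\<lambda>a u. tlift P (\<lambda>b c. f a b c) u) (tmap k H HH id \<Delta> R)"
    by (subst tlift_tmap[of H HH P _ _ H H]) (rule mlin | assumption | simp)+
  also have "\<dots> = tlift P (\<lambda>a u. tlift P (\<lambda>b c. f a b c) u)
      (assoc k H H H (leg13 k H R \<otimes>\<^bsub>T3\<^esub> leg12 k H R))"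
    by (simp add: quasitriangular_hopf_algebra.R_comul_right[OF qt] tensor3_def)
  also have "\<dots> = tlift P (\<lambda>u c. tlift P (\<lambda>a b. f a b c) u) (leg13 k H R \<otimes>\<^bsub>T3\<^esub> leg12 k H R)"
    by (rule tlift_assoc) (rule mlin lc | assumption)+
  also have "\<dots> = tlift P (\<lambda>a b. tlift P (\<lambda>a' b'. f (a \<otimes>\<^bsub>H\<^esub> a') b' b) R) R"
    unfolding leg13_def leg12 tensor3_def
    by (rule tlift_legs[OF _ f])
      (rule mlin | assumption |
       simp add: tensor_mult_ten tensor_algebra H_alg ten_closed mult_closed one_closed tlift_T3_ten[OF _ _ _ assms(1) f])+
  finally show ?thesis .
qed

lemma tlift_R_comul:
  assumes [mlin]: "kmod P" "h \<in> carrier H" and F: "bil k H H P F"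
  shows "tlift P (\<lambda>a b. tlift P (\<lambda>h1 h2. F (a \<otimes>\<^bsub>H\<^esub> h1) (b \<otimes>\<^bsub>H\<^esub> h2)) (\<Delta> h)) R =
    tlift P (\<lambda>h1 h2. tlift P (\<lambda>a b. F (h2 \<otimes>\<^bsub>H\<^esub> a) (h1 \<otimes>\<^bsub>H\<^esub> b)) R) (\<Delta> h)"
proof -
  note [mlin] = bil_left[OF F] bil_right[OF F] bil_closed[OF F]
  have "tlift P (\<lambda>a b. tlift P (\<lambda>h1 h2. F (a \<otimes>\<^bsub>H\<^esub> h1) (b \<otimes>\<^bsub>H\<^esub> h2)) (\<Delta> h)) R =
      tlift P F (R \<otimes>\<^bsub>HH\<^esub> \<Delta> h)"
    by (rule tlift_mult[symmetric]) (rule mlin F)+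
  also have "\<dots> = tlift P F (flip k H H (\<Delta> h) \<otimes>\<^bsub>HH\<^esub> R)"
    by (simp add: quasitriangular_hopf_algebra.R_comul[OF qt assms(2)])
  also have "\<dots> = tlift P (\<lambda>h2 h1. tlift P (\<lambda>a b. F (h2 \<otimes>\<^bsub>H\<^esub> a) (h1 \<otimes>\<^bsub>H\<^esub> b)) R) (flip k H H (\<Delta> h))"
    by (rule tlift_mult) (rule mlin F)+
  also have "\<dots> = tlift P (\<lambda>h1 h2. tlift P (\<lambda>a b. F (h2 \<otimes>\<^bsub>H\<^esub> a) (h1 \<otimes>\<^bsub>H\<^esub> b)) R) (\<Delta> h)"
    by (rule tlift_flip) (rule mlin | assumption)+
  finally show ?thesis .
qed

lemma tlift_inverse:
  assumes [mlin]: "kmod P" "s \<in> carrier HH" "t \<in> carrier HH" and F: "bil k H H P F"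
    and "s \<otimes>\<^bsub>HH\<^esub> t = \<one>\<^bsub>HH\<^esub>"
  shows "tlift P (\<lambda>a b. tlift P (\<lambda>a' b'. F (a \<otimes>\<^bsub>H\<^esub> a') (b \<otimes>\<^bsub>H\<^esub> b')) t) s = F \<one>\<^bsub>H\<^esub> \<one>\<^bsub>H\<^esub>"
proof -
  have "tlift P (\<lambda>a b. tlift P (\<lambda>a' b'. F (a \<otimes>\<^bsub>H\<^esub> a') (b \<otimes>\<^bsub>H\<^esub> b')) t) s = tlift P F (s \<otimes>\<^bsub>HH\<^esub> t)"
    by (rule tlift_mult[symmetric]) (rule mlin F)+
  also have "\<dots> = F \<one>\<^bsub>H\<^esub> \<one>\<^bsub>H\<^esub>"
    unfolding assms(5) tensor_one by (rule tlift_ten) (rule mlin F)+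
  finally show ?thesis .
qed

text \<open>Put u = (\<epsilon> \<otimes> id) R. The counit applied to the first leg of (\<Delta>
  \<otimes> id) R = R13 R23 gives R = (1 \<otimes> u) R, and \<open>R\<close> is invertible.\<close>

lemma R_counit_left: "tlift H (\<lambda>a b. \<epsilon> a \<odot>\<^bsub>H\<^esub> b) R = \<one>\<^bsub>H\<^esub>"
proof -
  interpret H: assoc_algebra k H by (rule H_alg)
  let ?u = "tlift H (\<lambda>a b. \<epsilon> a \<odot>\<^bsub>H\<^esub> b) R"
  have u [mlin]: "?u \<in> carrier H" by (rule mlin | assumption)+
  have "R = tlift HH (\<lambda>a b. tn H H a b) R"
    by (simp add: tlift_self R_closed H_mod)
  also have "\<dots> = tlift HH (\<lambda>a b. tlift HH (\<lambda>a1 a2. \<epsilon> a1 \<odot>\<^bsub>HH\<^esub> tn H H a2 b) (\<Delta> a)) R"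
    by (rule tlift_cong[of _ H H], (rule mlin)+, rule tlift_counit_left[symmetric]) (rule mlin | assumption)+
  also have "\<dots> = tlift HH (\<lambda>a b. tlift HH (\<lambda>a' b'. \<epsilon> a \<odot>\<^bsub>HH\<^esub> tn H H a' (b \<otimes>\<^bsub>H\<^esub> b')) R) R"
    by (rule tlift_R_left) (rule mlin | assumption)+
  also have "\<dots> = tlift HH (\<lambda>a b. tlift HH (\<lambda>a' b'. tn H H a' ((\<epsilon> a \<odot>\<^bsub>H\<^esub> b) \<otimes>\<^bsub>H\<^esub> b')) R) R"
    by (rule tlift_cong[of _ H H], (rule mlin)+, rule tlift_cong[of _ H H], (rule mlin)+)
      (simp add: H.smult_mult_left ten_smult(2) H_mod counit_closed)
  also have "\<dots> = tlift HH (\<lambda>a' b'. tlift HH (\<lambda>a b. tn H H a' ((\<epsilon> a \<odot>\<^bsub>H\<^esub> b) \<otimes>\<^bsub>H\<^esub> b')) R) R"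
    by (rule tlift_swap) (rule mlin | assumption)+
  also have "\<dots> = tlift HH (\<lambda>a' b'. tn H H a' (?u \<otimes>\<^bsub>H\<^esub> b')) R"
    by (rule tlift_cong[of _ H H], (rule mlin)+, rule tlift_hom[symmetric, of H]) (rule mlin | assumption)+
  also have "\<dots> = tn H H \<one>\<^bsub>H\<^esub> ?u \<otimes>\<^bsub>HH\<^esub> tlift HH (tn H H) R"
  proof -
    have "tn H H \<one>\<^bsub>H\<^esub> ?u \<otimes>\<^bsub>HH\<^esub> tlift HH (tn H H) R = tlift HH (\<lambda>a' b'. tn H H \<one>\<^bsub>H\<^esub> ?u \<otimes>\<^bsub>HH\<^esub> tn H H a' b') R"
      by (rule tlift_hom[of HH]) (rule mlin | assumption)+
    also have "\<dots> = tlift HH (\<lambda>a' b'. tn H H a' (?u \<otimes>\<^bsub>H\<^esub> b')) R"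
      by (rule tlift_cong[of _ H H], (rule mlin)+) (simp add: tensor_mult_ten H_alg u)
    finally show ?thesis ..
  qed
  also have "\<dots> = tn H H \<one>\<^bsub>H\<^esub> ?u \<otimes>\<^bsub>HH\<^esub> R"
    by (simp add: tlift_self R_closed H_mod)
  finally have "\<one>\<^bsub>HH\<^esub> = tn H H \<one>\<^bsub>H\<^esub> ?u \<otimes>\<^bsub>HH\<^esub> R \<otimes>\<^bsub>HH\<^esub> Ri"
    using R_Ri by simp
  also have "\<dots> = tn H H \<one>\<^bsub>H\<^esub> ?u"
  proof -
    have "tn H H \<one>\<^bsub>H\<^esub> ?u \<in> carrier HH" by (rule mlin)+
    then show ?thesis by (simp add: monoid.m_assoc[OF HH_monoid] R_closed Ri_closed R_Ri monoid.r_one[OF HH_monoid])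
  qed
  \<comment> \<open>Contracting the first leg with the counit, which maps 1 to 1, reads off
    \<open>?u\<close>.\<close>
  finally have "tlift H (\<lambda>a b. \<epsilon> a \<odot>\<^bsub>H\<^esub> b) (tn H H \<one>\<^bsub>H\<^esub> \<one>\<^bsub>H\<^esub>) = tlift H (\<lambda>a b. \<epsilon> a \<odot>\<^bsub>H\<^esub> b) (tn H H \<one>\<^bsub>H\<^esub> ?u)"
    by (simp add: tensor_one)
  moreover have "tlift H (\<lambda>a b. \<epsilon> a \<odot>\<^bsub>H\<^esub> b) (tn H H \<one>\<^bsub>H\<^esub> v) = v" if [mlin]: "v \<in> carrier H" for v
    by (subst tlift_ten, (rule mlin | assumption)+) (simp add: hopf_algebra.counit_one[OF hopf] that)
  ultimately show ?thesis by (simp add: u)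
qed

text \<open>The counit applied to the last leg of (id \<otimes> \<Delta>) R = R13 R12 gives R = (u
  \<otimes> 1) R, with u = (id \<otimes> \<epsilon>) R.\<close>

lemma R_counit_right: "tlift H (\<lambda>a b. \<epsilon> b \<odot>\<^bsub>H\<^esub> a) R = \<one>\<^bsub>H\<^esub>"
proof -
  interpret H: assoc_algebra k H by (rule H_alg)
  let ?u = "tlift H (\<lambda>a b. \<epsilon> b \<odot>\<^bsub>H\<^esub> a) R"
  have u [mlin]: "?u \<in> carrier H" by (rule mlin | assumption)+
  have "R = tlift HH (\<lambda>a b. tn H H a b) R"
    by (simp add: tlift_self R_closed H_mod)
  also have "\<dots> = tlift HH (\<lambda>a b. tlift HH (\<lambda>b1 b2. \<epsilon> b2 \<odot>\<^bsub>HH\<^esub> tn H H a b1) (\<Delta> b)) R"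
    by (rule tlift_cong[of _ H H], (rule mlin)+, rule tlift_counit_right[symmetric]) (rule mlin | assumption)+
  also have "\<dots> = tlift HH (\<lambda>a b. tlift HH (\<lambda>a' b'. \<epsilon> b \<odot>\<^bsub>HH\<^esub> tn H H (a \<otimes>\<^bsub>H\<^esub> a') b') R) R"
    by (rule tlift_R_right) (rule mlin | assumption)+
  also have "\<dots> = tlift HH (\<lambda>a b. tlift HH (\<lambda>a' b'. tn H H ((\<epsilon> b \<odot>\<^bsub>H\<^esub> a) \<otimes>\<^bsub>H\<^esub> a') b') R) R"
    by (rule tlift_cong[of _ H H], (rule mlin)+, rule tlift_cong[of _ H H], (rule mlin)+)
      (simp add: H.smult_mult_left ten_smult(1) H_mod counit_closed)
  also have "\<dots> = tlift HH (\<lambda>a' b'. tlift HH (\<lambda>a b. tn H H ((\<epsilon> b \<odot>\<^bsub>H\<^esub> a) \<otimes>\<^bsub>H\<^esub> a') b') R) R"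
    by (rule tlift_swap) (rule mlin | assumption)+
  also have "\<dots> = tlift HH (\<lambda>a' b'. tn H H (?u \<otimes>\<^bsub>H\<^esub> a') b') R"
    by (rule tlift_cong[of _ H H], (rule mlin)+,
      rule tlift_hom[symmetric, of H _ "\<lambda>u. tn H H (u \<otimes>\<^bsub>H\<^esub> _) _"]) (rule mlin | assumption)+
  also have "\<dots> = tn H H ?u \<one>\<^bsub>H\<^esub> \<otimes>\<^bsub>HH\<^esub> tlift HH (tn H H) R"
  proof -
    have "tn H H ?u \<one>\<^bsub>H\<^esub> \<otimes>\<^bsub>HH\<^esub> tlift HH (tn H H) R = tlift HH (\<lambda>a' b'. tn H H ?u \<one>\<^bsub>H\<^esub> \<otimes>\<^bsub>HH\<^esub> tn H H a' b') R"
      by (rule tlift_hom[of HH]) (rule mlin | assumption)+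
    also have "\<dots> = tlift HH (\<lambda>a' b'. tn H H (?u \<otimes>\<^bsub>H\<^esub> a') b') R"
      by (rule tlift_cong[of _ H H], (rule mlin)+) (simp add: tensor_mult_ten H_alg u)
    finally show ?thesis ..
  qed
  also have "\<dots> = tn H H ?u \<one>\<^bsub>H\<^esub> \<otimes>\<^bsub>HH\<^esub> R"
    by (simp add: tlift_self R_closed H_mod)
  finally have "\<one>\<^bsub>HH\<^esub> = tn H H ?u \<one>\<^bsub>H\<^esub> \<otimes>\<^bsub>HH\<^esub> R \<otimes>\<^bsub>HH\<^esub> Ri"
    using R_Ri by simp
  also have "\<dots> = tn H H ?u \<one>\<^bsub>H\<^esub>"
  proof -
    have "tn H H ?u \<one>\<^bsub>H\<^esub> \<in> carrier HH" by (rule mlin)+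
    then show ?thesis by (simp add: monoid.m_assoc[OF HH_monoid] R_closed Ri_closed R_Ri monoid.r_one[OF HH_monoid])
  qed
  finally have "tlift H (\<lambda>a b. \<epsilon> b \<odot>\<^bsub>H\<^esub> a) (tn H H \<one>\<^bsub>H\<^esub> \<one>\<^bsub>H\<^esub>) = tlift H (\<lambda>a b. \<epsilon> b \<odot>\<^bsub>H\<^esub> a) (tn H H ?u \<one>\<^bsub>H\<^esub>)"
    by (simp add: tensor_one)
  moreover have "tlift H (\<lambda>a b. \<epsilon> b \<odot>\<^bsub>H\<^esub> a) (tn H H v \<one>\<^bsub>H\<^esub>) = v" if [mlin]: "v \<in> carrier H" for v
    by (subst tlift_ten, (rule mlin | assumption)+) (simp add: hopf_algebra.counit_one[OF hopf] that)
  ultimately show ?thesis by (simp add: u)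
qed

subsection \<open>Tensor products of modules over a Hopf algebra\<close>

lemma htensor_simps [simp]:
  "carrier (htens X Y) = carrier (X \<otimes>\<^sub>k Y)" "zero (htens X Y) = zero (X \<otimes>\<^sub>k Y)"
  "add (htens X Y) = add (X \<otimes>\<^sub>k Y)" "smult (htens X Y) = smult (X \<otimes>\<^sub>k Y)"
  "tensor k (htens X Y) Z = tensor k (X \<otimes>\<^sub>k Y) Z" "tensor k Z (htens X Y) = tensor k Z (X \<otimes>\<^sub>k Y)"
  "ten k (htens X Y) Z = ten k (X \<otimes>\<^sub>k Y) Z" "ten k Z (htens X Y) = ten k Z (X \<otimes>\<^sub>k Y)"
  "tlift (htens X Y) = tlift (X \<otimes>\<^sub>k Y)"
  "tmap k (htens X Y) Z f g = tmap k (X \<otimes>\<^sub>k Y) Z f g" "tmap k Z (htens X Y) f g = tmap k Z (X \<otimes>\<^sub>k Y) f g"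
  "flip k (htens X Y) Z = flip k (X \<otimes>\<^sub>k Y) Z" "flip k Z (htens X Y) = flip k Z (X \<otimes>\<^sub>k Y)"
  "assoc k (htens X Y) Z W = assoc k (X \<otimes>\<^sub>k Y) Z W" "assoc k Z (htens X Y) W = assoc k Z (X \<otimes>\<^sub>k Y) W"
  "assoc k Z W (htens X Y) = assoc k Z W (X \<otimes>\<^sub>k Y)"
  by (simp_all add: htensor_def)

lemma htensor_lin [simp]:
  "lin_map k (htens X Y) M = lin_map k (X \<otimes>\<^sub>k Y) M" "lin_map k M (htens X Y) = lin_map k M (X \<otimes>\<^sub>k Y)"
  by (simp_all add: htensor_def)

lemma htensor_act: "act (htens X Y) h t = act2 k X Y (\<Delta> h) t"
  by (simp add: htensor_def)

lemma htensor_act_ten: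
  assumes "hmod X" "hmod Y" "h \<in> carrier H" "x \<in> carrier X" "y \<in> carrier Y"
  shows "act (htens X Y) h (tn X Y x y) =
    tlift (X \<otimes>\<^sub>k Y) (\<lambda>h1 h2. tn X Y (act X h1 x) (act Y h2 y)) (\<Delta> h)"
proof -
  interpret two_modules k H H X Y 
    by (intro two_modules.intro two_modules_axioms.intro base_axioms) (rule mlin assms)+
  show ?thesis unfolding htensor_act by (rule act2_pure) (rule mlin assms)+
qed

lemma hmod_htensor [mlin]:
  assumes "hmod X" "hmod Y"
  shows "hmod (htens X Y)"
proof -
  interpret two_modules k H H X Y 
    by (intro two_modules.intro two_modules_axioms.intro base_axioms) (rule mlin assms)+
  note A = act2_amodule
  note [mlin] = act2_lin
  have m: "kmod (htens X Y)"
    using module_with_act[OF tensor_mod[OF mods(3,4)]] by (simp add: htensor_def)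
  have b: "bil k H (X \<otimes>\<^sub>k Y) (X \<otimes>\<^sub>k Y) (\<lambda>h. act2 k X Y (\<Delta> h))"
    by (rule mlin | assumption)+
  show ?thesis
  proof (rule amoduleI[OF m])
    show "bil k H (htens X Y) (htens X Y) (act (htens X Y))"
      using b by (simp add: bil_def htensor_act)
  next
    fix a b x assume "a \<in> carrier H" "b \<in> carrier H" "x \<in> carrier (htens X Y)"
    then show "act (htens X Y) (a \<otimes>\<^bsub>H\<^esub> b) x = act (htens X Y) a (act (htens X Y) b x)"
      using amodule.act_mult[OF A, of "\<Delta> a" "\<Delta> b" x]
      by (simp add: htensor_act comul_closed hopf_algebra.comul_mult[OF hopf])
  next
    fix x assume "x \<in> carrier (htens X Y)"
    then show "act (htens X Y) \<one>\<^bsub>H\<^esub> x = x"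
      using amodule.act_one[OF A, of x] by (simp add: htensor_act hopf_algebra.comul_one[OF hopf])
  qed
qed

lemma htensor_act_lin_right [mlin]:
  "hmod X \<Longrightarrow> hmod Y \<Longrightarrow> h \<in> carrier H \<Longrightarrow> lin M (X \<otimes>\<^sub>k Y) f \<Longrightarrow>
    lin M (X \<otimes>\<^sub>k Y) (\<lambda>x. act (htens X Y) h (f x))"
  using act_lin_right[OF hmod_htensor, of X Y h M f] by simp

lemma htensor_act_lin_left [mlin]:
  "hmod X \<Longrightarrow> hmod Y \<Longrightarrow> lin M H f \<Longrightarrow> t \<in> carrier (X \<otimes>\<^sub>k Y) \<Longrightarrow>
    lin M (X \<otimes>\<^sub>k Y) (\<lambda>h. act (htens X Y) (f h) t)"
  using act_lin_left[OF hmod_htensor, of X Y M f t] by simp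

lemma htensor_act_closed [mlin]:
  "hmod X \<Longrightarrow> hmod Y \<Longrightarrow> h \<in> carrier H \<Longrightarrow> t \<in> carrier (X \<otimes>\<^sub>k Y) \<Longrightarrow>
    act (htens X Y) h t \<in> carrier (X \<otimes>\<^sub>k Y)"
  using act_closed[OF hmod_htensor, of X Y h t] by simp

end

section \<open>The braiding of modules\<close>

context qt_hopf
begin

text \<open>\<open>cb X Y x y = R\<^sub>2 y \<otimes> R\<^sub>1 x\<close> is the braiding, \<open>db X Y\<close> its inverse
  \<open>y \<otimes> x \<mapsto> R\<^sup>-\<^sup>1\<^sub>1 x \<otimes> R\<^sup>-\<^sup>1\<^sub>2 y\<close>. The hexagons are stated after composition with a multilinear map
  \<open>G\<close>, so that they can be used inside Sweedler-type sums.\<close>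

definition cb :: "('k, 'a univ, 'a univ) amod \<Rightarrow> ('k, 'a univ, 'a univ) amod \<Rightarrow>
    'a univ \<Rightarrow> 'a univ \<Rightarrow> 'a univ" where
  "cb X Y x y = tlift (Y \<otimes>\<^sub>k X) (\<lambda>a b. tn Y X (act Y b y) (act X a x)) R"

definition db :: "('k, 'a univ, 'a univ) amod \<Rightarrow> ('k, 'a univ, 'a univ) amod \<Rightarrow>
    'a univ \<Rightarrow> 'a univ \<Rightarrow> 'a univ" where
  "db X Y y x = tlift (X \<otimes>\<^sub>k Y) (\<lambda>a b. tn X Y (act X a x) (act Y b y)) Ri"

definition hlin where
  "hlin X Y f \<longleftrightarrow> lin X Y f \<and> (\<forall>h\<in>carrier H. \<forall>x\<in>carrier X. f (act X h x) = act Y h (f x))"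

lemma hact_closed: "hmod X \<Longrightarrow> h \<in> carrier H \<Longrightarrow> x \<in> carrier X \<Longrightarrow> act X h x \<in> carrier X"
  by (rule act_closed)

lemma htensor_carrier [mlin]: "t \<in> carrier (X \<otimes>\<^sub>k Y) \<Longrightarrow> t \<in> carrier (htens X Y)"
  by simp

lemma htensor_linI [mlin]:
  "lin (X \<otimes>\<^sub>k Y) M f \<Longrightarrow> lin (htens X Y) M f" "lin M (X \<otimes>\<^sub>k Y) g \<Longrightarrow> lin M (htens X Y) g"
  by simp_all

lemma bil_htensor [simp]:
  "bil k (htens X Y) Z P G = bil k (X \<otimes>\<^sub>k Y) Z P G" "bil k Z (htens X Y) P G = bil k Z (X \<otimes>\<^sub>k Y) P G"
  by (simp_all add: bil_def)

lemma cb_lin [mlin]: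
  "hmod X \<Longrightarrow> hmod Y \<Longrightarrow> lin M X f \<Longrightarrow> y \<in> carrier Y \<Longrightarrow> lin M (Y \<otimes>\<^sub>k X) (\<lambda>m. cb X Y (f m) y)"
  "hmod X \<Longrightarrow> hmod Y \<Longrightarrow> x \<in> carrier X \<Longrightarrow> lin M Y g \<Longrightarrow> lin M (Y \<otimes>\<^sub>k X) (\<lambda>m. cb X Y x (g m))"
  "hmod X \<Longrightarrow> hmod Y \<Longrightarrow> x \<in> carrier X \<Longrightarrow> y \<in> carrier Y \<Longrightarrow> cb X Y x y \<in> carrier (Y \<otimes>\<^sub>k X)"
proof -
  assume [mlin]: "hmod X" "hmod Y"
  have b: "bil k X Y (Y \<otimes>\<^sub>k X) (cb X Y)"
    unfolding cb_def by (rule mlin | assumption)+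
  show "lin M X f \<Longrightarrow> y \<in> carrier Y \<Longrightarrow> lin M (Y \<otimes>\<^sub>k X) (\<lambda>m. cb X Y (f m) y)"
    "x \<in> carrier X \<Longrightarrow> lin M Y g \<Longrightarrow> lin M (Y \<otimes>\<^sub>k X) (\<lambda>m. cb X Y x (g m))"
    "x \<in> carrier X \<Longrightarrow> y \<in> carrier Y \<Longrightarrow> cb X Y x y \<in> carrier (Y \<otimes>\<^sub>k X)"
    by (rule bil_left[OF b] bil_right[OF b] bil_closed[OF b]; assumption)+
qed

lemma db_lin [mlin]:
  "hmod X \<Longrightarrow> hmod Y \<Longrightarrow> lin M X f \<Longrightarrow> y \<in> carrier Y \<Longrightarrow> lin M (X \<otimes>\<^sub>k Y) (\<lambda>m. db X Y y (f m))"
  "hmod X \<Longrightarrow> hmod Y \<Longrightarrow> x \<in> carrier X \<Longrightarrow> lin M Y g \<Longrightarrow> lin M (X \<otimes>\<^sub>k Y) (\<lambda>m. db X Y (g m) x)"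
  "hmod X \<Longrightarrow> hmod Y \<Longrightarrow> x \<in> carrier X \<Longrightarrow> y \<in> carrier Y \<Longrightarrow> db X Y y x \<in> carrier (X \<otimes>\<^sub>k Y)"
proof -
  assume [mlin]: "hmod X" "hmod Y"
  have b: "bil k Y X (X \<otimes>\<^sub>k Y) (db X Y)"
    unfolding db_def by (rule mlin | assumption)+
  show "lin M X f \<Longrightarrow> y \<in> carrier Y \<Longrightarrow> lin M (X \<otimes>\<^sub>k Y) (\<lambda>m. db X Y y (f m))"
    "x \<in> carrier X \<Longrightarrow> lin M Y g \<Longrightarrow> lin M (X \<otimes>\<^sub>k Y) (\<lambda>m. db X Y (g m) x)"
    "x \<in> carrier X \<Longrightarrow> y \<in> carrier Y \<Longrightarrow> db X Y y x \<in> carrier (X \<otimes>\<^sub>k Y)"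
    by (rule bil_left[OF b] bil_right[OF b] bil_closed[OF b]; assumption)+
qed

lemma tlift_cb:
  assumes [mlin]: "hmod X" "hmod Y" "x \<in> carrier X" "y \<in> carrier Y" "kmod P" and G: "bil k Y X P G"
  shows "tlift P G (cb X Y x y) = tlift P (\<lambda>a b. G (act Y b y) (act X a x)) R"
proof -
  note [mlin] = bil_left[OF G] bil_right[OF G] bil_closed[OF G]
  have "tlift P G (cb X Y x y) = tlift P (\<lambda>a b. tlift P G (tn Y X (act Y b y) (act X a x))) R"
    unfolding cb_def by (rule tlift_hom) (rule mlin | assumption)+
  also have "\<dots> = tlift P (\<lambda>a b. G (act Y b y) (act X a x)) R"
    by (rule tlift_cong[of _ H H], (rule mlin)+, rule tlift_ten) (rule mlin | assumption)+
  finally show ?thesis .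
qed

lemma tlift_db:
  assumes [mlin]: "hmod X" "hmod Y" "x \<in> carrier X" "y \<in> carrier Y" "kmod P" and G: "bil k X Y P G"
  shows "tlift P G (db X Y y x) = tlift P (\<lambda>a b. G (act X a x) (act Y b y)) Ri"
proof -
  note [mlin] = bil_left[OF G] bil_right[OF G] bil_closed[OF G]
  have "tlift P G (db X Y y x) = tlift P (\<lambda>a b. tlift P G (tn X Y (act X a x) (act Y b y))) Ri"
    unfolding db_def by (rule tlift_hom) (rule mlin | assumption)+
  also have "\<dots> = tlift P (\<lambda>a b. G (act X a x) (act Y b y)) Ri"
    by (rule tlift_cong[of _ H H], (rule mlin)+, rule tlift_ten) (rule mlin | assumption)+
  finally show ?thesis .
qed

text \<open>The successive actions of the components of R^-1 and \<open>R\<close> combine, by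
  \<open>act_mult\<close>, to the action of R R^-1 = 1.\<close>

lemma cb_db:
  assumes [mlin]: "hmod X" "hmod Y" "x \<in> carrier X" "y \<in> carrier Y" "kmod P" and G: "bil k Y X P G"
  shows "tlift P (\<lambda>x y. tlift P G (cb X Y x y)) (db X Y y x) = G y x"
proof -
  note [mlin] = bil_left[OF G] bil_right[OF G] bil_closed[OF G]
  have "tlift P (\<lambda>x y. tlift P G (cb X Y x y)) (db X Y y x) =
      tlift P (\<lambda>a b. tlift P G (cb X Y (act X a x) (act Y b y))) Ri"
    by (rule tlift_db) (rule mlin | assumption)+
  also have "\<dots> = tlift P (\<lambda>a b. tlift P (\<lambda>a' b'. G (act Y b' (act Y b y)) (act X a' (act X a x))) R) Ri"
    by (rule tlift_cong[of _ H H], (rule mlin)+, rule tlift_cb) (rule mlin G | assumption)+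
  also have "\<dots> = tlift P (\<lambda>a' b'. tlift P (\<lambda>a b. G (act Y b' (act Y b y)) (act X a' (act X a x))) Ri) R"
    by (rule tlift_swap) (rule mlin | assumption)+
  also have "\<dots> = tlift P (\<lambda>a' b'. tlift P (\<lambda>a b. G (act Y (b' \<otimes>\<^bsub>H\<^esub> b) y) (act X (a' \<otimes>\<^bsub>H\<^esub> a) x)) Ri) R"
    by (rule tlift_cong[of _ H H], (rule mlin)+, rule tlift_cong[of _ H H], (rule mlin)+)
      (simp add: amodule.act_mult[OF assms(1)] amodule.act_mult[OF assms(2)] assms)
  also have "\<dots> = G (act Y \<one>\<^bsub>H\<^esub> y) (act X \<one>\<^bsub>H\<^esub> x)"
    by (rule tlift_inverse[where F = "\<lambda>u v. G (act Y v y) (act X u x)"]) (rule mlin R_Ri | assumption)+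
  finally show ?thesis by (simp add: amodule.act_one[OF assms(1)] amodule.act_one[OF assms(2)] assms)
qed

lemma db_cb:
  assumes [mlin]: "hmod X" "hmod Y" "x \<in> carrier X" "y \<in> carrier Y" "kmod P" and G: "bil k X Y P G"
  shows "tlift P (\<lambda>y x. tlift P G (db X Y y x)) (cb X Y x y) = G x y"
proof -
  note [mlin] = bil_left[OF G] bil_right[OF G] bil_closed[OF G]
  have "tlift P (\<lambda>y x. tlift P G (db X Y y x)) (cb X Y x y) =
      tlift P (\<lambda>a b. tlift P G (db X Y (act Y b y) (act X a x))) R"
    by (rule tlift_cb) (rule mlin | assumption)+
  also have "\<dots> = tlift P (\<lambda>a b. tlift P (\<lambda>a' b'. G (act X a' (act X a x)) (act Y b' (act Y b y))) Ri) R"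
    by (rule tlift_cong[of _ H H], (rule mlin)+, rule tlift_db) (rule mlin G | assumption)+
  also have "\<dots> = tlift P (\<lambda>a' b'. tlift P (\<lambda>a b. G (act X a' (act X a x)) (act Y b' (act Y b y))) R) Ri"
    by (rule tlift_swap) (rule mlin | assumption)+
  also have "\<dots> = tlift P (\<lambda>a' b'. tlift P (\<lambda>a b. G (act X (a' \<otimes>\<^bsub>H\<^esub> a) x) (act Y (b' \<otimes>\<^bsub>H\<^esub> b) y)) R) Ri"
    by (rule tlift_cong[of _ H H], (rule mlin)+, rule tlift_cong[of _ H H], (rule mlin)+)
      (simp add: amodule.act_mult[OF assms(1)] amodule.act_mult[OF assms(2)] assms)
  also have "\<dots> = G (act X \<one>\<^bsub>H\<^esub> x) (act Y \<one>\<^bsub>H\<^esub> y)"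
    by (rule tlift_inverse[where F = "\<lambda>u v. G (act X u x) (act Y v y)"]) (rule mlin R_Ri | assumption)+
  finally show ?thesis by (simp add: amodule.act_one[OF assms(1)] amodule.act_one[OF assms(2)] assms)
qed

text \<open>The axiom (id \<otimes> \<Delta>) R = R13 R12: the copy of \<open>R\<close> acting on y
  acts first on x, so x passes y and then z. The exchange of sums makes the passage over y the outer
  one.\<close>

lemma cb_htensor_right:
  assumes [mlin]: "hmod X" "hmod Y" "hmod Z" "x \<in> carrier X" "y \<in> carrier Y" "z \<in> carrier Z" "kmod P"
    and G: "bil k (Y \<otimes>\<^sub>k Z) X P G"
  shows "tlift P G (cb X (htens Y Z) x (tn Y Z y z)) =
    tlift P (\<lambda>y' x'. tlift P (\<lambda>z' x''. G (tn Y Z y' z') x'') (cb X Z x' z)) (cb X Y x y)"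
proof -
  note [mlin] = bil_left[OF G] bil_right[OF G] bil_closed[OF G]
  have "tlift P G (cb X (htens Y Z) x (tn Y Z y z)) =
      tlift P (\<lambda>a b. G (act (htens Y Z) b (tn Y Z y z)) (act X a x)) R"
    using G by (intro tlift_cb) (simp_all add: assms hmod_htensor ten_closed)
  also have "\<dots> = tlift P (\<lambda>a b. tlift P (\<lambda>b1 b2. G (tn Y Z (act Y b1 y) (act Z b2 z)) (act X a x)) (\<Delta> b)) R"
    by (rule tlift_cong[of _ H H], (rule mlin)+, subst htensor_act_ten,
        (rule mlin | assumption)+, rule tlift_hom[where h = "\<lambda>u. G u _" and P = "Y \<otimes>\<^sub>k Z"])
      (rule mlin | assumption)+
  also have "\<dots> = tlift P (\<lambda>a b. tlift P (\<lambda>a' b'. G (tn Y Z (act Y b' y) (act Z b z)) (act X (a \<otimes>\<^bsub>H\<^esub> a') x)) R) R"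
    by (rule tlift_R_right) (rule mlin | assumption)+
  also have "\<dots> = tlift P (\<lambda>a' b'. tlift P (\<lambda>a b. G (tn Y Z (act Y b' y) (act Z b z)) (act X (a \<otimes>\<^bsub>H\<^esub> a') x)) R) R"
    by (rule tlift_swap) (rule mlin | assumption)+
  also have "\<dots> = tlift P (\<lambda>a' b'. tlift P (\<lambda>a b. G (tn Y Z (act Y b' y) (act Z b z)) (act X a (act X a' x))) R) R"
    by (rule tlift_cong[of _ H H], (rule mlin)+, rule tlift_cong[of _ H H], (rule mlin)+)
      (simp add: amodule.act_mult[OF assms(1)] assms)
  also have "\<dots> = tlift P (\<lambda>a' b'. tlift P (\<lambda>z' x''. G (tn Y Z (act Y b' y) z') x'') (cb X Z (act X a' x) z)) R"
    by (rule tlift_cong[of _ H H], (rule mlin)+, rule tlift_cb[symmetric]) (rule mlin | assumption)+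
  also have "\<dots> = tlift P (\<lambda>y' x'. tlift P (\<lambda>z' x''. G (tn Y Z y' z') x'') (cb X Z x' z)) (cb X Y x y)"
    by (rule tlift_cb[symmetric]) (rule mlin | assumption)+
  finally show ?thesis .
qed

text \<open>The axiom (\<Delta> \<otimes> id) R = R13 R23: the copy of \<open>R\<close> acting on y
  acts first on z, so z passes y and then x.\<close>

lemma cb_htensor_left:
  assumes [mlin]: "hmod X" "hmod Y" "hmod Z" "x \<in> carrier X" "y \<in> carrier Y" "z \<in> carrier Z" "kmod P"
    and G: "bil k Z (X \<otimes>\<^sub>k Y) P G"
  shows "tlift P G (cb (htens X Y) Z (tn X Y x y) z) =
    tlift P (\<lambda>z' y'. tlift P (\<lambda>z'' x'. G z'' (tn X Y x' y')) (cb X Z x z')) (cb Y Z y z)"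
proof -
  note [mlin] = bil_left[OF G] bil_right[OF G] bil_closed[OF G]
  have "tlift P G (cb (htens X Y) Z (tn X Y x y) z) =
      tlift P (\<lambda>a b. G (act Z b z) (act (htens X Y) a (tn X Y x y))) R"
    using G by (intro tlift_cb) (simp_all add: assms hmod_htensor ten_closed)
  also have "\<dots> = tlift P (\<lambda>a b. tlift P (\<lambda>a1 a2. G (act Z b z) (tn X Y (act X a1 x) (act Y a2 y))) (\<Delta> a)) R"
    by (rule tlift_cong[of _ H H], (rule mlin)+, subst htensor_act_ten,
        (rule mlin | assumption)+, rule tlift_hom[where h = "\<lambda>u. G _ u" and P = "X \<otimes>\<^sub>k Y"])
      (rule mlin | assumption)+
  also have "\<dots> = tlift P (\<lambda>a b. tlift P (\<lambda>a' b'. G (act Z (b \<otimes>\<^bsub>H\<^esub> b') z) (tn X Y (act X a x) (act Y a' y))) R) R"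
    by (rule tlift_R_left) (rule mlin | assumption)+
  also have "\<dots> = tlift P (\<lambda>a' b'. tlift P (\<lambda>a b. G (act Z (b \<otimes>\<^bsub>H\<^esub> b') z) (tn X Y (act X a x) (act Y a' y))) R) R"
    by (rule tlift_swap) (rule mlin | assumption)+
  also have "\<dots> = tlift P (\<lambda>a' b'. tlift P (\<lambda>a b. G (act Z b (act Z b' z)) (tn X Y (act X a x) (act Y a' y))) R) R"
    by (rule tlift_cong[of _ H H], (rule mlin)+, rule tlift_cong[of _ H H], (rule mlin)+)
      (simp add: amodule.act_mult[OF assms(3)] assms)
  also have "\<dots> = tlift P (\<lambda>a' b'. tlift P (\<lambda>z'' x'. G z'' (tn X Y x' (act Y a' y))) (cb X Z x (act Z b' z))) R"
    by (rule tlift_cong[of _ H H], (rule mlin)+, rule tlift_cb[symmetric]) (rule mlin | assumption)+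
  also have "\<dots> = tlift P (\<lambda>z' y'. tlift P (\<lambda>z'' x'. G z'' (tn X Y x' y')) (cb X Z x z')) (cb Y Z y z)"
    by (rule tlift_cb[symmetric]) (rule mlin | assumption)+
  finally show ?thesis .
qed

section \<open>The braiding and its inverse as maps between tensor products\<close>

definition "cop X Y = tlift (Y \<otimes>\<^sub>k X) (cb X Y)"
definition "dop X Y = tlift (X \<otimes>\<^sub>k Y) (db X Y)"

lemma cop_lin [mlin]: "hmod X \<Longrightarrow> hmod Y \<Longrightarrow> lin M (X \<otimes>\<^sub>k Y) f \<Longrightarrow> lin M (Y \<otimes>\<^sub>k X) (\<lambda>m. cop X Y (f m))"
  unfolding cop_def by (rule mlin | assumption)+

lemma dop_lin [mlin]: "hmod X \<Longrightarrow> hmod Y \<Longrightarrow> lin M (Y \<otimes>\<^sub>k X) f \<Longrightarrow> lin M (X \<otimes>\<^sub>k Y) (\<lambda>m. dop X Y (f m))"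
  unfolding dop_def by (rule mlin | assumption)+

lemma dop_closed [mlin]:
  "hmod X \<Longrightarrow> hmod Y \<Longrightarrow> t \<in> carrier (Y \<otimes>\<^sub>k X) \<Longrightarrow> dop X Y t \<in> carrier (X \<otimes>\<^sub>k Y)"
  by (rule lin_map_closed[OF dop_lin[OF _ _ lin_id]])

lemma cop_ten:
  assumes "hmod X" "hmod Y" "x \<in> carrier X" "y \<in> carrier Y"
  shows "cop X Y (tn X Y x y) = cb X Y x y"
  unfolding cop_def by (rule tlift_ten) (rule mlin assms | assumption)+

lemma dop_ten:
  assumes "hmod X" "hmod Y" "x \<in> carrier X" "y \<in> carrier Y"
  shows "dop X Y (tn Y X y x) = db X Y y x"
  unfolding dop_def by (rule tlift_ten) (rule mlin assms | assumption)+

lemma dop_cop: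
  assumes [mlin]: "hmod X" "hmod Y" and t: "t \<in> carrier (X \<otimes>\<^sub>k Y)"
  shows "dop X Y (cop X Y t) = t"
proof (rule tensor_ext[OF t, of "X \<otimes>\<^sub>k Y"])
  fix x y assume [mlin]: "x \<in> carrier X" "y \<in> carrier Y"
  have "dop X Y (cb X Y x y) = tlift (X \<otimes>\<^sub>k Y) (\<lambda>y x. tlift (X \<otimes>\<^sub>k Y) (tn X Y) (db X Y y x)) (cb X Y x y)"
    unfolding dop_def
    by (rule tlift_cong[of _ Y X], (rule mlin)+, rule tlift_self[symmetric]) (rule mlin | assumption)+
  also have "\<dots> = tn X Y x y"
    by (rule db_cb) (rule mlin | assumption)+
  finally show "dop X Y (cop X Y (tn X Y x y)) = tn X Y x y"
    by (subst cop_ten) (rule mlin | assumption)+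
qed (rule mlin | assumption)+

lemma cop_dop:
  assumes [mlin]: "hmod X" "hmod Y" and t: "t \<in> carrier (Y \<otimes>\<^sub>k X)"
  shows "cop X Y (dop X Y t) = t"
proof (rule tensor_ext[OF t, of "Y \<otimes>\<^sub>k X"])
  fix y x assume [mlin]: "y \<in> carrier Y" "x \<in> carrier X"
  have "cop X Y (db X Y y x) = tlift (Y \<otimes>\<^sub>k X) (\<lambda>x y. tlift (Y \<otimes>\<^sub>k X) (tn Y X) (cb X Y x y)) (db X Y y x)"
    unfolding cop_def
    by (rule tlift_cong[of _ X Y], (rule mlin)+, rule tlift_self[symmetric]) (rule mlin | assumption)+
  also have "\<dots> = tn Y X y x"
    by (rule cb_db) (rule mlin | assumption)+
  finally show "cop X Y (dop X Y (tn Y X y x)) = tn Y X y x"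
    by (subst dop_ten) (rule mlin | assumption)+
qed (rule mlin | assumption)+

text \<open>Identifies \<open>cop\<close> with the action of \<open>R\<close> followed by the flip,
  the form in which \<open>dyn_braiding\<close> is given.\<close>

lemma flip_act2_R:
  assumes [mlin]: "hmod X" "hmod Y" and t: "t \<in> carrier (X \<otimes>\<^sub>k Y)"
  shows "flip k X Y (act2 k X Y R t) = cop X Y t"
proof -
  interpret t: two_modules k H H X Y
    by (intro two_modules.intro two_modules_axioms.intro base_axioms) (rule mlin)+
  show ?thesis
  proof (rule tensor_ext[OF t, of "Y \<otimes>\<^sub>k X"])
    fix x y assume [mlin]: "x \<in> carrier X" "y \<in> carrier Y"
    have "flip k X Y (act2 k X Y R (tn X Y x y)) =
        flip k X Y (tlift (X \<otimes>\<^sub>k Y) (\<lambda>a b. tn X Y (act X a x) (act Y b y)) R)"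
      by (rule arg_cong[where f = "flip k X Y"], rule t.act2_pure) (rule mlin)+
    also have "\<dots> = tlift (Y \<otimes>\<^sub>k X) (\<lambda>a b. flip k X Y (tn X Y (act X a x) (act Y b y))) R"
      by (rule tlift_hom) (rule mlin | assumption)+
    also have "\<dots> = cb X Y x y"
      unfolding cb_def
      by (rule tlift_cong[of _ H H], (rule mlin)+, rule flip_ten) (rule mlin | assumption)+
    finally show "flip k X Y (act2 k X Y R (tn X Y x y)) = cop X Y (tn X Y x y)"
      by (subst cop_ten) (rule mlin | assumption)+
  qed (rule mlin t.act2_lin | assumption)+
qed

text \<open>The intertwining axiom R \<Delta>(h) = \<Delta>^op(h) R, in the form
  \<open>tlift_R_comul\<close>, moves h from the right of \<open>R\<close> to its left and exchanges
  the parts of the coproduct.\<close>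

lemma cop_act:
  assumes [mlin]: "hmod X" "hmod Y" "h \<in> carrier H" and t: "t \<in> carrier (X \<otimes>\<^sub>k Y)"
  shows "cop X Y (act (htens X Y) h t) = act (htens Y X) h (cop X Y t)"
proof (rule tensor_ext[OF t, of "Y \<otimes>\<^sub>k X"])
  fix x y assume xy [mlin]: "x \<in> carrier X" "y \<in> carrier Y"
  have "cop X Y (act (htens X Y) h (tn X Y x y)) =
      tlift (Y \<otimes>\<^sub>k X) (\<lambda>h1 h2. cop X Y (tn X Y (act X h1 x) (act Y h2 y))) (\<Delta> h)"
    by (subst htensor_act_ten, (rule mlin)+, rule tlift_hom[of "X \<otimes>\<^sub>k Y"]) (rule mlin | assumption)+
  also have "\<dots> = tlift (Y \<otimes>\<^sub>k X) (\<lambda>h1 h2. cb X Y (act X h1 x) (act Y h2 y)) (\<Delta> h)"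
    by (rule tlift_cong[of _ H H], (rule mlin)+, rule cop_ten) (rule mlin | assumption)+
  also have "\<dots> = tlift (Y \<otimes>\<^sub>k X) (\<lambda>h1 h2. tlift (Y \<otimes>\<^sub>k X)
      (\<lambda>a b. tn Y X (act Y b (act Y h2 y)) (act X a (act X h1 x))) R) (\<Delta> h)"
    unfolding cb_def ..
  also have "\<dots> = tlift (Y \<otimes>\<^sub>k X) (\<lambda>a b. tlift (Y \<otimes>\<^sub>k X)
      (\<lambda>h1 h2. tn Y X (act Y b (act Y h2 y)) (act X a (act X h1 x))) (\<Delta> h)) R"
    by (rule tlift_swap) (rule mlin | assumption)+
  also have "\<dots> = tlift (Y \<otimes>\<^sub>k X) (\<lambda>a b. tlift (Y \<otimes>\<^sub>k X)
      (\<lambda>h1 h2. tn Y X (act Y (b \<otimes>\<^bsub>H\<^esub> h2) y) (act X (a \<otimes>\<^bsub>H\<^esub> h1) x)) (\<Delta> h)) R"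
    by (rule tlift_cong[of _ H H], (rule mlin)+, rule tlift_cong[of _ H H], (rule mlin)+)
      (simp add: amodule.act_mult[OF assms(1)] amodule.act_mult[OF assms(2)] xy)
  also have "\<dots> = tlift (Y \<otimes>\<^sub>k X) (\<lambda>h1 h2. tlift (Y \<otimes>\<^sub>k X)
      (\<lambda>a b. tn Y X (act Y (h1 \<otimes>\<^bsub>H\<^esub> b) y) (act X (h2 \<otimes>\<^bsub>H\<^esub> a) x)) R) (\<Delta> h)"
    by (rule tlift_R_comul[where F = "\<lambda>u v. tn Y X (act Y v y) (act X u x)"]) (rule mlin | assumption)+
  also have "\<dots> = tlift (Y \<otimes>\<^sub>k X) (\<lambda>a b. tlift (Y \<otimes>\<^sub>k X)
      (\<lambda>h1 h2. tn Y X (act Y (h1 \<otimes>\<^bsub>H\<^esub> b) y) (act X (h2 \<otimes>\<^bsub>H\<^esub> a) x)) (\<Delta> h)) R"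
    by (rule tlift_swap) (rule mlin | assumption)+
  also have "\<dots> = tlift (Y \<otimes>\<^sub>k X) (\<lambda>a b. tlift (Y \<otimes>\<^sub>k X)
      (\<lambda>h1 h2. tn Y X (act Y h1 (act Y b y)) (act X h2 (act X a x))) (\<Delta> h)) R"
    by (rule tlift_cong[of _ H H], (rule mlin)+, rule tlift_cong[of _ H H], (rule mlin)+)
      (simp add: amodule.act_mult[OF assms(1)] amodule.act_mult[OF assms(2)] xy)
  also have "\<dots> = tlift (Y \<otimes>\<^sub>k X) (\<lambda>a b. act (htens Y X) h (tn Y X (act Y b y) (act X a x))) R"
    by (rule tlift_cong[of _ H H], (rule mlin)+, rule htensor_act_ten[symmetric]) (rule mlin | assumption)+
  also have "\<dots> = act (htens Y X) h (cb X Y x y)"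
    unfolding cb_def by (rule tlift_hom[symmetric, of "Y \<otimes>\<^sub>k X"]) (rule mlin | assumption)+
  finally show "cop X Y (act (htens X Y) h (tn X Y x y)) = act (htens Y X) h (cop X Y (tn X Y x y))"
    by (simp add: cop_ten assms xy)
qed (rule mlin | assumption)+

lemma dop_act:
  assumes [mlin]: "hmod X" "hmod Y" "h \<in> carrier H" and t: "t \<in> carrier (Y \<otimes>\<^sub>k X)"
  shows "dop X Y (act (htens Y X) h t) = act (htens X Y) h (dop X Y t)"
proof -
  have "act (htens X Y) h (dop X Y t) = dop X Y (cop X Y (act (htens X Y) h (dop X Y t)))"
    by (rule dop_cop[symmetric]) (rule mlin t)+
  also have "cop X Y (act (htens X Y) h (dop X Y t)) = act (htens Y X) h (cop X Y (dop X Y t))"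
    by (rule cop_act) (rule mlin t)+
  also have "cop X Y (dop X Y t) = t"
    by (rule cop_dop) (rule mlin t)+
  finally show ?thesis ..
qed

lemma hlin_lin: "hlin X Y f \<Longrightarrow> lin M X g \<Longrightarrow> lin M Y (\<lambda>m. f (g m))"
  by (auto simp: hlin_def intro: lin_map_comp)

lemma hlin_act: "hlin X Y f \<Longrightarrow> h \<in> carrier H \<Longrightarrow> x \<in> carrier X \<Longrightarrow> f (act X h x) = act Y h (f x)"
  by (auto simp: hlin_def)

lemma hlin_closed: "hlin X Y f \<Longrightarrow> x \<in> carrier X \<Longrightarrow> f x \<in> carrier Y"
  by (auto simp: hlin_def lin_map_closed)

text \<open>Each component of \<open>R\<close> commutes with an equivariant map. Beyond H-linear
  maps X \<rightarrow> X', this will be applied to dynamical morphisms, as equivariant maps into X'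
  \<otimes> L.\<close>

lemma cb_natural:
  assumes [mlin]: "hmod X" "hmod Y" "hmod X'" "hmod Y'" "x \<in> carrier X" "y \<in> carrier Y" "kmod P"
    and G: "bil k Y' X' P G" and f: "hlin X X' f" and g: "hlin Y Y' g"
  shows "tlift P G (cb X' Y' (f x) (g y)) = tlift P (\<lambda>y' x'. G (g y') (f x')) (cb X Y x y)"
proof -
  note [mlin] = bil_left[OF G] bil_right[OF G] bil_closed[OF G] hlin_lin[OF f] hlin_lin[OF g]
    hlin_closed[OF f] hlin_closed[OF g]
  have "tlift P G (cb X' Y' (f x) (g y)) = tlift P (\<lambda>a b. G (act Y' b (g y)) (act X' a (f x))) R"
    by (rule tlift_cb) (rule mlin G | assumption)+
  also have "\<dots> = tlift P (\<lambda>a b. G (g (act Y b y)) (f (act X a x))) R"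
    by (rule tlift_cong[of _ H H], (rule mlin)+) (simp add: hlin_act[OF f] hlin_act[OF g] assms)
  also have "\<dots> = tlift P (\<lambda>y' x'. G (g y') (f x')) (cb X Y x y)"
    by (rule tlift_cb[symmetric]) (rule mlin | assumption)+
  finally show ?thesis .
qed

text \<open>Will be applied to the multiplication of \<open>L\<close>, which makes the coaction
  multiplicative, and to dynamical morphisms, which makes their extensions
  \<open>L\<close>-linear.\<close>

lemma db_natural:
  assumes [mlin]: "hmod X" "hmod Y" "hmod X'" "hmod Y'" "x \<in> carrier X" "y \<in> carrier Y" "kmod P"
    and G: "bil k X' Y' P G" and f: "hlin X X' f" and g: "hlin Y Y' g"
  shows "tlift P G (db X' Y' (g y) (f x)) = tlift P (\<lambda>x' y'. G (f x') (g y')) (db X Y y x)"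
proof -
  note [mlin] = bil_left[OF G] bil_right[OF G] bil_closed[OF G] hlin_lin[OF f] hlin_lin[OF g]
    hlin_closed[OF f] hlin_closed[OF g]
  have "tlift P G (db X' Y' (g y) (f x)) = tlift P (\<lambda>a b. G (act X' a (f x)) (act Y' b (g y))) Ri"
    by (rule tlift_db) (rule mlin G | assumption)+
  also have "\<dots> = tlift P (\<lambda>a b. G (f (act X a x)) (g (act Y b y))) Ri"
    by (rule tlift_cong[of _ H H], (rule mlin)+) (simp add: hlin_act[OF f] hlin_act[OF g] assms)
  also have "\<dots> = tlift P (\<lambda>x' y'. G (f x') (g y')) (db X Y y x)"
    by (rule tlift_db[symmetric]) (rule mlin | assumption)+
  finally show ?thesis .
qed

text \<open>The hexagons for the inverse braiding follow by applying the braiding to both sides.\<close>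

lemma db_htensor_left:
  assumes [mlin]: "hmod X" "hmod Y" "hmod Z" "x \<in> carrier X" "y \<in> carrier Y" "z \<in> carrier Z" "kmod P"
    and G: "bil k (X \<otimes>\<^sub>k Y) Z P G"
  shows "tlift P G (db (htens X Y) Z z (tn X Y x y)) =
    tlift P (\<lambda>x' z'. tlift P (\<lambda>y' z''. G (tn X Y x' y') z'') (db Y Z z' y)) (db X Z z x)"
proof -
  let ?XYZ = "X \<otimes>\<^sub>k Y \<otimes>\<^sub>k Z" and ?ZXY = "Z \<otimes>\<^sub>k (X \<otimes>\<^sub>k Y)"
  let ?v = "\<lambda>x' z'. tlift ?XYZ (\<lambda>y' z''. tn (X \<otimes>\<^sub>k Y) Z (tn X Y x' y') z'') (db Y Z z' y)"
  \<comment> \<open>\<open>?u\<close> is the right-hand side for the universal map, the pure tensor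
    itself. Its image under the braiding will be z \<otimes> (x \<otimes> y), so \<open>dop\<close>
    of that tensor is \<open>?u\<close>.\<close>
  let ?u = "tlift ?XYZ ?v (db X Z z x)"
  let ?c = "cop (htens X Y) Z"
  note [mlin] = bil_left[OF G] bil_right[OF G] bil_closed[OF G]
  have c [mlin]: "lin ?XYZ ?ZXY ?c"
    using cop_lin[OF hmod_htensor[OF assms(1,2)] assms(3), of ?XYZ "\<lambda>x. x"] by (simp add: lin_id)
  note [mlin] = lin_map_comp[OF _ c] lin_map_closed[OF c]
  have cv: "?c (?v x' z') = tlift ?ZXY (\<lambda>z'' x''. tn Z (X \<otimes>\<^sub>k Y) z'' (tn X Y x'' y)) (cb X Z x' z')"
    if [mlin]: "x' \<in> carrier X" "z' \<in> carrier Z" for x' z'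
  proof -
    have "?c (?v x' z') = tlift ?ZXY (\<lambda>y' z''. ?c (tn (X \<otimes>\<^sub>k Y) Z (tn X Y x' y') z'')) (db Y Z z' y)"
      by (rule tlift_hom) (rule mlin | assumption)+
    also have "\<dots> = tlift ?ZXY (\<lambda>y' z''. tlift ?ZXY (tn Z (X \<otimes>\<^sub>k Y)) (cb (htens X Y) Z (tn X Y x' y') z'')) (db Y Z z' y)"
    proof (rule tlift_cong[of _ Y Z])
      fix y' z'' assume [mlin]: "y' \<in> carrier Y" "z'' \<in> carrier Z"
      have c': "tn X Y x' y' \<in> carrier (X \<otimes>\<^sub>k Y)" and h: "hmod (htens X Y)" and z: "z'' \<in> carrier Z"
        by (rule mlin)+
      have m: "cb (htens X Y) Z (tn X Y x' y') z'' \<in> carrier ?ZXY"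
        using cb_lin(3)[OF h assms(3) htensor_carrier[OF c'] z] by simp
      have "?c (tn (X \<otimes>\<^sub>k Y) Z (tn X Y x' y') z'') = cb (htens X Y) Z (tn X Y x' y') z''"
        using cop_ten[OF h assms(3) htensor_carrier[OF c'] z] by simp
      also have "\<dots> = tlift ?ZXY (tn Z (X \<otimes>\<^sub>k Y)) \<dots>"
        by (rule tlift_self[symmetric]) (rule mlin m)+
      finally show "?c (tn (X \<otimes>\<^sub>k Y) Z (tn X Y x' y') z'') = \<dots>" .
    qed (rule mlin)+
    also have "\<dots> = tlift ?ZXY (\<lambda>y' z''. tlift ?ZXY (\<lambda>z3 y3. tlift ?ZXY (\<lambda>z4 x4. tn Z (X \<otimes>\<^sub>k Y) z4 (tn X Y x4 y3))
        (cb X Z x' z3)) (cb Y Z y' z'')) (db Y Z z' y)"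
      by (rule tlift_cong[of _ Y Z], (rule mlin)+, rule cb_htensor_left) (rule mlin | assumption)+
    also have "\<dots> = tlift ?ZXY (\<lambda>z4 x4. tn Z (X \<otimes>\<^sub>k Y) z4 (tn X Y x4 y)) (cb X Z x' z')"
      by (rule cb_db) (rule mlin | assumption)+
    finally show ?thesis .
  qed
  have u [mlin]: "?u \<in> carrier ?XYZ" by (rule mlin | assumption)+
  have "?c ?u = tlift ?ZXY (\<lambda>x' z'. ?c (?v x' z')) (db X Z z x)"
    by (rule tlift_hom) (rule mlin | assumption)+
  also have "\<dots> = tlift ?ZXY (\<lambda>x' z'. tlift ?ZXY (\<lambda>z'' x''. tn Z (X \<otimes>\<^sub>k Y) z'' (tn X Y x'' y)) (cb X Z x' z')) (db X Z z x)"
    by (rule tlift_cong[of _ X Z], (rule mlin)+, rule cv)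
  also have "\<dots> = tn Z (X \<otimes>\<^sub>k Y) z (tn X Y x y)"
    by (rule cb_db) (rule mlin | assumption)+
  finally have "dop (htens X Y) Z (?c ?u) = dop (htens X Y) Z (tn Z (htens X Y) z (tn X Y x y))"
    by simp
  also have "\<dots> = db (htens X Y) Z z (tn X Y x y)"
    by (rule dop_ten) (rule mlin)+
  also have "dop (htens X Y) Z (?c ?u) = ?u"
    by (rule dop_cop) (simp_all add: u assms hmod_htensor)
  finally have "tlift P G (db (htens X Y) Z z (tn X Y x y)) = tlift P G ?u" by simp
  also have "\<dots> = tlift P (\<lambda>x' z'. tlift P G (?v x' z')) (db X Z z x)"
    by (rule tlift_hom) (rule mlin | assumption)+
  also have "\<dots> = tlift P (\<lambda>x' z'. tlift P (\<lambda>y' z''. tlift P G (tn (X \<otimes>\<^sub>k Y) Z (tn X Y x' y') z'')) (db Y Z z' y)) (db X Z z x)"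
    by (rule tlift_cong[of _ X Z], (rule mlin)+, rule tlift_hom) (rule mlin | assumption)+
  also have "\<dots> = tlift P (\<lambda>x' z'. tlift P (\<lambda>y' z''. G (tn X Y x' y') z'') (db Y Z z' y)) (db X Z z x)"
    by (rule tlift_cong[of _ X Z], (rule mlin)+, rule tlift_cong[of _ Y Z], (rule mlin | assumption)+,
      rule tlift_ten) (rule mlin | assumption)+
  finally show ?thesis .
qed

lemma db_htensor_right:
  assumes [mlin]: "hmod X" "hmod Y" "hmod Z" "x \<in> carrier X" "y \<in> carrier Y" "z \<in> carrier Z" "kmod P"
    and G: "bil k X (Y \<otimes>\<^sub>k Z) P G"
  shows "tlift P G (db X (htens Y Z) (tn Y Z y z) x) =
    tlift P (\<lambda>x' z'. tlift P (\<lambda>x'' y'. G x'' (tn Y Z y' z')) (db X Y y x')) (db X Z z x)"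
proof -
  let ?T = "X \<otimes>\<^sub>k (Y \<otimes>\<^sub>k Z)" and ?S = "Y \<otimes>\<^sub>k Z \<otimes>\<^sub>k X"
  let ?v = "\<lambda>x' z'. tlift ?T (\<lambda>x'' y'. tn X (Y \<otimes>\<^sub>k Z) x'' (tn Y Z y' z')) (db X Y y x')"
  let ?u = "tlift ?T ?v (db X Z z x)"
  let ?c = "cop X (htens Y Z)"
  note [mlin] = bil_left[OF G] bil_right[OF G] bil_closed[OF G]
  have c [mlin]: "lin ?T ?S ?c"
    using cop_lin[OF assms(1) hmod_htensor[OF assms(2,3)], of ?T "\<lambda>x. x"] by (simp add: lin_id)
  note [mlin] = lin_map_comp[OF _ c] lin_map_closed[OF c]
  have cv: "?c (?v x' z') = tlift ?S (\<lambda>z'' x''. tn (Y \<otimes>\<^sub>k Z) X (tn Y Z y z'') x'') (cb X Z x' z')"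
    if [mlin]: "x' \<in> carrier X" "z' \<in> carrier Z" for x' z'
  proof -
    have "?c (?v x' z') = tlift ?S (\<lambda>x'' y'. ?c (tn X (Y \<otimes>\<^sub>k Z) x'' (tn Y Z y' z'))) (db X Y y x')"
      by (rule tlift_hom) (rule mlin | assumption)+
    also have "\<dots> = tlift ?S (\<lambda>x'' y'. tlift ?S (tn (Y \<otimes>\<^sub>k Z) X) (cb X (htens Y Z) x'' (tn Y Z y' z'))) (db X Y y x')"
    proof (rule tlift_cong[of _ X Y])
      fix x'' y' assume [mlin]: "y' \<in> carrier Y" "x'' \<in> carrier X"
      have c': "tn Y Z y' z' \<in> carrier (Y \<otimes>\<^sub>k Z)" and h: "hmod (htens Y Z)" and x: "x'' \<in> carrier X"
        by (rule mlin)+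
      have m: "cb X (htens Y Z) x'' (tn Y Z y' z') \<in> carrier ?S"
        using cb_lin(3)[OF assms(1) h x htensor_carrier[OF c']] by simp
      have "?c (tn X (Y \<otimes>\<^sub>k Z) x'' (tn Y Z y' z')) = cb X (htens Y Z) x'' (tn Y Z y' z')"
        using cop_ten[OF assms(1) h x htensor_carrier[OF c']] by simp
      also have "\<dots> = tlift ?S (tn (Y \<otimes>\<^sub>k Z) X) \<dots>"
        by (rule tlift_self[symmetric]) (rule mlin m)+
      finally show "?c (tn X (Y \<otimes>\<^sub>k Z) x'' (tn Y Z y' z')) = \<dots>" .
    qed (rule mlin)+
    also have "\<dots> = tlift ?S (\<lambda>x'' y'. tlift ?S (\<lambda>y3 x3. tlift ?S (\<lambda>z4 x4. tn (Y \<otimes>\<^sub>k Z) X (tn Y Z y3 z4) x4)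
        (cb X Z x3 z')) (cb X Y x'' y')) (db X Y y x')"
      by (rule tlift_cong[of _ X Y], (rule mlin)+, rule cb_htensor_right) (rule mlin | assumption)+
    also have "\<dots> = tlift ?S (\<lambda>z4 x4. tn (Y \<otimes>\<^sub>k Z) X (tn Y Z y z4) x4) (cb X Z x' z')"
      by (rule cb_db) (rule mlin | assumption)+
    finally show ?thesis .
  qed
  have u [mlin]: "?u \<in> carrier ?T" by (rule mlin | assumption)+
  have "?c ?u = tlift ?S (\<lambda>x' z'. ?c (?v x' z')) (db X Z z x)"
    by (rule tlift_hom) (rule mlin | assumption)+
  also have "\<dots> = tlift ?S (\<lambda>x' z'. tlift ?S (\<lambda>z'' x''. tn (Y \<otimes>\<^sub>k Z) X (tn Y Z y z'') x'') (cb X Z x' z')) (db X Z z x)"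
    by (rule tlift_cong[of _ X Z], (rule mlin)+, rule cv)
  also have "\<dots> = tn (Y \<otimes>\<^sub>k Z) X (tn Y Z y z) x"
    by (rule cb_db) (rule mlin | assumption)+
  finally have "dop X (htens Y Z) (?c ?u) = dop X (htens Y Z) (tn (htens Y Z) X (tn Y Z y z) x)"
    by simp
  also have "\<dots> = db X (htens Y Z) (tn Y Z y z) x"
    by (rule dop_ten) (rule mlin)+
  also have "dop X (htens Y Z) (?c ?u) = ?u"
    by (rule dop_cop) (simp_all add: u assms hmod_htensor)
  finally have "tlift P G (db X (htens Y Z) (tn Y Z y z) x) = tlift P G ?u" by simp
  also have "\<dots> = tlift P (\<lambda>x' z'. tlift P G (?v x' z')) (db X Z z x)"
    by (rule tlift_hom) (rule mlin | assumption)+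
  also have "\<dots> = tlift P (\<lambda>x' z'. tlift P (\<lambda>x'' y'. tlift P G (tn X (Y \<otimes>\<^sub>k Z) x'' (tn Y Z y' z'))) (db X Y y x')) (db X Z z x)"
    by (rule tlift_cong[of _ X Z], (rule mlin)+, rule tlift_hom) (rule mlin | assumption)+
  also have "\<dots> = tlift P (\<lambda>x' z'. tlift P (\<lambda>x'' y'. G x'' (tn Y Z y' z')) (db X Y y x')) (db X Z z x)"
    by (rule tlift_cong[of _ X Z], (rule mlin)+, rule tlift_cong[of _ X Y], (rule mlin | assumption)+,
      rule tlift_ten) (rule mlin | assumption)+
  finally show ?thesis .
qed

section \<open>Braiding with elements on which \<open>H\<close> acts through the counit\<close>

definition "trivial X x \<longleftrightarrow> x \<in> carrier X \<and> (\<forall>h\<in>carrier H. act X h x = \<epsilon> h \<odot>\<^bsub>X\<^esub> x)"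

text \<open>The first component of \<open>R\<close> acts on x through the counit, and (\<epsilon>
  \<otimes> id) R = 1. The elements in question will be the unit of \<open>L\<close> and all
  elements of the unit object.\<close>

lemma cb_trivial_left:
  assumes [mlin]: "hmod X" "hmod Y" "y \<in> carrier Y" and x: "trivial X x"
  shows "cb X Y x y = tn Y X y x"
proof -
  have [mlin]: "x \<in> carrier X" using x by (simp add: trivial_def)
  interpret Y: amodule k H Y by fact
  have "cb X Y x y = tlift (Y \<otimes>\<^sub>k X) (\<lambda>a b. tn Y X (act Y (\<epsilon> a \<odot>\<^bsub>H\<^esub> b) y) x) R"
    unfolding cb_def by (rule tlift_cong[of _ H H], (rule mlin)+)
      (use x in \<open>simp add: trivial_def ten_smult Y.act_smult counit_closed assms hmod_mod hact_closed\<close>)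
  also have "\<dots> = tn Y X (act Y (tlift H (\<lambda>a b. \<epsilon> a \<odot>\<^bsub>H\<^esub> b) R) y) x"
    by (rule tlift_hom[symmetric, of H _ "\<lambda>u. tn Y X (act Y u y) x"]) (rule mlin | assumption)+
  finally show ?thesis by (simp add: R_counit_left Y.act_one assms)
qed

lemma cb_trivial_right:
  assumes [mlin]: "hmod X" "hmod Y" "x \<in> carrier X" and y: "trivial Y y"
  shows "cb X Y x y = tn Y X y x"
proof -
  have [mlin]: "y \<in> carrier Y" using y by (simp add: trivial_def)
  interpret X: amodule k H X by fact
  have "cb X Y x y = tlift (Y \<otimes>\<^sub>k X) (\<lambda>a b. tn Y X y (act X (\<epsilon> b \<odot>\<^bsub>H\<^esub> a) x)) R"
    unfolding cb_def by (rule tlift_cong[of _ H H], (rule mlin)+)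
      (use y in \<open>simp add: trivial_def ten_smult X.act_smult counit_closed assms hmod_mod hact_closed\<close>)
  also have "\<dots> = tn Y X y (act X (tlift H (\<lambda>a b. \<epsilon> b \<odot>\<^bsub>H\<^esub> a) R) x)"
    by (rule tlift_hom[symmetric, of H _ "\<lambda>u. tn Y X y (act X u x)"]) (rule mlin | assumption)+
  finally show ?thesis by (simp add: R_counit_right X.act_one assms)
qed

text \<open>No formula for R^-1 is required: the braiding flips x \<otimes> y, so its inverse flips
  it back.\<close>

lemma db_trivial_left:
  assumes [mlin]: "hmod X" "hmod Y" "y \<in> carrier Y" and x: "trivial X x"
  shows "db X Y y x = tn X Y x y"
proof -
  have [mlin]: "x \<in> carrier X" using x by (simp add: trivial_def)
  have "db X Y y x = dop X Y (tn Y X y x)" by (rule dop_ten[symmetric]) (rule mlin)+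
  also have "\<dots> = dop X Y (cop X Y (tn X Y x y))"
    by (subst cop_ten, (rule mlin)+) (simp add: cb_trivial_left assms)
  also have "\<dots> = tn X Y x y" by (rule dop_cop) (rule mlin)+
  finally show ?thesis .
qed

lemma db_trivial_right:
  assumes [mlin]: "hmod X" "hmod Y" "x \<in> carrier X" and y: "trivial Y y"
  shows "db X Y y x = tn X Y x y"
proof -
  have [mlin]: "y \<in> carrier Y" using y by (simp add: trivial_def)
  have "db X Y y x = dop X Y (tn Y X y x)" by (rule dop_ten[symmetric]) (rule mlin)+
  also have "\<dots> = dop X Y (cop X Y (tn X Y x y))"
    by (subst cop_ten, (rule mlin)+) (simp add: cb_trivial_right assms)
  also have "\<dots> = tn X Y x y" by (rule dop_cop) (rule mlin)+
  finally show ?thesis .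
qed

end

section \<open>Free modules over the base algebra\<close>

locale dynamical = qt_hopf k H R for k :: "'a univ ring" and H :: "('a univ, 'a univ) hopf" and R +
  fixes L :: "('a univ, 'a univ, 'a univ) amod"
  assumes L_module_algebra: "module_algebra k H L" and L_commutative: "H_commutative R L"
begin

abbreviation "lmul \<equiv> (\<otimes>\<^bsub>L\<^esub>)"
abbreviation "tau Y \<equiv> db Y L"
abbreviation "free X \<equiv> X \<otimes>\<^sub>k L"

lemma L_alg [mlin]: "assoc_algebra k L"
  using L_module_algebra by (rule module_algebra.axioms)

lemma L_hmod [mlin]: "hmod L"
  using L_module_algebra by (rule module_algebra.axioms)

lemma L_mod [mlin]: "kmod L"
  by (rule hmod_mod[OF L_hmod])

lemma L_one_trivial: "trivial L \<one>\<^bsub>L\<^esub>"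
  unfolding trivial_def using module_algebra.act_one_L[OF L_module_algebra] one_closed[OF L_alg] by simp

lemma L_act_mult:
  assumes "h \<in> carrier H" "l \<in> carrier L" "m \<in> carrier L"
  shows "act L h (lmul l m) = tlift L (\<lambda>a b. lmul (act L a l) (act L b m)) (\<Delta> h)"
  using module_algebra.act_mult_L[OF L_module_algebra assms] .

lemma L_monoid: "monoid L"
  by (meson L_alg assoc_algebra.axioms(2) ring.is_monoid)

lemmas lmul_assoc = monoid.m_assoc[OF L_monoid]
lemmas lmul_one = monoid.l_one[OF L_monoid] monoid.r_one[OF L_monoid]

lemma lmul_cb:
  assumes "l \<in> carrier L" "m \<in> carrier L"
  shows "tlift L lmul (cb L L l m) = lmul l m"
proof -
  have "tlift L lmul (cb L L l m) = tlift L (\<lambda>a b. lmul (act L b m) (act L a l)) R"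
    by (rule tlift_cb) (rule mlin assms | assumption)+
  then show ?thesis using L_commutative assms by (simp add: H_commutative_def)
qed

text \<open>Insert the braiding by \<open>lmul_cb\<close> and cancel it against its inverse.\<close>

lemma lmul_db:
  assumes [mlin]: "l \<in> carrier L" "m \<in> carrier L"
  shows "tlift L lmul (db L L l m) = lmul l m"
proof -
  have "tlift L lmul (db L L l m) = tlift L (\<lambda>x y. tlift L lmul (cb L L x y)) (db L L l m)"
    by (rule tlift_cong[of _ L L], (rule mlin)+, rule lmul_cb[symmetric])
  also have "\<dots> = lmul l m"
    by (rule cb_db) (rule mlin | assumption)+
  finally show ?thesis .
qed

lemma hlin_id: "hlin X X (\<lambda>x. x)"
  by (simp add: hlin_def lin_id)

lemma hlin_lmul: "hlin (htens L L) L (tlift L lmul)"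
  unfolding hlin_def
proof (intro conjI ballI)
  show "lin (htens L L) L (tlift L lmul)" by (rule mlin | assumption)+
  fix h t assume h [mlin]: "h \<in> carrier H" and "t \<in> carrier (htens L L)"
  then have t: "t \<in> carrier (free L)" by simp
  show "tlift L lmul (act (htens L L) h t) = act L h (tlift L lmul t)"
  proof (rule tensor_ext[OF t, of L])
    fix l m assume lm [mlin]: "l \<in> carrier L" "m \<in> carrier L"
    have "tlift L lmul (act (htens L L) h (tn L L l m)) =
        tlift L (\<lambda>h1 h2. tlift L lmul (tn L L (act L h1 l) (act L h2 m))) (\<Delta> h)"
      by (subst htensor_act_ten, (rule mlin)+, rule tlift_hom[of "L \<otimes>\<^sub>k L"]) (rule mlin | assumption)+
    also have "\<dots> = tlift L (\<lambda>h1 h2. lmul (act L h1 l) (act L h2 m)) (\<Delta> h)"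
      by (rule tlift_cong[of _ H H], (rule mlin)+, rule tlift_ten) (rule mlin | assumption)+
    also have "\<dots> = act L h (tlift L lmul (tn L L l m))"
      by (subst tlift_ten, (rule mlin | assumption)+) (simp add: L_act_mult h lm)
    finally show "tlift L lmul (act (htens L L) h (tn L L l m)) = \<dots>" .
  qed (rule mlin | assumption)+
qed

lemma db_act:
  assumes [mlin]: "hmod X" "hmod Y" "h \<in> carrier H" "x \<in> carrier X" "y \<in> carrier Y"
  shows "act (htens X Y) h (db X Y y x) = tlift (X \<otimes>\<^sub>k Y) (\<lambda>h1 h2. db X Y (act Y h1 y) (act X h2 x)) (\<Delta> h)"
proof -
  have "act (htens X Y) h (db X Y y x) = act (htens X Y) h (dop X Y (tn Y X y x))"
    by (simp add: dop_ten assms)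
  also have "\<dots> = dop X Y (act (htens Y X) h (tn Y X y x))"
    by (rule dop_act[symmetric]) (rule mlin)+
  also have "\<dots> = tlift (X \<otimes>\<^sub>k Y) (\<lambda>h1 h2. dop X Y (tn Y X (act Y h1 y) (act X h2 x))) (\<Delta> h)"
    by (subst htensor_act_ten, (rule mlin)+, rule tlift_hom[of "Y \<otimes>\<^sub>k X"]) (rule mlin | assumption)+
  also have "\<dots> = tlift (X \<otimes>\<^sub>k Y) (\<lambda>h1 h2. db X Y (act Y h1 y) (act X h2 x)) (\<Delta> h)"
    by (rule tlift_cong[of _ H H], (rule mlin)+, rule dop_ten) (rule mlin | assumption)+
  finally show ?thesis .
qed

text \<open>The multiplication of \<open>L\<close> is equivariant, so the inverse braiding is
  natural for it. By the hexagon, passing l \<otimes> l' over x means that \<open>l'\<close> passes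
  first and \<open>l\<close> second.\<close>

lemma tau_mult:
  assumes [mlin]: "hmod X" "l \<in> carrier L" "l' \<in> carrier L" "x \<in> carrier X" "kmod P" and G: "bil k X L P G"
  shows "tlift P G (tau X (lmul l l') x) =
    tlift P (\<lambda>x' m'. tlift P (\<lambda>x'' m. G x'' (lmul m m')) (tau X l x')) (tau X l' x)"
proof -
  note [mlin] = bil_left[OF G] bil_right[OF G] bil_closed[OF G]
  have "tlift P G (tau X (tlift L lmul (tn L L l l')) x) =
      tlift P (\<lambda>x u. G x (tlift L lmul u)) (db X (htens L L) (tn L L l l') x)"
    by (rule db_natural[OF _ _ _ _ _ _ _ G hlin_id hlin_lmul]) (rule mlin)+
  also have "\<dots> = tlift P (\<lambda>x' m'. tlift P (\<lambda>x'' m. G x'' (tlift L lmul (tn L L m m'))) (tau X l x')) (tau X l' x)"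
    by (rule db_htensor_right) (rule mlin | assumption)+
  also have "\<dots> = tlift P (\<lambda>x' m'. tlift P (\<lambda>x'' m. G x'' (lmul m m')) (tau X l x')) (tau X l' x)"
    by (rule tlift_cong[of _ X L], (rule mlin)+, rule tlift_cong[of _ X L], (rule mlin | assumption)+,
      rule arg_cong[where f = "G _"], rule tlift_ten) (rule mlin | assumption)+
  also have "tlift L lmul (tn L L l l') = lmul l l'"
    by (rule tlift_ten) (rule mlin | assumption)+
  finally show ?thesis .
qed

definition "rmul Y t m = tlift (free Y) (\<lambda>y l. tn Y L y (lmul l m)) t"

lemma rmul_lin [mlin]:
  "kmod Y \<Longrightarrow> lin M (free Y) f \<Longrightarrow> m \<in> carrier L \<Longrightarrow> lin M (free Y) (\<lambda>x. rmul Y (f x) m)"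
  "kmod Y \<Longrightarrow> kmod M \<Longrightarrow> t \<in> carrier (free Y) \<Longrightarrow> lin M L g \<Longrightarrow> lin M (free Y) (\<lambda>x. rmul Y t (g x))"
  "kmod Y \<Longrightarrow> t \<in> carrier (free Y) \<Longrightarrow> m \<in> carrier L \<Longrightarrow> rmul Y t m \<in> carrier (free Y)"
  unfolding rmul_def by (rule mlin | assumption)+

lemma rmul_ten:
  "kmod Y \<Longrightarrow> y \<in> carrier Y \<Longrightarrow> l \<in> carrier L \<Longrightarrow> m \<in> carrier L \<Longrightarrow>
    rmul Y (tn Y L y l) m = tn Y L y (lmul l m)"
  unfolding rmul_def by (rule tlift_ten) (rule mlin | assumption)+

lemma rmul_rmul:
  assumes [mlin]: "kmod Y" "m \<in> carrier L" "n \<in> carrier L" and t: "t \<in> carrier (free Y)"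
  shows "rmul Y (rmul Y t m) n = rmul Y t (lmul m n)"
  by (rule tensor_ext[OF t, of "Y \<otimes>\<^sub>k L"])
    ((rule mlin | assumption)+, simp add: rmul_ten assms mult_closed[OF L_alg] lmul_assoc)

lemma rmul_one:
  assumes [mlin]: "kmod Y" and t: "t \<in> carrier (free Y)"
  shows "rmul Y t \<one>\<^bsub>L\<^esub> = t"
  by (rule tensor_ext[OF t, of "Y \<otimes>\<^sub>k L"])
    ((rule mlin | assumption)+, simp add: rmul_ten assms one_closed[OF L_alg] lmul_one)

lemma rmul_tlift:
  assumes [mlin]: "kmod Y" "m \<in> carrier L" and "t \<in> carrier (A \<otimes>\<^sub>k B)" "kmod A" "kmod B"
    "\<And>a b. a \<in> carrier A \<Longrightarrow> b \<in> carrier B \<Longrightarrow> F a b \<in> carrier (free Y)"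
  shows "rmul Y (tlift (free Y) F t) m = tlift (free Y) (\<lambda>a b. rmul Y (F a b) m) t"
  by (rule tlift_hom[where h = "\<lambda>u. rmul Y u m"]) (rule mlin assms | assumption)+

lemma rmul_act:
  assumes [mlin]: "hmod Y" "h \<in> carrier H" "m \<in> carrier L" and t: "t \<in> carrier (free Y)"
  shows "act (htens Y L) h (rmul Y t m) =
    tlift (free Y) (\<lambda>h1 h2. rmul Y (act (htens Y L) h1 t) (act L h2 m)) (\<Delta> h)"
proof (rule tensor_ext[OF t, of "Y \<otimes>\<^sub>k L"])
  let ?YL = "Y \<otimes>\<^sub>k L"
  fix y l assume yl [mlin]: "y \<in> carrier Y" "l \<in> carrier L"
  have "act (htens Y L) h (rmul Y (tn Y L y l) m) =
      tlift ?YL (\<lambda>h1 h2. tn Y L (act Y h1 y) (act L h2 (lmul l m))) (\<Delta> h)"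
    by (subst rmul_ten, (rule mlin)+, rule htensor_act_ten) (rule mlin)+
  also have "\<dots> = tlift ?YL (\<lambda>h1 h2. tn Y L (act Y h1 y) (tlift L (\<lambda>a b. lmul (act L a l) (act L b m)) (\<Delta> h2))) (\<Delta> h)"
    by (rule tlift_cong[of _ H H], (rule mlin)+) (simp add: L_act_mult assms yl)
  also have "\<dots> = tlift ?YL (\<lambda>h1 h2. tlift ?YL (\<lambda>a b. tn Y L (act Y h1 y) (lmul (act L a l) (act L b m))) (\<Delta> h2)) (\<Delta> h)"
    by (rule tlift_cong[of _ H H], (rule mlin)+, rule tlift_hom[of L]) (rule mlin | assumption)+
  also have "\<dots> = tlift ?YL (\<lambda>h1 h2. tlift ?YL (\<lambda>a b. tn Y L (act Y a y) (lmul (act L b l) (act L h2 m))) (\<Delta> h1)) (\<Delta> h)"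
    by (rule tlift_comul_assoc[symmetric]) (rule mlin | assumption)+
  also have "\<dots> = tlift ?YL (\<lambda>h1 h2. tlift ?YL (\<lambda>a b. rmul Y (tn Y L (act Y a y) (act L b l)) (act L h2 m)) (\<Delta> h1)) (\<Delta> h)"
    by (rule tlift_cong[of _ H H], (rule mlin)+, rule tlift_cong[of _ H H], (rule mlin | assumption)+,
      rule rmul_ten[symmetric]) (rule mlin | assumption)+
  also have "\<dots> = tlift ?YL (\<lambda>h1 h2. rmul Y (act (htens Y L) h1 (tn Y L y l)) (act L h2 m)) (\<Delta> h)"
    by (rule tlift_cong[of _ H H], (rule mlin)+, subst htensor_act_ten, (rule mlin | assumption)+,
      rule rmul_tlift[symmetric]) (rule mlin | assumption)+
  finally show "act (htens Y L) h (rmul Y (tn Y L y l) m) = \<dots>" .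
qed (rule mlin | assumption)+

subsection \<open>The left action of the base algebra\<close>

lemma tlift_coact:
  assumes [mlin]: "l \<in> carrier L" "kmod P" and G: "bil k H L P G"
  shows "tlift P G (coact k H R L l) = tlift P (\<lambda>a b. G a (act L b l)) Ri"
proof -
  note [mlin] = bil_left[OF G] bil_right[OF G] bil_closed[OF G]
  have "tlift P G (coact k H R L l) = tlift P (\<lambda>a b. tlift P G (tn H L a (act L b l))) Ri"
    unfolding coact_def by (rule tlift_hom) (rule mlin | assumption)+
  also have "\<dots> = tlift P (\<lambda>a b. G a (act L b l)) Ri"
    by (rule tlift_cong[of _ H H], (rule mlin)+, rule tlift_ten) (rule mlin | assumption)+
  finally show ?thesis .
qed

text \<open>The coaction sends l to R^-1_1 \<otimes> R^-1_2 l, so letting its first component act on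
  y gives precisely the inverse braiding of Y with \<open>L\<close>.\<close>

lemma dyn_tau: "hmod Y \<Longrightarrow> l \<in> carrier L \<Longrightarrow> y \<in> carrier Y \<Longrightarrow> dyn_tau k H R L Y l y = tau Y l y"
  unfolding dyn_tau_def db_def by (rule tlift_coact) (rule mlin | assumption)+

abbreviation "la \<equiv> lact k H R L"

lemma coact_closed [mlin]:
  "l \<in> carrier L \<Longrightarrow> coact k H R L l \<in> carrier (free H)"
  "lin M L f \<Longrightarrow> kmod M \<Longrightarrow> lin M (free H) (\<lambda>x. coact k H R L (f x))"
  unfolding coact_def by (rule mlin | assumption)+

lemma la_lin [mlin]:
  "hmod Y \<Longrightarrow> kmod M \<Longrightarrow> lin M L f \<Longrightarrow> t \<in> carrier (free Y) \<Longrightarrow> lin M (free Y) (\<lambda>x. la Y (f x) t)"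
  "hmod Y \<Longrightarrow> l \<in> carrier L \<Longrightarrow> lin M (free Y) g \<Longrightarrow> lin M (free Y) (\<lambda>x. la Y l (g x))"
  "hmod Y \<Longrightarrow> l \<in> carrier L \<Longrightarrow> t \<in> carrier (free Y) \<Longrightarrow> la Y l t \<in> carrier (free Y)"
  unfolding lact_def by (rule mlin | assumption)+

text \<open>An element of \<open>L\<close> passes y by the inverse braiding and is then multiplied
  to the left of m. Everything about this action is derived from this formula.\<close>

lemma la_ten:
  assumes [mlin]: "hmod Y" "l \<in> carrier L" "y \<in> carrier Y" "m \<in> carrier L"
  shows "la Y l (tn Y L y m) = rmul Y (tau Y l y) m"
proof -
  have "la Y l (tn Y L y m) = tlift (free Y) (\<lambda>a l'. tn Y L (act Y a y) (lmul l' m)) (coact k H R L l)"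
    unfolding lact_def by (rule tlift_ten) (rule mlin | assumption)+
  also have "\<dots> = tlift (free Y) (\<lambda>a b. tn Y L (act Y a y) (lmul (act L b l) m)) Ri"
    by (rule tlift_coact) (rule mlin | assumption)+
  also have "\<dots> = rmul Y (tau Y l y) m"
    unfolding rmul_def by (rule tlift_db[symmetric]) (rule mlin | assumption)+
  finally show ?thesis .
qed

lemma la_ten_one:
  assumes [mlin]: "hmod Y" "l \<in> carrier L" "y \<in> carrier Y"
  shows "la Y l (tn Y L y \<one>\<^bsub>L\<^esub>) = tau Y l y"
  by (subst la_ten, (rule mlin)+, rule rmul_one) (rule mlin)+

lemma la_rmul:
  assumes [mlin]: "hmod Y" "l \<in> carrier L" "m \<in> carrier L" and t: "t \<in> carrier (free Y)"
  shows "la Y l (rmul Y t m) = rmul Y (la Y l t) m"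
proof (rule tensor_ext[OF t, of "Y \<otimes>\<^sub>k L"])
  fix y n assume [mlin]: "y \<in> carrier Y" "n \<in> carrier L"
  show "la Y l (rmul Y (tn Y L y n) m) = rmul Y (la Y l (tn Y L y n)) m"
    by (subst rmul_ten, (rule mlin)+, subst la_ten, (rule mlin)+, subst la_ten, (rule mlin)+,
      rule rmul_rmul[symmetric]) (rule mlin)+
qed (rule mlin | assumption)+

lemma la_one:
  assumes [mlin]: "hmod Y" and t: "t \<in> carrier (free Y)"
  shows "la Y \<one>\<^bsub>L\<^esub> t = t"
proof (rule tensor_ext[OF t, of "Y \<otimes>\<^sub>k L"])
  fix y n assume yn [mlin]: "y \<in> carrier Y" "n \<in> carrier L"
  show "la Y \<one>\<^bsub>L\<^esub> (tn Y L y n) = tn Y L y n"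
    by (simp add: la_ten assms yn L_one_trivial one_closed[OF L_alg] db_trivial_right L_hmod rmul_ten lmul_one hmod_mod)
qed (rule mlin | assumption)+

text \<open>The action commutes with right multiplication, which reduces the claim to y \<otimes> 1.
  There it is multiplicativity of the coaction, \<open>tau_mult\<close>.\<close>

lemma la_mult:
  assumes [mlin]: "hmod Y" "l \<in> carrier L" "l' \<in> carrier L" and t: "t \<in> carrier (free Y)"
  shows "la Y (lmul l l') t = la Y l (la Y l' t)"
proof (rule tensor_ext[OF t, of "Y \<otimes>\<^sub>k L"])
  let ?YL = "Y \<otimes>\<^sub>k L"
  fix y n assume yn [mlin]: "y \<in> carrier Y" "n \<in> carrier L"
  have 1: "tau Y (lmul l l') y = la Y l (tau Y l' y)"
  proof -
    have "tau Y (lmul l l') y = tlift ?YL (tn Y L) (tau Y (lmul l l') y)"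
      by (rule tlift_self[symmetric]) (rule mlin)+
    also have "\<dots> = tlift ?YL (\<lambda>x' m'. tlift ?YL (\<lambda>x'' m. tn Y L x'' (lmul m m')) (tau Y l x')) (tau Y l' y)"
      by (rule tau_mult) (rule mlin | assumption)+
    also have "\<dots> = tlift ?YL (\<lambda>x' m'. la Y l (tn Y L x' m')) (tau Y l' y)"
      by (rule tlift_cong[of _ Y L], (rule mlin)+, subst la_ten, (rule mlin | assumption)+) (simp add: rmul_def)
    also have "\<dots> = la Y l (tlift ?YL (tn Y L) (tau Y l' y))"
      by (rule tlift_hom[symmetric, of ?YL]) (rule mlin | assumption)+
    also have "tlift ?YL (tn Y L) (tau Y l' y) = tau Y l' y"
      by (rule tlift_self) (rule mlin)+
    finally show ?thesis .
  qed
  have "la Y (lmul l l') (tn Y L y n) = rmul Y (la Y l (tau Y l' y)) n"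
    by (subst la_ten, (rule mlin)+) (simp only: 1)
  also have "\<dots> = la Y l (rmul Y (tau Y l' y) n)"
    by (rule la_rmul[symmetric]) (rule mlin)+
  also have "\<dots> = la Y l (la Y l' (tn Y L y n))"
    by (subst la_ten[of Y l'], (rule mlin)+) simp
  finally show "la Y (lmul l l') (tn Y L y n) = \<dots>" .
qed (rule mlin | assumption)+

text \<open>The inverse braiding is equivariant (\<open>db_act\<close>) and so is right
  multiplication (\<open>rmul_act\<close>); coassociativity regroups the three parts of h. This is
  the commutation relation of the smash product.\<close>

lemma la_act:
  assumes [mlin]: "hmod Y" "h \<in> carrier H" "l \<in> carrier L" and t: "t \<in> carrier (free Y)"
  shows "act (htens Y L) h (la Y l t) =
    tlift (free Y) (\<lambda>h1 h2. la Y (act L h1 l) (act (htens Y L) h2 t)) (\<Delta> h)"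
proof (rule tensor_ext[OF t, of "Y \<otimes>\<^sub>k L"])
  let ?YL = "Y \<otimes>\<^sub>k L"
  fix y m assume ym [mlin]: "y \<in> carrier Y" "m \<in> carrier L"
  have "act (htens Y L) h (la Y l (tn Y L y m)) =
      tlift ?YL (\<lambda>h1 h2. rmul Y (act (htens Y L) h1 (tau Y l y)) (act L h2 m)) (\<Delta> h)"
    by (subst la_ten, (rule mlin)+, rule rmul_act) (rule mlin)+
  also have "\<dots> = tlift ?YL (\<lambda>h1 h2. tlift ?YL (\<lambda>a b. rmul Y (tau Y (act L a l) (act Y b y)) (act L h2 m)) (\<Delta> h1)) (\<Delta> h)"
    by (rule tlift_cong[of _ H H], (rule mlin)+, subst db_act, (rule mlin | assumption)+,
      rule rmul_tlift) (rule mlin | assumption)+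
  also have "\<dots> = tlift ?YL (\<lambda>h1 h2. tlift ?YL (\<lambda>a b. rmul Y (tau Y (act L h1 l) (act Y a y)) (act L b m)) (\<Delta> h2)) (\<Delta> h)"
    by (rule tlift_comul_assoc) (rule mlin | assumption)+
  also have "\<dots> = tlift ?YL (\<lambda>h1 h2. tlift ?YL (\<lambda>a b. la Y (act L h1 l) (tn Y L (act Y a y) (act L b m))) (\<Delta> h2)) (\<Delta> h)"
    by (rule tlift_cong[of _ H H], (rule mlin)+, rule tlift_cong[of _ H H], (rule mlin | assumption)+,
      rule la_ten[symmetric]) (rule mlin | assumption)+
  also have "\<dots> = tlift ?YL (\<lambda>h1 h2. la Y (act L h1 l) (act (htens Y L) h2 (tn Y L y m))) (\<Delta> h)"
    by (rule tlift_cong[of _ H H], (rule mlin)+, subst htensor_act_ten, (rule mlin | assumption)+,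
      rule tlift_hom[symmetric, of ?YL]) (rule mlin | assumption)+
  finally show "act (htens Y L) h (la Y l (tn Y L y m)) = \<dots>" .
qed (rule mlin | assumption)+

subsection \<open>Kleisli extension\<close>

text \<open>The right \<open>L\<close>-linear extension of \<open>\<psi>\<close> to the free module.
  By \<open>mult_L_tmap\<close> it computes the composites through \<open>tmap\<close> that occur in
  \<open>Xi_mor\<close> and in the composition of dynamical morphisms; as a single sum it is
  evaluated directly on pure tensors.\<close>

definition "kl X Y \<psi> t = tlift (free Y) (\<lambda>x m. rmul Y (\<psi> x) m) t"

lemma kl_lin [mlin]:
  assumes "lin X (free Y) \<psi>" "kmod X" "kmod Y" "lin M (free X) f"
  shows "lin M (free Y) (\<lambda>x. kl X Y \<psi> (f x))"
proof -
  note [mlin] = lin_map_comp[OF _ assms(1)] lin_map_closed[OF assms(1)]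
  show ?thesis unfolding kl_def by (rule assms mlin | assumption)+
qed

lemma kl_closed [mlin]:
  "lin X (free Y) \<psi> \<Longrightarrow> kmod X \<Longrightarrow> kmod Y \<Longrightarrow> t \<in> carrier (free X) \<Longrightarrow> kl X Y \<psi> t \<in> carrier (free Y)"
  by (rule lin_map_closed[OF kl_lin[OF _ _ _ lin_id]])

lemma kl_ten:
  assumes "lin X (free Y) \<psi>" "kmod X" "kmod Y" "x \<in> carrier X" "m \<in> carrier L"
  shows "kl X Y \<psi> (tn X L x m) = rmul Y (\<psi> x) m"
proof -
  note [mlin] = lin_map_comp[OF _ assms(1)] lin_map_closed[OF assms(1)]
  show ?thesis unfolding kl_def by (rule tlift_ten) (rule mlin assms | assumption)+
qed

lemma kl_ten_one:
  assumes "lin X (free Y) \<psi>" "kmod X" "kmod Y" "x \<in> carrier X"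
  shows "kl X Y \<psi> (tn X L x \<one>\<^bsub>L\<^esub>) = \<psi> x"
  using lin_map_closed[OF assms(1,4)] by (simp add: kl_ten assms one_closed[OF L_alg] rmul_one)

lemma kl_cong:
  assumes "t \<in> carrier (free X)" "kmod X" "\<And>x. x \<in> carrier X \<Longrightarrow> \<psi> x = \<phi> x"
  shows "kl X Y \<psi> t = kl X Y \<phi> t"
  unfolding kl_def by (rule tlift_cong[OF assms(1,2) L_mod]) (simp add: assms)

lemma kl_rmul:
  assumes [mlin]: "lin X (free Y) \<psi>" "kmod X" "kmod Y" "m \<in> carrier L" and t: "t \<in> carrier (free X)"
  shows "kl X Y \<psi> (rmul X t m) = rmul Y (kl X Y \<psi> t) m"
proof (rule tensor_ext[OF t, of "Y \<otimes>\<^sub>k L"])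
  fix x n assume [mlin]: "x \<in> carrier X" "n \<in> carrier L"
  show "kl X Y \<psi> (rmul X (tn X L x n) m) = rmul Y (kl X Y \<psi> (tn X L x n)) m"
    by (subst rmul_ten, (rule mlin)+, subst kl_ten, (rule mlin)+, subst kl_ten, (rule mlin)+,
      rule rmul_rmul[symmetric]) (rule mlin lin_map_closed[OF assms(1)])+
qed (rule mlin | assumption)+

lemma hlin_htensor: "hlin X (htens Y Z) f \<Longrightarrow> lin X (Y \<otimes>\<^sub>k Z) f"
  by (simp add: hlin_def)

text \<open>The value of \<psi> at x has a component in \<open>L\<close>, and the inverse braiding
  makes \<open>l\<close> pass that component too, whereas the action of \<open>l\<close> on Y
  \<otimes> L merely multiplies. Commutativity of \<open>L\<close> removes the difference.\<close>

lemma kl_la: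
  assumes [mlin]: "hmod X" "hmod Y" "l \<in> carrier L" and \<psi>: "hlin X (htens Y L) \<psi>"
    and t: "t \<in> carrier (free X)"
  shows "kl X Y \<psi> (la X l t) = la Y l (kl X Y \<psi> t)"
proof -
  let ?YL = "Y \<otimes>\<^sub>k L"
  have p [mlin]: "lin X ?YL \<psi>" using \<psi> by (rule hlin_htensor)
  note [mlin] = lin_map_comp[OF _ p] lin_map_closed[OF p]
  have dl: "\<And>M f. lin M (free Y) f \<Longrightarrow> lin M (Y \<otimes>\<^sub>k L \<otimes>\<^sub>k L) (\<lambda>t. db (htens Y L) L l (f t))"
    using db_lin(1)[OF hmod_htensor[OF assms(2) L_hmod] L_hmod _ assms(3)] by simp
  \<comment> \<open>By the hexagon, passing y \<otimes> m means passing y and then m; the product in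
    \<open>L\<close> absorbs the second passage by \<open>lmul_db\<close>.\<close>
  have dn: "tlift ?YL (rmul Y) (db (htens Y L) L l t) = la Y l t" if t: "t \<in> carrier ?YL" for t
  proof (rule tensor_ext[OF t, of ?YL])
    fix y m assume [mlin]: "y \<in> carrier Y" "m \<in> carrier L"
    have "tlift ?YL (rmul Y) (db (htens Y L) L l (tn Y L y m)) =
        tlift ?YL (\<lambda>y' l'. tlift ?YL (\<lambda>m' l''. rmul Y (tn Y L y' m') l'') (db L L l' m)) (tau Y l y)"
      by (rule db_htensor_left) (rule mlin | assumption)+
    also have "\<dots> = tlift ?YL (\<lambda>y' l'. tlift ?YL (\<lambda>m' l''. tn Y L y' (lmul m' l'')) (db L L l' m)) (tau Y l y)"
      by (rule tlift_cong[of _ Y L], (rule mlin)+, rule tlift_cong[of _ L L], (rule mlin | assumption)+,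
        rule rmul_ten) (rule mlin | assumption)+
    also have "\<dots> = tlift ?YL (\<lambda>y' l'. tn Y L y' (lmul l' m)) (tau Y l y)"
      by (rule tlift_cong[of _ Y L], (rule mlin)+, subst lmul_db[symmetric], (rule mlin | assumption)+,
        rule tlift_hom[symmetric, of L]) (rule mlin | assumption)+
    also have "\<dots> = la Y l (tn Y L y m)"
      by (subst la_ten, (rule mlin)+) (simp add: rmul_def)
    finally show "tlift ?YL (rmul Y) (db (htens Y L) L l (tn Y L y m)) = la Y l (tn Y L y m)" .
  qed (rule mlin dl | assumption)+
  show ?thesis
  proof (rule tensor_ext[OF t, of ?YL])
    fix x m assume xm [mlin]: "x \<in> carrier X" "m \<in> carrier L"
    \<comment> \<open>Naturality of the inverse braiding for the equivariant map
      \<open>\<psi>\<close>.\<close>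
    have "kl X Y \<psi> (tau X l x) = tlift ?YL (\<lambda>u l'. rmul Y u l') (db (htens Y L) L l (\<psi> x))"
      unfolding kl_def
      by (rule db_natural[where g = "\<lambda>l. l" and f = \<psi>, symmetric])
        (simp | rule mlin hlin_id \<psi> | assumption)+
    also have "\<dots> = la Y l (\<psi> x)" by (rule dn) (rule mlin)+
    finally have 1: "kl X Y \<psi> (tau X l x) = la Y l (\<psi> x)" .
    have "kl X Y \<psi> (la X l (tn X L x m)) = kl X Y \<psi> (rmul X (tau X l x) m)"
      by (simp only: la_ten[OF assms(1,3) xm])
    also have "\<dots> = rmul Y (kl X Y \<psi> (tau X l x)) m"
      by (rule kl_rmul) (rule mlin)+
    also have "\<dots> = la Y l (rmul Y (\<psi> x) m)"
      unfolding 1 by (rule la_rmul[symmetric]) (rule mlin)+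
    also have "\<dots> = la Y l (kl X Y \<psi> (tn X L x m))"
      by (subst kl_ten, (rule mlin)+) simp
    finally show "kl X Y \<psi> (la X l (tn X L x m)) = \<dots>" .
  qed (rule mlin | assumption)+
qed

lemma kl_act:
  assumes [mlin]: "hmod X" "hmod Y" "h \<in> carrier H" and \<psi>: "hlin X (htens Y L) \<psi>"
    and t: "t \<in> carrier (free X)"
  shows "kl X Y \<psi> (act (htens X L) h t) = act (htens Y L) h (kl X Y \<psi> t)"
proof (rule tensor_ext[OF t, of "Y \<otimes>\<^sub>k L"])
  let ?YL = "Y \<otimes>\<^sub>k L"
  have p [mlin]: "lin X ?YL \<psi>" using \<psi> by (rule hlin_htensor)
  note [mlin] = lin_map_comp[OF _ p] lin_map_closed[OF p]
  fix x m assume xm [mlin]: "x \<in> carrier X" "m \<in> carrier L"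
  have "kl X Y \<psi> (act (htens X L) h (tn X L x m)) =
      tlift ?YL (\<lambda>h1 h2. kl X Y \<psi> (tn X L (act X h1 x) (act L h2 m))) (\<Delta> h)"
    by (subst htensor_act_ten, (rule mlin)+, rule tlift_hom[of "X \<otimes>\<^sub>k L"]) (rule mlin | assumption)+
  also have "\<dots> = tlift ?YL (\<lambda>h1 h2. rmul Y (\<psi> (act X h1 x)) (act L h2 m)) (\<Delta> h)"
    by (rule tlift_cong[of _ H H], (rule mlin)+, rule kl_ten) (rule mlin | assumption)+
  also have "\<dots> = tlift ?YL (\<lambda>h1 h2. rmul Y (act (htens Y L) h1 (\<psi> x)) (act L h2 m)) (\<Delta> h)"
    by (rule tlift_cong[of _ H H], (rule mlin)+) (simp add: hlin_act[OF \<psi>] xm)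
  also have "\<dots> = act (htens Y L) h (rmul Y (\<psi> x) m)"
    by (rule rmul_act[symmetric]) (rule mlin)+
  also have "\<dots> = act (htens Y L) h (kl X Y \<psi> (tn X L x m))"
    by (subst kl_ten, (rule mlin)+) simp
  finally show "kl X Y \<psi> (act (htens X L) h (tn X L x m)) = \<dots>" .
qed (rule mlin hlin_htensor[OF \<psi>] | assumption)+

text \<open>By right linearity both sides are determined by their values at x \<otimes> 1. This
  Kleisli law yields the associativity of the dynamical composition and the functoriality of
  \<Xi>.\<close>

lemma kl_kl:
  assumes [mlin]: "hmod X" "hmod Y" "hmod Z" "lin X (free Y) \<phi>" "lin Y (free Z) \<psi>"
    and t: "t \<in> carrier (free X)"
  shows "kl Y Z \<psi> (kl X Y \<phi> t) = kl X Z (\<lambda>x. kl Y Z \<psi> (\<phi> x)) t"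
proof (rule tensor_ext[OF t, of "Z \<otimes>\<^sub>k L"])
  fix x m assume xm [mlin]: "x \<in> carrier X" "m \<in> carrier L"
  have p: "\<phi> x \<in> carrier (free Y)" by (rule lin_map_closed[OF assms(4) xm(1)])
  have "kl Y Z \<psi> (kl X Y \<phi> (tn X L x m)) = rmul Z (kl Y Z \<psi> (\<phi> x)) m"
    by (subst kl_ten, (rule mlin)+, rule kl_rmul) (rule mlin p)+
  also have "\<dots> = kl X Z (\<lambda>x. kl Y Z \<psi> (\<phi> x)) (tn X L x m)"
    by (rule kl_ten[symmetric]) (rule mlin)+
  finally show "kl Y Z \<psi> (kl X Y \<phi> (tn X L x m)) = \<dots>" .
qed (rule mlin | assumption)+

subsection \<open>The lax structure\<close>

text \<open>Tensoring with x on the left, with the brackets moved. It separates the map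
  \<open>jj\<close> into the action of \<open>L\<close> on the second factor and an insertion that
  involves no braiding.\<close>

definition "ins X Y x t = tlift (X \<otimes>\<^sub>k Y \<otimes>\<^sub>k L) (\<lambda>y m. tn (X \<otimes>\<^sub>k Y) L (tn X Y x y) m) t"

definition "jj X Y s t = tlift (X \<otimes>\<^sub>k Y \<otimes>\<^sub>k L) (\<lambda>x l. ins X Y x (la Y l t)) s"

lemma ins_lin [mlin]:
  "kmod X \<Longrightarrow> kmod Y \<Longrightarrow> kmod M \<Longrightarrow> lin M X f \<Longrightarrow> t \<in> carrier (free Y) \<Longrightarrow>
    lin M (X \<otimes>\<^sub>k Y \<otimes>\<^sub>k L) (\<lambda>m. ins X Y (f m) t)"
  "kmod X \<Longrightarrow> kmod Y \<Longrightarrow> x \<in> carrier X \<Longrightarrow> lin M (free Y) g \<Longrightarrow>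
    lin M (X \<otimes>\<^sub>k Y \<otimes>\<^sub>k L) (\<lambda>m. ins X Y x (g m))"
  "kmod X \<Longrightarrow> kmod Y \<Longrightarrow> x \<in> carrier X \<Longrightarrow> t \<in> carrier (free Y) \<Longrightarrow>
    ins X Y x t \<in> carrier (X \<otimes>\<^sub>k Y \<otimes>\<^sub>k L)"
  unfolding ins_def by (rule mlin | assumption)+

lemma jj_lin [mlin]:
  "kmod X \<Longrightarrow> hmod Y \<Longrightarrow> lin M (free X) f \<Longrightarrow> t \<in> carrier (free Y) \<Longrightarrow>
    lin M (X \<otimes>\<^sub>k Y \<otimes>\<^sub>k L) (\<lambda>m. jj X Y (f m) t)"
  "kmod X \<Longrightarrow> hmod Y \<Longrightarrow> kmod M \<Longrightarrow> s \<in> carrier (free X) \<Longrightarrow> lin M (free Y) g \<Longrightarrow>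
    lin M (X \<otimes>\<^sub>k Y \<otimes>\<^sub>k L) (\<lambda>m. jj X Y s (g m))"
  "kmod X \<Longrightarrow> hmod Y \<Longrightarrow> s \<in> carrier (free X) \<Longrightarrow> t \<in> carrier (free Y) \<Longrightarrow>
    jj X Y s t \<in> carrier (X \<otimes>\<^sub>k Y \<otimes>\<^sub>k L)"
  unfolding jj_def by (rule mlin | assumption)+

lemma ins_ten:
  "kmod X \<Longrightarrow> kmod Y \<Longrightarrow> x \<in> carrier X \<Longrightarrow> y \<in> carrier Y \<Longrightarrow> m \<in> carrier L \<Longrightarrow>
    ins X Y x (tn Y L y m) = tn (X \<otimes>\<^sub>k Y) L (tn X Y x y) m"
  unfolding ins_def by (rule tlift_ten) (rule mlin | assumption)+

lemma jj_ten:
  "kmod X \<Longrightarrow> hmod Y \<Longrightarrow> x \<in> carrier X \<Longrightarrow> l \<in> carrier L \<Longrightarrow> t \<in> carrier (free Y) \<Longrightarrow>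
    jj X Y (tn X L x l) t = ins X Y x (la Y l t)"
  unfolding jj_def by (rule tlift_ten) (rule mlin | assumption)+

lemma jj_ten_one:
  "kmod X \<Longrightarrow> hmod Y \<Longrightarrow> x \<in> carrier X \<Longrightarrow> t \<in> carrier (free Y) \<Longrightarrow>
    jj X Y (tn X L x \<one>\<^bsub>L\<^esub>) t = ins X Y x t"
  by (simp add: jj_ten one_closed[OF L_alg] la_one)

lemma ins_rmul:
  assumes [mlin]: "kmod X" "kmod Y" "x \<in> carrier X" "m \<in> carrier L" and t: "t \<in> carrier (free Y)"
  shows "ins X Y x (rmul Y t m) = rmul (X \<otimes>\<^sub>k Y) (ins X Y x t) m"
  by (rule tensor_ext[OF t, of "X \<otimes>\<^sub>k Y \<otimes>\<^sub>k L"])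
    ((rule mlin | assumption)+, simp add: rmul_ten ins_ten assms tensor_mod ten_closed mult_closed[OF L_alg])

lemma ins_act:
  assumes [mlin]: "hmod X" "hmod Y" "h \<in> carrier H" "x \<in> carrier X" and t: "t \<in> carrier (free Y)"
  shows "act (htens (htens X Y) L) h (ins X Y x t) =
    tlift (X \<otimes>\<^sub>k Y \<otimes>\<^sub>k L) (\<lambda>h1 h2. ins X Y (act X h1 x) (act (htens Y L) h2 t)) (\<Delta> h)"
proof (rule tensor_ext[OF t, of "X \<otimes>\<^sub>k Y \<otimes>\<^sub>k L"])
  let ?P = "X \<otimes>\<^sub>k Y \<otimes>\<^sub>k L"
  have XY: "hmod (htens X Y)" by (rule mlin)+
  show "lin (free Y) ?P (\<lambda>t. act (htens (htens X Y) L) h (ins X Y x t))"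
    using htensor_act_lin_right[OF XY L_hmod assms(3), of "Y \<otimes>\<^sub>k L" "ins X Y x"]
      ins_lin(2)[OF hmod_mod[OF assms(1)] hmod_mod[OF assms(2)] assms(4) lin_id] by simp
  fix y m assume ym [mlin]: "y \<in> carrier Y" "m \<in> carrier L"
  have "act (htens (htens X Y) L) h (ins X Y x (tn Y L y m)) =
      act (htens (htens X Y) L) h (tn (htens X Y) L (tn X Y x y) m)"
    by (subst ins_ten, (rule mlin)+) simp
  also have "\<dots> = tlift ?P (\<lambda>h1 h2. tn (X \<otimes>\<^sub>k Y) L (act (htens X Y) h1 (tn X Y x y)) (act L h2 m)) (\<Delta> h)"
    by (subst htensor_act_ten, (rule mlin)+) simp
  also have "\<dots> = tlift ?P (\<lambda>h1 h2. tlift ?P (\<lambda>a b. tn (X \<otimes>\<^sub>k Y) L (tn X Y (act X a x) (act Y b y)) (act L h2 m)) (\<Delta> h1)) (\<Delta> h)"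
    by (rule tlift_cong[of _ H H], (rule mlin)+, subst htensor_act_ten, (rule mlin | assumption)+,
      rule tlift_hom[of "X \<otimes>\<^sub>k Y" _ "\<lambda>u. tn (X \<otimes>\<^sub>k Y) L u _"]) (rule mlin | assumption)+
  also have "\<dots> = tlift ?P (\<lambda>h1 h2. tlift ?P (\<lambda>a b. tn (X \<otimes>\<^sub>k Y) L (tn X Y (act X h1 x) (act Y a y)) (act L b m)) (\<Delta> h2)) (\<Delta> h)"
    by (rule tlift_comul_assoc) (rule mlin | assumption)+
  also have "\<dots> = tlift ?P (\<lambda>h1 h2. tlift ?P (\<lambda>a b. ins X Y (act X h1 x) (tn Y L (act Y a y) (act L b m))) (\<Delta> h2)) (\<Delta> h)"
    by (rule tlift_cong[of _ H H], (rule mlin)+, rule tlift_cong[of _ H H], (rule mlin | assumption)+,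
      rule ins_ten[symmetric]) (rule mlin | assumption)+
  also have "\<dots> = tlift ?P (\<lambda>h1 h2. ins X Y (act X h1 x) (act (htens Y L) h2 (tn Y L y m))) (\<Delta> h)"
    by (rule tlift_cong[of _ H H], (rule mlin)+, subst htensor_act_ten, (rule mlin | assumption)+,
      rule tlift_hom[symmetric, of "Y \<otimes>\<^sub>k L"]) (rule mlin | assumption)+
  finally show "act (htens (htens X Y) L) h (ins X Y x (tn Y L y m)) = \<dots>" .
qed (rule mlin | assumption)+

lemma la_htensor_lin [mlin]:
  assumes "hmod X" "hmod Y"
  shows "kmod M \<Longrightarrow> lin M L f \<Longrightarrow> t \<in> carrier (X \<otimes>\<^sub>k Y \<otimes>\<^sub>k L) \<Longrightarrow>
      lin M (X \<otimes>\<^sub>k Y \<otimes>\<^sub>k L) (\<lambda>m. la (htens X Y) (f m) t)"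
    "l \<in> carrier L \<Longrightarrow> lin M (X \<otimes>\<^sub>k Y \<otimes>\<^sub>k L) g \<Longrightarrow> lin M (X \<otimes>\<^sub>k Y \<otimes>\<^sub>k L) (\<lambda>m. la (htens X Y) l (g m))"
    "l \<in> carrier L \<Longrightarrow> t \<in> carrier (X \<otimes>\<^sub>k Y \<otimes>\<^sub>k L) \<Longrightarrow> la (htens X Y) l t \<in> carrier (X \<otimes>\<^sub>k Y \<otimes>\<^sub>k L)"
  using la_lin[OF hmod_htensor[OF assms]] by simp_all

lemma rmul_htensor [simp]: "rmul (htens X Y) = rmul (X \<otimes>\<^sub>k Y)"
  by (simp add: rmul_def fun_eq_iff)

text \<open>Hexagon: to pass x \<otimes> y, an element of \<open>L\<close> passes x and what results
  then acts on the factor containing y.\<close>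

lemma ins_la:
  assumes [mlin]: "hmod X" "hmod Y" "l \<in> carrier L" "x \<in> carrier X" and t: "t \<in> carrier (free Y)"
  shows "la (htens X Y) l (ins X Y x t) =
    tlift (X \<otimes>\<^sub>k Y \<otimes>\<^sub>k L) (\<lambda>x' l'. ins X Y x' (la Y l' t)) (tau X l x)"
proof (rule tensor_ext[OF t, of "X \<otimes>\<^sub>k Y \<otimes>\<^sub>k L"])
  let ?P = "X \<otimes>\<^sub>k Y \<otimes>\<^sub>k L"
  fix y m assume ym [mlin]: "y \<in> carrier Y" "m \<in> carrier L"
  have "la (htens X Y) l (ins X Y x (tn Y L y m)) = la (htens X Y) l (tn (htens X Y) L (tn X Y x y) m)"
    by (subst ins_ten, (rule mlin)+) simp
  also have "\<dots> = tlift ?P (\<lambda>u l'. tn (X \<otimes>\<^sub>k Y) L u (lmul l' m)) (db (htens X Y) L l (tn X Y x y))"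
    by (subst la_ten, (rule mlin)+) (simp add: rmul_def)
  also have "\<dots> = tlift ?P (\<lambda>x' l'. tlift ?P (\<lambda>y' l''. tn (X \<otimes>\<^sub>k Y) L (tn X Y x' y') (lmul l'' m)) (tau Y l' y)) (tau X l x)"
    by (rule db_htensor_left) (rule mlin | assumption)+
  also have "\<dots> = tlift ?P (\<lambda>x' l'. tlift ?P (\<lambda>y' l''. ins X Y x' (tn Y L y' (lmul l'' m))) (tau Y l' y)) (tau X l x)"
    by (rule tlift_cong[of _ X L], (rule mlin)+, rule tlift_cong[of _ Y L], (rule mlin | assumption)+,
      rule ins_ten[symmetric]) (rule mlin | assumption)+
  also have "\<dots> = tlift ?P (\<lambda>x' l'. ins X Y x' (rmul Y (tau Y l' y) m)) (tau X l x)"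
    unfolding rmul_def
    by (rule tlift_cong[of _ X L], (rule mlin)+, rule tlift_hom[symmetric, of "Y \<otimes>\<^sub>k L"]) (rule mlin | assumption)+
  also have "\<dots> = tlift ?P (\<lambda>x' l'. ins X Y x' (la Y l' (tn Y L y m))) (tau X l x)"
    by (rule tlift_cong[of _ X L], (rule mlin)+) (simp add: la_ten assms ym)
  finally show "la (htens X Y) l (ins X Y x (tn Y L y m)) = \<dots>" .
qed (rule mlin | assumption)+

text \<open>Since \<open>la\<close> is an action, a right factor of the first argument may as well
  act on the second from the left. This is balance over \<open>L\<close>.\<close>

lemma jj_rmul_left:
  assumes [mlin]: "hmod X" "hmod Y" "l \<in> carrier L" "s \<in> carrier (free X)" "t \<in> carrier (free Y)"
  shows "jj X Y (rmul X s l) t = jj X Y s (la Y l t)"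
proof (rule tensor_ext[OF assms(4), of "X \<otimes>\<^sub>k Y \<otimes>\<^sub>k L"])
  fix x m assume xm [mlin]: "x \<in> carrier X" "m \<in> carrier L"
  have "jj X Y (rmul X (tn X L x m) l) t = ins X Y x (la Y (lmul m l) t)"
    by (subst rmul_ten, (rule mlin)+, rule jj_ten) (rule mlin)+
  also have "\<dots> = ins X Y x (la Y m (la Y l t))"
    by (simp only: la_mult[OF assms(2) xm(2) assms(3,5)])
  also have "\<dots> = jj X Y (tn X L x m) (la Y l t)"
    by (rule jj_ten[symmetric]) (rule mlin)+
  finally show "jj X Y (rmul X (tn X L x m) l) t = \<dots>" .
qed (rule mlin | assumption)+

lemma jj_rmul:
  assumes [mlin]: "hmod X" "hmod Y" "l \<in> carrier L" "s \<in> carrier (free X)" "t \<in> carrier (free Y)"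
  shows "jj X Y s (rmul Y t l) = rmul (X \<otimes>\<^sub>k Y) (jj X Y s t) l"
proof (rule tensor_ext[OF assms(4), of "X \<otimes>\<^sub>k Y \<otimes>\<^sub>k L"])
  fix x m assume xm [mlin]: "x \<in> carrier X" "m \<in> carrier L"
  show "jj X Y (tn X L x m) (rmul Y t l) = rmul (X \<otimes>\<^sub>k Y) (jj X Y (tn X L x m) t) l"
    by (subst jj_ten, (rule mlin)+, subst jj_ten, (rule mlin)+, subst la_rmul, (rule mlin)+,
      rule ins_rmul) (rule mlin)+
qed (rule mlin | assumption)+

text \<open>On x \<otimes> m the left action is the inverse braiding with x, multiplied by m on the
  right. Balance moves m to the second argument, and \<open>ins_la\<close> collects the
  rest.\<close>

lemma jj_la:
  assumes [mlin]: "hmod X" "hmod Y" "l \<in> carrier L" "s \<in> carrier (free X)" "t \<in> carrier (free Y)"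
  shows "jj X Y (la X l s) t = la (htens X Y) l (jj X Y s t)"
proof (rule tensor_ext[OF assms(4), of "X \<otimes>\<^sub>k Y \<otimes>\<^sub>k L"])
  fix x m assume xm [mlin]: "x \<in> carrier X" "m \<in> carrier L"
  have "jj X Y (la X l (tn X L x m)) t = jj X Y (tau X l x) (la Y m t)"
    by (subst la_ten, (rule mlin)+, rule jj_rmul_left) (rule mlin)+
  also have "\<dots> = tlift (X \<otimes>\<^sub>k Y \<otimes>\<^sub>k L) (\<lambda>x' l'. ins X Y x' (la Y l' (la Y m t))) (tau X l x)"
    by (simp add: jj_def)
  also have "\<dots> = la (htens X Y) l (ins X Y x (la Y m t))"
    by (rule ins_la[symmetric]) (rule mlin)+
  also have "\<dots> = la (htens X Y) l (jj X Y (tn X L x m) t)"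
    by (subst jj_ten, (rule mlin)+) simp
  finally show "jj X Y (la X l (tn X L x m)) t = \<dots>" .
qed (rule mlin | assumption)+

lemma htensor3_act_lin [mlin]:
  assumes "hmod X" "hmod Y" "hmod Z" "h \<in> carrier H" "lin M (X \<otimes>\<^sub>k Y \<otimes>\<^sub>k Z) f"
  shows "lin M (X \<otimes>\<^sub>k Y \<otimes>\<^sub>k Z) (\<lambda>m. act (htens (htens X Y) Z) h (f m))"
  using htensor_act_lin_right[OF hmod_htensor[OF assms(1,2)] assms(3,4), of M f] assms(5) by simp

text \<open>\<open>ins_act\<close> distributes h over x and the second argument,
  \<open>la_act\<close> further over l and t. Coassociativity regroups the two parts that act on x
  and l.\<close>

lemma jj_act:
  assumes [mlin]: "hmod X" "hmod Y" "h \<in> carrier H" "s \<in> carrier (free X)" "t \<in> carrier (free Y)"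
  shows "act (htens (htens X Y) L) h (jj X Y s t) =
    tlift (X \<otimes>\<^sub>k Y \<otimes>\<^sub>k L) (\<lambda>h1 h2. jj X Y (act (htens X L) h1 s) (act (htens Y L) h2 t)) (\<Delta> h)"
proof (rule tensor_ext[OF assms(4), of "X \<otimes>\<^sub>k Y \<otimes>\<^sub>k L"])
  let ?P = "X \<otimes>\<^sub>k Y \<otimes>\<^sub>k L"
  fix x l assume xm [mlin]: "x \<in> carrier X" "l \<in> carrier L"
  have "act (htens (htens X Y) L) h (jj X Y (tn X L x l) t) =
      tlift ?P (\<lambda>h1 h2. ins X Y (act X h1 x) (act (htens Y L) h2 (la Y l t))) (\<Delta> h)"
    by (subst jj_ten, (rule mlin)+, rule ins_act) (rule mlin)+
  also have "\<dots> = tlift ?P (\<lambda>h1 h2. tlift ?P (\<lambda>a b. ins X Y (act X h1 x) (la Y (act L a l) (act (htens Y L) b t))) (\<Delta> h2)) (\<Delta> h)"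
    by (rule tlift_cong[of _ H H], (rule mlin)+, subst la_act, (rule mlin | assumption)+,
      rule tlift_hom[of "Y \<otimes>\<^sub>k L"]) (rule mlin | assumption)+
  also have "\<dots> = tlift ?P (\<lambda>h1 h2. tlift ?P (\<lambda>a b. ins X Y (act X a x) (la Y (act L b l) (act (htens Y L) h2 t))) (\<Delta> h1)) (\<Delta> h)"
    by (rule tlift_comul_assoc[symmetric]) (rule mlin | assumption)+
  also have "\<dots> = tlift ?P (\<lambda>h1 h2. tlift ?P (\<lambda>a b. jj X Y (tn X L (act X a x) (act L b l)) (act (htens Y L) h2 t)) (\<Delta> h1)) (\<Delta> h)"
    by (rule tlift_cong[of _ H H], (rule mlin)+, rule tlift_cong[of _ H H], (rule mlin | assumption)+,
      rule jj_ten[symmetric]) (rule mlin | assumption)+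
  also have "\<dots> = tlift ?P (\<lambda>h1 h2. jj X Y (act (htens X L) h1 (tn X L x l)) (act (htens Y L) h2 t)) (\<Delta> h)"
    by (rule tlift_cong[of _ H H], (rule mlin)+, subst htensor_act_ten, (rule mlin | assumption)+,
      rule tlift_hom[symmetric, of "X \<otimes>\<^sub>k L" _ "\<lambda>u. jj X Y u _"]) (rule mlin | assumption)+
  finally show "act (htens (htens X Y) L) h (jj X Y (tn X L x l) t) = \<dots>" .
qed (rule mlin | assumption)+

text \<open>The nested sums of the definition collapse from the inside: the sum over the coaction is
  \<open>la\<close> on a pure tensor, the sum over t is \<open>la\<close> on t, and the sum over s
  is \<open>jj\<close>.\<close>

lemma dyn_merge:
  assumes [mlin]: "hmod X" "hmod Y" "u \<in> carrier (X \<otimes>\<^sub>k L \<otimes>\<^sub>k (free Y))"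
  shows "dyn_merge k H R L X Y u = tlift (X \<otimes>\<^sub>k Y \<otimes>\<^sub>k L) (jj X Y) u"
proof -
  let ?P = "X \<otimes>\<^sub>k Y \<otimes>\<^sub>k L"
  let ?g = "\<lambda>x l y m. tlift ?P (\<lambda>y' l'. tn (X \<otimes>\<^sub>k Y) L (tn X Y x y') (lmul l' m)) (dyn_tau k H R L Y l y)"
  have 1: "?g x l y m = ins X Y x (la Y l (tn Y L y m))"
    if [mlin]: "x \<in> carrier X" "l \<in> carrier L" "y \<in> carrier Y" "m \<in> carrier L" for x l y m
  proof -
    have "?g x l y m = tlift ?P (\<lambda>y' l'. ins X Y x (tn Y L y' (lmul l' m))) (tau Y l y)"
      unfolding dyn_tau[OF assms(2) that(2,3)]
      by (rule tlift_cong[of _ Y L], (rule mlin)+, rule ins_ten[symmetric]) (rule mlin | assumption)+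
    also have "\<dots> = ins X Y x (rmul Y (tau Y l y) m)"
      unfolding rmul_def by (rule tlift_hom[symmetric, of "Y \<otimes>\<^sub>k L"]) (rule mlin | assumption)+
    finally show ?thesis by (simp add: la_ten assms that)
  qed
  have 2: "tlift ?P (?g x l) t = ins X Y x (la Y l t)"
    if [mlin]: "x \<in> carrier X" "l \<in> carrier L" "t \<in> carrier (free Y)" for x l t
  proof -
    have "tlift ?P (?g x l) t = tlift ?P (\<lambda>y m. ins X Y x (la Y l (tn Y L y m))) t"
      by (rule tlift_cong[of _ Y L], (rule mlin)+, rule 1) (rule mlin | assumption)+
    also have "\<dots> = ins X Y x (la Y l (tlift (free Y) (tn Y L) t))"
      by (rule tlift_hom[symmetric, of "Y \<otimes>\<^sub>k L"]) (rule mlin | assumption)+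
    finally show ?thesis by (simp add: tlift_self assms that hmod_mod L_mod)
  qed
  have 3: "tlift ?P (\<lambda>x l. tlift ?P (?g x l) t) s = jj X Y s t"
    if [mlin]: "s \<in> carrier (free X)" "t \<in> carrier (free Y)" for s t
    unfolding jj_def by (rule tlift_cong[of _ X L], (rule mlin)+, rule 2) (rule mlin | assumption)+
  show ?thesis
    unfolding dyn_merge_def Let_def
    by (rule tlift_cong[of _ "X \<otimes>\<^sub>k L" "Y \<otimes>\<^sub>k L"], (rule mlin)+, rule 3)
qed

section \<open>The tensor product of dynamical morphisms\<close>

definition "tm X Y \<phi> \<psi> t = tlift (X \<otimes>\<^sub>k Y \<otimes>\<^sub>k L) (\<lambda>x y. jj X Y (\<phi> x) (\<psi> y)) t"

lemma tm_lin [mlin]: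
  assumes "lin M (X' \<otimes>\<^sub>k Y') f" and [mlin]: "lin X' (free X) \<phi>" "lin Y' (free Y) \<psi>"
    "kmod X'" "kmod Y'" "kmod X" "hmod Y"
  shows "lin M (X \<otimes>\<^sub>k Y \<otimes>\<^sub>k L) (\<lambda>m. tm X Y \<phi> \<psi> (f m))"
proof -
  note [mlin] = lin_map_comp[OF _ assms(2)] lin_map_closed[OF assms(2)]
    lin_map_comp[OF _ assms(3)] lin_map_closed[OF assms(3)]
  show ?thesis unfolding tm_def by (rule assms(1) mlin | assumption)+
qed

lemma tm_ten:
  assumes [mlin]: "kmod X'" "kmod Y'" "kmod X" "hmod Y"
    "lin X' (free X) \<phi>" "lin Y' (free Y) \<psi>" "x \<in> carrier X'" "y \<in> carrier Y'"
  shows "tm X Y \<phi> \<psi> (tn X' Y' x y) = jj X Y (\<phi> x) (\<psi> y)"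
proof -
  note [mlin] = lin_map_comp[OF _ assms(5)] lin_map_closed[OF assms(5)]
    lin_map_comp[OF _ assms(6)] lin_map_closed[OF assms(6)]
  show ?thesis unfolding tm_def by (rule tlift_ten) (rule mlin | assumption)+
qed

text \<open>The component l of x \<otimes> l acts on t before \<open>\<psi>\<close> is applied on
  one side and afterwards on the other, which is \<open>kl_la\<close>; the remaining steps are right
  linearity. Both the interchange law of the dynamical category and the naturality of the comparison
  map of \<Xi> rest on this.\<close>

lemma kl_jj:
  assumes [mlin]: "hmod X'" "hmod Y'" "hmod X" "hmod Y" "s \<in> carrier (free X')" "t \<in> carrier (free Y')"
    and \<phi>: "hlin X' (htens X L) \<phi>" and \<psi>: "hlin Y' (htens Y L) \<psi>"
  shows "kl (X' \<otimes>\<^sub>k Y') (X \<otimes>\<^sub>k Y) (tm X Y \<phi> \<psi>) (jj X' Y' s t) = jj X Y (kl X' X \<phi> s) (kl Y' Y \<psi> t)"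
proof -
  let ?P = "X \<otimes>\<^sub>k Y \<otimes>\<^sub>k L"
  note p = hlin_htensor[OF \<phi>] hlin_htensor[OF \<psi>]
  note [mlin] = p lin_map_closed[OF p(1)] lin_map_closed[OF p(2)]
  have 1: "kl (X' \<otimes>\<^sub>k Y') (X \<otimes>\<^sub>k Y) (tm X Y \<phi> \<psi>) (ins X' Y' x t) = jj X Y (\<phi> x) (kl Y' Y \<psi> t)"
    if [mlin]: "x \<in> carrier X'" and t: "t \<in> carrier (free Y')" for x t
  proof (rule tensor_ext[OF t, of ?P])
    fix y m assume ym [mlin]: "y \<in> carrier Y'" "m \<in> carrier L"
    have "kl (X' \<otimes>\<^sub>k Y') (X \<otimes>\<^sub>k Y) (tm X Y \<phi> \<psi>) (ins X' Y' x (tn Y' L y m)) =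
        rmul (X \<otimes>\<^sub>k Y) (tm X Y \<phi> \<psi> (tn X' Y' x y)) m"
      by (subst ins_ten, (rule mlin)+, rule kl_ten) (rule mlin)+
    also have "\<dots> = rmul (X \<otimes>\<^sub>k Y) (jj X Y (\<phi> x) (\<psi> y)) m"
      by (subst tm_ten, (rule mlin)+) simp
    also have "\<dots> = jj X Y (\<phi> x) (rmul Y (\<psi> y) m)"
      by (rule jj_rmul[symmetric]) (rule mlin)+
    also have "\<dots> = jj X Y (\<phi> x) (kl Y' Y \<psi> (tn Y' L y m))"
      by (subst kl_ten, (rule mlin)+) simp
    finally show "kl (X' \<otimes>\<^sub>k Y') (X \<otimes>\<^sub>k Y) (tm X Y \<phi> \<psi>) (ins X' Y' x (tn Y' L y m)) = \<dots>" .
  qed (rule mlin | assumption)+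
  show ?thesis
  proof (rule tensor_ext[OF assms(5), of ?P])
    fix x l assume xl [mlin]: "x \<in> carrier X'" "l \<in> carrier L"
    have "kl (X' \<otimes>\<^sub>k Y') (X \<otimes>\<^sub>k Y) (tm X Y \<phi> \<psi>) (jj X' Y' (tn X' L x l) t) =
        jj X Y (\<phi> x) (kl Y' Y \<psi> (la Y' l t))"
      by (subst jj_ten, (rule mlin)+, rule 1) (rule mlin)+
    also have "\<dots> = jj X Y (\<phi> x) (la Y l (kl Y' Y \<psi> t))"
      by (simp only: kl_la[OF assms(2,4) xl(2) \<psi> assms(6)])
    also have "\<dots> = jj X Y (rmul X (\<phi> x) l) (kl Y' Y \<psi> t)"
      by (rule jj_rmul_left[symmetric]) (rule mlin)+
    also have "\<dots> = jj X Y (kl X' X \<phi> (tn X' L x l)) (kl Y' Y \<psi> t)"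
      by (subst kl_ten, (rule mlin)+) simp
    finally show "kl (X' \<otimes>\<^sub>k Y') (X \<otimes>\<^sub>k Y) (tm X Y \<phi> \<psi>) (jj X' Y' (tn X' L x l) t) = \<dots>" .
  qed (rule mlin | assumption)+
qed

text \<open>On pure tensors the claim is coassociativity of the coproduct.\<close>

lemma assoc_hlin:
  assumes [mlin]: "hmod X" "hmod Y" "hmod Z"
  shows "hlin (htens (htens X Y) Z) (htens X (htens Y Z)) (assoc k X Y Z)"
  unfolding hlin_def
proof (intro conjI ballI)
  show "lin (htens (htens X Y) Z) (htens X (htens Y Z)) (assoc k X Y Z)"
    by simp (rule mlin | assumption)+
  let ?P = "X \<otimes>\<^sub>k (Y \<otimes>\<^sub>k Z)"
  have h [mlin]: "hmod (htens X Y)" "hmod (htens Y Z)" by (rule mlin)+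
  fix h t assume hh [mlin]: "h \<in> carrier H" and "t \<in> carrier (htens (htens X Y) Z)"
  then have t: "t \<in> carrier (X \<otimes>\<^sub>k Y \<otimes>\<^sub>k Z)" by simp
  have al: "lin M ?P (\<lambda>m. act (htens X (htens Y Z)) h (f m))" if "lin M ?P f" for M and f :: "'a univ \<Rightarrow> 'a univ"
    using htensor_act_lin_right[OF assms(1) h(2) hh, of M f] that by simp
  show "assoc k X Y Z (act (htens (htens X Y) Z) h t) = act (htens X (htens Y Z)) h (assoc k X Y Z t)"
  proof (rule tensor_ext3[OF t, of ?P])
    fix x y z assume xyz [mlin]: "x \<in> carrier X" "y \<in> carrier Y" "z \<in> carrier Z"
    have "act (htens (htens X Y) Z) h (tn (X \<otimes>\<^sub>k Y) Z (tn X Y x y) z) =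
        tlift (X \<otimes>\<^sub>k Y \<otimes>\<^sub>k Z) (\<lambda>h1 h2. tn (X \<otimes>\<^sub>k Y) Z (act (htens X Y) h1 (tn X Y x y)) (act Z h2 z)) (\<Delta> h)"
      using htensor_act_ten[OF h(1) assms(3) hh htensor_carrier[OF ten_closed[OF xyz(1,2)]] xyz(3)] by simp
    also have "assoc k X Y Z \<dots> = tlift ?P (\<lambda>h1 h2. assoc k X Y Z (tn (X \<otimes>\<^sub>k Y) Z (act (htens X Y) h1 (tn X Y x y)) (act Z h2 z))) (\<Delta> h)"
      by (rule tlift_hom) (rule mlin | assumption)+
    also have "\<dots> = tlift ?P (\<lambda>h1 h2. tlift ?P (\<lambda>a b. assoc k X Y Z (tn (X \<otimes>\<^sub>k Y) Z (tn X Y (act X a x) (act Y b y)) (act Z h2 z))) (\<Delta> h1)) (\<Delta> h)"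
      by (rule tlift_cong[of _ H H], (rule mlin)+, subst htensor_act_ten, (rule mlin | assumption)+,
        rule tlift_hom[of "X \<otimes>\<^sub>k Y" _ "\<lambda>u. assoc k X Y Z (tn (X \<otimes>\<^sub>k Y) Z u _)"]) (rule mlin | assumption)+
    also have "\<dots> = tlift ?P (\<lambda>h1 h2. tlift ?P (\<lambda>a b. tn X (Y \<otimes>\<^sub>k Z) (act X a x) (tn Y Z (act Y b y) (act Z h2 z))) (\<Delta> h1)) (\<Delta> h)"
      by (rule tlift_cong[of _ H H], (rule mlin)+, rule tlift_cong[of _ H H], (rule mlin | assumption)+,
        rule assoc_ten) (rule mlin | assumption)+
    also have "\<dots> = tlift ?P (\<lambda>h1 h2. tlift ?P (\<lambda>a b. tn X (Y \<otimes>\<^sub>k Z) (act X h1 x) (tn Y Z (act Y a y) (act Z b z))) (\<Delta> h2)) (\<Delta> h)"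
      by (rule tlift_comul_assoc) (rule mlin | assumption)+
    also have "\<dots> = tlift ?P (\<lambda>h1 h2. tn X (Y \<otimes>\<^sub>k Z) (act X h1 x) (act (htens Y Z) h2 (tn Y Z y z))) (\<Delta> h)"
      by (rule tlift_cong[of _ H H], (rule mlin)+, subst htensor_act_ten, (rule mlin | assumption)+,
        rule tlift_hom[symmetric, of "Y \<otimes>\<^sub>k Z"]) (rule mlin | assumption)+
    also have "\<dots> = act (htens X (htens Y Z)) h (tn X (Y \<otimes>\<^sub>k Z) x (tn Y Z y z))"
      using htensor_act_ten[OF assms(1) h(2) hh xyz(1) htensor_carrier[OF ten_closed[OF xyz(2,3)]]] by simp
    also have "\<dots> = act (htens X (htens Y Z)) h (assoc k X Y Z (tn (X \<otimes>\<^sub>k Y) Z (tn X Y x y) z))"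
      by (subst assoc_ten, (rule mlin)+) simp
    finally show "assoc k X Y Z (act (htens (htens X Y) Z) h (tn (X \<otimes>\<^sub>k Y) Z (tn X Y x y) z)) = \<dots>" .
  qed (rule mlin al | assumption)+
qed

lemma hlin_inverse:
  assumes "hlin X Y f" "hmod X" "hmod Y" "\<And>y. y \<in> carrier Y \<Longrightarrow> g y \<in> carrier X"
    "\<And>x. x \<in> carrier X \<Longrightarrow> g (f x) = x" "\<And>y. y \<in> carrier Y \<Longrightarrow> f (g y) = y"
  shows "hlin Y X g"
proof -
  interpret X: amodule k H X by fact
  interpret Y: amodule k H Y by fact
  note f = lin_map_add[of k X Y f] lin_map_smult[of k X Y f] hlin_act[OF assms(1)]
  have l: "lin X Y f" using assms(1) by (simp add: hlin_def)
  have "g (y \<oplus>\<^bsub>Y\<^esub> y') = g y \<oplus>\<^bsub>X\<^esub> g y'" if "y \<in> carrier Y" "y' \<in> carrier Y" for y y'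
    using assms(5)[of "g y \<oplus>\<^bsub>X\<^esub> g y'"] f(1)[OF l, of "g y" "g y'"] that assms(4,6) by simp
  moreover have "g (r \<odot>\<^bsub>Y\<^esub> y) = r \<odot>\<^bsub>X\<^esub> g y" if "r \<in> carrier k" "y \<in> carrier Y" for r y
    using assms(5)[of "r \<odot>\<^bsub>X\<^esub> g y"] f(2)[OF l, of r "g y"] that assms(4,6) by simp
  moreover have "g (act Y h y) = act X h (g y)" if "h \<in> carrier H" "y \<in> carrier Y" for h y
    using assms(5)[of "act X h (g y)"] f(3)[of h "g y"] that assms(4,6) act_closed[OF assms(2)] by simp
  ultimately show ?thesis
    using assms(4) by (auto simp: hlin_def intro!: lin_mapI)
qed

section \<open>The dynamical category\<close>

abbreviation "D \<equiv> dyn_cat_prime k H R L"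
abbreviation "MP \<equiv> M_prime k H R L"
abbreviation "Hm X Y \<equiv> ahom k H X (htens Y L)"
abbreviation "dh \<equiv> dyn_of_hom k L"
abbreviation "K \<equiv> base_module k"
abbreviation "U \<equiv> hunit k H"

lemma MP_hmod: "X \<in> MP \<Longrightarrow> hmod X"
  by (simp add: M_prime_def)

lemma D_simps [simp]:
  "Ob D = MP" "Hom D X Y = Hm X Y" "Idt D X = dh X X id"
  "TenO D = htens" "Unt D = U"
  "Assoc D X Y Z = dh (htens (htens X Y) Z) (htens X (htens Y Z)) (assoc k X Y Z)"
  "LUnit D X = dh (htens U X) X (tlift X (\<lambda>r x. r \<odot>\<^bsub>X\<^esub> x))"
  "RUnit D X = dh (htens X U) X (tlift X (\<lambda>x r. r \<odot>\<^bsub>X\<^esub> x))"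
  by (auto simp: dyn_cat_prime_def full_subcat_def dyn_cat_def M_prime_def)

lemma hlin_cong:
  assumes "hlin X Y f" "hmod X" "\<And>x. x \<in> carrier X \<Longrightarrow> f x = g x"
  shows "hlin X Y g"
  using assms lin_map_cong[of k X Y f g] hmod_mod[OF assms(2)] act_closed[OF assms(2)]
  by (auto simp: hlin_def)

lemma ahom_iff: "f \<in> ahom k H X Y \<longleftrightarrow> f \<in> extensional (carrier X) \<and> hlin X Y f"
  by (auto simp: ahom_def hlin_def lin_map_def PiE_def)

lemma Hm_hlin: "f \<in> Hm X Y \<Longrightarrow> hlin X (htens Y L) f"
  by (simp add: ahom_iff)

lemma Hm_lin: "f \<in> Hm X Y \<Longrightarrow> lin X (free Y) f"
  by (rule hlin_htensor[OF Hm_hlin])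

lemma HmI: "hlin X (htens Y L) f \<Longrightarrow> hmod X \<Longrightarrow> restrict f (carrier X) \<in> Hm X Y"
  unfolding ahom_iff by (auto intro: hlin_cong)

lemma Hm_eqI:
  "f \<in> Hm X Y \<Longrightarrow> (\<And>x. x \<in> carrier X \<Longrightarrow> g x = f x) \<Longrightarrow> restrict g (carrier X) = f"
  by (rule extensionalityI[of _ "carrier X"]) (auto simp: ahom_iff)

lemma mult_L_tmap:
  assumes "lin X (free Y) \<psi>" "kmod X" "kmod Y" "t \<in> carrier (free X)"
  shows "mult_L k L Y (tmap k (free Y) L \<psi> id t) = kl X Y \<psi> t"
proof -
  have "mult_L k L Y (tmap k (free Y) L \<psi> id t) =
      tlift (free Y) (\<lambda>t m. rmul Y t m) (tmap k (free Y) L \<psi> id t)"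
    by (simp add: mult_L_def rmul_def)
  also have "\<dots> = tlift (free Y) (\<lambda>a b. rmul Y (\<psi> a) (id b)) t"
    by (rule tlift_tmap[OF _ assms(4,1)]) (rule mlin assms | assumption | simp only: id_def)+
  finally show ?thesis by (simp add: kl_def)
qed

lemma Cmp_D:
  assumes "hmod X" "hmod Y" "hmod Z" "\<phi> \<in> Hm X Y" "\<psi> \<in> Hm Y Z"
  shows "Cmp D X Y Z \<psi> \<phi> = (\<lambda>x\<in>carrier X. kl Y Z \<psi> (\<phi> x))"
  using mult_L_tmap[OF Hm_lin[OF assms(5)]] lin_map_closed[OF Hm_lin[OF assms(4)]]
    hmod_mod[OF assms(2)] hmod_mod[OF assms(3)]
  by (auto simp: dyn_cat_prime_def full_subcat_def dyn_cat_def intro!: restrict_ext)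

lemma TenM_D:
  assumes "hmod X" "hmod Y" "hmod X'" "hmod Y'" "\<phi> \<in> Hm X X'" "\<psi> \<in> Hm Y Y'"
  shows "TenM D X X' Y Y' \<phi> \<psi> = (\<lambda>t\<in>carrier (X \<otimes>\<^sub>k Y). tm X' Y' \<phi> \<psi> t)"
proof -
  note [mlin] = Hm_lin[OF assms(5)] Hm_lin[OF assms(6)]
  have "dyn_merge k H R L X' Y' (tmap k (free X') (free Y') \<phi> \<psi> t) = tm X' Y' \<phi> \<psi> t"
    if t: "t \<in> carrier (X \<otimes>\<^sub>k Y)" for t
    by (subst dyn_merge, (rule mlin assms t | assumption)+, unfold tm_def, rule tlift_tmap[OF _ t])
      (rule mlin assms t | assumption)+
  then show ?thesis
    by (auto simp: dyn_cat_prime_def full_subcat_def dyn_cat_def intro!: restrict_ext)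
qed

lemma dh_app: "x \<in> carrier X \<Longrightarrow> dh X Y f x = tn Y L (f x) \<one>\<^bsub>L\<^esub>"
  by (simp add: dyn_of_hom_def)

lemma dh_cong: "(\<And>x. x \<in> carrier X \<Longrightarrow> f x = g x) \<Longrightarrow> dh X Y f = dh X Y g"
  by (auto simp: dyn_of_hom_def)

text \<open>\<open>H\<close> acts on the unit of \<open>L\<close> through the counit, which
  contracts the second part of the coproduct.\<close>

lemma hlin_ten_one:
  assumes [mlin]: "hmod X" "hmod Y" and f: "hlin X Y f"
  shows "hlin X (htens Y L) (\<lambda>x. tn Y L (f x) \<one>\<^bsub>L\<^esub>)"
  unfolding hlin_def
proof (intro conjI ballI)
  note [mlin] = hlin_lin[OF f] hlin_closed[OF f]
  show "lin X (htens Y L) (\<lambda>x. tn Y L (f x) \<one>\<^bsub>L\<^esub>)" by (rule mlin | assumption)+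
  fix h x assume hx [mlin]: "h \<in> carrier H" "x \<in> carrier X"
  have "act (htens Y L) h (tn Y L (f x) \<one>\<^bsub>L\<^esub>) =
      tlift (free Y) (\<lambda>h1 h2. \<epsilon> h2 \<odot>\<^bsub>Y \<otimes>\<^sub>k L\<^esub> tn Y L (act Y h1 (f x)) \<one>\<^bsub>L\<^esub>) (\<Delta> h)"
    by (subst htensor_act_ten, (rule mlin)+, rule tlift_cong[of _ H H], (rule mlin)+)
      (use L_one_trivial in \<open>simp add: trivial_def ten_smult assms hmod_mod L_mod counit_closed hact_closed hlin_closed[OF f hx(2)]\<close>)
  also have "\<dots> = tn Y L (act Y h (f x)) \<one>\<^bsub>L\<^esub>"
    by (rule tlift_counit_right) (rule mlin | assumption)+
  finally show "tn Y L (f (act X h x)) \<one>\<^bsub>L\<^esub> = act (htens Y L) h (tn Y L (f x) \<one>\<^bsub>L\<^esub>)"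
    by (simp add: hlin_act[OF f] hx)
qed

lemma dh_Hm: "hmod X \<Longrightarrow> hmod Y \<Longrightarrow> hlin X Y f \<Longrightarrow> dh X Y f \<in> Hm X Y"
  unfolding dyn_of_hom_def by (rule HmI[OF hlin_ten_one])

lemma hlin_id' [simp]: "hlin X X id"
  using hlin_id[of X] by (simp add: id_def)

lemma kl_dh:
  assumes [mlin]: "hmod X" "hmod Y" and f: "hlin X Y f" and t: "t \<in> carrier (free X)"
  shows "kl X Y (dh X Y f) t = tmap k Y L f (\<lambda>m. m) t"
proof -
  note [mlin] = hlin_lin[OF f] hlin_closed[OF f]
  have [mlin]: "lin X Y f" using f by (simp add: hlin_def)
  have "kl X Y (dh X Y f) t = kl X Y (\<lambda>x. tn Y L (f x) \<one>\<^bsub>L\<^esub>) t"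
    by (rule kl_cong[OF t]) (rule mlin dh_app | assumption)+
  also have "\<dots> = tmap k Y L f (\<lambda>m. m) t"
  proof (rule tensor_ext[OF t, of "Y \<otimes>\<^sub>k L"])
    fix x m assume xm [mlin]: "x \<in> carrier X" "m \<in> carrier L"
    have "kl X Y (\<lambda>x. tn Y L (f x) \<one>\<^bsub>L\<^esub>) (tn X L x m) = tn Y L (f x) m"
      by (subst kl_ten, (rule mlin | assumption)+, subst rmul_ten, (rule mlin)+) (simp add: lmul_one xm)
    also have "\<dots> = tmap k Y L f (\<lambda>m. m) (tn X L x m)"
      by (rule tmap_ten[symmetric]) (rule mlin)+
    finally show "kl X Y (\<lambda>x. tn Y L (f x) \<one>\<^bsub>L\<^esub>) (tn X L x m) = \<dots>" .
  qed (rule mlin | assumption)+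
  finally show ?thesis .
qed

lemma tmap_id:
  assumes "t \<in> carrier (X \<otimes>\<^sub>k Y)" "kmod X" "kmod Y"
  shows "tmap k X Y id (\<lambda>m. m) t = t" "tmap k X Y (\<lambda>m. m) id t = t" "tmap k X Y id id t = t"
  using tlift_self[OF assms] by (simp_all add: tmap_def)

lemma Cmp_Hm:
  assumes [mlin]: "hmod X" "hmod Y" "hmod Z" and \<phi>: "\<phi> \<in> Hm X Y" and \<psi>: "\<psi> \<in> Hm Y Z"
  shows "Cmp D X Y Z \<psi> \<phi> \<in> Hm X Z"
  unfolding Cmp_D[OF assms]
proof (rule HmI)
  note [mlin] = Hm_lin[OF \<phi>] Hm_lin[OF \<psi>]
  have "lin X (free Z) (\<lambda>x. kl Y Z \<psi> (\<phi> x))" by (rule mlin)+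
  then show "hlin X (htens Z L) (\<lambda>x. kl Y Z \<psi> (\<phi> x))"
    using lin_map_closed[OF Hm_lin[OF \<phi>]] hlin_act[OF Hm_hlin[OF \<phi>]] kl_act[OF assms(2,3) _ Hm_hlin[OF \<psi>]]
    by (simp add: hlin_def)
qed fact

lemma Cmp_dh_left:
  assumes [mlin]: "hmod X" "hmod Y" "hmod Z" and \<phi>: "\<phi> \<in> Hm X Y" and g: "hlin Y Z g"
  shows "Cmp D X Y Z (dh Y Z g) \<phi> = (\<lambda>x\<in>carrier X. tmap k Z L g (\<lambda>m. m) (\<phi> x))"
  unfolding Cmp_D[OF assms(1-3) \<phi> dh_Hm[OF assms(2,3) g]]
  by (rule restrict_ext) (rule kl_dh[OF assms(2,3) g lin_map_closed[OF Hm_lin[OF \<phi>]]])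

lemma Cmp_dh_right:
  assumes [mlin]: "hmod X" "hmod Y" "hmod Z" and f: "hlin X Y f" and \<psi>: "\<psi> \<in> Hm Y Z"
  shows "Cmp D X Y Z \<psi> (dh X Y f) = (\<lambda>x\<in>carrier X. \<psi> (f x))"
  unfolding Cmp_D[OF assms(1-3) dh_Hm[OF assms(1,2) f] \<psi>]
  by (rule restrict_ext, simp add: dh_app, rule kl_ten_one)
    (rule mlin Hm_lin[OF \<psi>] hlin_closed[OF f] | assumption)+

lemma hlin_comp: "hlin X Y f \<Longrightarrow> hlin Y Z g \<Longrightarrow> hlin X Z (\<lambda>x. g (f x))"
  using lin_map_comp[of k X Y f Z g] by (auto simp: hlin_def lin_map_closed)

lemma Cmp_dh_dh:
  assumes [mlin]: "hmod X" "hmod Y" "hmod Z" and f: "hlin X Y f" and g: "hlin Y Z g"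
  shows "Cmp D X Y Z (dh Y Z g) (dh X Y f) = dh X Z (\<lambda>x. g (f x))"
  unfolding Cmp_dh_right[OF assms(1-3) f dh_Hm[OF assms(2,3) g]]
  using hlin_closed[OF f] by (auto simp: dyn_of_hom_def)

lemma category_D: "category D"
proof (unfold_locales; simp only: D_simps)
  fix X assume X: "X \<in> MP"
  show "dh X X id \<in> Hm X X" using X by (intro dh_Hm MP_hmod hlin_id')
  fix Y f assume Y: "Y \<in> MP" and f: "f \<in> Hm X Y"
  note h = MP_hmod[OF X] MP_hmod[OF Y]
  show "Cmp D X X Y f (dh X X id) = f"
    using f h by (simp add: Cmp_dh_right Hm_eqI)
  show "Cmp D X Y Y (dh Y Y id) f = f"
    using f h lin_map_closed[OF Hm_lin[OF f]] by (simp add: Cmp_dh_left Hm_eqI tmap_id hmod_mod L_mod)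
next
  fix X Y Z f g assume "X \<in> MP" "Y \<in> MP" "Z \<in> MP" "f \<in> Hm X Y" "g \<in> Hm Y Z"
  then show "Cmp D X Y Z g f \<in> Hm X Z" by (intro Cmp_Hm MP_hmod)
next
  fix W X Y Z f g h assume ob: "W \<in> MP" "X \<in> MP" "Y \<in> MP" "Z \<in> MP"
    and f: "f \<in> Hm W X" and g: "g \<in> Hm X Y" and h: "h \<in> Hm Y Z"
  note m = MP_hmod[OF ob(1)] MP_hmod[OF ob(2)] MP_hmod[OF ob(3)] MP_hmod[OF ob(4)]
  have gf: "Cmp D W X Y g f \<in> Hm W Y" and hg: "Cmp D X Y Z h g \<in> Hm X Z"
    using m f g h by (auto intro: Cmp_Hm)
  show "Cmp D W Y Z h (Cmp D W X Y g f) = Cmp D W X Z (Cmp D X Y Z h g) f"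
    unfolding Cmp_D[OF m(1,3,4) gf h] Cmp_D[OF m(1,2,4) f hg]
  proof (rule restrict_ext)
    fix x assume x: "x \<in> carrier W"
    have fx: "f x \<in> carrier (free X)" using lin_map_closed[OF Hm_lin[OF f] x] .
    have "kl Y Z h (Cmp D W X Y g f x) = kl Y Z h (kl X Y g (f x))"
      by (simp add: Cmp_D[OF m(1-3) f g] x)
    also have "\<dots> = kl X Z (\<lambda>x. kl Y Z h (g x)) (f x)"
      by (rule kl_kl[OF m(2-4) Hm_lin[OF g] Hm_lin[OF h] fx])
    also have "\<dots> = kl X Z (Cmp D X Y Z h g) (f x)"
      by (rule kl_cong[OF fx hmod_mod[OF m(2)]]) (simp add: Cmp_D[OF m(2-4) g h])
    finally show "kl Y Z h (Cmp D W X Y g f x) = \<dots>" .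
  qed
qed

lemma TenM_Hm:
  assumes [mlin]: "hmod X" "hmod Y" "hmod X'" "hmod Y'" and \<phi>: "\<phi> \<in> Hm X X'" and \<psi>: "\<psi> \<in> Hm Y Y'"
  shows "TenM D X X' Y Y' \<phi> \<psi> \<in> Hm (htens X Y) (htens X' Y')"
proof -
  note [mlin] = Hm_lin[OF \<phi>] Hm_lin[OF \<psi>]
  note [mlin] = lin_map_comp[OF _ Hm_lin[OF \<phi>]] lin_map_comp[OF _ Hm_lin[OF \<psi>]]
    lin_map_closed[OF Hm_lin[OF \<phi>]] lin_map_closed[OF Hm_lin[OF \<psi>]]
  let ?P = "X' \<otimes>\<^sub>k Y' \<otimes>\<^sub>k L"
  have "tm X' Y' \<phi> \<psi> (act (htens X Y) h t) = act (htens (htens X' Y') L) h (tm X' Y' \<phi> \<psi> t)"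
    if h [mlin]: "h \<in> carrier H" and t: "t \<in> carrier (X \<otimes>\<^sub>k Y)" for h t
  proof (rule tensor_ext[OF t, of ?P])
    fix x y assume xy [mlin]: "x \<in> carrier X" "y \<in> carrier Y"
    have "tm X' Y' \<phi> \<psi> (act (htens X Y) h (tn X Y x y)) =
        tlift ?P (\<lambda>h1 h2. tm X' Y' \<phi> \<psi> (tn X Y (act X h1 x) (act Y h2 y))) (\<Delta> h)"
      by (subst htensor_act_ten, (rule mlin)+, rule tlift_hom[of "X \<otimes>\<^sub>k Y"]) (rule mlin | assumption)+
    also have "\<dots> = tlift ?P (\<lambda>h1 h2. jj X' Y' (\<phi> (act X h1 x)) (\<psi> (act Y h2 y))) (\<Delta> h)"
      by (rule tlift_cong[of _ H H], (rule mlin)+, rule tm_ten) (rule mlin | assumption)+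
    also have "\<dots> = tlift ?P (\<lambda>h1 h2. jj X' Y' (act (htens X' L) h1 (\<phi> x)) (act (htens Y' L) h2 (\<psi> y))) (\<Delta> h)"
      by (rule tlift_cong[of _ H H], (rule mlin)+)
        (simp add: hlin_act[OF Hm_hlin[OF \<phi>]] hlin_act[OF Hm_hlin[OF \<psi>]] xy)
    also have "\<dots> = act (htens (htens X' Y') L) h (jj X' Y' (\<phi> x) (\<psi> y))"
      by (rule jj_act[symmetric]) (rule mlin)+
    also have "\<dots> = act (htens (htens X' Y') L) h (tm X' Y' \<phi> \<psi> (tn X Y x y))"
      by (subst tm_ten, (rule mlin)+) simp
    finally show "tm X' Y' \<phi> \<psi> (act (htens X Y) h (tn X Y x y)) = \<dots>" .
  qed (rule mlin | assumption)+
  moreover have "lin (X \<otimes>\<^sub>k Y) ?P (tm X' Y' \<phi> \<psi>)" by (rule mlin | assumption)+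
  ultimately have "hlin (htens X Y) (htens (htens X' Y') L) (tm X' Y' \<phi> \<psi>)"
    by (simp add: hlin_def)
  from HmI[OF this] show ?thesis
    using TenM_D[OF assms] assms by (simp add: hmod_htensor)
qed

text \<open>With trivial components in \<open>L\<close> nothing has to be passed. Together with
  \<open>Cmp_dh_dh\<close> this makes f \<mapsto> f \<otimes> 1 compatible with composition and
  tensor products, so that pentagon, triangle and hexagons reduce to equations between linear
  maps.\<close>

lemma TenM_dh:
  assumes [mlin]: "hmod X" "hmod Y" "hmod X'" "hmod Y'" and f: "hlin X X' f" and g: "hlin Y Y' g"
  shows "TenM D X X' Y Y' (dh X X' f) (dh Y Y' g) = dh (htens X Y) (htens X' Y') (tmap k X' Y' f g)"
proof -
  note [mlin] = hlin_lin[OF f] hlin_lin[OF g] hlin_closed[OF f] hlin_closed[OF g]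
  have fg [mlin]: "lin X X' f" "lin Y Y' g" using f g by (auto simp: hlin_def)
  note d [mlin] = Hm_lin[OF dh_Hm[OF assms(1,3) f]] Hm_lin[OF dh_Hm[OF assms(2,4) g]]
  have "tm X' Y' (dh X X' f) (dh Y Y' g) t = tn (X' \<otimes>\<^sub>k Y') L (tmap k X' Y' f g t) \<one>\<^bsub>L\<^esub>"
    if t: "t \<in> carrier (X \<otimes>\<^sub>k Y)" for t
  proof (rule tensor_ext[OF t, of "X' \<otimes>\<^sub>k Y' \<otimes>\<^sub>k L"])
    fix x y assume xy [mlin]: "x \<in> carrier X" "y \<in> carrier Y"
    have "tm X' Y' (dh X X' f) (dh Y Y' g) (tn X Y x y) = jj X' Y' (tn X' L (f x) \<one>\<^bsub>L\<^esub>) (tn Y' L (g y) \<one>\<^bsub>L\<^esub>)"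
      by (subst tm_ten, (rule mlin | assumption)+) (simp add: dh_app xy)
    also have "\<dots> = tn (X' \<otimes>\<^sub>k Y') L (tn X' Y' (f x) (g y)) \<one>\<^bsub>L\<^esub>"
      by (subst jj_ten_one, (rule mlin)+, rule ins_ten) (rule mlin)+
    also have "tn X' Y' (f x) (g y) = tmap k X' Y' f g (tn X Y x y)"
      by (rule tmap_ten[symmetric]) (rule mlin)+
    finally show "tm X' Y' (dh X X' f) (dh Y Y' g) (tn X Y x y) =
      tn (X' \<otimes>\<^sub>k Y') L (tmap k X' Y' f g (tn X Y x y)) \<one>\<^bsub>L\<^esub>" .
  qed (rule mlin | assumption)+
  then show ?thesis
    unfolding TenM_D[OF assms(1-4) dh_Hm[OF assms(1,3) f] dh_Hm[OF assms(2,4) g]]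
    by (auto simp: dyn_of_hom_def)
qed

lemma tmap_hlin:
  assumes [mlin]: "hmod X" "hmod Y" "hmod X'" "hmod Y'" and f: "hlin X X' f" and g: "hlin Y Y' g"
  shows "hlin (htens X Y) (htens X' Y') (tmap k X' Y' f g)"
  unfolding hlin_def
proof (intro conjI ballI)
  note [mlin] = hlin_lin[OF f] hlin_lin[OF g] hlin_closed[OF f] hlin_closed[OF g]
  have fg [mlin]: "lin X X' f" "lin Y Y' g" using f g by (auto simp: hlin_def)
  show "lin (htens X Y) (htens X' Y') (tmap k X' Y' f g)" by (rule mlin | assumption)+
  fix h t assume h [mlin]: "h \<in> carrier H" and "t \<in> carrier (htens X Y)"
  then have t: "t \<in> carrier (X \<otimes>\<^sub>k Y)" by simp
  show "tmap k X' Y' f g (act (htens X Y) h t) = act (htens X' Y') h (tmap k X' Y' f g t)"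
  proof (rule tensor_ext[OF t, of "X' \<otimes>\<^sub>k Y'"])
    fix x y assume xy [mlin]: "x \<in> carrier X" "y \<in> carrier Y"
    have "tmap k X' Y' f g (act (htens X Y) h (tn X Y x y)) =
        tlift (X' \<otimes>\<^sub>k Y') (\<lambda>h1 h2. tmap k X' Y' f g (tn X Y (act X h1 x) (act Y h2 y))) (\<Delta> h)"
      by (subst htensor_act_ten, (rule mlin)+, rule tlift_hom[of "X \<otimes>\<^sub>k Y"]) (rule mlin | assumption)+
    also have "\<dots> = tlift (X' \<otimes>\<^sub>k Y') (\<lambda>h1 h2. tn X' Y' (f (act X h1 x)) (g (act Y h2 y))) (\<Delta> h)"
      by (rule tlift_cong[of _ H H], (rule mlin)+, rule tmap_ten) (rule mlin | assumption)+
    also have "\<dots> = tlift (X' \<otimes>\<^sub>k Y') (\<lambda>h1 h2. tn X' Y' (act X' h1 (f x)) (act Y' h2 (g y))) (\<Delta> h)"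
      by (rule tlift_cong[of _ H H], (rule mlin)+) (simp add: hlin_act[OF f] hlin_act[OF g] xy)
    also have "\<dots> = act (htens X' Y') h (tn X' Y' (f x) (g y))"
      by (rule htensor_act_ten[symmetric]) (rule mlin)+
    also have "tn X' Y' (f x) (g y) = tmap k X' Y' f g (tn X Y x y)"
      by (rule tmap_ten[symmetric]) (rule mlin)+
    finally show "tmap k X' Y' f g (act (htens X Y) h (tn X Y x y)) =
      act (htens X' Y') h (tmap k X' Y' f g (tn X Y x y))" .
  qed (rule mlin | assumption)+
qed

lemma dh_inverses:
  assumes "hmod X" "hmod Y" "hlin X Y f" "hlin Y X g"
    "\<And>x. x \<in> carrier X \<Longrightarrow> g (f x) = x" "\<And>y. y \<in> carrier Y \<Longrightarrow> f (g y) = y"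
  shows "inverses_in D X Y (dh X Y f) (dh Y X g)"
  unfolding inverses_in_def
  by (auto simp: dh_Hm Cmp_dh_dh assms intro!: dh_cong)

lemma inverses_unique:
  assumes "category C" "X \<in> Ob C" "Y \<in> Ob C" "inverses_in C X Y f g"
  shows "inv_in C X Y f = g"
  unfolding inv_in_def
proof (rule the_equality[where P = "\<lambda>g. inverses_in C X Y f g", OF assms(4)])
  interpret category C by fact
  fix g' assume g': "inverses_in C X Y f g'"
  note i = g'[unfolded inverses_in_def] assms(4)[unfolded inverses_in_def]
  have "g' = Cmp C Y X X (Idt C X) g'" using Cmp_Idt_left[OF assms(3,2)] i by simp
  also have "\<dots> = Cmp C Y X X (Cmp C X Y X g f) g'" using i by simp
  also have "\<dots> = Cmp C Y Y X g (Cmp C Y X Y f g')"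
    using Cmp_assoc[OF assms(3,2,3,2), of g' f g] i by simp
  also have "\<dots> = g" using Cmp_Idt_right[OF assms(3,2)] i by simp
  finally show "g' = g" .
qed

text \<open>Inverses are unique, so the definite description in \<open>inv_in\<close> can be
  evaluated; the second hexagon requires this. A set-theoretic inverse \<open>g\<close> suffices,
  because the inverse of an equivariant bijection is equivariant.\<close>

lemma dh_iso:
  assumes "X \<in> MP" "Y \<in> MP" "hlin X Y f" "\<And>y. y \<in> carrier Y \<Longrightarrow> g y \<in> carrier X"
    "\<And>x. x \<in> carrier X \<Longrightarrow> g (f x) = x" "\<And>y. y \<in> carrier Y \<Longrightarrow> f (g y) = y"
  shows "iso_in D X Y (dh X Y f)" "inv_in D X Y (dh X Y f) = dh Y X g"
proof -
  note h = MP_hmod[OF assms(1)] MP_hmod[OF assms(2)]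
  have g: "hlin Y X g" using hlin_inverse[OF assms(3) h assms(4-6)] .
  note i = dh_inverses[OF h assms(3) g assms(5,6)]
  show "iso_in D X Y (dh X Y f)" using i assms(1,2) by (auto simp: iso_in_def)
  show "inv_in D X Y (dh X Y f) = dh Y X g"
    using inverses_unique[OF category_D _ _ i] assms(1,2) by simp
qed

subsection \<open>The unit object\<close>

lemma hunit_simps [simp]:
  "carrier U = carrier k" "zero U = zero k" "add U = add k" "smult U = mult k"
  "tensor k U X = tensor k K X" "tensor k X U = tensor k X K"
  "ten k U X = ten k K X" "ten k X U = ten k X K"
  "tmap k U X f g = tmap k K X f g" "tmap k X U f g = tmap k X K f g"
  "assoc k U X Y = assoc k K X Y" "assoc k X U Y = assoc k X K Y" "assoc k X Y U = assoc k X Y K"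
  "act U h r = mult k (\<epsilon> h) r"
  by (simp_all add: hunit_def)

lemma hunit_lin [simp]: "lin_map k M U g = lin_map k M K g"
  by (simp add: hunit_def)

lemma k_one [mlin]: "\<one>\<^bsub>k\<^esub> \<in> carrier k"
proof -
  interpret k: cring k by (rule cring_k)
  show ?thesis by simp
qed

lemma hmod_U [mlin]: "hmod U"
proof -
  interpret k: cring k by (rule cring_k)
  have m: "kmod U" unfolding hunit_def by (rule mlin)+
  have e: "\<epsilon> (a \<oplus>\<^bsub>H\<^esub> b) = \<epsilon> a \<oplus>\<^bsub>k\<^esub> \<epsilon> b" if "a \<in> carrier H" "b \<in> carrier H" for a b
    using lin_map_add[OF hopf_algebra.counit_lin[OF hopf] that] by simp
  have s: "\<epsilon> (r \<odot>\<^bsub>H\<^esub> a) = r \<otimes>\<^bsub>k\<^esub> \<epsilon> a" if "r \<in> carrier k" "a \<in> carrier H" for a r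
    using lin_map_smult[OF hopf_algebra.counit_lin[OF hopf] that] by simp
  show ?thesis
  proof (rule amoduleI[OF m])
    show "bil k H U U (act U)"
      by (rule bilI; rule lin_mapI)
        (auto simp: counit_closed e s k.l_distr k.r_distr k.m_assoc k.m_lcomm)
    show "act U (a \<otimes>\<^bsub>H\<^esub> b) x = act U a (act U b x)"
      if "a \<in> carrier H" "b \<in> carrier H" "x \<in> carrier U" for a b x
      using that by (simp add: hopf_algebra.counit_mult[OF hopf] counit_closed k.m_assoc)
    show "act U \<one>\<^bsub>H\<^esub> x = x" if "x \<in> carrier U" for x
      using that by (simp add: hopf_algebra.counit_one[OF hopf])
  qed
qed

lemma U_trivial: "r \<in> carrier k \<Longrightarrow> trivial U r"
  by (simp add: trivial_def)

abbreviation "lu X \<equiv> tlift X (\<lambda>r x. r \<odot>\<^bsub>X\<^esub> x)"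
abbreviation "ru X \<equiv> tlift X (\<lambda>x r. r \<odot>\<^bsub>X\<^esub> x)"

lemma lu_ten: "kmod X \<Longrightarrow> r \<in> carrier k \<Longrightarrow> x \<in> carrier X \<Longrightarrow> lu X (tn K X r x) = r \<odot>\<^bsub>X\<^esub> x"
  by (rule tlift_ten) (rule mlin | assumption | simp)+

lemma ru_ten: "kmod X \<Longrightarrow> r \<in> carrier k \<Longrightarrow> x \<in> carrier X \<Longrightarrow> ru X (tn X K x r) = r \<odot>\<^bsub>X\<^esub> x"
  by (rule tlift_ten) (rule mlin | assumption | simp)+

lemma act_smult: "hmod X \<Longrightarrow> r \<in> carrier k \<Longrightarrow> h \<in> carrier H \<Longrightarrow> x \<in> carrier X \<Longrightarrow>
    act X h (r \<odot>\<^bsub>X\<^esub> x) = r \<odot>\<^bsub>X\<^esub> act X h x"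
  by (rule lin_map_smult[OF act_lin_right[OF _ _ lin_id]])

lemma lu_hlin:
  assumes [mlin]: "hmod X"
  shows "hlin (htens U X) X (lu X)"
  unfolding hlin_def
proof (intro conjI ballI)
  interpret X: amodule k H X by fact
  show "lin (htens U X) X (lu X)" by simp (rule mlin | assumption | simp)+
  fix h t assume h [mlin]: "h \<in> carrier H" and "t \<in> carrier (htens U X)"
  then have t: "t \<in> carrier (K \<otimes>\<^sub>k X)" by simp
  show "lu X (act (htens U X) h t) = act X h (lu X t)"
  proof (rule tensor_ext[OF t, of X])
    show "lin (K \<otimes>\<^sub>k X) X (\<lambda>t. lu X (act (htens U X) h t))"
    proof (rule tlift_lin_arg[where M = K and N = X])
      show "lin (K \<otimes>\<^sub>k X) (K \<otimes>\<^sub>k X) (act (htens U X) h)"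
        using htensor_act_lin_right[OF hmod_U assms h, of "K \<otimes>\<^sub>k X" "\<lambda>x. x"] by (simp add: lin_id)
    qed (rule mlin | assumption | simp)+
    fix r x assume rx: "r \<in> carrier K" "x \<in> carrier X"
    then have r [mlin]: "r \<in> carrier k" "x \<in> carrier X" by simp_all
    have "act (htens U X) h (tn K X r x) = tlift (K \<otimes>\<^sub>k X) (\<lambda>h1 h2. tn K X (mult k (\<epsilon> h1) r) (act X h2 x)) (\<Delta> h)"
      using htensor_act_ten[OF hmod_U assms h, of r x] r by simp
    also have "\<dots> = tlift (K \<otimes>\<^sub>k X) (\<lambda>h1 h2. \<epsilon> h1 \<odot>\<^bsub>K \<otimes>\<^sub>k X\<^esub> tn K X r (act X h2 x)) (\<Delta> h)"
      by (rule tlift_cong[of _ H H], (rule mlin)+)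
        (use ten_smult(1)[of K X _ r] in \<open>simp add: r counit_closed base_module_mod hmod_mod assms hact_closed\<close>)
    also have "\<dots> = tn K X r (act X h x)"
      by (rule tlift_counit_left) (rule mlin | assumption | simp)+
    finally show "lu X (act (htens U X) h (tn K X r x)) = act X h (lu X (tn K X r x))"
      by (simp add: lu_ten hmod_mod assms r h hact_closed act_smult)
  qed (rule mlin | assumption | simp)+
qed

lemma ru_hlin:
  assumes [mlin]: "hmod X"
  shows "hlin (htens X U) X (ru X)"
  unfolding hlin_def
proof (intro conjI ballI)
  interpret X: amodule k H X by fact
  show "lin (htens X U) X (ru X)" by simp (rule mlin | assumption | simp)+
  fix h t assume h [mlin]: "h \<in> carrier H" and "t \<in> carrier (htens X U)"
  then have t: "t \<in> carrier (X \<otimes>\<^sub>k K)" by simp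
  show "ru X (act (htens X U) h t) = act X h (ru X t)"
  proof (rule tensor_ext[OF t, of X])
    show "lin (X \<otimes>\<^sub>k K) X (\<lambda>t. ru X (act (htens X U) h t))"
    proof (rule tlift_lin_arg[where M = X and N = K])
      show "lin (X \<otimes>\<^sub>k K) (X \<otimes>\<^sub>k K) (act (htens X U) h)"
        using htensor_act_lin_right[OF assms hmod_U h, of "X \<otimes>\<^sub>k K" "\<lambda>x. x"] by (simp add: lin_id)
    qed (rule mlin | assumption | simp)+
    fix x r assume rx: "r \<in> carrier K" "x \<in> carrier X"
    then have r [mlin]: "r \<in> carrier k" "x \<in> carrier X" by simp_all
    have "act (htens X U) h (tn X K x r) = tlift (X \<otimes>\<^sub>k K) (\<lambda>h1 h2. tn X K (act X h1 x) (mult k (\<epsilon> h2) r)) (\<Delta> h)"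
      using htensor_act_ten[OF assms hmod_U h, of x r] r by simp
    also have "\<dots> = tlift (X \<otimes>\<^sub>k K) (\<lambda>h1 h2. \<epsilon> h2 \<odot>\<^bsub>X \<otimes>\<^sub>k K\<^esub> tn X K (act X h1 x) r) (\<Delta> h)"
      by (rule tlift_cong[of _ H H], (rule mlin)+)
        (use ten_smult(2)[of X K _ _ r] in \<open>simp add: r counit_closed base_module_mod hmod_mod assms hact_closed\<close>)
    also have "\<dots> = tn X K (act X h x) r"
      by (rule tlift_counit_right) (rule mlin | assumption | simp)+
    finally show "ru X (act (htens X U) h (tn X K x r)) = act X h (ru X (tn X K x r))"
      by (simp add: ru_ten hmod_mod assms r h hact_closed act_smult)
  qed (rule mlin | assumption | simp)+
qed

lemma ten_lu:
  assumes [mlin]: "kmod X" and t: "t \<in> carrier (K \<otimes>\<^sub>k X)"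
  shows "tn K X \<one>\<^bsub>k\<^esub> (lu X t) = t"
proof (rule tensor_ext[OF t, of "K \<otimes>\<^sub>k X"])
  interpret k: cring k by (rule cring_k)
  fix r x assume "r \<in> carrier K" "x \<in> carrier X"
  then show "tn K X \<one>\<^bsub>k\<^esub> (lu X (tn K X r x)) = tn K X r x"
    using ten_smult[of K X r "\<one>\<^bsub>k\<^esub>" x] lu_ten[OF assms(1), of r x] by (simp add: assms(1) base_module_mod)
qed (rule mlin | assumption | simp)+

lemma ten_ru:
  assumes [mlin]: "kmod X" and t: "t \<in> carrier (X \<otimes>\<^sub>k K)"
  shows "tn X K (ru X t) \<one>\<^bsub>k\<^esub> = t"
proof (rule tensor_ext[OF t, of "X \<otimes>\<^sub>k K"])
  interpret k: cring k by (rule cring_k)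
  fix x r assume "r \<in> carrier K" "x \<in> carrier X"
  then show "tn X K (ru X (tn X K x r)) \<one>\<^bsub>k\<^esub> = tn X K x r"
    using ten_smult[of X K r x "\<one>\<^bsub>k\<^esub>"] ru_ten[OF assms(1), of r x] by (simp add: assms(1) base_module_mod)
qed (rule mlin | assumption | simp)+

subsection \<open>Objects whose double braiding with the base algebra is trivial\<close>

lemma flip_mult:
  assumes r: "r \<in> carrier HH" and s: "s \<in> carrier HH"
  shows "flip k H H (r \<otimes>\<^bsub>HH\<^esub> s) = flip k H H r \<otimes>\<^bsub>HH\<^esub> flip k H H s"
proof (rule tensor_ext[OF r, of HH])
  fix a b assume [mlin]: "a \<in> carrier H" "b \<in> carrier H"
  show "flip k H H (tn H H a b \<otimes>\<^bsub>HH\<^esub> s) = flip k H H (tn H H a b) \<otimes>\<^bsub>HH\<^esub> flip k H H s"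
  proof (rule tensor_ext[OF s, of HH])
    fix a' b' assume [mlin]: "a' \<in> carrier H" "b' \<in> carrier H"
    show "flip k H H (tn H H a b \<otimes>\<^bsub>HH\<^esub> tn H H a' b') =
        flip k H H (tn H H a b) \<otimes>\<^bsub>HH\<^esub> flip k H H (tn H H a' b')"
      by (subst tensor_mult_ten, (rule mlin)+, subst flip_ten, (rule mlin)+, subst flip_ten, (rule mlin)+,
        subst flip_ten, (rule mlin)+, rule tensor_mult_ten[symmetric]) (rule mlin)+
  qed (rule mlin | assumption)+
qed (rule mlin s | assumption)+

text \<open>The flip is an algebra homomorphism, so the inverse of R21 is the flip of R^-1.\<close>

lemma R_minus_eq: "R_minus k H R = flip k H H Ri"
proof -
  have o: "flip k H H \<one>\<^bsub>HH\<^esub> = \<one>\<^bsub>HH\<^esub>"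
    unfolding tensor_one by (rule flip_ten) (rule mlin)+
  have c: "flip k H H R \<in> carrier HH" "flip k H H Ri \<in> carrier HH" by (rule mlin)+
  have "flip k H H R \<otimes>\<^bsub>HH\<^esub> flip k H H Ri = \<one>\<^bsub>HH\<^esub>" "flip k H H Ri \<otimes>\<^bsub>HH\<^esub> flip k H H R = \<one>\<^bsub>HH\<^esub>"
    using flip_mult[of R Ri] flip_mult[of Ri R] o by (simp_all add: R_closed Ri_closed R_Ri)
  from monoid.inv_char[OF HH_monoid c this] show ?thesis
    by (simp add: R_minus_def)
qed

lemma R_minus_closed [mlin]: "R_minus k H R \<in> carrier HH"
  unfolding R_minus_eq by (rule mlin)+

lemma act2_R_flip:
  assumes [mlin]: "hmod X" "x \<in> carrier X" "l \<in> carrier L"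
  shows "act2 k X L R (tn X L x l) = flip k L X (cb X L x l)"
    "act2 k X L (R_minus k H R) (tn X L x l) = flip k L X (db L X x l)"
proof -
  interpret t: two_modules k H H X L
    by (intro two_modules.intro two_modules_axioms.intro base_axioms) (rule mlin)+
  have "flip k L X (cb X L x l) = flip k L X (flip k X L (act2 k X L R (tn X L x l)))"
    by (simp add: flip_act2_R cop_ten ten_closed assms L_hmod)
  also have "\<dots> = act2 k X L R (tn X L x l)"
    by (rule flip_flip) (rule mlin bil_closed[OF t.act2_bil])+
  finally show "act2 k X L R (tn X L x l) = flip k L X (cb X L x l)" ..
  have "act2 k X L (R_minus k H R) (tn X L x l) =
      tlift (free X) (\<lambda>a b. tn X L (act X a x) (act L b l)) (flip k H H Ri)"
    unfolding R_minus_eq by (rule t.act2_pure) (rule mlin)+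
  also have "\<dots> = tlift (free X) (\<lambda>b a. tn X L (act X a x) (act L b l)) Ri"
    by (rule tlift_flip) (rule mlin | assumption)+
  also have "\<dots> = flip k L X (db L X x l)"
    unfolding flip_def by (rule tlift_db[symmetric]) (rule mlin | assumption)+
  finally show "act2 k X L (R_minus k H R) (tn X L x l) = \<dots>" .
qed

text \<open>The two actions are, up to the flip, the braiding of X with \<open>L\<close> and the
  inverse of the braiding of \<open>L\<close> with X. Membership thus means that the double braiding
  of X with \<open>L\<close> is the identity.\<close>

lemma MP_iff: "X \<in> MP \<longleftrightarrow> hmod X \<and> (\<forall>x\<in>carrier X. \<forall>l\<in>carrier L. cb X L x l = db L X x l)"
proof (cases "hmod X")
  case True
  have "act2 k X L R (tn X L x l) = act2 k X L (R_minus k H R) (tn X L x l) \<longleftrightarrow> cb X L x l = db L X x l"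
    if xl: "x \<in> carrier X" "l \<in> carrier L" for x l
    using flip_flip[OF cb_lin(3)[OF True L_hmod xl]] flip_flip[OF db_lin(3)[OF L_hmod True xl(2,1)]]
      hmod_mod[OF True] L_mod
    by (metis act2_R_flip[OF True xl])
  then show ?thesis using True by (auto simp: M_prime_def)
qed (simp add: M_prime_def)

lemma MP_cb: "X \<in> MP \<Longrightarrow> x \<in> carrier X \<Longrightarrow> l \<in> carrier L \<Longrightarrow> cb X L x l = db L X x l"
  by (simp add: MP_iff)

text \<open>If the braiding of X with \<open>L\<close> is the inverse of the braiding of
  \<open>L\<close> with X, then the inverse of the former is the latter. So on these objects the
  coaction acts by the braiding itself.\<close>

lemma MP_tau:
  assumes X: "X \<in> MP" and [mlin]: "x \<in> carrier X" "l \<in> carrier L"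
  shows "tau X l x = cb L X l x"
proof -
  note [mlin] = MP_hmod[OF X]
  have eq: "cop X L t = dop L X t" if t: "t \<in> carrier (free X)" for t
    unfolding cop_def dop_def
    by (rule tlift_cong[OF t]) (rule mlin MP_cb[OF X] | assumption)+
  have "tau X l x = cop L X (dop L X (dop X L (tn L X l x)))"
    by (subst cop_dop, (rule mlin)+, rule dop_ten[symmetric]) (rule mlin)+
  also have "dop L X (dop X L (tn L X l x)) = cop X L (dop X L (tn L X l x))"
    by (rule eq[symmetric]) (rule mlin)+
  also have "\<dots> = tn L X l x" by (rule cop_dop) (rule mlin)+
  also have "cop L X (tn L X l x) = cb L X l x" by (rule cop_ten) (rule mlin)+
  finally show ?thesis .
qed

text \<open>The hexagons for the braiding and for the inverse braiding decompose the passage of x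
  \<otimes> y in the same order, over y first and then over x, so they can be compared factor by
  factor.\<close>

lemma MP_htensor:
  assumes X: "X \<in> MP" and Y: "Y \<in> MP"
  shows "htens X Y \<in> MP"
proof -
  note [mlin] = MP_hmod[OF X] MP_hmod[OF Y] 
  have XY: "hmod (htens X Y)" by (rule mlin)+
  let ?P = "L \<otimes>\<^sub>k (X \<otimes>\<^sub>k Y)"
  let ?c = "cop (htens X Y) L" and ?d = "dop L (htens X Y)"
  have cd: "lin (X \<otimes>\<^sub>k Y \<otimes>\<^sub>k L) ?P ?c" "lin (X \<otimes>\<^sub>k Y \<otimes>\<^sub>k L) ?P ?d"
    using cop_lin[OF XY L_hmod lin_id] dop_lin[OF L_hmod XY lin_id] by simp_all
  have "?c (tn (X \<otimes>\<^sub>k Y) L t l) = ?d (tn (X \<otimes>\<^sub>k Y) L t l)"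
    if t: "t \<in> carrier (X \<otimes>\<^sub>k Y)" and l: "l \<in> carrier L" for t l
  proof (rule tensor_ext3[OF ten_closed[OF t l], of ?P])
    fix x y l assume xyl [mlin]: "x \<in> carrier X" "y \<in> carrier Y" "l \<in> carrier L"
    have xy: "tn X Y x y \<in> carrier (htens X Y)" by (rule mlin)+
    have "cb (htens X Y) L (tn X Y x y) l = tlift ?P (tn L (X \<otimes>\<^sub>k Y)) (cb (htens X Y) L (tn X Y x y) l)"
      using cb_lin(3)[OF XY L_hmod xy xyl(3)] by (intro tlift_self[symmetric]) (simp | rule mlin)+
    also have "\<dots> = tlift ?P (\<lambda>l' y'. tlift ?P (\<lambda>l'' x'. tn L (X \<otimes>\<^sub>k Y) l'' (tn X Y x' y')) (cb X L x l')) (cb Y L y l)"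
      by (rule cb_htensor_left) (rule mlin | assumption)+
    also have "\<dots> = tlift ?P (\<lambda>l' y'. tlift ?P (\<lambda>l'' x'. tn L (X \<otimes>\<^sub>k Y) l'' (tn X Y x' y')) (db L X x l')) (cb Y L y l)"
      by (rule tlift_cong[of _ L Y], (rule mlin)+) (simp add: MP_cb[OF X] xyl)
    also have "\<dots> = tlift ?P (\<lambda>l' y'. tlift ?P (\<lambda>l'' x'. tn L (X \<otimes>\<^sub>k Y) l'' (tn X Y x' y')) (db L X x l')) (db L Y y l)"
      by (simp add: MP_cb[OF Y] xyl)
    also have "\<dots> = tlift ?P (tn L (X \<otimes>\<^sub>k Y)) (db L (htens X Y) (tn X Y x y) l)"
      by (rule db_htensor_right[symmetric]) (rule mlin | assumption)+
    also have "\<dots> = db L (htens X Y) (tn X Y x y) l"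
      using db_lin(3)[OF L_hmod XY xyl(3) xy] by (intro tlift_self) (simp | rule mlin)+
    finally show "?c (tn (X \<otimes>\<^sub>k Y) L (tn X Y x y) l) = ?d (tn (X \<otimes>\<^sub>k Y) L (tn X Y x y) l)"
      using cop_ten[OF XY L_hmod xy xyl(3)] dop_ten[OF L_hmod XY xyl(3) xy] by simp
  qed (rule mlin cd | assumption)+
  then show ?thesis
    using cop_ten[OF XY L_hmod] dop_ten[OF L_hmod XY] XY by (simp add: MP_iff)
qed

lemma MP_U: "U \<in> MP"
  unfolding MP_iff
  using cb_trivial_left[OF hmod_U L_hmod _ U_trivial] db_trivial_right[OF L_hmod hmod_U _ U_trivial]
  by (simp add: hmod_U)

subsection \<open>The monoidal structure\<close>

lemma Hm_ext2:
  assumes "\<phi> \<in> Hm (htens X Y) W" "\<psi> \<in> Hm (htens X Y) W" "kmod X" "kmod Y" "kmod W"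
    "\<And>x y. x \<in> carrier X \<Longrightarrow> y \<in> carrier Y \<Longrightarrow> \<phi> (tn X Y x y) = \<psi> (tn X Y x y)"
  shows "\<phi> = \<psi>"
proof (rule extensionalityI)
  show "\<phi> \<in> extensional (carrier (X \<otimes>\<^sub>k Y))" "\<psi> \<in> extensional (carrier (X \<otimes>\<^sub>k Y))"
    using assms(1,2) by (auto simp: ahom_iff)
  fix t assume "t \<in> carrier (X \<otimes>\<^sub>k Y)"
  from this show "\<phi> t = \<psi> t"
    by (rule tensor_ext[OF _ assms(3,4) tensor_mod[OF assms(5) L_mod]])
      (use Hm_lin[OF assms(1)] Hm_lin[OF assms(2)] assms(6) in simp_all)
qed

lemma Hm_ext3:
  assumes "\<phi> \<in> Hm (htens (htens X Y) Z) W" "\<psi> \<in> Hm (htens (htens X Y) Z) W"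
    "kmod X" "kmod Y" "kmod Z" "kmod W"
    "\<And>x y z. x \<in> carrier X \<Longrightarrow> y \<in> carrier Y \<Longrightarrow> z \<in> carrier Z \<Longrightarrow>
      \<phi> (tn (X \<otimes>\<^sub>k Y) Z (tn X Y x y) z) = \<psi> (tn (X \<otimes>\<^sub>k Y) Z (tn X Y x y) z)"
  shows "\<phi> = \<psi>"
proof (rule extensionalityI)
  show "\<phi> \<in> extensional (carrier (X \<otimes>\<^sub>k Y \<otimes>\<^sub>k Z))" "\<psi> \<in> extensional (carrier (X \<otimes>\<^sub>k Y \<otimes>\<^sub>k Z))"
    using assms(1,2) by (auto simp: ahom_iff)
  fix t assume "t \<in> carrier (X \<otimes>\<^sub>k Y \<otimes>\<^sub>k Z)"
  from this show "\<phi> t = \<psi> t"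
    by (rule tensor_ext3[OF _ assms(3,4,5) tensor_mod[OF assms(6) L_mod]])
      (use Hm_lin[OF assms(1)] Hm_lin[OF assms(2)] assms(7) in simp_all)
qed

lemma Cmp_app:
  "hmod X \<Longrightarrow> hmod Y \<Longrightarrow> hmod Z \<Longrightarrow> \<phi> \<in> Hm X Y \<Longrightarrow> \<psi> \<in> Hm Y Z \<Longrightarrow> x \<in> carrier X \<Longrightarrow>
    Cmp D X Y Z \<psi> \<phi> x = kl Y Z \<psi> (\<phi> x)"
  by (simp add: Cmp_D)

lemma Cmp_dh_left_app:
  "hmod X \<Longrightarrow> hmod Y \<Longrightarrow> hmod Z \<Longrightarrow> \<phi> \<in> Hm X Y \<Longrightarrow> hlin Y Z g \<Longrightarrow> x \<in> carrier X \<Longrightarrow>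
    Cmp D X Y Z (dh Y Z g) \<phi> x = tmap k Z L g (\<lambda>m. m) (\<phi> x)"
  by (simp add: Cmp_dh_left)

lemma Cmp_dh_right_app:
  "hmod X \<Longrightarrow> hmod Y \<Longrightarrow> hmod Z \<Longrightarrow> hlin X Y f \<Longrightarrow> \<psi> \<in> Hm Y Z \<Longrightarrow> x \<in> carrier X \<Longrightarrow>
    Cmp D X Y Z \<psi> (dh X Y f) x = \<psi> (f x)"
  by (simp add: Cmp_dh_right)

lemma TenM_app:
  assumes "hmod X" "hmod Y" "hmod X'" "hmod Y'" "\<phi> \<in> Hm X X'" "\<psi> \<in> Hm Y Y'"
    "x \<in> carrier X" "y \<in> carrier Y"
  shows "TenM D X X' Y Y' \<phi> \<psi> (tn X Y x y) = jj X' Y' (\<phi> x) (\<psi> y)"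
  by (simp add: TenM_D assms(1-6) ten_closed[OF assms(7,8)], rule tm_ten)
    (rule assms Hm_lin hmod_mod)+

lemma ins_htensor [simp]: "ins (htens X Y) Z = ins (X \<otimes>\<^sub>k Y) Z" "ins X (htens Y Z) = ins X (Y \<otimes>\<^sub>k Z)"
  by (simp_all add: ins_def fun_eq_iff)

lemma jj_htensor [simp]: "jj (htens X Y) Z = jj (X \<otimes>\<^sub>k Y) Z"
  by (simp add: jj_def fun_eq_iff)

lemma kl_htensor [simp]: "kl (htens X Y) Z = kl (X \<otimes>\<^sub>k Y) Z" "kl Z (htens X Y) = kl Z (X \<otimes>\<^sub>k Y)"
  by (simp_all add: kl_def fun_eq_iff)

text \<open>In the second bracketing l acts on the whole of \<open>jj Y Z t u\<close>, in the first
  only on t. By \<open>jj_la\<close> these agree; what remains is insertions, where the associator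
  moves brackets.\<close>

lemma jj_assoc:
  assumes [mlin]: "hmod X" "hmod Y" "hmod Z"
    "s \<in> carrier (free X)" "t \<in> carrier (free Y)" "u \<in> carrier (free Z)"
  shows "tmap k (X \<otimes>\<^sub>k (Y \<otimes>\<^sub>k Z)) L (assoc k X Y Z) (\<lambda>m. m) (jj (X \<otimes>\<^sub>k Y) Z (jj X Y s t) u) =
    jj X (htens Y Z) s (jj Y Z t u)"
proof -
  let ?P = "X \<otimes>\<^sub>k (Y \<otimes>\<^sub>k Z) \<otimes>\<^sub>k L"
  let ?a = "tmap k (X \<otimes>\<^sub>k (Y \<otimes>\<^sub>k Z)) L (assoc k X Y Z) (\<lambda>m. m)"
  have YZ: "hmod (htens Y Z)" by (rule mlin)+
  have al [mlin]: "lin (X \<otimes>\<^sub>k Y \<otimes>\<^sub>k Z) (X \<otimes>\<^sub>k (Y \<otimes>\<^sub>k Z)) (assoc k X Y Z)" by (rule mlin)+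
  have jl: "\<And>M f t. lin M (free X) f \<Longrightarrow> t \<in> carrier (Y \<otimes>\<^sub>k Z \<otimes>\<^sub>k L) \<Longrightarrow>
      lin M ?P (\<lambda>m. jj X (htens Y Z) (f m) t)"
    using jj_lin(1)[OF hmod_mod[OF assms(1)] YZ] by simp
  have B: "?a (ins (X \<otimes>\<^sub>k Y) Z (tn X Y x y) w) = ins X (Y \<otimes>\<^sub>k Z) x (ins Y Z y w)"
    if [mlin]: "x \<in> carrier X" "y \<in> carrier Y" and w: "w \<in> carrier (free Z)" for x y w
  proof (rule tensor_ext[OF w, of ?P])
    fix z m assume [mlin]: "z \<in> carrier Z" "m \<in> carrier L"
    show "?a (ins (X \<otimes>\<^sub>k Y) Z (tn X Y x y) (tn Z L z m)) = ins X (Y \<otimes>\<^sub>k Z) x (ins Y Z y (tn Z L z m))"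
      by (subst ins_ten, (rule mlin)+, subst ins_ten, (rule mlin)+, subst ins_ten, (rule mlin)+,
        subst tmap_ten, (rule mlin)+, subst assoc_ten, (rule mlin)+) simp
  qed (rule mlin | assumption)+
  have A: "?a (jj (X \<otimes>\<^sub>k Y) Z (ins X Y x v) u) = ins X (Y \<otimes>\<^sub>k Z) x (jj Y Z v u)"
    if [mlin]: "x \<in> carrier X" and v: "v \<in> carrier (free Y)" for x v
  proof (rule tensor_ext[OF v, of ?P])
    fix y n assume [mlin]: "y \<in> carrier Y" "n \<in> carrier L"
    show "?a (jj (X \<otimes>\<^sub>k Y) Z (ins X Y x (tn Y L y n)) u) = ins X (Y \<otimes>\<^sub>k Z) x (jj Y Z (tn Y L y n) u)"
      by (subst ins_ten, (rule mlin)+, subst jj_ten, (rule mlin)+, subst jj_ten, (rule mlin)+, rule B) (rule mlin)+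
  qed (rule mlin | assumption)+
  show ?thesis
  proof (rule tensor_ext[OF assms(4), of ?P])
    fix x l assume xl [mlin]: "x \<in> carrier X" "l \<in> carrier L"
    have "?a (jj (X \<otimes>\<^sub>k Y) Z (jj X Y (tn X L x l) t) u) = ins X (Y \<otimes>\<^sub>k Z) x (jj Y Z (la Y l t) u)"
      by (subst jj_ten, (rule mlin)+, rule A) (rule mlin)+
    also have "\<dots> = ins X (Y \<otimes>\<^sub>k Z) x (la (htens Y Z) l (jj Y Z t u))"
      by (simp only: jj_la[OF assms(2,3) xl(2) assms(5,6)])
    also have "\<dots> = jj X (htens Y Z) (tn X L x l) (jj Y Z t u)"
    proof -
      have "jj Y Z t u \<in> carrier (Y \<otimes>\<^sub>k Z \<otimes>\<^sub>k L)" by (rule mlin)+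
      then show ?thesis using jj_ten[OF hmod_mod[OF assms(1)] YZ xl, of "jj Y Z t u"] by simp
    qed
    finally show "?a (jj (X \<otimes>\<^sub>k Y) Z (jj X Y (tn X L x l) t) u) = \<dots>" .
  qed (rule mlin jl | assumption)+
qed

lemma TenM_Idt:
  assumes "hmod X" "hmod Y"
  shows "TenM D X X Y Y (dh X X id) (dh Y Y id) = dh (htens X Y) (htens X Y) id"
  using assms by (simp add: TenM_dh hlin_id') (auto intro!: dh_cong simp: tmap_id hmod_mod)

lemma TenM_Cmp:
  assumes [mlin]: "hmod X" "hmod X'" "hmod X''" "hmod Y" "hmod Y'" "hmod Y''"
    and [mlin]: "f \<in> Hm X X'" "f' \<in> Hm X' X''" "g \<in> Hm Y Y'" "g' \<in> Hm Y' Y''"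
  shows "TenM D X X'' Y Y'' (Cmp D X X' X'' f' f) (Cmp D Y Y' Y'' g' g) =
    Cmp D (htens X Y) (htens X' Y') (htens X'' Y'') (TenM D X' X'' Y' Y'' f' g') (TenM D X X' Y Y' f g)"
proof (rule Hm_ext2)
  fix x y assume xy [mlin]: "x \<in> carrier X" "y \<in> carrier Y"
  note c = lin_map_closed[OF Hm_lin[OF assms(7)] xy(1)] lin_map_closed[OF Hm_lin[OF assms(9)] xy(2)]
  have "TenM D X X'' Y Y'' (Cmp D X X' X'' f' f) (Cmp D Y Y' Y'' g' g) (tn X Y x y) =
      jj X'' Y'' (kl X' X'' f' (f x)) (kl Y' Y'' g' (g y))"
    by (subst TenM_app, (rule mlin Cmp_Hm)+) (simp add: Cmp_app assms xy)
  also have "\<dots> = kl (X' \<otimes>\<^sub>k Y') (X'' \<otimes>\<^sub>k Y'') (tm X'' Y'' f' g') (jj X' Y' (f x) (g y))"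
    by (rule kl_jj[symmetric]) (rule mlin c Hm_hlin)+
  also have "\<dots> = kl (X' \<otimes>\<^sub>k Y') (X'' \<otimes>\<^sub>k Y'') (TenM D X' X'' Y' Y'' f' g') (jj X' Y' (f x) (g y))"
    by (rule kl_cong) (rule mlin c | assumption | simp add: TenM_D assms)+
  also have "\<dots> = kl (htens X' Y') (htens X'' Y'') (TenM D X' X'' Y' Y'' f' g') (TenM D X X' Y Y' f g (tn X Y x y))"
    by (simp add: TenM_app assms xy)
  also have "\<dots> = Cmp D (htens X Y) (htens X' Y') (htens X'' Y'') (TenM D X' X'' Y' Y'' f' g') (TenM D X X' Y Y' f g) (tn X Y x y)"
    by (rule Cmp_app[symmetric]) (rule mlin TenM_Hm)+
  finally show "TenM D X X'' Y Y'' (Cmp D X X' X'' f' f) (Cmp D Y Y' Y'' g' g) (tn X Y x y) = \<dots>" .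
qed (rule mlin TenM_Hm Cmp_Hm)+

text \<open>At x \<otimes> y \<otimes> z both sides combine f x, g y and h z by \<open>jj\<close>,
  with the two possible bracketings.\<close>

lemma Assoc_natural_D:
  assumes [mlin]: "hmod X" "hmod X'" "hmod Y" "hmod Y'" "hmod Z" "hmod Z'"
    and [mlin]: "f \<in> Hm X X'" "g \<in> Hm Y Y'" "h \<in> Hm Z Z'"
  shows "Cmp D (htens (htens X Y) Z) (htens (htens X' Y') Z') (htens X' (htens Y' Z'))
      (dh (htens (htens X' Y') Z') (htens X' (htens Y' Z')) (assoc k X' Y' Z'))
      (TenM D (htens X Y) (htens X' Y') Z Z' (TenM D X X' Y Y' f g) h) =
    Cmp D (htens (htens X Y) Z) (htens X (htens Y Z)) (htens X' (htens Y' Z'))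
      (TenM D X X' (htens Y Z) (htens Y' Z') f (TenM D Y Y' Z Z' g h))
      (dh (htens (htens X Y) Z) (htens X (htens Y Z)) (assoc k X Y Z))" (is "?l = ?r")
proof (rule Hm_ext3)
  fix x y z assume xyz [mlin]: "x \<in> carrier X" "y \<in> carrier Y" "z \<in> carrier Z"
  note c = lin_map_closed[OF Hm_lin[OF assms(7)] xyz(1)] lin_map_closed[OF Hm_lin[OF assms(8)] xyz(2)]
    lin_map_closed[OF Hm_lin[OF assms(9)] xyz(3)]
  have xy: "tn X Y x y \<in> carrier (htens X Y)" and yz: "tn Y Z y z \<in> carrier (htens Y Z)" by (rule mlin)+
  let ?t = "tn (X \<otimes>\<^sub>k Y) Z (tn X Y x y) z"
  have t: "?t \<in> carrier (htens (htens X Y) Z)" using xy xyz by (simp add: ten_closed)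
  have "?l ?t = tmap k (htens X' (htens Y' Z')) L (assoc k X' Y' Z') (\<lambda>m. m)
      (TenM D (htens X Y) (htens X' Y') Z Z' (TenM D X X' Y Y' f g) h ?t)"
    by (rule Cmp_dh_left_app[OF _ _ _ _ _ t]) (rule mlin TenM_Hm assoc_hlin)+
  also have "TenM D (htens X Y) (htens X' Y') Z Z' (TenM D X X' Y Y' f g) h ?t =
      jj (X' \<otimes>\<^sub>k Y') Z' (jj X' Y' (f x) (g y)) (h z)"
    using TenM_app[OF hmod_htensor[OF assms(1,3)] assms(5) hmod_htensor[OF assms(2,4)] assms(6)
      TenM_Hm[OF assms(1,3,2,4,7,8)] assms(9) xy xyz(3)] by (simp add: TenM_app assms xyz)
  also have "tmap k (htens X' (htens Y' Z')) L (assoc k X' Y' Z') (\<lambda>m. m) \<dots> =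
      jj X' (htens Y' Z') (f x) (jj Y' Z' (g y) (h z))"
    using jj_assoc[OF assms(2,4,6) c] by simp
  also have "\<dots> = TenM D X X' (htens Y Z) (htens Y' Z') f (TenM D Y Y' Z Z' g h) (tn X (Y \<otimes>\<^sub>k Z) x (tn Y Z y z))"
    using TenM_app[OF assms(1) hmod_htensor[OF assms(3,5)] assms(2) hmod_htensor[OF assms(4,6)]
      assms(7) TenM_Hm[OF assms(3,5,4,6,8,9)] xyz(1) yz] by (simp add: TenM_app assms xyz)
  also have "tn X (Y \<otimes>\<^sub>k Z) x (tn Y Z y z) = assoc k X Y Z ?t"
    by (rule assoc_ten[symmetric]) (rule mlin)+
  also have "TenM D X X' (htens Y Z) (htens Y' Z') f (TenM D Y Y' Z Z' g h) \<dots> = ?r ?t"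
    by (rule Cmp_dh_right_app[OF _ _ _ _ _ t, symmetric]) (rule mlin TenM_Hm assoc_hlin)+
  finally show "?l ?t = ?r ?t" .
qed (rule mlin TenM_Hm Cmp_Hm dh_Hm assoc_hlin)+

lemma Assoc_iso_D:
  assumes "X \<in> MP" "Y \<in> MP" "Z \<in> MP"
  shows "iso_in D (htens (htens X Y) Z) (htens X (htens Y Z))
      (dh (htens (htens X Y) Z) (htens X (htens Y Z)) (assoc k X Y Z))"
    "inv_in D (htens (htens X Y) Z) (htens X (htens Y Z))
      (dh (htens (htens X Y) Z) (htens X (htens Y Z)) (assoc k X Y Z)) =
     dh (htens X (htens Y Z)) (htens (htens X Y) Z) (assoc' X Y Z)"
  by (rule dh_iso[where g = "assoc' X Y Z"]; use assms in \<open>simp add: MP_htensor MP_hmod hmod_mod assoc_hlin assoc'_assoc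
    assoc_assoc' assoc'_closed\<close>)+

lemma tensor_ext4:
  assumes "t \<in> carrier (A \<otimes>\<^sub>k B \<otimes>\<^sub>k C \<otimes>\<^sub>k E)" "kmod A" "kmod B" "kmod C" "kmod E" "kmod P"
    "lin (A \<otimes>\<^sub>k B \<otimes>\<^sub>k C \<otimes>\<^sub>k E) P f" "lin (A \<otimes>\<^sub>k B \<otimes>\<^sub>k C \<otimes>\<^sub>k E) P g"
    "\<And>a b c e. a \<in> carrier A \<Longrightarrow> b \<in> carrier B \<Longrightarrow> c \<in> carrier C \<Longrightarrow> e \<in> carrier E \<Longrightarrow>
      f (tn (A \<otimes>\<^sub>k B \<otimes>\<^sub>k C) E (tn (A \<otimes>\<^sub>k B) C (tn A B a b) c) e) =
      g (tn (A \<otimes>\<^sub>k B \<otimes>\<^sub>k C) E (tn (A \<otimes>\<^sub>k B) C (tn A B a b) c) e)"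
  shows "f t = g t"
proof (rule tensor_ext[OF assms(1) _ assms(5-8)])
  fix u c assume u: "u \<in> carrier (A \<otimes>\<^sub>k B \<otimes>\<^sub>k C)" and c: "c \<in> carrier E"
  have *: "lin (A \<otimes>\<^sub>k B \<otimes>\<^sub>k C) P (\<lambda>u. h (tn (A \<otimes>\<^sub>k B \<otimes>\<^sub>k C) E u c))"
    if "lin (A \<otimes>\<^sub>k B \<otimes>\<^sub>k C \<otimes>\<^sub>k E) P h" for h
    by (rule lin_map_comp[OF _ that]) (rule mlin assms c | assumption)+
  show "f (tn (A \<otimes>\<^sub>k B \<otimes>\<^sub>k C) E u c) = g (tn (A \<otimes>\<^sub>k B \<otimes>\<^sub>k C) E u c)"
    by (rule tensor_ext3[OF u assms(2,3,4,6) *[OF assms(7)] *[OF assms(8)]]) (rule assms(9) c | assumption)+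
qed (rule mlin assms)+

lemma pentagon_D:
  assumes [mlin]: "hmod W" "hmod X" "hmod Y" "hmod Z"
  shows "Cmp D (htens (htens (htens W X) Y) Z) (htens (htens W X) (htens Y Z))
      (htens W (htens X (htens Y Z)))
      (dh (htens (htens W X) (htens Y Z)) (htens W (htens X (htens Y Z))) (assoc k W X (htens Y Z)))
      (dh (htens (htens (htens W X) Y) Z) (htens (htens W X) (htens Y Z)) (assoc k (htens W X) Y Z)) =
    Cmp D (htens (htens (htens W X) Y) Z) (htens W (htens (htens X Y) Z))
      (htens W (htens X (htens Y Z)))
      (TenM D W W (htens (htens X Y) Z) (htens X (htens Y Z)) (dh W W id)
        (dh (htens (htens X Y) Z) (htens X (htens Y Z)) (assoc k X Y Z)))
      (Cmp D (htens (htens (htens W X) Y) Z) (htens (htens W (htens X Y)) Z)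
        (htens W (htens (htens X Y) Z))
        (dh (htens (htens W (htens X Y)) Z) (htens W (htens (htens X Y) Z)) (assoc k W (htens X Y) Z))
        (TenM D (htens (htens W X) Y) (htens W (htens X Y)) Z Z
          (dh (htens (htens W X) Y) (htens W (htens X Y)) (assoc k W X Y)) (dh Z Z id)))"
proof -
  have h: "hmod (htens W X)" "hmod (htens X Y)" "hmod (htens Y Z)" "hmod (htens (htens W X) Y)"
    "hmod (htens W (htens X Y))" "hmod (htens (htens X Y) Z)" "hmod (htens X (htens Y Z))"
    "hmod (htens (htens (htens W X) Y) Z)" "hmod (htens (htens W X) (htens Y Z))"
    "hmod (htens W (htens X (htens Y Z)))" "hmod (htens W (htens (htens X Y) Z))"
    "hmod (htens (htens W (htens X Y)) Z)"
    by (rule mlin)+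
  note a = assoc_hlin
  note th = tmap_hlin[OF h(4) assms(4) h(5) assms(4) a[OF assms(1-3)] hlin_id']
  note th' = tmap_hlin[OF assms(1) h(6) assms(1) h(7) hlin_id' a[OF assms(2-4)]]
  have al [mlin]: "lin (X \<otimes>\<^sub>k Y \<otimes>\<^sub>k Z) (X \<otimes>\<^sub>k (Y \<otimes>\<^sub>k Z)) (assoc k X Y Z)"
    "lin (W \<otimes>\<^sub>k X \<otimes>\<^sub>k Y) (W \<otimes>\<^sub>k (X \<otimes>\<^sub>k Y)) (assoc k W X Y)"
    "lin W W id" "lin Z Z id" by (simp_all only: id_def) (rule mlin)+
  have eq: "assoc k W X (Y \<otimes>\<^sub>k Z) (assoc k (W \<otimes>\<^sub>k X) Y Z t) =
    tmap k W (X \<otimes>\<^sub>k (Y \<otimes>\<^sub>k Z)) id (assoc k X Y Z) (assoc k W (X \<otimes>\<^sub>k Y) Z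
      (tmap k (W \<otimes>\<^sub>k (X \<otimes>\<^sub>k Y)) Z (assoc k W X Y) id t))"
    if t: "t \<in> carrier (W \<otimes>\<^sub>k X \<otimes>\<^sub>k Y \<otimes>\<^sub>k Z)" for t
  proof (rule tensor_ext4[OF t, of "W \<otimes>\<^sub>k (X \<otimes>\<^sub>k (Y \<otimes>\<^sub>k Z))"])
    fix w x y z assume wz [mlin]: "w \<in> carrier W" "x \<in> carrier X" "y \<in> carrier Y" "z \<in> carrier Z"
    let ?t = "tn (W \<otimes>\<^sub>k X \<otimes>\<^sub>k Y) Z (tn (W \<otimes>\<^sub>k X) Y (tn W X w x) y) z"
    have "tmap k (W \<otimes>\<^sub>k (X \<otimes>\<^sub>k Y)) Z (assoc k W X Y) id ?t = tn (W \<otimes>\<^sub>k (X \<otimes>\<^sub>k Y)) Z (tn W (X \<otimes>\<^sub>k Y) w (tn X Y x y)) z"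
      by (subst tmap_ten, (rule mlin)+, subst assoc_ten, (rule mlin)+) simp
    moreover have "assoc k W (X \<otimes>\<^sub>k Y) Z \<dots> = tn W (X \<otimes>\<^sub>k Y \<otimes>\<^sub>k Z) w (tn (X \<otimes>\<^sub>k Y) Z (tn X Y x y) z)"
      by (rule assoc_ten) (rule mlin)+
    moreover have "tmap k W (X \<otimes>\<^sub>k (Y \<otimes>\<^sub>k Z)) id (assoc k X Y Z) \<dots> = tn W (X \<otimes>\<^sub>k (Y \<otimes>\<^sub>k Z)) w (tn X (Y \<otimes>\<^sub>k Z) x (tn Y Z y z))"
      by (subst tmap_ten, (rule mlin)+, subst assoc_ten, (rule mlin)+) simp
    moreover have "assoc k W X (Y \<otimes>\<^sub>k Z) (assoc k (W \<otimes>\<^sub>k X) Y Z ?t) = tn W (X \<otimes>\<^sub>k (Y \<otimes>\<^sub>k Z)) w (tn X (Y \<otimes>\<^sub>k Z) x (tn Y Z y z))"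
      by (subst assoc_ten, (rule mlin)+, rule assoc_ten) (rule mlin)+
    ultimately show "assoc k W X (Y \<otimes>\<^sub>k Z) (assoc k (W \<otimes>\<^sub>k X) Y Z ?t) =
      tmap k W (X \<otimes>\<^sub>k (Y \<otimes>\<^sub>k Z)) id (assoc k X Y Z) (assoc k W (X \<otimes>\<^sub>k Y) Z
        (tmap k (W \<otimes>\<^sub>k (X \<otimes>\<^sub>k Y)) Z (assoc k W X Y) id ?t))" by simp
  qed (rule mlin | assumption)+
  show ?thesis
    unfolding TenM_dh[OF h(4) assms(4) h(5) assms(4) a[OF assms(1-3)] hlin_id']
      TenM_dh[OF assms(1) h(6) assms(1) h(7) hlin_id' a[OF assms(2-4)]]
      Cmp_dh_dh[OF h(8,12,11) th a[OF assms(1) h(2) assms(4)]]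
      Cmp_dh_dh[OF h(8,9,10) a[OF h(1) assms(3,4)] a[OF assms(1,2) h(3)]]
      Cmp_dh_dh[OF h(8,11,10) hlin_comp[OF th a[OF assms(1) h(2) assms(4)]] th']
    by (rule dh_cong) (use eq in simp)
qed

lemma triangle_D:
  assumes [mlin]: "hmod X" "hmod Y"
  shows "Cmp D (htens (htens X U) Y) (htens X (htens U Y)) (htens X Y)
      (TenM D X X (htens U Y) Y (dh X X id) (dh (htens U Y) Y (lu Y)))
      (dh (htens (htens X U) Y) (htens X (htens U Y)) (assoc k X U Y)) =
    TenM D (htens X U) X Y Y (dh (htens X U) X (ru X)) (dh Y Y id)"
proof -
  have h: "hmod (htens U Y)" "hmod (htens X U)" "hmod (htens (htens X U) Y)" "hmod (htens X (htens U Y))"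
    "hmod (htens X Y)"
    by (rule mlin)+
  have l [mlin]: "lin X X id" "lin Y Y id" by (simp_all only: id_def) (rule mlin)+
  have lu [mlin]: "lin (K \<otimes>\<^sub>k Y) Y (lu Y)" and ru [mlin]: "lin (X \<otimes>\<^sub>k K) X (ru X)"
    using lu_hlin[OF assms(2)] ru_hlin[OF assms(1)] by (simp_all add: hlin_def)
  have eq: "tmap k X Y id (lu Y) (assoc k X K Y t) = tmap k X Y (ru X) id t"
    if t: "t \<in> carrier (X \<otimes>\<^sub>k K \<otimes>\<^sub>k Y)" for t
  proof (rule tensor_ext3[OF t, of "X \<otimes>\<^sub>k Y"])
    fix x r y assume xry [mlin]: "x \<in> carrier X" "r \<in> carrier K" "y \<in> carrier Y"
    then have r: "r \<in> carrier k" by simp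
    have "tmap k X Y id (lu Y) (assoc k X K Y (tn (X \<otimes>\<^sub>k K) Y (tn X K x r) y)) = tn X Y x (r \<odot>\<^bsub>Y\<^esub> y)"
      by (subst assoc_ten, (rule mlin)+, subst tmap_ten, (rule mlin)+) (simp add: lu_ten xry r assms hmod_mod)
    also have "\<dots> = tn X Y (r \<odot>\<^bsub>X\<^esub> x) y"
      by (simp add: ten_smult xry r assms hmod_mod)
    also have "\<dots> = tmap k X Y (ru X) id (tn (X \<otimes>\<^sub>k K) Y (tn X K x r) y)"
      by (subst tmap_ten, (rule mlin)+) (simp add: ru_ten xry r assms hmod_mod)
    finally show "tmap k X Y id (lu Y) (assoc k X K Y (tn (X \<otimes>\<^sub>k K) Y (tn X K x r) y)) = \<dots>" .
  qed (rule mlin | assumption)+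
  show ?thesis
    unfolding TenM_dh[OF assms(1) h(1) assms hlin_id' lu_hlin[OF assms(2)]]
      TenM_dh[OF h(2) assms(2) assms ru_hlin[OF assms(1)] hlin_id']
      Cmp_dh_dh[OF h(3,4,5) assoc_hlin[OF assms(1) hmod_U assms(2)]
        tmap_hlin[OF assms(1) h(1) assms hlin_id' lu_hlin[OF assms(2)]]]
    by (rule dh_cong) (use eq in simp)
qed

lemma jj_U_left:
  assumes [mlin]: "hmod Y" "r \<in> carrier k" and t: "t \<in> carrier (free Y)"
  shows "tmap k Y L (lu Y) (\<lambda>m. m) (jj U Y (tn K L r \<one>\<^bsub>L\<^esub>) t) = r \<odot>\<^bsub>Y \<otimes>\<^sub>k L\<^esub> t"
proof -
  have lu [mlin]: "lin (K \<otimes>\<^sub>k Y) Y (lu Y)" using lu_hlin[OF assms(1)] by (simp add: hlin_def)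
  have r [mlin]: "r \<in> carrier K" by (simp add: assms)
  have i: "ins U Y = ins K Y" by (simp add: ins_def fun_eq_iff)
  have "jj U Y (tn K L r \<one>\<^bsub>L\<^esub>) t = ins K Y r t"
    using jj_ten_one[OF hmod_mod[OF hmod_U] assms(1), of r t] assms t i by simp
  also have "tmap k Y L (lu Y) (\<lambda>m. m) \<dots> = r \<odot>\<^bsub>Y \<otimes>\<^sub>k L\<^esub> t"
  proof (rule tensor_ext[OF t, of "Y \<otimes>\<^sub>k L"])
    fix y m assume ym [mlin]: "y \<in> carrier Y" "m \<in> carrier L"
    show "tmap k Y L (lu Y) (\<lambda>m. m) (ins K Y r (tn Y L y m)) = r \<odot>\<^bsub>Y \<otimes>\<^sub>k L\<^esub> tn Y L y m"
      by (subst ins_ten, (rule mlin)+, subst tmap_ten, (rule mlin)+)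
        (simp add: lu_ten assms ym ten_smult hmod_mod L_mod)
  qed (rule mlin | assumption)+
  finally show ?thesis .
qed

text \<open>Here the component m in \<open>L\<close> has to pass r. As \<open>H\<close> acts on the
  unit object through the counit, it does so by the flip.\<close>

lemma jj_U_right:
  assumes [mlin]: "hmod Y" "r \<in> carrier k" and t: "t \<in> carrier (free Y)"
  shows "tmap k Y L (ru Y) (\<lambda>m. m) (jj Y U t (tn K L r \<one>\<^bsub>L\<^esub>)) = r \<odot>\<^bsub>Y \<otimes>\<^sub>k L\<^esub> t"
proof (rule tensor_ext[OF t, of "Y \<otimes>\<^sub>k L"])
  have ru [mlin]: "lin (Y \<otimes>\<^sub>k K) Y (ru Y)" using ru_hlin[OF assms(1)] by (simp add: hlin_def)
  have r [mlin]: "r \<in> carrier K" by (simp add: assms)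
  have i: "ins Y U = ins Y K" by (simp add: ins_def fun_eq_iff)
  have rr: "tn K L r \<one>\<^bsub>L\<^esub> \<in> carrier (free K)" by (rule mlin)+
  fix y m assume ym [mlin]: "y \<in> carrier Y" "m \<in> carrier L"
  have "la U m (tn K L r \<one>\<^bsub>L\<^esub>) = tn K L r m"
    using la_ten_one[OF hmod_U ym(2), of r] db_trivial_left[OF hmod_U L_hmod ym(2) U_trivial[OF assms(2)]] assms by simp
  then have "jj Y U (tn Y L y m) (tn K L r \<one>\<^bsub>L\<^esub>) = tn (Y \<otimes>\<^sub>k K) L (tn Y K y r) m"
    using jj_ten[OF hmod_mod[OF assms(1)] hmod_U ym, of "tn K L r \<one>\<^bsub>L\<^esub>"] rr i
      ins_ten[OF hmod_mod[OF assms(1)] base_module_mod ym(1) r ym(2)] by simp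
  also have "tmap k Y L (ru Y) (\<lambda>m. m) \<dots> = r \<odot>\<^bsub>Y \<otimes>\<^sub>k L\<^esub> tn Y L y m"
    by (subst tmap_ten, (rule mlin)+) (simp add: ru_ten assms ym ten_smult hmod_mod L_mod)
  finally show "tmap k Y L (ru Y) (\<lambda>m. m) (jj Y U (tn Y L y m) (tn K L r \<one>\<^bsub>L\<^esub>)) = \<dots>" .
next
  have ru [mlin]: "lin (Y \<otimes>\<^sub>k K) Y (ru Y)" using ru_hlin[OF assms(1)] by (simp add: hlin_def)
  have "lin (free Y) (Y \<otimes>\<^sub>k K \<otimes>\<^sub>k L) (\<lambda>t. jj Y U t (tn K L r \<one>\<^bsub>L\<^esub>))"
    using jj_lin(1)[OF hmod_mod[OF assms(1)] hmod_U lin_id, of "tn K L r \<one>\<^bsub>L\<^esub>"]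
      ten_closed[of r K "\<one>\<^bsub>L\<^esub>" L] assms one_closed[OF L_alg] by simp
  then show "lin (free Y) (free Y) (\<lambda>t. tmap k Y L (ru Y) (\<lambda>m. m) (jj Y U t (tn K L r \<one>\<^bsub>L\<^esub>)))"
    by (rule tmap_lin) (rule mlin)+
qed (rule mlin | assumption)+

lemma LUnit_natural_D:
  assumes [mlin]: "hmod X" "hmod Y" and f [mlin]: "f \<in> Hm X Y"
  shows "Cmp D (htens U X) (htens U Y) Y (dh (htens U Y) Y (lu Y)) (TenM D U U X Y (dh U U id) f) =
    Cmp D (htens U X) X Y f (dh (htens U X) X (lu X))" (is "?l = ?r")
proof (rule Hm_ext2)
  fix r x assume r: "r \<in> carrier U" and x: "x \<in> carrier X"
  have t: "tn U X r x \<in> carrier (htens U X)" using r x by (simp add: ten_closed)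
  note fx = lin_map_closed[OF Hm_lin[OF f] x]
  have "?l (tn U X r x) = tmap k Y L (lu Y) (\<lambda>m. m) (TenM D U U X Y (dh U U id) f (tn U X r x))"
    by (rule Cmp_dh_left_app[OF _ _ _ _ _ t]) (rule mlin TenM_Hm dh_Hm lu_hlin hlin_id')+
  also have "TenM D U U X Y (dh U U id) f (tn U X r x) = jj U Y (dh U U id r) (f x)"
    by (rule TenM_app) (rule mlin dh_Hm r x hlin_id')+
  also have "\<dots> = jj U Y (tn K L r \<one>\<^bsub>L\<^esub>) (f x)" using r by (simp add: dh_app)
  also have "tmap k Y L (lu Y) (\<lambda>m. m) \<dots> = r \<odot>\<^bsub>Y \<otimes>\<^sub>k L\<^esub> f x"
    using r by (intro jj_U_left assms fx) simp
  also have "\<dots> = f (lu X (tn U X r x))"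
    using r x lin_map_smult[OF Hm_lin[OF f], of r x] by (simp add: lu_ten assms hmod_mod)
  also have "\<dots> = ?r (tn U X r x)"
    by (rule Cmp_dh_right_app[OF _ _ _ _ _ t, symmetric]) (rule mlin TenM_Hm dh_Hm lu_hlin)+
  finally show "?l (tn U X r x) = ?r (tn U X r x)" .
qed (rule mlin TenM_Hm Cmp_Hm dh_Hm lu_hlin hlin_id')+

lemma RUnit_natural_D:
  assumes [mlin]: "hmod X" "hmod Y" and f [mlin]: "f \<in> Hm X Y"
  shows "Cmp D (htens X U) (htens Y U) Y (dh (htens Y U) Y (ru Y)) (TenM D X Y U U f (dh U U id)) =
    Cmp D (htens X U) X Y f (dh (htens X U) X (ru X))" (is "?l = ?r")
proof (rule Hm_ext2)
  fix x r assume r: "r \<in> carrier U" and x: "x \<in> carrier X"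
  have t: "tn X U x r \<in> carrier (htens X U)" using r x by (simp add: ten_closed)
  note fx = lin_map_closed[OF Hm_lin[OF f] x]
  have "?l (tn X U x r) = tmap k Y L (ru Y) (\<lambda>m. m) (TenM D X Y U U f (dh U U id) (tn X U x r))"
    by (rule Cmp_dh_left_app[OF _ _ _ _ _ t]) (rule mlin TenM_Hm dh_Hm ru_hlin hlin_id')+
  also have "TenM D X Y U U f (dh U U id) (tn X U x r) = jj Y U (f x) (dh U U id r)"
    by (rule TenM_app) (rule mlin dh_Hm r x hlin_id')+
  also have "\<dots> = jj Y U (f x) (tn K L r \<one>\<^bsub>L\<^esub>)" using r by (simp add: dh_app)
  also have "tmap k Y L (ru Y) (\<lambda>m. m) \<dots> = r \<odot>\<^bsub>Y \<otimes>\<^sub>k L\<^esub> f x"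
    using r by (intro jj_U_right assms fx) simp
  also have "\<dots> = f (ru X (tn X U x r))"
    using r x lin_map_smult[OF Hm_lin[OF f], of r x] by (simp add: ru_ten assms hmod_mod)
  also have "\<dots> = ?r (tn X U x r)"
    by (rule Cmp_dh_right_app[OF _ _ _ _ _ t, symmetric]) (rule mlin TenM_Hm dh_Hm ru_hlin)+
  finally show "?l (tn X U x r) = ?r (tn X U x r)" .
qed (rule mlin TenM_Hm Cmp_Hm dh_Hm ru_hlin hlin_id')+

lemma LUnit_iso_D: "X \<in> MP \<Longrightarrow> iso_in D (htens U X) X (dh (htens U X) X (lu X))"
  by (rule dh_iso(1)[where g = "tn K X \<one>\<^bsub>k\<^esub>"])
    (simp_all add: MP_htensor MP_U lu_hlin MP_hmod ten_lu hmod_mod ten_closed k_one lu_ten module.smult_one)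

lemma RUnit_iso_D: "X \<in> MP \<Longrightarrow> iso_in D (htens X U) X (dh (htens X U) X (ru X))"
  by (rule dh_iso(1)[where g = "\<lambda>x. tn X K x \<one>\<^bsub>k\<^esub>"])
    (simp_all add: MP_htensor MP_U ru_hlin MP_hmod ten_ru hmod_mod ten_closed k_one ru_ten module.smult_one)

lemma monoidal_D: "monoidal_category D"
proof (intro monoidal_category.intro category_D monoidal_category_axioms.intro; unfold D_simps)
qed (rule MP_htensor MP_U TenM_Hm TenM_Idt TenM_Cmp Assoc_iso_D LUnit_iso_D RUnit_iso_D Assoc_natural_D
  LUnit_natural_D RUnit_natural_D pentagon_D triangle_D; (assumption | rule MP_hmod, assumption))+

subsection \<open>The braiding\<close>

lemma cop_hlin: "hmod X \<Longrightarrow> hmod Y \<Longrightarrow> hlin (htens X Y) (htens Y X) (cop X Y)"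
  using cop_act[of X Y] cop_lin[OF _ _ lin_id, of X Y] by (simp add: hlin_def)

lemma braiding_eq:
  "hmod X \<Longrightarrow> hmod Y \<Longrightarrow> dyn_braiding k H R L X Y = dh (htens X Y) (htens Y X) (cop X Y)"
  unfolding dyn_braiding_def by (rule dh_cong) (simp add: flip_act2_R)

text \<open>Expands the braiding into pure tensors under a linear map, the form in which the hexagon
  lemmas with a parameter \<open>G\<close> apply.\<close>

lemma cop_hom:
  assumes "lin (Y \<otimes>\<^sub>k X) P f" "hmod X" "hmod Y" "kmod P" "x \<in> carrier X" "y \<in> carrier Y"
  shows "f (cb X Y x y) = tlift P (\<lambda>y x. f (tn Y X y x)) (cb X Y x y)"
proof -
  note c = cb_lin(3)[OF assms(2,3,5,6)]
  have "f (cb X Y x y) = f (tlift (Y \<otimes>\<^sub>k X) (tn Y X) (cb X Y x y))"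
    by (simp add: tlift_self[OF c] hmod_mod assms)
  also have "\<dots> = tlift P (\<lambda>y x. f (tn Y X y x)) (cb X Y x y)"
    by (rule tlift_hom[OF assms(1) c]) (rule mlin assms | assumption)+
  finally show ?thesis .
qed

text \<open>Both sides are sums of terms \<open>y' \<otimes> x' \<otimes> l' m\<close>. On the left \<open>l\<close> passes \<open>y\<close> by the coaction. On
  the right it passes \<open>y\<close> by the braiding, which agrees with the coaction as \<open>Y\<close> belongs to \<open>MP\<close>.\<close>

lemma cop_jj:
  assumes X: "X \<in> MP" and Y: "Y \<in> MP" and st: "s \<in> carrier (free X)" "t \<in> carrier (free Y)"
  shows "tmap k (Y \<otimes>\<^sub>k X) L (cop X Y) (\<lambda>m. m) (jj X Y s t) =
    tlift (Y \<otimes>\<^sub>k X \<otimes>\<^sub>k L) (jj Y X) (cb (htens X L) (htens Y L) s t)"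
proof -
  note [mlin] = MP_hmod[OF X] MP_hmod[OF Y] st
  have hm: "hmod X" "hmod Y" "hmod (htens X L)" "hmod (htens Y L)" by (rule mlin)+
  let ?P = "Y \<otimes>\<^sub>k X \<otimes>\<^sub>k L"
  let ?J = "jj Y X"
  have Jb: "bil k (free Y) (free X) ?P ?J" by (rule mlin | assumption)+
  have cl [mlin]: "lin (X \<otimes>\<^sub>k Y) (Y \<otimes>\<^sub>k X) (cop X Y)" by (rule mlin | assumption)+
  have cbl: "\<And>M f t. lin M (free X) f \<Longrightarrow> t \<in> carrier (free Y) \<Longrightarrow>
      lin M (Y \<otimes>\<^sub>k L \<otimes>\<^sub>k (free X)) (\<lambda>m. cb (htens X L) (htens Y L) (f m) t)"
    "\<And>M f s. lin M (free Y) f \<Longrightarrow> s \<in> carrier (free X) \<Longrightarrow>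
      lin M (Y \<otimes>\<^sub>k L \<otimes>\<^sub>k (free X)) (\<lambda>m. cb (htens X L) (htens Y L) s (f m))"
    "\<And>M f x. lin M (free Y) f \<Longrightarrow> x \<in> carrier X \<Longrightarrow>
      lin M (Y \<otimes>\<^sub>k L \<otimes>\<^sub>k X) (\<lambda>m. cb X (htens Y L) x (f m))"
    "\<And>M f t. lin M X f \<Longrightarrow> t \<in> carrier (free Y) \<Longrightarrow>
      lin M (Y \<otimes>\<^sub>k L \<otimes>\<^sub>k X) (\<lambda>m. cb X (htens Y L) (f m) t)"
    "\<And>x t. x \<in> carrier X \<Longrightarrow> t \<in> carrier (free Y) \<Longrightarrow>
      cb X (htens Y L) x t \<in> carrier (Y \<otimes>\<^sub>k L \<otimes>\<^sub>k X)"
    "\<And>x t. x \<in> carrier L \<Longrightarrow> t \<in> carrier (free Y) \<Longrightarrow>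
      cb L (htens Y L) x t \<in> carrier (Y \<otimes>\<^sub>k L \<otimes>\<^sub>k L)"
    using cb_lin[OF hm(3,4)] cb_lin[OF hm(1,4)] cb_lin[OF L_hmod hm(4)] by simp_all
  note [mlin] = cbl
  \<comment> \<open>x passes y1 and then m1; afterwards \<open>jj\<close> brings m1 back over x by
    the coaction. The last two passages are inverse to each other, so only the braiding of x with y1
    survives.\<close>
  have 1: "tlift ?P (\<lambda>w' x'. ?J w' (tn X L x' l2)) (cb X (htens Y L) x (tn Y L y1 m1)) =
      tn (Y \<otimes>\<^sub>k X) L (cb X Y x y1) (lmul m1 l2)"
    if c [mlin]: "x \<in> carrier X" "y1 \<in> carrier Y" "m1 \<in> carrier L" "l2 \<in> carrier L" for x y1 m1 l2
  proof -
    have "tlift ?P (\<lambda>w' x'. ?J w' (tn X L x' l2)) (cb X (htens Y L) x (tn Y L y1 m1)) =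
        tlift ?P (\<lambda>y2 x1. tlift ?P (\<lambda>m2 x2. ?J (tn Y L y2 m2) (tn X L x2 l2)) (cb X L x1 m1)) (cb X Y x y1)"
      by (rule cb_htensor_right) (rule mlin | assumption)+
    also have "\<dots> = tlift ?P (\<lambda>y2 x1. tlift ?P (\<lambda>m2 x2. tlift ?P (\<lambda>x3 m3. ins Y X y2 (tn X L x3 (lmul m3 l2)))
        (tau X m2 x2)) (cb X L x1 m1)) (cb X Y x y1)"
    proof (rule tlift_cong[of _ Y X], (rule mlin)+, rule tlift_cong[of _ L X], (rule mlin | assumption)+)
      fix y2 x1 m2 x2 assume [mlin]: "y2 \<in> carrier Y" "x1 \<in> carrier X" "m2 \<in> carrier L" "x2 \<in> carrier X"
      have "?J (tn Y L y2 m2) (tn X L x2 l2) = ins Y X y2 (rmul X (tau X m2 x2) l2)"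
        by (subst jj_ten, (rule mlin)+, subst la_ten, (rule mlin)+) simp
      also have "\<dots> = tlift ?P (\<lambda>x3 m3. ins Y X y2 (tn X L x3 (lmul m3 l2))) (tau X m2 x2)"
        unfolding rmul_def by (rule tlift_hom[of "X \<otimes>\<^sub>k L"]) (rule mlin | assumption)+
      finally show "?J (tn Y L y2 m2) (tn X L x2 l2) = \<dots>" .
    qed
    also have "\<dots> = tlift ?P (\<lambda>y2 x1. ins Y X y2 (tn X L x1 (lmul m1 l2))) (cb X Y x y1)"
      by (rule tlift_cong[of _ Y X], (rule mlin)+, rule db_cb) (rule mlin | assumption)+
    also have "\<dots> = tlift ?P (\<lambda>y2 x1. tn (Y \<otimes>\<^sub>k X) L (tn Y X y2 x1) (lmul m1 l2)) (cb X Y x y1)"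
      by (rule tlift_cong[of _ Y X], (rule mlin)+, rule ins_ten) (rule mlin | assumption)+
    also have "\<dots> = tn (Y \<otimes>\<^sub>k X) L (cb X Y x y1) (lmul m1 l2)"
      by (rule cop_hom[where f = "\<lambda>u. tn (Y \<otimes>\<^sub>k X) L u (lmul m1 l2)", symmetric]) (rule mlin)+
    finally show ?thesis .
  qed
  show ?thesis
  proof (rule tensor_ext[OF st(1), of ?P])
    fix x l assume xl [mlin]: "x \<in> carrier X" "l \<in> carrier L"
    show "tmap k (Y \<otimes>\<^sub>k X) L (cop X Y) (\<lambda>m. m) (jj X Y (tn X L x l) t) =
      tlift ?P ?J (cb (htens X L) (htens Y L) (tn X L x l) t)"
    proof (rule tensor_ext[OF st(2), of ?P])
      fix y m assume ym [mlin]: "y \<in> carrier Y" "m \<in> carrier L"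
      have "tlift ?P ?J (cb (htens X L) (htens Y L) (tn X L x l) (tn Y L y m)) =
          tlift ?P (\<lambda>w l2. tlift ?P (\<lambda>w' x'. ?J w' (tn X L x' l2)) (cb X (htens Y L) x w)) (cb L (htens Y L) l (tn Y L y m))"
        using Jb by (intro cb_htensor_left) (simp_all add: hm L_hmod xl ym ten_closed tensor_mod hmod_mod L_mod)
      also have "\<dots> = tlift ?P (\<lambda>y1 l1. tlift ?P (\<lambda>m1 l2. tlift ?P (\<lambda>w' x'. ?J w' (tn X L x' l2))
          (cb X (htens Y L) x (tn Y L y1 m1))) (cb L L l1 m)) (cb L Y l y)"
        by (rule cb_htensor_right) (rule mlin | assumption)+
      also have "\<dots> = tlift ?P (\<lambda>y1 l1. tlift ?P (\<lambda>m1 l2. tn (Y \<otimes>\<^sub>k X) L (cb X Y x y1) (lmul m1 l2))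
          (cb L L l1 m)) (cb L Y l y)"
        by (rule tlift_cong[of _ Y L], (rule mlin)+, rule tlift_cong[of _ L L], (rule mlin | assumption)+, rule 1)
          (rule mlin | assumption)+
      \<comment> \<open>The braiding of l1 with m is absorbed by the product in
        \<open>L\<close>.\<close>
      also have "\<dots> = tlift ?P (\<lambda>y1 l1. tn (Y \<otimes>\<^sub>k X) L (cb X Y x y1) (lmul l1 m)) (cb L Y l y)"
        by (rule tlift_cong[of _ Y L], (rule mlin)+, subst lmul_cb[symmetric], (rule mlin | assumption)+,
          rule tlift_hom[symmetric, of L]) (rule mlin | assumption)+
      also have "\<dots> = tlift ?P (\<lambda>y1 l1. tn (Y \<otimes>\<^sub>k X) L (cb X Y x y1) (lmul l1 m)) (tau Y l y)"
        by (simp add: MP_tau[OF Y] xl ym)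
      also have "\<dots> = tlift ?P (\<lambda>y1 l1. tmap k (Y \<otimes>\<^sub>k X) L (cop X Y) (\<lambda>m. m) (ins X Y x (tn Y L y1 (lmul l1 m)))) (tau Y l y)"
      proof (rule tlift_cong[of _ Y L])
        fix y1 l1 assume c [mlin]: "y1 \<in> carrier Y" "l1 \<in> carrier L"
        show "tn (Y \<otimes>\<^sub>k X) L (cb X Y x y1) (lmul l1 m) =
          tmap k (Y \<otimes>\<^sub>k X) L (cop X Y) (\<lambda>m. m) (ins X Y x (tn Y L y1 (lmul l1 m)))"
          by (subst ins_ten, (rule mlin)+, subst tmap_ten, (rule mlin)+) (simp add: cop_ten hm xl c)
      qed (rule mlin)+
      also have "\<dots> = tmap k (Y \<otimes>\<^sub>k X) L (cop X Y) (\<lambda>m. m) (ins X Y x (rmul Y (tau Y l y) m))"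
        unfolding rmul_def
        by (rule tlift_hom[symmetric, of "Y \<otimes>\<^sub>k L" _ "\<lambda>u. tmap k (Y \<otimes>\<^sub>k X) L (cop X Y) (\<lambda>m. m) (ins X Y x u)"])
          (rule mlin | assumption)+
      also have "\<dots> = tmap k (Y \<otimes>\<^sub>k X) L (cop X Y) (\<lambda>m. m) (jj X Y (tn X L x l) (tn Y L y m))"
        by (subst jj_ten, (rule mlin)+, subst la_ten, (rule mlin)+) simp
      finally show "tmap k (Y \<otimes>\<^sub>k X) L (cop X Y) (\<lambda>m. m) (jj X Y (tn X L x l) (tn Y L y m)) =
        tlift ?P ?J (cb (htens X L) (htens Y L) (tn X L x l) (tn Y L y m))" ..
    qed (rule mlin | assumption)+
  qed (rule mlin | assumption)+
qed

text \<open>By \<open>cop_jj\<close> the left side is the braiding of f x with g y as elements of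
  the modules X' \<otimes> L and Y' \<otimes> L. There f and g are ordinary equivariant maps, and
  naturality of the braiding of \<open>H\<close>-modules applies.\<close>

lemma braid_natural_D:
  assumes ob: "X \<in> MP" "X' \<in> MP" "Y \<in> MP" "Y' \<in> MP" and f: "f \<in> Hm X X'" and g: "g \<in> Hm Y Y'"
  shows "Cmp D (htens X Y) (htens X' Y') (htens Y' X') (dyn_braiding k H R L X' Y') (TenM D X X' Y Y' f g) =
    Cmp D (htens X Y) (htens Y X) (htens Y' X') (TenM D Y Y' X X' g f) (dyn_braiding k H R L X Y)"
    (is "?l = ?r")
proof -
  note h [mlin] = MP_hmod[OF ob(1)] MP_hmod[OF ob(2)] MP_hmod[OF ob(3)] MP_hmod[OF ob(4)]
  note br = braiding_eq[OF h(1,3)] braiding_eq[OF h(2,4)]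
  have b: "dyn_braiding k H R L X Y \<in> Hm (htens X Y) (htens Y X)"
    "dyn_braiding k H R L X' Y' \<in> Hm (htens X' Y') (htens Y' X')"
    unfolding br by (rule dh_Hm cop_hlin mlin)+
  show ?thesis
  proof (rule Hm_ext2)
    fix x y assume xy [mlin]: "x \<in> carrier X" "y \<in> carrier Y"
    have t: "tn X Y x y \<in> carrier (htens X Y)" by (rule mlin)+
    note c = lin_map_closed[OF Hm_lin[OF f] xy(1)] lin_map_closed[OF Hm_lin[OF g] xy(2)]
    let ?P = "Y' \<otimes>\<^sub>k X' \<otimes>\<^sub>k L"
    have "?l (tn X Y x y) = tmap k (htens Y' X') L (cop X' Y') (\<lambda>m. m) (TenM D X X' Y Y' f g (tn X Y x y))"
      unfolding br by (rule Cmp_dh_left_app[OF _ _ _ _ _ t]) (rule mlin TenM_Hm cop_hlin f g)+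
    also have "TenM D X X' Y Y' f g (tn X Y x y) = jj X' Y' (f x) (g y)"
      by (rule TenM_app) (rule mlin f g)+
    also have "tmap k (htens Y' X') L (cop X' Y') (\<lambda>m. m) \<dots> =
        tlift ?P (jj Y' X') (cb (htens X' L) (htens Y' L) (f x) (g y))"
      using cop_jj[OF ob(2,4) c] by simp
    also have "\<dots> = tlift ?P (\<lambda>y x. jj Y' X' (g y) (f x)) (cb X Y x y)"
      by (rule cb_natural[where f = f and g = g]) (simp | rule mlin Hm_hlin f g | assumption)+
    also have "\<dots> = tm Y' X' g f (cb X Y x y)" by (simp add: tm_def)
    also have "\<dots> = TenM D Y Y' X X' g f (cop X Y (tn X Y x y))"
      by (simp add: TenM_D h f g cop_ten xy cb_lin(3))
    also have "\<dots> = ?r (tn X Y x y)"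
      unfolding br by (rule Cmp_dh_right_app[OF _ _ _ _ _ t, symmetric]) (rule mlin TenM_Hm cop_hlin f g)+
    finally show "?l (tn X Y x y) = ?r (tn X Y x y)" .
  qed (rule Cmp_Hm TenM_Hm b f g mlin)+
qed

text \<open>All arrows come from equivariant maps through \<open>dh\<close>, so this is the hexagon
  of \<open>H\<close>-modules, which on pure tensors is \<open>cb_htensor_right\<close>.\<close>

lemma hexagon1_D:
  assumes [mlin]: "hmod X" "hmod Y" "hmod Z"
  shows "Cmp D (htens (htens X Y) Z) (htens (htens Y Z) X) (htens Y (htens Z X))
      (dh (htens (htens Y Z) X) (htens Y (htens Z X)) (assoc k Y Z X))
      (Cmp D (htens (htens X Y) Z) (htens X (htens Y Z)) (htens (htens Y Z) X)
        (dyn_braiding k H R L X (htens Y Z))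
        (dh (htens (htens X Y) Z) (htens X (htens Y Z)) (assoc k X Y Z))) =
    Cmp D (htens (htens X Y) Z) (htens Y (htens X Z)) (htens Y (htens Z X))
      (TenM D Y Y (htens X Z) (htens Z X) (dh Y Y id) (dyn_braiding k H R L X Z))
      (Cmp D (htens (htens X Y) Z) (htens (htens Y X) Z) (htens Y (htens X Z))
        (dh (htens (htens Y X) Z) (htens Y (htens X Z)) (assoc k Y X Z))
        (TenM D (htens X Y) (htens Y X) Z Z (dyn_braiding k H R L X Y) (dh Z Z id)))"
proof -
  have h: "hmod (htens X Y)" "hmod (htens Y X)" "hmod (htens Y Z)" "hmod (htens X Z)" "hmod (htens Z X)"
    "hmod (htens (htens X Y) Z)" "hmod (htens X (htens Y Z))" "hmod (htens (htens Y Z) X)"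
    "hmod (htens Y (htens Z X))" "hmod (htens (htens Y X) Z)" "hmod (htens Y (htens X Z))"
    by (rule mlin)+
  note a = assoc_hlin and c = cop_hlin
  note t1 = tmap_hlin[OF h(1) assms(3) h(2) assms(3) c[OF assms(1,2)] hlin_id']
    and t2 = tmap_hlin[OF assms(2) h(4) assms(2) h(5) hlin_id' c[OF assms(1,3)]]
  have al [mlin]: "lin (X \<otimes>\<^sub>k Y) (Y \<otimes>\<^sub>k X) (cop X Y)" "lin (X \<otimes>\<^sub>k Z) (Z \<otimes>\<^sub>k X) (cop X Z)"
    by (rule mlin | assumption)+
  have al' [mlin]: "lin Y Y id" "lin Z Z id" by (simp_all only: id_def) (rule mlin)+
  have cl: "lin M (Y \<otimes>\<^sub>k Z \<otimes>\<^sub>k X) (\<lambda>m. cop X (htens Y Z) (f m))" if "lin M (X \<otimes>\<^sub>k (Y \<otimes>\<^sub>k Z)) f"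
    for M :: "('a univ, 'a univ) module" and f
    using cop_lin[OF assms(1) h(3), of M f] that by simp
  note [mlin] = cl
  let ?P = "Y \<otimes>\<^sub>k (Z \<otimes>\<^sub>k X)"
  have eq: "assoc k Y Z X (cop X (htens Y Z) (assoc k X Y Z t)) =
    tmap k Y (Z \<otimes>\<^sub>k X) id (cop X Z) (assoc k Y X Z (tmap k (Y \<otimes>\<^sub>k X) Z (cop X Y) id t))"
    if t: "t \<in> carrier (X \<otimes>\<^sub>k Y \<otimes>\<^sub>k Z)" for t
  proof (rule tensor_ext3[OF t, of ?P])
    fix x y z assume xyz [mlin]: "x \<in> carrier X" "y \<in> carrier Y" "z \<in> carrier Z"
    let ?t = "tn (X \<otimes>\<^sub>k Y) Z (tn X Y x y) z"
    have yz: "tn Y Z y z \<in> carrier (htens Y Z)" by (rule mlin)+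
    have "assoc k Y Z X (cop X (htens Y Z) (assoc k X Y Z ?t)) =
        assoc k Y Z X (cb X (htens Y Z) x (tn Y Z y z))"
      using cop_ten[OF assms(1) h(3) xyz(1) yz] by (simp add: assoc_ten xyz assms hmod_mod)
    also have "\<dots> = tlift ?P (\<lambda>u x. assoc k Y Z X (tn (Y \<otimes>\<^sub>k Z) X u x)) (cb X (htens Y Z) x (tn Y Z y z))"
      using cop_hom[OF _ assms(1) h(3) _ xyz(1) yz, of ?P "assoc k Y Z X"] assoc_lin[OF lin_id, of Y Z X]
      by (simp add: tensor_mod hmod_mod assms)
    also have "\<dots> = tlift ?P (\<lambda>y' x'. tlift ?P (\<lambda>z' x''. assoc k Y Z X (tn (Y \<otimes>\<^sub>k Z) X (tn Y Z y' z') x'')) (cb X Z x' z)) (cb X Y x y)"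
      by (rule cb_htensor_right) (rule mlin | assumption)+
    also have "\<dots> = tlift ?P (\<lambda>y' x'. tlift ?P (\<lambda>z' x''. tn Y (Z \<otimes>\<^sub>k X) y' (tn Z X z' x'')) (cb X Z x' z)) (cb X Y x y)"
      by (rule tlift_cong[of _ Y X], (rule mlin)+, rule tlift_cong[of _ Z X], (rule mlin | assumption)+,
        rule assoc_ten) (rule mlin | assumption)+
    also have "\<dots> = tlift ?P (\<lambda>y' x'. tn Y (Z \<otimes>\<^sub>k X) y' (cb X Z x' z)) (cb X Y x y)"
      by (rule tlift_cong[of _ Y X], (rule mlin)+, rule cop_hom[symmetric]) (rule mlin | assumption)+
    also have "\<dots> = tlift ?P (\<lambda>y' x'. tmap k Y (Z \<otimes>\<^sub>k X) id (cop X Z) (assoc k Y X Z (tn (Y \<otimes>\<^sub>k X) Z (tn Y X y' x') z))) (cb X Y x y)"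
    proof (rule tlift_cong[of _ Y X])
      fix y' x' assume c' [mlin]: "y' \<in> carrier Y" "x' \<in> carrier X"
      show "tn Y (Z \<otimes>\<^sub>k X) y' (cb X Z x' z) =
        tmap k Y (Z \<otimes>\<^sub>k X) id (cop X Z) (assoc k Y X Z (tn (Y \<otimes>\<^sub>k X) Z (tn Y X y' x') z))"
        by (subst assoc_ten, (rule mlin)+, subst tmap_ten, (rule mlin)+) (simp add: cop_ten assms xyz c')
    qed (rule mlin)+
    also have "\<dots> = tmap k Y (Z \<otimes>\<^sub>k X) id (cop X Z) (assoc k Y X Z (tn (Y \<otimes>\<^sub>k X) Z (cb X Y x y) z))"
      by (rule cop_hom[symmetric, where f = "\<lambda>u. tmap k Y (Z \<otimes>\<^sub>k X) id (cop X Z) (assoc k Y X Z (tn (Y \<otimes>\<^sub>k X) Z u z))"])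
        (rule mlin | assumption)+
    also have "tn (Y \<otimes>\<^sub>k X) Z (cb X Y x y) z = tmap k (Y \<otimes>\<^sub>k X) Z (cop X Y) id ?t"
      by (subst tmap_ten, (rule mlin)+) (simp add: cop_ten assms xyz)
    finally show "assoc k Y Z X (cop X (htens Y Z) (assoc k X Y Z ?t)) =
      tmap k Y (Z \<otimes>\<^sub>k X) id (cop X Z) (assoc k Y X Z (tmap k (Y \<otimes>\<^sub>k X) Z (cop X Y) id ?t))" .
  qed (rule mlin | assumption)+
  show ?thesis
    unfolding braiding_eq[OF assms(1,2)] braiding_eq[OF assms(1,3)] braiding_eq[OF assms(1) h(3)]
      TenM_dh[OF h(1) assms(3) h(2) assms(3) c[OF assms(1,2)] hlin_id']
      TenM_dh[OF assms(2) h(4) assms(2) h(5) hlin_id' c[OF assms(1,3)]]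
      Cmp_dh_dh[OF h(6,10,11) t1 a[OF assms(2,1,3)]]
      Cmp_dh_dh[OF h(6,7,8) a[OF assms] c[OF assms(1) h(3)]]
      Cmp_dh_dh[OF h(6,11,9) hlin_comp[OF t1 a[OF assms(2,1,3)]] t2]
      Cmp_dh_dh[OF h(6,8,9) hlin_comp[OF a[OF assms] c[OF assms(1) h(3)]] a[OF assms(2,3,1)]]
    by (rule dh_cong) (use eq in simp)
qed

lemma assoc'_hlin: "hmod X \<Longrightarrow> hmod Y \<Longrightarrow> hmod Z \<Longrightarrow> hlin (htens X (htens Y Z)) (htens (htens X Y) Z) (assoc' X Y Z)"
  by (rule hlin_inverse[OF assoc_hlin]) (simp_all add: hmod_htensor hmod_mod assoc'_closed assoc_assoc' assoc'_assoc)

text \<open>The inverse constraints are evaluated as \<open>assoc'\<close> by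
  \<open>Assoc_iso_D\<close>; then the claim is \<open>cb_htensor_left\<close> on pure
  tensors.\<close>

lemma hexagon2_D:
  assumes ob: "X \<in> MP" "Y \<in> MP" "Z \<in> MP"
  shows "Cmp D (htens X (htens Y Z)) (htens Z (htens X Y)) (htens (htens Z X) Y)
      (inv_in D (htens (htens Z X) Y) (htens Z (htens X Y))
        (dh (htens (htens Z X) Y) (htens Z (htens X Y)) (assoc k Z X Y)))
      (Cmp D (htens X (htens Y Z)) (htens (htens X Y) Z) (htens Z (htens X Y))
        (dyn_braiding k H R L (htens X Y) Z)
        (inv_in D (htens (htens X Y) Z) (htens X (htens Y Z))
          (dh (htens (htens X Y) Z) (htens X (htens Y Z)) (assoc k X Y Z)))) =
    Cmp D (htens X (htens Y Z)) (htens (htens X Z) Y) (htens (htens Z X) Y)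
      (TenM D (htens X Z) (htens Z X) Y Y (dyn_braiding k H R L X Z) (dh Y Y id))
      (Cmp D (htens X (htens Y Z)) (htens X (htens Z Y)) (htens (htens X Z) Y)
        (inv_in D (htens (htens X Z) Y) (htens X (htens Z Y))
          (dh (htens (htens X Z) Y) (htens X (htens Z Y)) (assoc k X Z Y)))
        (TenM D X X (htens Y Z) (htens Z Y) (dh X X id) (dyn_braiding k H R L Y Z)))"
proof -
  note ass [mlin] = MP_hmod[OF ob(1)] MP_hmod[OF ob(2)] MP_hmod[OF ob(3)]
  have h: "hmod (htens X Y)" "hmod (htens Y Z)" "hmod (htens X Z)" "hmod (htens Z X)" "hmod (htens Z Y)"
    "hmod (htens X (htens Y Z))" "hmod (htens (htens X Y) Z)" "hmod (htens Z (htens X Y))"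
    "hmod (htens (htens Z X) Y)" "hmod (htens X (htens Z Y))" "hmod (htens (htens X Z) Y)"
    by (rule mlin)+
  note a = assoc'_hlin and c = cop_hlin
  note t1 = tmap_hlin[OF ass(1) h(2) ass(1) h(5) hlin_id' c[OF ass(2,3)]]
    and t2 = tmap_hlin[OF h(3) ass(2) h(4) ass(2) c[OF ass(1,3)] hlin_id']
  have al [mlin]: "lin (X \<otimes>\<^sub>k Z) (Z \<otimes>\<^sub>k X) (cop X Z)" "lin (Y \<otimes>\<^sub>k Z) (Z \<otimes>\<^sub>k Y) (cop Y Z)"
    by (rule mlin | assumption)+
  have al' [mlin]: "lin Y Y id" "lin X X id" by (simp_all only: id_def) (rule mlin)+
  have cl: "lin M (Z \<otimes>\<^sub>k (X \<otimes>\<^sub>k Y)) (\<lambda>m. cop (htens X Y) Z (f m))" if "lin M (X \<otimes>\<^sub>k Y \<otimes>\<^sub>k Z) f"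
    for M :: "('a univ, 'a univ) module" and f
    using cop_lin[OF h(1) ass(3), of M f] that by simp
  note [mlin] = cl
  let ?P = "Z \<otimes>\<^sub>k X \<otimes>\<^sub>k Y"
  have eq: "assoc' Z X Y (cop (htens X Y) Z (assoc' X Y Z t)) =
    tmap k (Z \<otimes>\<^sub>k X) Y (cop X Z) id (assoc' X Z Y (tmap k X (Z \<otimes>\<^sub>k Y) id (cop Y Z) t))"
    if t: "t \<in> carrier (X \<otimes>\<^sub>k (Y \<otimes>\<^sub>k Z))" for t
  proof (rule tensor_ext3'[OF t, of ?P])
    fix x y z assume xyz [mlin]: "x \<in> carrier X" "y \<in> carrier Y" "z \<in> carrier Z"
    let ?t = "tn X (Y \<otimes>\<^sub>k Z) x (tn Y Z y z)"
    have xy: "tn X Y x y \<in> carrier (htens X Y)" by (rule mlin)+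
    have "assoc' Z X Y (cop (htens X Y) Z (assoc' X Y Z ?t)) =
        assoc' Z X Y (cb (htens X Y) Z (tn X Y x y) z)"
      using cop_ten[OF h(1) ass(3) xy xyz(3)] by (simp add: assoc'_ten xyz ass hmod_mod)
    also have "\<dots> = tlift ?P (\<lambda>z u. assoc' Z X Y (tn Z (X \<otimes>\<^sub>k Y) z u)) (cb (htens X Y) Z (tn X Y x y) z)"
      using cop_hom[OF _ h(1) ass(3) _ xy xyz(3), of ?P "assoc' Z X Y"] assoc'_lin[OF lin_id, of Z X Y]
      by (simp add: tensor_mod hmod_mod ass)
    also have "\<dots> = tlift ?P (\<lambda>z' y'. tlift ?P (\<lambda>z'' x'. assoc' Z X Y (tn Z (X \<otimes>\<^sub>k Y) z'' (tn X Y x' y'))) (cb X Z x z')) (cb Y Z y z)"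
      by (rule cb_htensor_left) (rule mlin | assumption)+
    also have "\<dots> = tlift ?P (\<lambda>z' y'. tlift ?P (\<lambda>z'' x'. tn (Z \<otimes>\<^sub>k X) Y (tn Z X z'' x') y') (cb X Z x z')) (cb Y Z y z)"
      by (rule tlift_cong[of _ Z Y], (rule mlin)+, rule tlift_cong[of _ Z X], (rule mlin | assumption)+,
        rule assoc'_ten) (rule mlin | assumption)+
    also have "\<dots> = tlift ?P (\<lambda>z' y'. tn (Z \<otimes>\<^sub>k X) Y (cb X Z x z') y') (cb Y Z y z)"
      by (rule tlift_cong[of _ Z Y], (rule mlin)+, rule cop_hom[where f = "\<lambda>u. tn (Z \<otimes>\<^sub>k X) Y u _", symmetric])
        (rule mlin | assumption)+
    also have "\<dots> = tlift ?P (\<lambda>z' y'. tmap k (Z \<otimes>\<^sub>k X) Y (cop X Z) id (assoc' X Z Y (tn X (Z \<otimes>\<^sub>k Y) x (tn Z Y z' y')))) (cb Y Z y z)"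
    proof (rule tlift_cong[of _ Z Y])
      fix z' y' assume c' [mlin]: "z' \<in> carrier Z" "y' \<in> carrier Y"
      show "tn (Z \<otimes>\<^sub>k X) Y (cb X Z x z') y' =
        tmap k (Z \<otimes>\<^sub>k X) Y (cop X Z) id (assoc' X Z Y (tn X (Z \<otimes>\<^sub>k Y) x (tn Z Y z' y')))"
        by (subst assoc'_ten, (rule mlin)+, subst tmap_ten, (rule mlin)+) (simp add: cop_ten ass xyz c')
    qed (rule mlin)+
    also have "\<dots> = tmap k (Z \<otimes>\<^sub>k X) Y (cop X Z) id (assoc' X Z Y (tn X (Z \<otimes>\<^sub>k Y) x (cb Y Z y z)))"
      by (rule cop_hom[symmetric, where f = "\<lambda>u. tmap k (Z \<otimes>\<^sub>k X) Y (cop X Z) id (assoc' X Z Y (tn X (Z \<otimes>\<^sub>k Y) x u))"])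
        (rule mlin | assumption)+
    also have "tn X (Z \<otimes>\<^sub>k Y) x (cb Y Z y z) = tmap k X (Z \<otimes>\<^sub>k Y) id (cop Y Z) ?t"
      by (subst tmap_ten, (rule mlin)+) (simp add: cop_ten ass xyz)
    finally show "assoc' Z X Y (cop (htens X Y) Z (assoc' X Y Z ?t)) =
      tmap k (Z \<otimes>\<^sub>k X) Y (cop X Z) id (assoc' X Z Y (tmap k X (Z \<otimes>\<^sub>k Y) id (cop Y Z) ?t))" .
  qed (rule mlin | assumption)+
  show ?thesis
    unfolding braiding_eq[OF ass(1,3)] braiding_eq[OF ass(2,3)] braiding_eq[OF h(1) ass(3)]
      Assoc_iso_D(2)[OF ob(3,1,2)] Assoc_iso_D(2)[OF ob] Assoc_iso_D(2)[OF ob(1,3,2)]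
      TenM_dh[OF ass(1) h(2) ass(1) h(5) hlin_id' c[OF ass(2,3)]]
      TenM_dh[OF h(3) ass(2) h(4) ass(2) c[OF ass(1,3)] hlin_id']
      Cmp_dh_dh[OF h(6,10,11) t1 a[OF ass(1,3,2)]]
      Cmp_dh_dh[OF h(6,7,8) a[OF ass] c[OF h(1) ass(3)]]
      Cmp_dh_dh[OF h(6,11,9) hlin_comp[OF t1 a[OF ass(1,3,2)]] t2]
      Cmp_dh_dh[OF h(6,8,9) hlin_comp[OF a[OF ass] c[OF h(1) ass(3)]] a[OF ass(3,1,2)]]
    by (rule dh_cong) (use eq in simp)
qed

lemma braid_iso_D: "X \<in> MP \<Longrightarrow> Y \<in> MP \<Longrightarrow> iso_in D (htens X Y) (htens Y X) (dyn_braiding k H R L X Y)"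
  unfolding braiding_eq[OF MP_hmod MP_hmod]
  by (rule dh_iso(1)[where g = "dop X Y"])
    (simp_all add: MP_htensor cop_hlin MP_hmod dop_closed dop_cop cop_dop)

theorem braided_D: "braided_monoidal_category D (dyn_braiding k H R L)"
proof (intro braided_monoidal_category.intro monoidal_D braided_monoidal_category_axioms.intro; unfold D_simps)
qed (rule braid_iso_D braid_natural_D hexagon1_D hexagon2_D; (assumption | rule MP_hmod, assumption))+

section \<open>The smash product\<close>

abbreviation "S \<equiv> smash k H L"
abbreviation "LH \<equiv> L \<otimes>\<^sub>k H"

lemma smash_simps [simp]:
  "carrier S = carrier LH" "zero S = zero LH" "add S = add LH" "smult S = smult LH"
  "one S = tn L H \<one>\<^bsub>L\<^esub> \<one>\<^bsub>H\<^esub>"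
  by (simp_all add: smash_def tensor_one)

lemma smash_lin [simp]: "lin_map k S M f = lin_map k LH M f" "lin_map k M S g = lin_map k M LH g"
  by (simp_all add: lin_map_def)

text \<open>Modules over the smash product are \<open>H\<close>-modules with a compatible action of \<open>L\<close>. This is used
  for \<open>L \<otimes> H\<close> itself, where it yields the associativity of the smash product, for \<open>L\<close> and for \<open>X \<otimes> L\<close>.\<close>

definition compat :: "('a univ, 'a univ, 'a univ) amod \<Rightarrow> ('a univ \<Rightarrow> 'a univ \<Rightarrow> 'a univ) \<Rightarrow> bool" where
  "compat V A \<longleftrightarrow> hmod V \<and> bil k L V V A \<and> (\<forall>v\<in>carrier V. A \<one>\<^bsub>L\<^esub> v = v) \<and>
    (\<forall>l\<in>carrier L. \<forall>m\<in>carrier L. \<forall>v\<in>carrier V. A (lmul l m) v = A l (A m v)) \<and>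
    (\<forall>h\<in>carrier H. \<forall>l\<in>carrier L. \<forall>v\<in>carrier V.
      act V h (A l v) = tlift V (\<lambda>h1 h2. A (act L h1 l) (act V h2 v)) (\<Delta> h))"

definition "sact V A a v = tlift V (\<lambda>l h. A l (act V h v)) a"

lemma sact_ten:
  assumes "compat V A" "l \<in> carrier L" "h \<in> carrier H" "v \<in> carrier V"
  shows "sact V A (tn L H l h) v = A l (act V h v)"
proof -
  have [mlin]: "hmod V" and b: "bil k L V V A" using assms(1) by (auto simp: compat_def)
  note [mlin] = bil_left[OF b] bil_right[OF b]
  show ?thesis unfolding sact_def by (rule tlift_ten) (rule mlin assms(2-4) | assumption)+
qed

lemma sact_bil:
  assumes "compat V A"
  shows "bil k LH V V (sact V A)"
proof -
  have [mlin]: "hmod V" and b: "bil k L V V A" using assms(1) by (auto simp: compat_def)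
  note [mlin] = bil_left[OF b] bil_right[OF b]
  show ?thesis unfolding sact_def by (rule mlin | assumption)+
qed

lemma smash_mult:
  "a \<otimes>\<^bsub>S\<^esub> b = tlift LH (\<lambda>l f. tlift LH (\<lambda>m g. tlift LH
     (\<lambda>f1 f2. tn L H (lmul l (act L f1 m)) (f2 \<otimes>\<^bsub>H\<^esub> g)) (\<Delta> f)) b) a"
  by (simp add: smash_def)

lemma smash_mult_bil: "bil k LH LH LH (\<lambda>a b. a \<otimes>\<^bsub>S\<^esub> b)"
  unfolding smash_mult by (rule mlin | assumption)+

lemmas smash_mult_lin = bil_left[OF smash_mult_bil] bil_right[OF smash_mult_bil] bil_closed[OF smash_mult_bil]

lemma smash_mult_ten:
  assumes "l \<in> carrier L" "f \<in> carrier H" "m \<in> carrier L" "g \<in> carrier H"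
  shows "tn L H l f \<otimes>\<^bsub>S\<^esub> tn L H m g =
    tlift LH (\<lambda>f1 f2. tn L H (lmul l (act L f1 m)) (f2 \<otimes>\<^bsub>H\<^esub> g)) (\<Delta> f)"
  unfolding smash_mult
  by (subst tlift_ten, (rule mlin assms | assumption)+, rule tlift_ten) (rule mlin assms | assumption)+

text \<open>The exchange relation in \<open>compat\<close> is what the product of 1 \<otimes> f with
  m \<otimes> 1 requires; the other factors are multiplicativity of the two given actions.\<close>

lemma sact_mult:
  assumes C: "compat V A" and a: "a \<in> carrier LH" and b: "b \<in> carrier LH" and v [mlin]: "v \<in> carrier V"
  shows "sact V A (a \<otimes>\<^bsub>S\<^esub> b) v = sact V A a (sact V A b v)"
proof -
  have V [mlin]: "hmod V" and A: "bil k L V V A" using C by (auto simp: compat_def)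
  note [mlin] = bil_left[OF A] bil_right[OF A] bil_closed[OF A]
  note sb = sact_bil[OF C]
  note [mlin] = bil_left[OF sb] bil_right[OF sb] bil_closed[OF sb] smash_mult_lin
  show ?thesis
  proof (rule tensor_ext[OF a, of V])
    fix l f assume lf [mlin]: "l \<in> carrier L" "f \<in> carrier H"
    show "sact V A (tn L H l f \<otimes>\<^bsub>S\<^esub> b) v = sact V A (tn L H l f) (sact V A b v)"
    proof (rule tensor_ext[OF b, of V])
      fix m g assume mg [mlin]: "m \<in> carrier L" "g \<in> carrier H"
      have "sact V A (tn L H l f \<otimes>\<^bsub>S\<^esub> tn L H m g) v =
          tlift V (\<lambda>f1 f2. sact V A (tn L H (lmul l (act L f1 m)) (f2 \<otimes>\<^bsub>H\<^esub> g)) v) (\<Delta> f)"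
        by (subst smash_mult_ten, (rule mlin)+, rule tlift_hom[of LH _ "\<lambda>u. sact V A u v"]) (rule mlin | assumption)+
      also have "\<dots> = tlift V (\<lambda>f1 f2. A l (A (act L f1 m) (act V f2 (act V g v)))) (\<Delta> f)"
        by (rule tlift_cong[of _ H H], (rule mlin)+, subst sact_ten[OF C], (rule mlin | assumption)+)
          (use C in \<open>simp add: compat_def lf mg v hact_closed V L_hmod amodule.act_mult[OF V]\<close>)
      also have "\<dots> = A l (tlift V (\<lambda>f1 f2. A (act L f1 m) (act V f2 (act V g v))) (\<Delta> f))"
        by (rule tlift_hom[symmetric, of V]) (rule mlin | assumption)+
      also have "tlift V (\<lambda>f1 f2. A (act L f1 m) (act V f2 (act V g v))) (\<Delta> f) = act V f (A m (act V g v))"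
        using C by (simp add: compat_def lf mg v hact_closed V)
      also have "A l \<dots> = sact V A (tn L H l f) (sact V A (tn L H m g) v)"
        by (subst sact_ten[OF C], (rule mlin)+, subst sact_ten[OF C], (rule mlin)+) simp
      finally show "sact V A (tn L H l f \<otimes>\<^bsub>S\<^esub> tn L H m g) v = \<dots>" .
    qed (rule mlin | assumption)+
  qed (rule mlin b | assumption)+
qed

lemma sact_one:
  assumes C: "compat V A" and "v \<in> carrier V"
  shows "sact V A \<one>\<^bsub>S\<^esub> v = v"
proof -
  have V: "hmod V" using C by (auto simp: compat_def)
  have "sact V A \<one>\<^bsub>S\<^esub> v = A \<one>\<^bsub>L\<^esub> (act V \<one>\<^bsub>H\<^esub> v)"
    unfolding smash_simps by (rule sact_ten[OF C]) (rule mlin assms(2))+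
  then show ?thesis using C assms(2) by (simp add: compat_def amodule.act_one[OF V])
qed

text \<open>The left regular module, so that \<open>htens L Hreg\<close> carries the action of
  \<open>H\<close> on L \<otimes> H occurring in the product of the smash algebra.\<close>

definition "Hreg = with_act H (\<lambda>h g. h \<otimes>\<^bsub>H\<^esub> g)"

lemma Hreg_simps [simp]:
  "carrier Hreg = carrier H" "tensor k X Hreg = tensor k X H" "ten k X Hreg = ten k X H"
  "act Hreg h g = h \<otimes>\<^bsub>H\<^esub> g"
  by (simp_all add: Hreg_def)

lemma hmod_Hreg: "hmod Hreg"
proof -
  interpret H: assoc_algebra k H by (rule H_alg)
  show ?thesis
  proof (rule amoduleI)
    show "kmod Hreg" unfolding Hreg_def by (rule mlin)+
    show "bil k H Hreg Hreg (act Hreg)" using mult_bil[OF H_alg] by (simp add: bil_def Hreg_def)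
  qed (simp_all add: H.A.m_assoc)
qed

definition "llm l t = tlift LH (\<lambda>m g. tn L H (lmul l m) g) t"

lemma llm_ten: "l \<in> carrier L \<Longrightarrow> m \<in> carrier L \<Longrightarrow> g \<in> carrier H \<Longrightarrow> llm l (tn L H m g) = tn L H (lmul l m) g"
  unfolding llm_def by (rule tlift_ten) (rule mlin | assumption)+

lemma compat_llm: "compat (htens L Hreg) llm"
  unfolding compat_def
proof (intro conjI ballI)
  let ?V = "htens L Hreg"
  show V: "hmod ?V" by (rule mlin hmod_Hreg)+
  have b: "bil k L LH LH llm" unfolding llm_def by (rule mlin | assumption)+
  then show "bil k L ?V ?V llm" by (simp add: bil_def)
  note [mlin] = bil_left[OF b] bil_right[OF b] bil_closed[OF b]
  have vl: "lin M LH (\<lambda>m. act ?V h (f m))" if "h \<in> carrier H" "lin M LH f" for M :: "('a univ, 'a univ) module" and f h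
    using htensor_act_lin_right[OF L_hmod hmod_Hreg that(1), of M f] that(2) by simp
  have vl': "lin M LH (\<lambda>m. act ?V (f m) t)" if "lin M H f" "t \<in> carrier LH" for M :: "('a univ, 'a univ) hopf" and f t
    using htensor_act_lin_left[OF L_hmod hmod_Hreg that(1), of t] that(2) by simp
  have vc: "act ?V h t \<in> carrier LH" if "h \<in> carrier H" "t \<in> carrier LH" for h t
    using htensor_act_closed[OF L_hmod hmod_Hreg that(1), of t] that(2) by simp
  have va: "act ?V h (tn L H m g) = tlift LH (\<lambda>h1 h2. tn L H (act L h1 m) (h2 \<otimes>\<^bsub>H\<^esub> g)) (\<Delta> h)"
    if "h \<in> carrier H" "m \<in> carrier L" "g \<in> carrier H" for h m g
    using htensor_act_ten[OF L_hmod hmod_Hreg that(1,2), of g] that(3) by simp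
  note [mlin] = vl vl' vc
  {
    fix v assume "v \<in> carrier ?V"
    then have v: "v \<in> carrier LH" by simp
    show "llm \<one>\<^bsub>L\<^esub> v = v"
      by (rule tensor_ext[OF v, of LH]) ((rule mlin | assumption)+, simp add: llm_ten one_closed[OF L_alg] lmul_one)
    fix l m assume lm [mlin]: "l \<in> carrier L" "m \<in> carrier L"
    show "llm (lmul l m) v = llm l (llm m v)"
      by (rule tensor_ext[OF v, of LH])
        ((rule mlin | assumption)+, simp add: llm_ten lm mult_closed[OF L_alg] lmul_assoc)
  }
  fix h l v assume hl [mlin]: "h \<in> carrier H" "l \<in> carrier L" and "v \<in> carrier ?V"
  then have v: "v \<in> carrier LH" by simp
  have "act ?V h (llm l v) = tlift LH (\<lambda>h1 h2. llm (act L h1 l) (act ?V h2 v)) (\<Delta> h)"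
  proof (rule tensor_ext[OF v, of LH])
    fix m g assume mg [mlin]: "m \<in> carrier L" "g \<in> carrier H"
    have "act ?V h (llm l (tn L H m g)) = tlift LH (\<lambda>h1 h2. tn L H (act L h1 (lmul l m)) (h2 \<otimes>\<^bsub>H\<^esub> g)) (\<Delta> h)"
      by (subst llm_ten, (rule mlin)+, rule va) (rule mlin)+
    also have "\<dots> = tlift LH (\<lambda>h1 h2. tlift LH (\<lambda>a b. tn L H (lmul (act L a l) (act L b m)) (h2 \<otimes>\<^bsub>H\<^esub> g)) (\<Delta> h1)) (\<Delta> h)"
      by (rule tlift_cong[of _ H H], (rule mlin)+, subst L_act_mult, (rule mlin | assumption)+,
        rule tlift_hom[of L _ "\<lambda>u. tn L H u _"]) (rule mlin | assumption)+
    also have "\<dots> = tlift LH (\<lambda>h1 h2. tlift LH (\<lambda>a b. tn L H (lmul (act L h1 l) (act L a m)) (b \<otimes>\<^bsub>H\<^esub> g)) (\<Delta> h2)) (\<Delta> h)"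
      by (rule tlift_comul_assoc) (rule mlin | assumption)+
    also have "\<dots> = tlift LH (\<lambda>h1 h2. tlift LH (\<lambda>a b. llm (act L h1 l) (tn L H (act L a m) (b \<otimes>\<^bsub>H\<^esub> g))) (\<Delta> h2)) (\<Delta> h)"
      by (rule tlift_cong[of _ H H], (rule mlin)+, rule tlift_cong[of _ H H], (rule mlin | assumption)+,
        rule llm_ten[symmetric]) (rule mlin | assumption)+
    also have "\<dots> = tlift LH (\<lambda>h1 h2. llm (act L h1 l) (act ?V h2 (tn L H m g))) (\<Delta> h)"
      by (rule tlift_cong[of _ H H], (rule mlin)+, subst va, (rule mlin | assumption)+,
        rule tlift_hom[symmetric, of LH]) (rule mlin | assumption)+
    finally show "act ?V h (llm l (tn L H m g)) = \<dots>" .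
  qed (rule mlin | assumption)+
  then show "act ?V h (llm l v) = tlift ?V (\<lambda>h1 h2. llm (act L h1 l) (act ?V h2 v)) (\<Delta> h)" by simp
qed

lemma smash_mult_sact:
  assumes "a \<in> carrier LH" "b \<in> carrier LH"
  shows "a \<otimes>\<^bsub>S\<^esub> b = sact (htens L Hreg) llm a b"
proof -
  note sb = sact_bil[OF compat_llm]
  have sl: "lin LH LH (\<lambda>a. sact (htens L Hreg) llm a b)" "\<And>a. a \<in> carrier LH \<Longrightarrow> lin LH LH (sact (htens L Hreg) llm a)"
    if "b \<in> carrier LH" for b
    using sb that by (auto simp: bil_def)
  show ?thesis
  proof (rule tensor_ext[OF assms(1), of LH])
    fix l f assume lf [mlin]: "l \<in> carrier L" "f \<in> carrier H"
    show "tn L H l f \<otimes>\<^bsub>S\<^esub> b = sact (htens L Hreg) llm (tn L H l f) b"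
    proof (rule tensor_ext[OF assms(2), of LH])
      fix m g assume mg [mlin]: "m \<in> carrier L" "g \<in> carrier H"
      have c: "tn L H m g \<in> carrier (htens L Hreg)" using mg by (simp add: ten_closed)
      have "sact (htens L Hreg) llm (tn L H l f) (tn L H m g) = llm l (act (htens L Hreg) f (tn L H m g))"
        by (rule sact_ten[OF compat_llm lf c])
      also have "act (htens L Hreg) f (tn L H m g) = tlift LH (\<lambda>h1 h2. tn L H (act L h1 m) (h2 \<otimes>\<^bsub>H\<^esub> g)) (\<Delta> f)"
        using htensor_act_ten[OF L_hmod hmod_Hreg lf(2) mg(1), of g] mg by simp
      also have "llm l \<dots> = tlift LH (\<lambda>h1 h2. llm l (tn L H (act L h1 m) (h2 \<otimes>\<^bsub>H\<^esub> g))) (\<Delta> f)"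
        unfolding llm_def by (rule tlift_hom[of LH]) (rule mlin | assumption)+
      also have "\<dots> = tlift LH (\<lambda>h1 h2. tn L H (lmul l (act L h1 m)) (h2 \<otimes>\<^bsub>H\<^esub> g)) (\<Delta> f)"
        by (rule tlift_cong[of _ H H], (rule mlin)+, rule llm_ten) (rule mlin | assumption)+
      finally show "tn L H l f \<otimes>\<^bsub>S\<^esub> tn L H m g = sact (htens L Hreg) llm (tn L H l f) (tn L H m g)"
        by (simp add: smash_mult_ten lf mg)
    qed (rule mlin smash_mult_lin sl(2)[OF assms(2)] assms | assumption)+
  qed (rule mlin smash_mult_lin sl(1) assms | assumption)+
qed

lemma S_alg: "assoc_algebra k S"
proof -
  interpret T: module k LH by (rule mlin)+
  interpret H: assoc_algebra k H by (rule H_alg)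
  have m: "kmod S" by (rule module_cong[OF T.module_axioms]) simp_all
  interpret S: module k S by (rule m)
  note bl = smash_mult_bil
  note sm = smash_mult_sact
  have one: "\<one>\<^bsub>S\<^esub> \<in> carrier LH" unfolding smash_simps by (rule mlin)+
  \<comment> \<open>Associativity and the left unit come from the action on L \<otimes> H, but the
    right unit does not. It is checked directly: \<open>H\<close> acts on the unit of
    \<open>L\<close> through the counit.\<close>
  have r1: "x \<otimes>\<^bsub>S\<^esub> \<one>\<^bsub>S\<^esub> = x" if x: "x \<in> carrier LH" for x
  proof (rule tensor_ext[OF x, of LH])
    fix l h assume lh [mlin]: "l \<in> carrier L" "h \<in> carrier H"
    have "tn L H l h \<otimes>\<^bsub>S\<^esub> \<one>\<^bsub>S\<^esub> = tlift LH (\<lambda>f1 f2. tn L H (lmul l (act L f1 \<one>\<^bsub>L\<^esub>)) (f2 \<otimes>\<^bsub>H\<^esub> \<one>\<^bsub>H\<^esub>)) (\<Delta> h)"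
      unfolding smash_simps by (rule smash_mult_ten) (rule mlin)+
    also have "\<dots> = tlift LH (\<lambda>f1 f2. \<epsilon> f1 \<odot>\<^bsub>LH\<^esub> tn L H l f2) (\<Delta> h)"
      by (rule tlift_cong[of _ H H], (rule mlin)+)
        (use L_one_trivial in \<open>simp add: trivial_def assoc_algebra.smult_mult_right[OF L_alg] lh lmul_one
          ten_smult L_mod H_mod counit_closed\<close>)
    also have "\<dots> = tn L H l h"
      by (rule tlift_counit_left) (rule mlin | assumption)+
    finally show "tn L H l h \<otimes>\<^bsub>S\<^esub> \<one>\<^bsub>S\<^esub> = tn L H l h" .
  qed (rule mlin smash_mult_lin one | assumption)+
  show ?thesis
  proof (intro assoc_algebra.intro m assoc_algebra_axioms.intro ringI S.abelian_group_axioms monoidI)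
    fix x y assume "x \<in> carrier S" "y \<in> carrier S"
    then show "x \<otimes>\<^bsub>S\<^esub> y \<in> carrier S" using bil_closed[OF bl] by simp
  next
    show "\<one>\<^bsub>S\<^esub> \<in> carrier S" using one by simp
  next
    fix x y z assume xyz: "x \<in> carrier S" "y \<in> carrier S" "z \<in> carrier S"
    then show "x \<otimes>\<^bsub>S\<^esub> y \<otimes>\<^bsub>S\<^esub> z = x \<otimes>\<^bsub>S\<^esub> (y \<otimes>\<^bsub>S\<^esub> z)"
      using sact_mult[OF compat_llm, of x y z] sm[of "x \<otimes>\<^bsub>S\<^esub> y" z] sm[of x "y \<otimes>\<^bsub>S\<^esub> z"] sm[of y z]
        bil_closed[OF bl, of x y] bil_closed[OF bl, of y z] by simp
    show "(x \<oplus>\<^bsub>S\<^esub> y) \<otimes>\<^bsub>S\<^esub> z = x \<otimes>\<^bsub>S\<^esub> z \<oplus>\<^bsub>S\<^esub> y \<otimes>\<^bsub>S\<^esub> z" "z \<otimes>\<^bsub>S\<^esub> (x \<oplus>\<^bsub>S\<^esub> y) = z \<otimes>\<^bsub>S\<^esub> x \<oplus>\<^bsub>S\<^esub> z \<otimes>\<^bsub>S\<^esub> y"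
      using bl xyz by (auto simp: bil_def lin_map_def)
  next
    fix x assume x: "x \<in> carrier S"
    show "\<one>\<^bsub>S\<^esub> \<otimes>\<^bsub>S\<^esub> x = x"
      using sact_one[OF compat_llm, of x] sm[OF one, of x] x by simp
    show "x \<otimes>\<^bsub>S\<^esub> \<one>\<^bsub>S\<^esub> = x" using r1 x by simp
  next
    fix r x y assume "r \<in> carrier k" "x \<in> carrier S" "y \<in> carrier S"
    then show "(r \<odot>\<^bsub>S\<^esub> x) \<otimes>\<^bsub>S\<^esub> y = r \<odot>\<^bsub>S\<^esub> (x \<otimes>\<^bsub>S\<^esub> y)" "x \<otimes>\<^bsub>S\<^esub> (r \<odot>\<^bsub>S\<^esub> y) = r \<odot>\<^bsub>S\<^esub> (x \<otimes>\<^bsub>S\<^esub> y)"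
      using bl by (auto simp: bil_def lin_map_def)
  qed
qed

text \<open>Restricted in both arguments because the objects of \<open>mod_cat\<close> are
  extensional. Both \<Xi> X (\<open>Xi_SM\<close>) and the unit object (\<open>lunit_SM\<close>)
  have this form.\<close>

definition "SM V A = with_act V (\<lambda>a\<in>carrier S. restrict (sact V A a) (carrier V))"

lemma SM_act: "a \<in> carrier LH \<Longrightarrow> v \<in> carrier V \<Longrightarrow> act (SM V A) a v = sact V A a v"
  by (simp add: SM_def)

lemma SM_simps [simp]:
  "carrier (SM V A) = carrier V" "zero (SM V A) = zero V" "add (SM V A) = add V" "smult (SM V A) = smult V"
  by (simp_all add: SM_def)

lemma SM_amodule:
  assumes C: "compat V A"
  shows "amodule k S (SM V A)"
proof -
  have V: "hmod V" using C by (auto simp: compat_def)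
  note sb = sact_bil[OF C]
  have one: "\<one>\<^bsub>S\<^esub> \<in> carrier LH" by (simp add: ten_closed one_closed[OF L_alg] one_closed[OF H_alg])
  have cg: "lin_map k LH V (\<lambda>a. act (SM V A) a v)" if "v \<in> carrier V" for v
    by (rule lin_map_cong[of _ _ _ "\<lambda>a. sact V A a v"]) (use sb that in \<open>auto simp: bil_def SM_act L_mod H_mod tensor_mod\<close>)
  have cg': "lin_map k V V (act (SM V A) a)" if "a \<in> carrier LH" for a
    by (rule lin_map_cong[of _ _ _ "sact V A a"]) (use sb that V in \<open>auto simp: bil_def SM_act hmod_mod\<close>)
  show ?thesis
  proof (rule amoduleI)
    show "kmod (SM V A)" unfolding SM_def by (rule module_with_act hmod_mod V)+
    show "bil k S (SM V A) (SM V A) (act (SM V A))"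
      using cg cg' by (simp add: bil_def) (simp add: lin_map_def)
    show "act (SM V A) (a \<otimes>\<^bsub>S\<^esub> b) x = act (SM V A) a (act (SM V A) b x)"
      if "a \<in> carrier S" "b \<in> carrier S" "x \<in> carrier (SM V A)" for a b x
      using that sact_mult[OF C, of a b x] smash_mult_lin(3)[of a b] bil_closed[OF sb, of b x] by (simp add: SM_act)
    show "act (SM V A) \<one>\<^bsub>S\<^esub> x = x" if "x \<in> carrier (SM V A)" for x
      using that sact_one[OF C, of x] one by (simp add: SM_act)
  qed
qed

lemma SM_Ob: "compat V A \<Longrightarrow> SM V A \<in> Ob (mod_cat k S)"
  using SM_amodule[of V A] by (auto simp: mod_cat_def SM_def)

lemma SM_src: "compat V A \<Longrightarrow> l \<in> carrier L \<Longrightarrow> v \<in> carrier V \<Longrightarrow> act (SM V A) (src k H L l) v = A l v"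
  unfolding src_def using amodule.act_one[of k H V v]
  by (simp add: SM_act sact_ten ten_closed one_closed[OF H_alg]) (simp add: compat_def)

lemma src_closed: "l \<in> carrier L \<Longrightarrow> src k H L l \<in> carrier LH"
  unfolding src_def by (rule mlin | assumption)+

text \<open>The elements 1 \<otimes> h and l \<otimes> 1 act as h and l, which gives one direction.
  Conversely l \<otimes> h acts as h followed by l.\<close>

lemma SM_ahom:
  assumes V: "compat V A" and W: "compat W B"
  shows "f \<in> ahom k S (SM V A) (SM W B) \<longleftrightarrow> f \<in> extensional (carrier V) \<and> hlin V W f \<and>
    (\<forall>l\<in>carrier L. \<forall>v\<in>carrier V. f (A l v) = B l (f v))" (is "?l \<longleftrightarrow> ?r")
proof
  have hV [mlin]: "hmod V" and bV: "bil k L V V A" and A1: "\<And>v. v \<in> carrier V \<Longrightarrow> A \<one>\<^bsub>L\<^esub> v = v"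
    using V by (auto simp: compat_def)
  have hW [mlin]: "hmod W" and bW: "bil k L W W B" and B1: "\<And>v. v \<in> carrier W \<Longrightarrow> B \<one>\<^bsub>L\<^esub> v = v"
    using W by (auto simp: compat_def)
  note [mlin] = bil_left[OF bV] bil_right[OF bV] bil_closed[OF bV] bil_left[OF bW] bil_right[OF bW] bil_closed[OF bW]
  {
    assume f: ?l
    then have l: "lin V W f" and e: "f \<in> extensional (carrier V)"
      by (auto simp: ahom_def lin_map_def PiE_def)
    have c: "f v \<in> carrier W" if "v \<in> carrier V" for v using lin_map_closed[OF l that] .
    have eq: "f (sact V A a v) = sact W B a (f v)" if "a \<in> carrier LH" "v \<in> carrier V" for a v
      using f that c by (auto simp: ahom_def SM_act)
    have "f (act V h v) = act W h (f v)" if "h \<in> carrier H" "v \<in> carrier V" for h v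
      using eq[of "tn L H \<one>\<^bsub>L\<^esub> h" v] that
      by (simp add: ten_closed one_closed[OF L_alg] sact_ten[OF V] sact_ten[OF W] c A1 B1 hact_closed hV hW)
    moreover have "f (A l v) = B l (f v)" if "l \<in> carrier L" "v \<in> carrier V" for l v
      using eq[of "tn L H l \<one>\<^bsub>H\<^esub>" v] that
      by (simp add: ten_closed one_closed[OF H_alg] sact_ten[OF V] sact_ten[OF W] c amodule.act_one[OF hV] amodule.act_one[OF hW])
    ultimately show ?r using l e by (simp add: hlin_def)
  }
  assume f: ?r
  then have hf: "hlin V W f" and l [mlin]: "lin V W f" by (auto simp: hlin_def)
  note [mlin] = lin_map_comp[OF _ l] lin_map_closed[OF l]
  have "f (act (SM V A) a v) = act (SM W B) a (f v)" if a: "a \<in> carrier LH" and v [mlin]: "v \<in> carrier V" for a v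
  proof -
    have "f (sact V A a v) = tlift W (\<lambda>l h. f (A l (act V h v))) a"
      unfolding sact_def by (rule tlift_hom[of V]) (rule mlin a | assumption)+
    also have "\<dots> = sact W B a (f v)"
      unfolding sact_def by (rule tlift_cong[OF a], (rule mlin)+)
        (use f v in \<open>simp add: hact_closed hV hlin_act[OF hf]\<close>)
    finally show ?thesis using a v lin_map_closed[OF l v] by (simp add: SM_act)
  qed
  then show ?l using f lin_map_closed[OF l] by (auto simp: ahom_def PiE_def lin_map_def hlin_def)
qed

lemma compat_la: "hmod X \<Longrightarrow> compat (htens X L) (la X)"
  unfolding compat_def
  by (intro conjI) (rule mlin | assumption | simp add: la_one la_mult la_act)+

lemma compat_lmul: "compat L lmul"
  unfolding compat_def using L_act_mult mult_bil[OF L_alg] by (simp add: L_hmod lmul_one lmul_assoc)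

lemma with_act_with_act [simp]: "with_act (with_act M f) g = with_act M g"
  by (simp add: with_act_def)

lemma Xi_SM: "Xi k H R L X = SM (htens X L) (la X)"
  unfolding Xi_def smash_act_def SM_def sact_def[abs_def] by (simp add: htensor_def)

lemma counit_mult: "a \<in> carrier H \<Longrightarrow> b \<in> carrier H \<Longrightarrow> \<epsilon> (a \<otimes>\<^bsub>H\<^esub> b) = \<epsilon> a \<otimes>\<^bsub>k\<^esub> \<epsilon> b"
  by (rule hopf_algebra.counit_mult[OF hopf])

text \<open>The product of l \<otimes> h with m \<otimes> 1 is l (h1 m) \<otimes> h2, and the counit
  contracts h2. So the unit object is \<open>L\<close> with \<open>H\<close> acting as given and
  \<open>L\<close> by left multiplication.\<close>

lemma lunit_SM: "lunit_mod k H L = SM L lmul"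
proof -
  have t: "with_act (module.truncate L) f = with_act L f" for f :: "'a univ \<Rightarrow> 'a univ \<Rightarrow> 'a univ"
    by (simp add: with_act_def module.truncate_def)
  interpret k: cring k by (rule cring_k)
  have bl: "lin LH L (bcounit H L)" unfolding bcounit_def by (rule mlin | assumption)+
  have "bcounit H L (a \<otimes>\<^bsub>S\<^esub> src k H L m) = sact L lmul a m"
    if a: "a \<in> carrier LH" and m [mlin]: "m \<in> carrier L" for a m
  proof (rule tensor_ext[OF a, of L])
    show "lin LH L (\<lambda>a. bcounit H L (a \<otimes>\<^bsub>S\<^esub> src k H L m))"
      by (rule lin_map_comp[OF _ bl]) (rule smash_mult_lin lin_id src_closed m)+
    show "lin LH L (\<lambda>a. sact L lmul a m)"
      by (rule bil_left[OF sact_bil[OF compat_lmul] lin_id m])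
    fix l h assume lh [mlin]: "l \<in> carrier L" "h \<in> carrier H"
    have "bcounit H L (tn L H l h \<otimes>\<^bsub>S\<^esub> src k H L m) =
        tlift L (\<lambda>h1 h2. bcounit H L (tn L H (lmul l (act L h1 m)) (h2 \<otimes>\<^bsub>H\<^esub> \<one>\<^bsub>H\<^esub>))) (\<Delta> h)"
      unfolding src_def
      by (subst smash_mult_ten, (rule mlin)+, rule tlift_hom[OF bl]) (rule mlin | assumption)+
    also have "\<dots> = tlift L (\<lambda>h1 h2. \<epsilon> (h2 \<otimes>\<^bsub>H\<^esub> \<one>\<^bsub>H\<^esub>) \<odot>\<^bsub>L\<^esub> lmul l (act L h1 m)) (\<Delta> h)"
      unfolding bcounit_def
      by (rule tlift_cong[of _ H H], (rule mlin)+, rule tlift_ten) (rule mlin | assumption)+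
    also have "\<dots> = tlift L (\<lambda>h1 h2. \<epsilon> h2 \<odot>\<^bsub>L\<^esub> lmul l (act L h1 m)) (\<Delta> h)"
      by (rule tlift_cong[of _ H H], (rule mlin)+)
        (simp add: counit_mult one_closed[OF H_alg] hopf_algebra.counit_one[OF hopf] counit_closed)
    also have "\<dots> = lmul l (act L h m)"
      by (rule tlift_counit_right) (rule mlin | assumption)+
    finally show "bcounit H L (tn L H l h \<otimes>\<^bsub>S\<^esub> src k H L m) = sact L lmul (tn L H l h) m"
      by (simp add: sact_ten[OF compat_lmul] lh m)
  qed (rule mlin)+
  then show ?thesis
    unfolding lunit_mod_def smash_act_def SM_def t
    by (intro arg_cong[where f = "with_act L"]) (auto intro!: restrict_ext simp: module.truncate_def)
qed

subsection \<open>The target maps\<close>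

lemma tgt_closed [mlin]: "r \<in> carrier HH \<Longrightarrow> l \<in> carrier L \<Longrightarrow> tgt k H L r l \<in> carrier LH"
  unfolding tgt_def by (rule mlin | assumption)+

lemma sact_tgt:
  assumes C: "compat V A" and [mlin]: "r \<in> carrier HH" "l \<in> carrier L" "v \<in> carrier V"
  shows "sact V A (tgt k H L r l) v = tlift V (\<lambda>a b. A (act L b l) (act V a v)) r"
proof -
  have [mlin]: "hmod V" and b: "bil k L V V A" using C by (auto simp: compat_def)
  note [mlin] = bil_left[OF sact_bil[OF C]]
  have "sact V A (tgt k H L r l) v = tlift V (\<lambda>a b. sact V A (tn L H (act L b l) a) v) r"
    unfolding tgt_def by (rule tlift_hom[of LH _ "\<lambda>u. sact V A u v"]) (rule mlin | assumption)+
  also have "\<dots> = tlift V (\<lambda>a b. A (act L b l) (act V a v)) r"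
    by (rule tlift_cong[of _ H H], (rule mlin)+, rule sact_ten[OF C]) (rule mlin | assumption)+
  finally show ?thesis .
qed

text \<open>As t^+(l) = R_2 l \<otimes> R_1, it braids l from the right of v to its left and then
  lets it act.\<close>

lemma sact_tgt_plus:
  assumes C: "compat V A" and [mlin]: "l \<in> carrier L" "v \<in> carrier V"
  shows "sact V A (tgt_plus k H R L l) v = tlift V A (cb V L v l)"
proof -
  have [mlin]: "hmod V" and b: "bil k L V V A" using C by (auto simp: compat_def)
  show ?thesis
    unfolding tgt_plus_def
    by (subst sact_tgt[OF C], (rule mlin)+, rule tlift_cb[symmetric]) (rule mlin b)+
qed

text \<open>R^- is the flip of R^-1, so here l reaches the left side of v by the inverse
  braiding.\<close>

lemma sact_tgt_minus:
  assumes C: "compat V A" and [mlin]: "l \<in> carrier L" "v \<in> carrier V"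
  shows "sact V A (tgt_minus k H R L l) v = tlift V A (db L V v l)"
proof -
  have [mlin]: "hmod V" and b: "bil k L V V A" using C by (auto simp: compat_def)
  note [mlin] = bil_left[OF b] bil_right[OF b]
  have "sact V A (tgt_minus k H R L l) v = tlift V (\<lambda>a b. A (act L b l) (act V a v)) (flip k H H Ri)"
    unfolding tgt_minus_def R_minus_eq by (rule sact_tgt[OF C]) (rule mlin)+
  also have "\<dots> = tlift V (\<lambda>a b. A (act L a l) (act V b v)) Ri"
    by (rule tlift_flip) (rule mlin | assumption)+
  also have "\<dots> = tlift V A (db L V v l)"
    by (rule tlift_db[symmetric]) (rule mlin b)+
  finally show ?thesis .
qed

text \<open>The braiding takes l to the left of x, and the coaction takes it back: the net effect is
  a product in \<open>L\<close>.\<close>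

lemma la_db_cb:
  assumes [mlin]: "hmod X" "x \<in> carrier X" "l \<in> carrier L" "m \<in> carrier L"
  shows "tlift (free X) (\<lambda>l' x'. la X l' (tn X L x' m)) (cb X L x l) = tn X L x (lmul l m)"
proof -
  have "tlift (free X) (\<lambda>l' x'. la X l' (tn X L x' m)) (cb X L x l) =
      tlift (free X) (\<lambda>l' x'. tlift (free X) (\<lambda>x l. tn X L x (lmul l m)) (tau X l' x')) (cb X L x l)"
    by (rule tlift_cong[of _ L X], (rule mlin)+, subst la_ten, (rule mlin | assumption)+) (simp add: rmul_def)
  also have "\<dots> = tn X L x (lmul l m)"
    by (rule db_cb) (rule mlin | assumption)+
  finally show ?thesis .
qed

text \<open>To reach the left side, l passes m and then x. Acting from there brings it back over x
  by \<open>la_db_cb\<close>, and the passage over m is absorbed by the product in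
  \<open>L\<close>.\<close>

lemma Xi_tgt_plus:
  assumes [mlin]: "hmod X" "l \<in> carrier L" and v: "v \<in> carrier (free X)"
  shows "act (Xi k H R L X) (tgt_plus k H R L l) v = rmul X v l"
proof -
  note C = compat_la[OF assms(1)]
  have XL: "hmod (htens X L)" by (rule mlin)+
  have tp: "tgt_plus k H R L l \<in> carrier LH" unfolding tgt_plus_def by (rule mlin)+
  have "sact (htens X L) (la X) (tgt_plus k H R L l) v = rmul X v l"
  proof (rule tensor_ext[OF v, of "X \<otimes>\<^sub>k L"])
    show "lin (free X) (free X) (sact (htens X L) (la X) (tgt_plus k H R L l))"
      using sact_bil[OF C] tp by (simp add: bil_def)
    fix x m assume xm [mlin]: "x \<in> carrier X" "m \<in> carrier L"
    have c: "tn X L x m \<in> carrier (htens X L)" by (rule mlin)+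
    have "sact (htens X L) (la X) (tgt_plus k H R L l) (tn X L x m) =
        tlift (free X) (la X) (cb (htens X L) L (tn X L x m) l)"
      using sact_tgt_plus[OF C assms(2) c] by simp
    also have "\<dots> = tlift (free X) (\<lambda>l' m'. tlift (free X) (\<lambda>l'' x'. la X l'' (tn X L x' m')) (cb X L x l')) (cb L L m l)"
      by (rule cb_htensor_left) (rule mlin | assumption)+
    also have "\<dots> = tlift (free X) (\<lambda>l' m'. tn X L x (lmul l' m')) (cb L L m l)"
      by (rule tlift_cong[of _ L L], (rule mlin)+, rule la_db_cb) (rule mlin | assumption)+
    also have "\<dots> = tn X L x (tlift L lmul (cb L L m l))"
      by (rule tlift_hom[symmetric, of L]) (rule mlin | assumption)+
    also have "\<dots> = rmul X (tn X L x m) l"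
      by (simp add: lmul_cb rmul_ten hmod_mod assms xm)
    finally show "sact (htens X L) (la X) (tgt_plus k H R L l) (tn X L x m) = \<dots>" .
  qed (rule mlin | assumption)+
  then show ?thesis unfolding Xi_SM using v tp by (simp add: SM_act)
qed

text \<open>As for t^+, with the inverse braiding in place of the braiding. On M' the two agree for
  x, and \<open>lmul_db\<close> absorbs the passage over m.\<close>

lemma Xi_tgt_minus:
  assumes X: "X \<in> MP" and [mlin]: "l \<in> carrier L" and v: "v \<in> carrier (free X)"
  shows "act (Xi k H R L X) (tgt_minus k H R L l) v = rmul X v l"
proof -
  note h [mlin] = MP_hmod[OF X]
  note C = compat_la[OF h]
  have XL: "hmod (htens X L)" by (rule mlin)+
  have tp: "tgt_minus k H R L l \<in> carrier LH" unfolding tgt_minus_def by (rule mlin)+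
  have "sact (htens X L) (la X) (tgt_minus k H R L l) v = rmul X v l"
  proof (rule tensor_ext[OF v, of "X \<otimes>\<^sub>k L"])
    show "lin (free X) (free X) (sact (htens X L) (la X) (tgt_minus k H R L l))"
      using sact_bil[OF C] tp by (simp add: bil_def)
    fix x m assume xm [mlin]: "x \<in> carrier X" "m \<in> carrier L"
    have c: "tn X L x m \<in> carrier (htens X L)" by (rule mlin)+
    have "sact (htens X L) (la X) (tgt_minus k H R L l) (tn X L x m) =
        tlift (free X) (la X) (db L (htens X L) (tn X L x m) l)"
      using sact_tgt_minus[OF C assms(2) c] by simp
    also have "\<dots> = tlift (free X) (\<lambda>l' m'. tlift (free X) (\<lambda>l'' x'. la X l'' (tn X L x' m')) (db L X x l')) (db L L m l)"
      by (rule db_htensor_right) (rule mlin | assumption)+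
    also have "\<dots> = tlift (free X) (\<lambda>l' m'. tn X L x (lmul l' m')) (db L L m l)"
    proof (rule tlift_cong[of _ L L])
      fix l' m' assume c [mlin]: "l' \<in> carrier L" "m' \<in> carrier L"
      show "tlift (free X) (\<lambda>l'' x'. la X l'' (tn X L x' m')) (db L X x l') = tn X L x (lmul l' m')"
        unfolding MP_cb[OF X xm(1) c(1), symmetric] by (rule la_db_cb) (rule mlin)+
    qed (rule mlin)+
    also have "\<dots> = tn X L x (tlift L lmul (db L L m l))"
      by (rule tlift_hom[symmetric, of L]) (rule mlin | assumption)+
    also have "\<dots> = rmul X (tn X L x m) l"
      by (simp add: lmul_db rmul_ten hmod_mod assms xm h)
    finally show "sact (htens X L) (la X) (tgt_minus k H R L l) (tn X L x m) = \<dots>" .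
  qed (rule mlin | assumption)+
  then show ?thesis unfolding Xi_SM using v tp by (simp add: SM_act)
qed

section \<open>Categories of modules\<close>

lemma category_mod_cat: "category (mod_cat k A)"
proof
  fix X assume "X \<in> Ob (mod_cat k A)"
  then have X: "amodule k A X" by (simp add: mod_cat_def)
  note m = amodule_mod[OF X]
  interpret X: module k X by (rule m)
  show "Idt (mod_cat k A) X \<in> Hom (mod_cat k A) X X"
    using act_closed[OF X] by (auto simp: mod_cat_def ahom_def lin_map_def)
next
  fix X Y Z f g assume "X \<in> Ob (mod_cat k A)" "Y \<in> Ob (mod_cat k A)" "Z \<in> Ob (mod_cat k A)"
    and "f \<in> Hom (mod_cat k A) X Y" "g \<in> Hom (mod_cat k A) Y Z"
  then have X: "amodule k A X" and f: "lin X Y f" "\<And>a x. a \<in> carrier A \<Longrightarrow> x \<in> carrier X \<Longrightarrow> f (act X a x) = act Y a (f x)"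
    and g: "lin Y Z g" "\<And>a x. a \<in> carrier A \<Longrightarrow> x \<in> carrier Y \<Longrightarrow> g (act Y a x) = act Z a (g x)"
    by (auto simp: mod_cat_def ahom_def)
  have "lin X Z (compose (carrier X) g f)"
    by (rule lin_map_cong[OF lin_map_comp[OF f(1) g(1)] amodule_mod[OF X]]) (simp add: compose_def)
  then show "Cmp (mod_cat k A) X Y Z g f \<in> Hom (mod_cat k A) X Z"
    using act_closed[OF X] f g lin_map_closed[OF f(1)] lin_map_closed[OF g(1)]
    by (auto simp: mod_cat_def ahom_def compose_def)
next
  fix X Y f assume "f \<in> Hom (mod_cat k A) X Y"
  then have "f \<in> carrier X \<rightarrow>\<^sub>E carrier Y" by (simp add: mod_cat_def ahom_def)
  then show "Cmp (mod_cat k A) X X Y f (Idt (mod_cat k A) X) = f"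
    "Cmp (mod_cat k A) X Y Y (Idt (mod_cat k A) Y) f = f"
    by (auto simp: mod_cat_def compose_def fun_eq_iff PiE_def extensional_def)
next
  fix W X Y Z f g h assume "f \<in> Hom (mod_cat k A) W X"
  then have "f \<in> carrier W \<rightarrow>\<^sub>E carrier X" by (simp add: mod_cat_def ahom_def)
  then show "Cmp (mod_cat k A) W Y Z h (Cmp (mod_cat k A) W X Y g f) =
      Cmp (mod_cat k A) W X Z (Cmp (mod_cat k A) X Y Z h g) f"
    by (auto simp: mod_cat_def compose_def intro!: restrict_ext)
qed

lemma ahom_inverse:
  assumes f: "f \<in> ahom k A X Y" and X: "amodule k A X" and Y: "amodule k A Y"
    and g: "\<And>y. y \<in> carrier Y \<Longrightarrow> g y \<in> carrier X" "\<And>x. x \<in> carrier X \<Longrightarrow> g (f x) = x"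
      "\<And>y. y \<in> carrier Y \<Longrightarrow> f (g y) = y"
  shows "restrict g (carrier Y) \<in> ahom k A Y X"
proof -
  interpret X: amodule k A X by fact
  interpret Y: amodule k A Y by fact
  have l: "lin X Y f" and e: "\<And>a x. a \<in> carrier A \<Longrightarrow> x \<in> carrier X \<Longrightarrow> f (act X a x) = act Y a (f x)"
    using f by (auto simp: ahom_def)
  have "g (y \<oplus>\<^bsub>Y\<^esub> y') = g y \<oplus>\<^bsub>X\<^esub> g y'" if "y \<in> carrier Y" "y' \<in> carrier Y" for y y'
    using g(2)[of "g y \<oplus>\<^bsub>X\<^esub> g y'"] lin_map_add[OF l, of "g y" "g y'"] that g(1,3) by simp
  moreover have "g (r \<odot>\<^bsub>Y\<^esub> y) = r \<odot>\<^bsub>X\<^esub> g y" if "r \<in> carrier k" "y \<in> carrier Y" for r y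
    using g(2)[of "r \<odot>\<^bsub>X\<^esub> g y"] lin_map_smult[OF l, of r "g y"] that g(1,3) by simp
  moreover have "g (act Y h y) = act X h (g y)" if "h \<in> carrier A" "y \<in> carrier Y" for h y
    using g(2)[of "act X h (g y)"] e[of h "g y"] that g(1,3) act_closed[OF X] by simp
  ultimately show ?thesis
    using g(1) act_closed[OF Y] by (auto simp: ahom_def lin_map_def)
qed

lemma mod_iso:
  assumes ob: "X \<in> Ob (mod_cat k A)" "Y \<in> Ob (mod_cat k A)" and f: "f \<in> ahom k A X Y"
    and g: "\<And>y. y \<in> carrier Y \<Longrightarrow> g y \<in> carrier X" "\<And>x. x \<in> carrier X \<Longrightarrow> g (f x) = x"
      "\<And>y. y \<in> carrier Y \<Longrightarrow> f (g y) = y"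
  shows "iso_in (mod_cat k A) X Y f"
proof -
  have am: "amodule k A X" "amodule k A Y" using ob by (auto simp: mod_cat_def)
  have "inverses_in (mod_cat k A) X Y f (restrict g (carrier Y))"
    using f ahom_inverse[OF f am g] g
    by (auto simp: inverses_in_def mod_cat_def compose_def fun_eq_iff ahom_def)
  then show ?thesis using ob by (auto simp: iso_in_def)
qed

abbreviation "II \<equiv> bideal k H R L"
abbreviation "TP \<equiv> tgt_plus k H R L"
abbreviation "TM \<equiv> tgt_minus k H R L"
abbreviation "QQ \<equiv> HL k H R L"
abbreviation "rs \<equiv> restr k H R L"
abbreviation "ds \<equiv> descend k H R L"
abbreviation "pi a \<equiv> II +>\<^bsub>S\<^esub> a"
abbreviation "XX \<equiv> Xi k H R L"
abbreviation "XH \<equiv> Xi_HL k H R L"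
abbreviation "MH \<equiv> Mod_HL k H R L"
abbreviation "M0 \<equiv> Mod0_HL k H R L"

lemma S_ring: "ring S"
  using S_alg by (rule assoc_algebra.axioms)

lemma TP_closed: "l \<in> carrier L \<Longrightarrow> TP l \<in> carrier LH" "l \<in> carrier L \<Longrightarrow> TM l \<in> carrier LH"
  unfolding tgt_plus_def tgt_minus_def by (rule mlin | assumption)+

lemma gens: "{TP l \<ominus>\<^bsub>S\<^esub> TM l | l. l \<in> carrier L} \<subseteq> carrier S"
proof -
  interpret S: ring S by (rule S_ring)
  have "TP l \<ominus>\<^bsub>S\<^esub> TM l \<in> carrier S" if "l \<in> carrier L" for l
    using TP_closed[OF that] by (intro S.minus_closed) simp_all
  then show ?thesis by blast
qed

lemma II_ideal: "ideal II S"
  unfolding bideal_def by (rule ring.genideal_ideal[OF S_ring gens])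

definition "killed M \<longleftrightarrow> (\<forall>a\<in>II. \<forall>m\<in>carrier M. act M a m = \<zero>\<^bsub>M\<^esub>)"

text \<open>The annihilator of a module is a two-sided ideal. By \<open>eq\<close> it contains the
  generators of \<open>II\<close>, hence \<open>II\<close> itself.\<close>

lemma killedI:
  assumes M: "amodule k S M" and eq: "\<And>l m. l \<in> carrier L \<Longrightarrow> m \<in> carrier M \<Longrightarrow> act M (TP l) m = act M (TM l) m"
  shows "killed M"
proof -
  interpret S: ring S by (rule S_ring)
  interpret M: amodule k S M by (rule M)
  let ?A = "{a \<in> carrier S. \<forall>m\<in>carrier M. act M a m = \<zero>\<^bsub>M\<^esub>}"
  have z: "act M a \<zero>\<^bsub>M\<^esub> = \<zero>\<^bsub>M\<^esub>" if "a \<in> carrier S" for a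
    using lin_map_zero[OF M.act_lin[OF that]] M.M.module_axioms by simp
  have z0: "act M \<zero>\<^bsub>S\<^esub> m = \<zero>\<^bsub>M\<^esub>" if "m \<in> carrier M" for m
    by (rule lin_map_zero[OF act_lin_left[OF M lin_id that] alg_mod[OF S_alg] M.M.module_axioms])
  have neg: "act M (\<ominus>\<^bsub>S\<^esub> a) m = \<ominus>\<^bsub>M\<^esub> act M a m" if "a \<in> carrier S" "m \<in> carrier M" for a m
  proof -
    have "act M (\<ominus>\<^bsub>S\<^esub> a) m \<oplus>\<^bsub>M\<^esub> act M a m = \<zero>\<^bsub>M\<^esub>"
      using M.act_add[of "\<ominus>\<^bsub>S\<^esub> a" a m] that z0[of m] by (simp add: S.l_neg del: smash_simps)
    moreover have "act M (\<ominus>\<^bsub>S\<^esub> a) m \<in> carrier M" "act M a m \<in> carrier M"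
      using act_closed[OF M] that S.a_inv_closed by blast+
    ultimately show ?thesis by (simp add: M.M.minus_equality)
  qed
  have "ideal ?A S"
  proof (rule idealI[OF S_ring])
    show "subgroup ?A (add_monoid S)"
    proof (rule group.subgroupI[OF S.add.is_group])
      show "?A \<noteq> {}" using z0 S.zero_closed by blast
      show "inv\<^bsub>add_monoid S\<^esub> a \<in> ?A" if "a \<in> ?A" for a
        using neg[of a] that S.a_inv_closed[of a] by (auto simp: a_inv_def[symmetric] simp del: smash_simps)
      show "a \<otimes>\<^bsub>add_monoid S\<^esub> b \<in> ?A" if "a \<in> ?A" "b \<in> ?A" for a b
        using that M.act_add[of a b] S.a_closed[of a b] by (auto simp del: smash_simps)
    qed auto
    show "x \<otimes>\<^bsub>S\<^esub> a \<in> ?A" "a \<otimes>\<^bsub>S\<^esub> x \<in> ?A" if "a \<in> ?A" "x \<in> carrier S" for a x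
      using that M.act_mult z act_closed[OF M] by (auto simp del: smash_simps)
  qed
  moreover have "act M (TP l \<ominus>\<^bsub>S\<^esub> TM l) m = \<zero>\<^bsub>M\<^esub>" if "l \<in> carrier L" "m \<in> carrier M" for l m
  proof -
    have t: "TP l \<in> carrier S" "TM l \<in> carrier S" using TP_closed[OF that(1)] by simp_all
    show ?thesis
      using M.act_add[of "TP l" "\<ominus>\<^bsub>S\<^esub> TM l" m] neg[OF t(2) that(2)] eq[OF that] t that
        act_closed[OF M t(2) that(2)] M.M.r_neg[of "act M (TM l) m"]
      by (simp add: a_minus_def del: smash_simps)
  qed
  ultimately have "II \<subseteq> ?A"
    unfolding bideal_def using gens by (intro S.genideal_minimal) auto
  then show ?thesis by (auto simp: killed_def)
qed

subsection \<open>The quotient algebra\<close>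

lemma QQ_simps:
  "carrier QQ = a_rcosets\<^bsub>S\<^esub> II" "one QQ = pi \<one>\<^bsub>S\<^esub>" "add QQ = set_add S" "mult QQ = rcoset_mult S II"
  "smult QQ r c = (\<Union>a\<in>c. pi (r \<odot>\<^bsub>S\<^esub> a))"
  by (simp_all add: HL_def ring.defs module.defs FactRing_def)

lemma QQ_carrier: "c \<in> carrier QQ \<longleftrightarrow> (\<exists>a\<in>carrier S. c = pi a)"
  unfolding QQ_simps A_RCOSETS_def' by auto

lemma pi_closed: "a \<in> carrier S \<Longrightarrow> pi a \<in> carrier QQ"
  unfolding QQ_carrier by auto

lemma pi_add: "a \<in> carrier S \<Longrightarrow> b \<in> carrier S \<Longrightarrow> pi a \<oplus>\<^bsub>QQ\<^esub> pi b = pi (a \<oplus>\<^bsub>S\<^esub> b)"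
  unfolding QQ_simps by (rule ideal.a_rcos_sum[OF II_ideal])

lemma pi_mult: "a \<in> carrier S \<Longrightarrow> b \<in> carrier S \<Longrightarrow> pi a \<otimes>\<^bsub>QQ\<^esub> pi b = pi (a \<otimes>\<^bsub>S\<^esub> b)"
  unfolding QQ_simps by (rule ideal.rcoset_mult_add[OF II_ideal])

lemma pi_mem:
  assumes "a \<in> carrier S" "b \<in> pi a"
  obtains i where "i \<in> II" "b = i \<oplus>\<^bsub>S\<^esub> a"
  using assms by (auto simp: a_r_coset_def')

lemma pi_self: "a \<in> carrier S \<Longrightarrow> a \<in> pi a"
proof -
  assume a: "a \<in> carrier S"
  interpret S: ring S by (rule S_ring)
  interpret I: ideal II S by (rule II_ideal)
  have "\<zero>\<^bsub>S\<^esub> \<oplus>\<^bsub>S\<^esub> a \<in> pi a" unfolding a_r_coset_def' using I.zero_closed by blast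
  then show ?thesis using S.l_zero[OF a] by (simp only:)
qed

lemma II_carrier: "i \<in> II \<Longrightarrow> i \<in> carrier S"
  by (rule ideal.Icarr[OF II_ideal])

lemma pi_eqI:
  assumes "a \<in> carrier S" "b \<in> pi a"
  shows "pi b = pi a"
proof -
  interpret I: ideal II S by (rule II_ideal)
  show ?thesis using I.a_repr_independence'[OF assms(2,1)] by simp
qed

lemma pi_smult:
  assumes r: "r \<in> carrier k" and a: "a \<in> carrier S"
  shows "r \<odot>\<^bsub>QQ\<^esub> pi a = pi (r \<odot>\<^bsub>S\<^esub> a)"
proof -
  interpret S: assoc_algebra k S by (rule S_alg)
  interpret I: ideal II S by (rule II_ideal)
  have "pi (r \<odot>\<^bsub>S\<^esub> b) = pi (r \<odot>\<^bsub>S\<^esub> a)" if "b \<in> pi a" for b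
  proof -
    obtain i where i: "i \<in> II" "b = i \<oplus>\<^bsub>S\<^esub> a" by (rule pi_mem[OF a \<open>b \<in> pi a\<close>])
    note ic = II_carrier[OF i(1)]
    \<comment> \<open>A ring ideal is stable under scalars because r i = (r 1) i.\<close>
    have "r \<odot>\<^bsub>S\<^esub> i = (r \<odot>\<^bsub>S\<^esub> \<one>\<^bsub>S\<^esub>) \<otimes>\<^bsub>S\<^esub> i"
      using S.smult_mult_left[of r "\<one>\<^bsub>S\<^esub>" i] r ic by (simp del: smash_simps)
    also have "\<dots> \<in> II" using I.I_l_closed[OF i(1)] r by (simp del: smash_simps)
    finally have ri: "r \<odot>\<^bsub>S\<^esub> i \<in> II" .
    have "r \<odot>\<^bsub>S\<^esub> b = r \<odot>\<^bsub>S\<^esub> i \<oplus>\<^bsub>S\<^esub> r \<odot>\<^bsub>S\<^esub> a"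
      unfolding i(2) using r ic a by (rule S.M.smult_r_distr)
    then have "r \<odot>\<^bsub>S\<^esub> b \<in> pi (r \<odot>\<^bsub>S\<^esub> a)" using ri by (auto simp: a_r_coset_def')
    then show ?thesis by (rule pi_eqI[rotated]) (use r a in \<open>simp del: smash_simps\<close>)
  qed
  then show ?thesis unfolding QQ_simps using pi_self[OF a] by (intro SUP_eq_const) blast+
qed

lemma rs_simps [simp]:
  "carrier (rs M) = carrier M" "zero (rs M) = zero M" "add (rs M) = add M" "smult (rs M) = smult M"
  "carrier (ds N) = carrier N" "zero (ds N) = zero N" "add (ds N) = add N" "smult (ds N) = smult N"
  by (simp_all add: restr_def descend_def)

lemma rs_act: "a \<in> carrier S \<Longrightarrow> act (rs M) a = act M (pi a)"
  by (simp add: restr_def)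

lemma Ob_mod_cat:
  "M \<in> Ob (mod_cat k A) \<longleftrightarrow> amodule k A M \<and> act M \<in> extensional (carrier A) \<and>
    (\<forall>a\<in>carrier A. act M a \<in> extensional (carrier M))"
  by (simp add: mod_cat_def)

lemma rs_Ob:
  assumes "M \<in> Ob (mod_cat k QQ)"
  shows "rs M \<in> Ob (mod_cat k S)"
proof -
  have M: "amodule k QQ M" and e: "\<forall>c\<in>carrier QQ. act M c \<in> extensional (carrier M)"
    using assms unfolding Ob_mod_cat by blast+
  interpret M: amodule k QQ M by fact
  interpret S: assoc_algebra k S by (rule S_alg)
  note p = rs_act[where M = M] and q = pi_closed
  have "amodule k S (rs M)"
  proof (rule amodule.intro)
    show "kmod (rs M)" unfolding restr_def by (rule module_with_act M.M.module_axioms)+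
    show "amodule_axioms k S (rs M)"
    proof
      fix a b x assume a: "a \<in> carrier S" and b: "b \<in> carrier S" and "x \<in> carrier (rs M)"
      then have x: "x \<in> carrier M" by simp
      show "act (rs M) (a \<oplus>\<^bsub>S\<^esub> b) x = act (rs M) a x \<oplus>\<^bsub>rs M\<^esub> act (rs M) b x"
        unfolding p[OF a] p[OF b] p[OF S.M.a_closed[OF a b]] pi_add[OF a b, symmetric] rs_simps
        by (rule M.act_add[OF q[OF a] q[OF b] x])
      show "act (rs M) (a \<otimes>\<^bsub>S\<^esub> b) x = act (rs M) a (act (rs M) b x)"
        unfolding p[OF a] p[OF b] p[OF S.A.m_closed[OF a b]] pi_mult[OF a b, symmetric]
        by (rule M.act_mult[OF q[OF a] q[OF b] x])
    next
      fix r a x assume r: "r \<in> carrier k" and a: "a \<in> carrier S" and "x \<in> carrier (rs M)"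
      then have x: "x \<in> carrier M" by simp
      show "act (rs M) (r \<odot>\<^bsub>S\<^esub> a) x = r \<odot>\<^bsub>rs M\<^esub> act (rs M) a x"
        unfolding p[OF a] p[OF S.M.smult_closed[OF r a]] pi_smult[OF r a, symmetric] rs_simps
        by (rule M.act_smult[OF r q[OF a] x])
    next
      fix x assume "x \<in> carrier (rs M)"
      then have x: "x \<in> carrier M" by simp
      show "act (rs M) \<one>\<^bsub>S\<^esub> x = x"
        unfolding p[OF S.A.one_closed] QQ_simps(2)[symmetric] by (rule M.act_one[OF x])
    next
      fix a assume a: "a \<in> carrier S"
      show "lin (rs M) (rs M) (act (rs M) a)"
        using M.act_lin[OF q[OF a]] unfolding p[OF a] lin_map_def rs_simps .
    qed
  qed
  moreover have "\<forall>a\<in>carrier S. act (rs M) a \<in> extensional (carrier (rs M))"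
    using e q p by (metis rs_simps(1))
  moreover have "act (rs M) \<in> extensional (carrier S)" by (simp add: restr_def)
  ultimately show ?thesis unfolding Ob_mod_cat by blast
qed

text \<open>Every element of the quotient is the image of an element of the smash product, so
  linearity over either algebra is the same condition.\<close>

lemma ahom_rs: "ahom k QQ M N = ahom k S (rs M) (rs N)"
proof -
  have "(\<forall>a\<in>carrier QQ. \<forall>x\<in>carrier M. f (act M a x) = act N a (f x)) \<longleftrightarrow>
    (\<forall>a\<in>carrier S. \<forall>x\<in>carrier M. f (act (rs M) a x) = act (rs N) a (f x))" for f
    unfolding Ball_def QQ_carrier by (auto simp: rs_act simp del: smash_simps)
  then show ?thesis by (auto simp: ahom_def lin_map_def)
qed

text \<open>\<open>descend\<close> acts through an arbitrary element of the coset. It differs from a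
  by an element of the ideal, which acts as zero, and extensionality turns agreement on the carrier
  into equality of operators.\<close>

lemma ds_act:
  assumes M: "M \<in> Ob (mod_cat k S)" and k: "killed M" and a: "a \<in> carrier S"
  shows "act (ds M) (pi a) = act M a"
proof -
  have am: "amodule k S M" and e: "\<forall>a\<in>carrier S. act M a \<in> extensional (carrier M)"
    using M unfolding Ob_mod_cat by blast+
  interpret M: amodule k S M by fact
  interpret S: ring S by (rule S_ring)
  define b where "b = (SOME b. b \<in> pi a)"
  have "b \<in> pi a" unfolding b_def by (rule someI[where P = "\<lambda>b. b \<in> pi a", OF pi_self[OF a]])
  then obtain i where i: "i \<in> II" "b = i \<oplus>\<^bsub>S\<^esub> a" by (rule pi_mem[OF a])
  have ic: "i \<in> carrier S" using II_carrier[OF i(1)] .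
  have b: "b \<in> carrier S" unfolding i(2) by (rule S.a_closed[OF ic a])
  have "act M b m = act M a m" if m: "m \<in> carrier M" for m
  proof -
    have "act M i m = \<zero>\<^bsub>M\<^esub>" using k i(1) m by (simp only: killed_def)
    then show ?thesis
      unfolding i(2) M.act_add[OF ic a m] using M.M.l_zero[OF act_closed[OF am a m]] by simp
  qed
  moreover have "act M b \<in> extensional (carrier M)" "act M a \<in> extensional (carrier M)"
    using e b a by blast+
  ultimately have "act M b = act M a" by (intro extensionalityI[of _ "carrier M"])
  then show ?thesis using pi_closed[OF a] by (simp only: descend_def with_act_simps restrict_apply b_def if_True)
qed

lemma rs_ds:
  assumes M: "M \<in> Ob (mod_cat k S)" and k: "killed M"
  shows "rs (ds M) = M"
proof -
  have "(\<lambda>a\<in>carrier S. act (ds M) (pi a)) = act M"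
  proof (rule extensionalityI[of _ "carrier S"])
    show "act M \<in> extensional (carrier S)" using M unfolding Ob_mod_cat by blast
    show "(\<lambda>a\<in>carrier S. act (ds M) (pi a)) x = act M x" if "x \<in> carrier S" for x
      by (simp only: ds_act[OF M k that] restrict_apply that if_True)
  qed (rule restrict_extensional)
  then have "rs (ds M) = with_act (ds M) (act M)" by (simp only: restr_def)
  then show ?thesis by (simp add: descend_def)
qed

lemma ds_Ob:
  assumes M: "M \<in> Ob (mod_cat k S)" and k: "killed M"
  shows "ds M \<in> Ob (mod_cat k QQ)"
proof -
  have am: "amodule k S M" and e: "\<forall>a\<in>carrier S. act M a \<in> extensional (carrier M)"
    using M unfolding Ob_mod_cat by blast+
  interpret M: amodule k S M by fact
  interpret S: assoc_algebra k S by (rule S_alg)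
  note d = ds_act[OF M k]
  have "amodule k QQ (ds M)"
  proof (rule amodule.intro)
    show "kmod (ds M)" unfolding descend_def by (rule module_with_act M.M.module_axioms)+
    show "amodule_axioms k QQ (ds M)"
    proof
      fix a b x assume "a \<in> carrier QQ" "b \<in> carrier QQ" and "x \<in> carrier (ds M)"
      then obtain a' b' where a': "a' \<in> carrier S" and b': "b' \<in> carrier S" and ab: "a = pi a'" "b = pi b'"
        and x: "x \<in> carrier M" unfolding QQ_carrier rs_simps by blast
      show "act (ds M) (a \<oplus>\<^bsub>QQ\<^esub> b) x = act (ds M) a x \<oplus>\<^bsub>ds M\<^esub> act (ds M) b x"
        unfolding ab pi_add[OF a' b'] d[OF a'] d[OF b'] d[OF S.M.a_closed[OF a' b']] rs_simps
        by (rule M.act_add[OF a' b' x])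
      show "act (ds M) (a \<otimes>\<^bsub>QQ\<^esub> b) x = act (ds M) a (act (ds M) b x)"
        unfolding ab pi_mult[OF a' b'] d[OF a'] d[OF b'] d[OF S.A.m_closed[OF a' b']]
        by (rule M.act_mult[OF a' b' x])
    next
      fix r a x assume r: "r \<in> carrier k" and "a \<in> carrier QQ" and "x \<in> carrier (ds M)"
      then obtain a' where a': "a' \<in> carrier S" and a: "a = pi a'" and x: "x \<in> carrier M"
        unfolding QQ_carrier rs_simps by blast
      show "act (ds M) (r \<odot>\<^bsub>QQ\<^esub> a) x = r \<odot>\<^bsub>ds M\<^esub> act (ds M) a x"
        unfolding a pi_smult[OF r a'] d[OF a'] d[OF S.M.smult_closed[OF r a']] rs_simps
        by (rule M.act_smult[OF r a' x])
    next
      fix x assume "x \<in> carrier (ds M)"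
      then have x: "x \<in> carrier M" by simp
      show "act (ds M) \<one>\<^bsub>QQ\<^esub> x = x"
        unfolding QQ_simps(2) d[OF S.A.one_closed] by (rule M.act_one[OF x])
    next
      fix a assume "a \<in> carrier QQ"
      then obtain a' where a': "a' \<in> carrier S" and a: "a = pi a'" unfolding QQ_carrier by blast
      show "lin (ds M) (ds M) (act (ds M) a)"
        using M.act_lin[OF a'] unfolding a d[OF a'] lin_map_def rs_simps .
    qed
  qed
  moreover have "\<forall>c\<in>carrier QQ. act (ds M) c \<in> extensional (carrier (ds M))"
    unfolding QQ_carrier Ball_def rs_simps using d e by metis
  moreover have "act (ds M) \<in> extensional (carrier QQ)" by (simp add: descend_def)
  ultimately show ?thesis unfolding Ob_mod_cat by blast
qed

lemma MH_simps [simp]: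
  "Ob MH = Ob (mod_cat k QQ)" "Hom MH = ahom k QQ" "Idt MH M = restrict id (carrier M)"
  "Cmp MH M N P g f = compose (carrier M) g f"
  by (simp_all add: Mod_HL_def cat.defs mod_cat_def)

lemma category_MH: "category MH"
proof -
  interpret category "mod_cat k QQ" by (rule category_mod_cat)
  show ?thesis
    by unfold_locales
      (use Idt_Hom Cmp_Hom Cmp_Idt_right Cmp_Idt_left Cmp_assoc in \<open>simp_all add: mod_cat_def\<close>)
qed

theorem full_embedding_rs: "full_embedding MH (mod_cat k S) rs (\<lambda>M N f. f)"
proof (intro full_embedding.intro fully_faithful_functor.intro cat_functor.intro category_MH
    category_mod_cat cat_functor_axioms.intro fully_faithful_functor_axioms.intro full_embedding_axioms.intro)
  fix M assume "M \<in> Ob MH"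
  then show "rs M \<in> Ob (mod_cat k S)" by (simp add: rs_Ob)
next
  fix M N f assume "f \<in> Hom MH M N"
  then show "f \<in> Hom (mod_cat k S) (rs M) (rs N)" by (simp add: mod_cat_def ahom_rs)
next
  fix M N
  show "bij_betw (\<lambda>f. f) (Hom MH M N) (Hom (mod_cat k S) (rs M) (rs N))"
    by (simp add: mod_cat_def ahom_rs bij_betw_def)
next
  show "inj_on rs (Ob MH)"
  proof (rule inj_onI)
    fix M N assume MN: "M \<in> Ob MH" "N \<in> Ob MH" and eq: "rs M = rs N"
    \<comment> \<open>The projection is onto and actions are extensional, so the restriction
      determines the action of the quotient.\<close>
    have "act M (pi a) = act N (pi a)" if "a \<in> carrier S" for a
      using rs_act[OF that, of M] rs_act[OF that, of N] eq by simp
    then have "act M = act N"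
      using MN by (intro extensionalityI[of _ "carrier QQ"])
        (auto simp: Ob_mod_cat QQ_carrier simp del: smash_simps)
    then show "M = N" using eq by (cases M; cases N) (simp add: restr_def with_act_def)
  qed
qed (simp_all add: mod_cat_def)

subsection \<open>The functor\<close>

lemma XX_Ob: "hmod X \<Longrightarrow> XX X \<in> Ob (mod_cat k S)"
  unfolding Xi_SM by (rule SM_Ob[OF compat_la])

lemma XX_carrier [simp]: "carrier (XX X) = carrier (free X)"
  by (simp add: Xi_SM)

lemma XX_killed: "X \<in> MP \<Longrightarrow> killed (XX X)"
  using XX_Ob[OF MP_hmod] Xi_tgt_plus[OF MP_hmod] Xi_tgt_minus
  by (intro killedI) (auto simp: Ob_mod_cat)

lemma XH_Ob: "X \<in> MP \<Longrightarrow> XH X \<in> Ob (mod_cat k QQ)"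
  unfolding Xi_HL_def by (rule ds_Ob[OF XX_Ob[OF MP_hmod] XX_killed])

lemma rs_XH: "X \<in> MP \<Longrightarrow> rs (XH X) = XX X"
  unfolding Xi_HL_def by (rule rs_ds[OF XX_Ob[OF MP_hmod] XX_killed])

lemma XH_carrier [simp]: "carrier (XH X) = carrier (free X)"
  by (simp add: Xi_HL_def)

lemma Xi_mor_eq:
  assumes "hmod X" "hmod Y" "\<psi> \<in> Hm X Y"
  shows "Xi_mor k L X Y \<psi> = (\<lambda>t\<in>carrier (free X). kl X Y \<psi> t)"
  using mult_L_tmap[OF Hm_lin[OF assms(3)]] hmod_mod[OF assms(1)] hmod_mod[OF assms(2)]
  by (auto simp: Xi_mor_def intro!: restrict_ext)

lemma Xi_mor_Hom:
  assumes [mlin]: "hmod X" "hmod Y" and \<psi>: "\<psi> \<in> Hm X Y"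
  shows "Xi_mor k L X Y \<psi> \<in> ahom k S (XX X) (XX Y)"
proof -
  note h = Hm_hlin[OF \<psi>]
  have [mlin]: "lin X (free Y) \<psi>" by (rule Hm_lin[OF \<psi>])
  have "lin (free X) (free Y) (kl X Y \<psi>)" by (rule mlin | assumption)+
  then have "hlin (htens X L) (htens Y L) (kl X Y \<psi>)"
    using kl_act[OF assms(1,2) _ h] by (simp add: hlin_def)
  then have "hlin (htens X L) (htens Y L) (\<lambda>t\<in>carrier (free X). kl X Y \<psi> t)"
    by (rule hlin_cong) (rule mlin | simp)+
  then show ?thesis
    unfolding Xi_mor_eq[OF assms] Xi_SM SM_ahom[OF compat_la[OF assms(1)] compat_la[OF assms(2)]]
    using kl_la[OF assms(1,2) _ h] la_lin(3)[OF assms(1)] by simp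
qed

text \<open>The inverse evaluates at x \<otimes> 1. A map linear over the smash product commutes
  with t^+(l), which is right multiplication by l, so it is the right linear extension of these
  values.\<close>

lemma Xi_mor_bij:
  assumes h [mlin]: "hmod X" "hmod Y"
  shows "bij_betw (Xi_mor k L X Y) (Hm X Y) (ahom k S (XX X) (XX Y))"
proof (rule bij_betwI[where g = "\<lambda>f. \<lambda>x\<in>carrier X. f (tn X L x \<one>\<^bsub>L\<^esub>)"])
  show "Xi_mor k L X Y \<in> Hm X Y \<rightarrow> ahom k S (XX X) (XX Y)" using Xi_mor_Hom[OF h] by blast
  have hf: "hlin X (htens Y L) (\<lambda>x. f (tn X L x \<one>\<^bsub>L\<^esub>))" if "f \<in> ahom k S (XX X) (XX Y)" for f
  proof -
    have "hlin (htens X L) (htens Y L) f"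
      using that unfolding Xi_SM SM_ahom[OF compat_la[OF h(1)] compat_la[OF h(2)]] by simp
    from hlin_comp[OF hlin_ten_one[OF h(1,1) hlin_id] this] show ?thesis .
  qed
  then show "(\<lambda>f. \<lambda>x\<in>carrier X. f (tn X L x \<one>\<^bsub>L\<^esub>)) \<in> ahom k S (XX X) (XX Y) \<rightarrow> Hm X Y"
    using HmI[OF hf h(1)] by blast
  show "(\<lambda>x\<in>carrier X. Xi_mor k L X Y \<psi> (tn X L x \<one>\<^bsub>L\<^esub>)) = \<psi>" if \<psi>: "\<psi> \<in> Hm X Y" for \<psi>
    by (rule Hm_eqI[OF \<psi>])
      (simp add: Xi_mor_eq[OF h \<psi>] ten_closed one_closed[OF L_alg] kl_ten_one[OF Hm_lin[OF \<psi>]] h hmod_mod)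
  show "Xi_mor k L X Y (\<lambda>x\<in>carrier X. f (tn X L x \<one>\<^bsub>L\<^esub>)) = f" if f: "f \<in> ahom k S (XX X) (XX Y)" for f
  proof -
    let ?\<psi> = "\<lambda>x\<in>carrier X. f (tn X L x \<one>\<^bsub>L\<^esub>)"
    have e: "f \<in> extensional (carrier (free X))" and hl: "hlin (htens X L) (htens Y L) f"
      using f unfolding Xi_SM SM_ahom[OF compat_la[OF h(1)] compat_la[OF h(2)]] by simp_all
    have fl [mlin]: "lin (free X) (free Y) f" using hl by (simp add: hlin_def)
    have \<psi>: "?\<psi> \<in> Hm X Y" by (rule HmI[OF hf[OF f] h(1)])
    note [mlin] = Hm_lin[OF \<psi>] lin_map_closed[OF fl]
    \<comment> \<open>Right linearity is linearity with respect to the target elements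
      t^+(l).\<close>
    have r: "f (rmul X t l) = rmul Y (f t) l" if "t \<in> carrier (free X)" "l \<in> carrier L" for t l
    proof -
      have "f (rmul X t l) = f (act (XX X) (TP l) t)" using that by (simp add: Xi_tgt_plus h)
      also have "\<dots> = act (XX Y) (TP l) (f t)"
        using f that TP_closed(1)[OF that(2)] by (simp add: ahom_def)
      also have "\<dots> = rmul Y (f t) l"
        using that lin_map_closed[OF fl that(1)] by (simp add: Xi_tgt_plus h)
      finally show ?thesis .
    qed
    have "kl X Y ?\<psi> t = f t" if t: "t \<in> carrier (free X)" for t
    proof (rule tensor_ext[OF t, of "Y \<otimes>\<^sub>k L"])
      fix x l assume xl [mlin]: "x \<in> carrier X" "l \<in> carrier L"
      have "kl X Y ?\<psi> (tn X L x l) = rmul Y (?\<psi> x) l"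
        by (rule kl_ten) (rule mlin)+
      also have "\<dots> = rmul Y (f (tn X L x \<one>\<^bsub>L\<^esub>)) l" using xl by simp
      also have "\<dots> = f (rmul X (tn X L x \<one>\<^bsub>L\<^esub>) l)"
        by (rule r[symmetric]) (rule mlin)+
      also have "rmul X (tn X L x \<one>\<^bsub>L\<^esub>) l = tn X L x l"
        by (simp add: rmul_ten h hmod_mod xl one_closed[OF L_alg] lmul_one)
      finally show "kl X Y ?\<psi> (tn X L x l) = f (tn X L x l)" .
    qed (rule mlin | assumption)+
    then show ?thesis
      unfolding Xi_mor_eq[OF h \<psi>] by (intro extensionalityI[OF _ e]) auto
  qed
qed

lemma Xi_mor_dh:
  assumes "hmod X" "hmod Y" "hlin X Y f"
  shows "Xi_mor k L X Y (dh X Y f) = (\<lambda>t\<in>carrier (free X). tmap k Y L f (\<lambda>m. m) t)"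
  unfolding Xi_mor_eq[OF assms(1,2) dh_Hm[OF assms]]
  by (rule restrict_ext) (rule kl_dh[OF assms])

lemma Xi_functor: "cat_functor D MH XH (Xi_mor k L)"
proof (intro cat_functor.intro category_D category_MH cat_functor_axioms.intro)
  fix X assume "X \<in> Ob D"
  then have X: "X \<in> MP" by simp
  then show "XH X \<in> Ob MH" by (simp add: XH_Ob)
  note h = MP_hmod[OF X]
  show "Xi_mor k L X X (Idt D X) = Idt MH (XH X)"
    by (auto simp: Xi_mor_dh[OF h h hlin_id'] tmap_id hmod_mod[OF h] L_mod intro!: restrict_ext)
next
  fix X Y f assume "X \<in> Ob D" "Y \<in> Ob D" "f \<in> Hom D X Y"
  then show "Xi_mor k L X Y f \<in> Hom MH (XH X) (XH Y)"
    by (simp add: ahom_rs rs_XH Xi_mor_Hom MP_hmod)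
next
  fix X Y Z f g assume "X \<in> Ob D" "Y \<in> Ob D" "Z \<in> Ob D" "f \<in> Hom D X Y" "g \<in> Hom D Y Z"
  then have h: "hmod X" "hmod Y" "hmod Z" and f: "f \<in> Hm X Y" and g: "g \<in> Hm Y Z" by (auto simp: MP_hmod)
  have "kl X Z (Cmp D X Y Z g f) t = kl Y Z g (kl X Y f t)" if t: "t \<in> carrier (free X)" for t
  proof -
    have "kl X Z (Cmp D X Y Z g f) t = kl X Z (\<lambda>x. kl Y Z g (f x)) t"
      by (rule kl_cong[OF t hmod_mod[OF h(1)]]) (simp add: Cmp_D[OF h f g])
    then show ?thesis by (simp add: kl_kl[OF h Hm_lin[OF f] Hm_lin[OF g] t])
  qed
  then show "Xi_mor k L X Z (Cmp D X Y Z g f) = Cmp MH (XH X) (XH Y) (XH Z) (Xi_mor k L Y Z g) (Xi_mor k L X Y f)"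
    using kl_closed[OF Hm_lin[OF f] hmod_mod[OF h(1)] hmod_mod[OF h(2)]]
    by (auto simp: Xi_mor_eq[OF h(1,3) Cmp_Hm[OF h f g]] Xi_mor_eq[OF h(1,2) f] Xi_mor_eq[OF h(2,3) g] compose_def
      intro!: restrict_ext)
qed

lemma M0_simps [simp]:
  "Ob M0 = {(X, M). X \<in> MP \<and> M \<in> Ob (mod_cat k QQ) \<and> M = XH X}"
  "Hom M0 P Q = ahom k QQ (snd P) (snd Q)" "Idt M0 P = restrict id (carrier (snd P))"
  "Cmp M0 P Q T g f = compose (carrier (snd P)) g f"
  by (simp_all add: Mod0_HL_def full_subcat_of_form_def)

lemma category_M0: "category M0"
proof -
  interpret category MH by (rule category_MH)
  have ob: "X \<in> MP \<Longrightarrow> XH X \<in> Ob MH" for X by (simp add: XH_Ob)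
  note [simp] = XH_Ob and [simp del] = XH_carrier
  show ?thesis
  proof
    fix P Q T f g assume "P \<in> Ob M0" "Q \<in> Ob M0" "T \<in> Ob M0" "f \<in> Hom M0 P Q" "g \<in> Hom M0 Q T"
    then show "Cmp M0 P Q T g f \<in> Hom M0 P T"
      using Cmp_Hom[OF ob ob ob, of "fst P" "fst Q" "fst T" f g] by auto
  next
    fix P Q f assume "P \<in> Ob M0" "Q \<in> Ob M0" "f \<in> Hom M0 P Q"
    then show "Cmp M0 P P Q f (Idt M0 P) = f" "Cmp M0 P Q Q (Idt M0 Q) f = f"
      using Cmp_Idt_right[OF ob ob, of "fst P" "fst Q" f] Cmp_Idt_left[OF ob ob, of "fst P" "fst Q" f] by auto
  next
    fix W P Q T f g h assume "W \<in> Ob M0" "P \<in> Ob M0" "Q \<in> Ob M0" "T \<in> Ob M0"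
      "f \<in> Hom M0 W P" "g \<in> Hom M0 P Q" "h \<in> Hom M0 Q T"
    then show "Cmp M0 W Q T h (Cmp M0 W P Q g f) = Cmp M0 W P T (Cmp M0 P Q T h g) f"
      using Cmp_assoc[OF ob ob ob ob, of "fst W" "fst P" "fst Q" "fst T" f g h] by auto
  qed (use Idt_Hom[OF ob] in auto)
qed

text \<open>An object of \<open>M0\<close> remembers the X from which it is formed, so the first
  projection inverts the functor on objects; on morphisms \<open>Xi_mor_bij\<close> applies through
  \<open>ahom_rs\<close>.\<close>

theorem Xi_isomorphism: "category_isomorphism D M0 (\<lambda>X. (X, XH X)) (Xi_mor k L)"
proof -
  interpret F: cat_functor D MH XH "Xi_mor k L" by (rule Xi_functor)
  show ?thesis
  proof (intro category_isomorphism.intro fully_faithful_functor.intro cat_functor.intro category_D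
      category_M0 cat_functor_axioms.intro fully_faithful_functor_axioms.intro category_isomorphism_axioms.intro)
    show "bij_betw (\<lambda>X. (X, XH X)) (Ob D) (Ob M0)"
      by (rule bij_betwI[where g = fst]) (auto simp: XH_Ob)
    fix X Y assume "X \<in> Ob D" "Y \<in> Ob D"
    then show "bij_betw (Xi_mor k L X Y) (Hom D X Y) (Hom M0 (X, XH X) (Y, XH Y))"
      using Xi_mor_bij[OF MP_hmod MP_hmod] by (simp add: ahom_rs rs_XH)
  qed (use F.F_Hom F.F_Idt F.F_Cmp in \<open>auto simp: XH_Ob\<close>)
qed

theorem Mod0_full: "fully_faithful_functor M0 (mod_cat k S) (\<lambda>(X, M). rs M) (\<lambda>P Q f. f)"
proof -
  interpret F: full_embedding MH "mod_cat k S" rs "\<lambda>M N f. f" by (rule full_embedding_rs)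
  show ?thesis
  proof (intro fully_faithful_functor.intro cat_functor.intro category_M0 category_mod_cat
      cat_functor_axioms.intro fully_faithful_functor_axioms.intro)
    fix P Q f assume "P \<in> Ob M0" "Q \<in> Ob M0" "f \<in> Hom M0 P Q"
    then show "f \<in> Hom (mod_cat k S) (case P of (X, M) \<Rightarrow> rs M) (case Q of (X, M) \<Rightarrow> rs M)"
      by (auto simp: mod_cat_def ahom_rs)
  next
    fix P Q assume "P \<in> Ob M0" "Q \<in> Ob M0"
    then show "bij_betw (\<lambda>f. f) (Hom M0 P Q) (Hom (mod_cat k S) (case P of (X, M) \<Rightarrow> rs M) (case Q of (X, M) \<Rightarrow> rs M))"
      by (auto simp: mod_cat_def ahom_rs bij_betw_def)
  next
    fix P assume "P \<in> Ob M0"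
    then show "(case P of (X, M) \<Rightarrow> rs M) \<in> Ob (mod_cat k S)" by (auto intro!: rs_Ob)
  qed (auto simp: mod_cat_def)
qed

section \<open>Tensor products over \<open>L\<close>\<close>

abbreviation "smod \<equiv> amodule k S"
abbreviation "SR \<equiv> src k H L"
abbreviation "LT \<equiv> ltensor k H R L"
abbreviation "lt \<equiv> lten k H R L"
abbreviation "LM \<equiv> ltensor_mod k H R L"

lemma S_closed [mlin]:
  "l \<in> carrier L \<Longrightarrow> TP l \<in> carrier S" "l \<in> carrier L \<Longrightarrow> SR l \<in> carrier S"
  by (simp_all add: TP_closed src_closed)

text \<open>\<open>H\<close> acts on the unit of \<open>L\<close> through the counit, and (id
  \<otimes> \<epsilon>) R = 1. This makes balance over \<open>L\<close> include balance over
  scalars, see \<open>TP_smult\<close>.\<close>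

lemma TP_one: "TP \<one>\<^bsub>L\<^esub> = \<one>\<^bsub>S\<^esub>"
proof -
  have "TP \<one>\<^bsub>L\<^esub> = tlift LH (\<lambda>a b. tn L H \<one>\<^bsub>L\<^esub> (\<epsilon> b \<odot>\<^bsub>H\<^esub> a)) R"
    unfolding tgt_plus_def tgt_def
    by (rule tlift_cong[of _ H H], (rule mlin)+)
      (use L_one_trivial in \<open>simp add: trivial_def ten_smult L_mod H_mod counit_closed one_closed[OF L_alg]\<close>)
  also have "\<dots> = tn L H \<one>\<^bsub>L\<^esub> (tlift H (\<lambda>a b. \<epsilon> b \<odot>\<^bsub>H\<^esub> a) R)"
    by (rule tlift_hom[symmetric, of H]) (rule mlin | assumption)+
  finally show ?thesis by (simp add: R_counit_right)
qed

lemma TP_smult: "r \<in> carrier k \<Longrightarrow> TP (r \<odot>\<^bsub>L\<^esub> \<one>\<^bsub>L\<^esub>) = r \<odot>\<^bsub>S\<^esub> \<one>\<^bsub>S\<^esub>"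
proof -
  assume r: "r \<in> carrier k"
  have "lin L LH TP" unfolding tgt_plus_def tgt_def by (rule mlin | assumption)+
  from lin_map_smult[OF this r one_closed[OF L_alg]] show ?thesis
    unfolding TP_one by (simp only: smash_simps(4))
qed

lemma SR_smult: "r \<in> carrier k \<Longrightarrow> SR (r \<odot>\<^bsub>L\<^esub> \<one>\<^bsub>L\<^esub>) = r \<odot>\<^bsub>S\<^esub> \<one>\<^bsub>S\<^esub>"
  by (simp add: src_def ten_smult L_mod H_mod one_closed[OF L_alg] one_closed[OF H_alg])

definition lbil where
  "lbil M N P f \<longleftrightarrow> bil k M N P f \<and>
    (\<forall>m\<in>carrier M. \<forall>l\<in>carrier L. \<forall>n\<in>carrier N. f (act M (TP l) m) n = f m (act N (SR l) n))"

lemma LT_balanced: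
  assumes [mlin]: "smod M" "smod N"
  shows "balanced k (carrier L) (\<lambda>m l. act M (TP l) m) (\<lambda>l n. act N (SR l) n) M N"
proof (rule balanced.intro)
  note [mlin] = assms[THEN amodule_mod]
  show "kmod M" "kmod N" by (rule mlin)+
  fix l assume [mlin]: "l \<in> carrier L"
  show "act M (TP l) m \<in> carrier M" if "m \<in> carrier M" for m by (rule mlin that)+
  show "act N (SR l) n \<in> carrier N" if "n \<in> carrier N" for n by (rule mlin that)+
  show "act M (TP l) (r \<odot>\<^bsub>M\<^esub> m) = r \<odot>\<^bsub>M\<^esub> act M (TP l) m" if "r \<in> carrier k" "m \<in> carrier M" for r m
    by (rule lin_map_smult[of k M M]) (rule mlin that)+
qed

lemma lbil_balmap:
  "lbil M N P f \<Longrightarrow> balmap (carrier L) (\<lambda>m l. act M (TP l) m) (\<lambda>l n. act N (SR l) n) M N P f"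
  by (auto simp: lbil_def balmap_def bil_def lin_map_def)

lemma LT_mod: "smod M \<Longrightarrow> smod N \<Longrightarrow> kmod (LT M N)"
  unfolding ltensor_def by (rule balanced.module_BT[OF LT_balanced])

lemma lt_lbil:
  assumes M: "smod M" and N: "smod N"
  shows "lbil M N (LT M N) (lt M N)"
proof -
  interpret b: balanced k "carrier L" "\<lambda>m l. act M (TP l) m" "\<lambda>l n. act N (SR l) n" M N
    by (rule LT_balanced[OF assms])
  interpret M: amodule k S M by fact
  interpret N: amodule k S N by fact
  note d = ltensor_def lten_def
  have bal: "lt M N (act M (TP l) m) n = lt M N m (act N (SR l) n)"
    if "m \<in> carrier M" "l \<in> carrier L" "n \<in> carrier N" for m l n
    unfolding d using that by (intro b.cls_eqI bal_eq.balance)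
  have s: "lt M N (r \<odot>\<^bsub>M\<^esub> m) n = r \<odot>\<^bsub>LT M N\<^esub> lt M N m n" "lt M N m (r \<odot>\<^bsub>N\<^esub> n) = r \<odot>\<^bsub>LT M N\<^esub> lt M N m n"
    if r: "r \<in> carrier k" and mn: "m \<in> carrier M" "n \<in> carrier N" for r m n
  proof -
    show 1: "lt M N (r \<odot>\<^bsub>M\<^esub> m) n = r \<odot>\<^bsub>LT M N\<^esub> lt M N m n"
      unfolding d using b.smult_cls[of "[(m, n)]" r] that by simp
    \<comment> \<open>For l = r 1 source and target both give r 1 in the smash product, so balancing
      over \<open>L\<close> carries scalars from one factor to the other.\<close>
    have rl: "r \<odot>\<^bsub>L\<^esub> \<one>\<^bsub>L\<^esub> \<in> carrier L"
      using r module.smult_closed[OF L_mod] one_closed[OF L_alg] by blast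
    have one: "\<one>\<^bsub>S\<^esub> \<in> carrier S" by (rule one_closed[OF S_alg])
    have "act M (TP (r \<odot>\<^bsub>L\<^esub> \<one>\<^bsub>L\<^esub>)) m = r \<odot>\<^bsub>M\<^esub> m" "act N (SR (r \<odot>\<^bsub>L\<^esub> \<one>\<^bsub>L\<^esub>)) n = r \<odot>\<^bsub>N\<^esub> n"
      unfolding TP_smult[OF r] SR_smult[OF r] M.act_smult[OF r one mn(1)] N.act_smult[OF r one mn(2)]
        M.act_one[OF mn(1)] N.act_one[OF mn(2)] by simp_all
    with bal[OF mn(1) rl mn(2)] 1 show "lt M N m (r \<odot>\<^bsub>N\<^esub> n) = r \<odot>\<^bsub>LT M N\<^esub> lt M N m n" by simp
  qed
  have c: "lt M N m n \<in> carrier (LT M N)" if "m \<in> carrier M" "n \<in> carrier N" for m n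
    unfolding d using that by (intro b.cls_closed) simp
  have a: "lt M N (m \<oplus>\<^bsub>M\<^esub> m') n = lt M N m n \<oplus>\<^bsub>LT M N\<^esub> lt M N m' n"
    if "m \<in> carrier M" "m' \<in> carrier M" "n \<in> carrier N" for m m' n
    unfolding d using that b.add_cls[of "[(m, n)]" "[(m', n)]"] b.cls_eqI[OF bal_eq.add_left[of m M m' n N]] by simp
  have a': "lt M N m (n \<oplus>\<^bsub>N\<^esub> n') = lt M N m n \<oplus>\<^bsub>LT M N\<^esub> lt M N m n'"
    if "m \<in> carrier M" "n \<in> carrier N" "n' \<in> carrier N" for m n n'
    unfolding d using that b.add_cls[of "[(m, n)]" "[(m, n')]"] b.cls_eqI[OF bal_eq.add_right[of m M n N n']] by simp
  show ?thesis
    unfolding lbil_def bil_def using bal s c a a' by (auto intro!: lin_mapI)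
qed

lemma lt_bil: "smod M \<Longrightarrow> smod N \<Longrightarrow> bil k M N (LT M N) (lt M N)"
  using lt_lbil by (auto simp: lbil_def)

lemma lt_balance:
  "smod M \<Longrightarrow> smod N \<Longrightarrow> m \<in> carrier M \<Longrightarrow> l \<in> carrier L \<Longrightarrow> n \<in> carrier N \<Longrightarrow>
    lt M N (act M (TP l) m) n = lt M N m (act N (SR l) n)"
  using lt_lbil by (auto simp: lbil_def)

lemma lt_lin [mlin]:
  "smod M \<Longrightarrow> smod N \<Longrightarrow> lin Q M f \<Longrightarrow> n \<in> carrier N \<Longrightarrow> lin Q (LT M N) (\<lambda>x. lt M N (f x) n)"
  "smod M \<Longrightarrow> smod N \<Longrightarrow> m \<in> carrier M \<Longrightarrow> lin Q N g \<Longrightarrow> lin Q (LT M N) (\<lambda>x. lt M N m (g x))"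
  "smod M \<Longrightarrow> smod N \<Longrightarrow> m \<in> carrier M \<Longrightarrow> n \<in> carrier N \<Longrightarrow> lt M N m n \<in> carrier (LT M N)"
  by (rule bil_left[OF lt_bil] bil_right[OF lt_bil] bil_closed[OF lt_bil]; assumption)+

lemma LT_tlift:
  "smod M \<Longrightarrow> smod N \<Longrightarrow> kmod P \<Longrightarrow> lbil M N P f \<Longrightarrow> m \<in> carrier M \<Longrightarrow> n \<in> carrier N \<Longrightarrow>
    tlift P f (lt M N m n) = f m n"
  unfolding lten_def by (rule balanced.tlift_cls1[OF LT_balanced mod_ab lbil_balmap])

lemma LT_tlift_lin0:
  "smod M \<Longrightarrow> smod N \<Longrightarrow> kmod P \<Longrightarrow> lbil M N P f \<Longrightarrow> lin (LT M N) P (tlift P f)"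
  unfolding ltensor_def
  by (rule balanced.tlift_lin[OF LT_balanced _ lbil_balmap]) (auto simp: lbil_def bil_def lin_map_def)

lemma LT_ext:
  assumes t: "t \<in> carrier (LT M N)" and MN: "smod M" "smod N" and P: "kmod P"
    and f: "lin (LT M N) P f" and g: "lin (LT M N) P g"
    and eq: "\<And>m n. m \<in> carrier M \<Longrightarrow> n \<in> carrier N \<Longrightarrow> f (lt M N m n) = g (lt M N m n)"
  shows "f t = g t"
proof -
  interpret b: balanced k "carrier L" "\<lambda>m l. act M (TP l) m" "\<lambda>l n. act N (SR l) n" M N
    by (rule LT_balanced[OF MN])
  note d = ltensor_def lten_def
  from t show ?thesis unfolding d
  proof (induction rule: b.BT_induct)
    case zero
    then show ?case
      using lin_map_zero[OF f LT_mod[OF MN] P] lin_map_zero[OF g LT_mod[OF MN] P] by (simp add: d)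
  next
    case (pure m n)
    then show ?case using eq by (simp add: d)
  next
    case (add s t)
    then show ?case using lin_map_add[OF f, of s t] lin_map_add[OF g, of s t] by (simp add: d)
  qed
qed

lemma LT_prs:
  "t \<in> carrier (LT M N) \<Longrightarrow> smod M \<Longrightarrow> smod N \<Longrightarrow> set (summands t) \<subseteq> carrier M \<times> carrier N"
  by (rule balanced.BT_prs[OF LT_balanced]) (simp_all add: ltensor_def)

lemma LT_lin_fun:
  assumes "t \<in> carrier (LT M N)" "smod M" "smod N" "kmod Q" "kmod P"
    "\<And>m n. m \<in> carrier M \<Longrightarrow> n \<in> carrier N \<Longrightarrow> lin Q P (\<lambda>x. F x m n)"
  shows "lin Q P (\<lambda>x. tlift P (\<lambda>m n. F x m n) t)"
  unfolding tlift_lsum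
  by (rule lin_lsum[OF assms(5,4) LT_prs[OF assms(1-3)] assms(6)])

lemma LT_cong:
  assumes "t \<in> carrier (LT M N)" "smod M" "smod N"
    "\<And>m n. m \<in> carrier M \<Longrightarrow> n \<in> carrier N \<Longrightarrow> f m n = g m n"
  shows "tlift P f t = tlift P g t"
  unfolding tlift_lsum by (rule lsum_cong[OF LT_prs[OF assms(1-3)] assms(4)])

lemma LT_hom:
  assumes "lin P Q h" "t \<in> carrier (LT M N)" "smod M" "smod N" "kmod P" "kmod Q"
    "\<And>m n. m \<in> carrier M \<Longrightarrow> n \<in> carrier N \<Longrightarrow> f m n \<in> carrier P"
  shows "h (tlift P f t) = tlift Q (\<lambda>m n. h (f m n)) t"
  unfolding tlift_lsum
  by (rule lsum_hom[OF mod_ab[OF assms(5)] mod_ab[OF assms(6)] LT_prs[OF assms(2-4)]])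
    (use assms in \<open>auto intro: lin_map_zero lin_map_add\<close>)

lemma LT_swap:
  assumes "s \<in> carrier (A \<otimes>\<^sub>k B)" "t \<in> carrier (LT M N)" "kmod A" "kmod B" "smod M" "smod N" "kmod P"
    "\<And>a b m n. a \<in> carrier A \<Longrightarrow> b \<in> carrier B \<Longrightarrow> m \<in> carrier M \<Longrightarrow> n \<in> carrier N \<Longrightarrow>
      f a b m n \<in> carrier P"
  shows "tlift P (\<lambda>a b. tlift P (f a b) t) s = tlift P (\<lambda>m n. tlift P (\<lambda>a b. f a b m n) s) t"
  unfolding tlift_lsum
  by (rule lsum_swap[OF mod_ab[OF assms(7)] prs_summands[OF assms(1,3,4)]
        LT_prs[OF assms(2,5,6)] assms(8)])

text \<open>The smash product as a left module over itself. It makes the tensor square containing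
  the coproduct an instance of \<open>LT\<close>, as \<open>bcomul_eq\<close> records.\<close>

definition "Sreg = with_act S (\<lambda>a b. a \<otimes>\<^bsub>S\<^esub> b)"

lemma Sreg_simps:
  "carrier Sreg = carrier S" "act Sreg a b = a \<otimes>\<^bsub>S\<^esub> b"
  by (simp_all add: Sreg_def)

lemma smod_Sreg: "smod Sreg"
proof -
  interpret S: assoc_algebra k S by (rule S_alg)
  show ?thesis
  proof (rule amoduleI)
    show "kmod Sreg" unfolding Sreg_def by (rule mlin alg_mod S_alg)+
    show "bil k S Sreg Sreg (act Sreg)" using mult_bil[OF S_alg] by (simp add: bil_def Sreg_def)
  qed (simp_all add: Sreg_simps S.A.m_assoc S.A.l_one del: smash_simps)
qed

lemma bcomul_eq:
  "bcomul k H R L = tlift (LT Sreg Sreg) (\<lambda>l h. tlift (LT Sreg Sreg)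
     (\<lambda>h1 h2. lt Sreg Sreg (tn L H l h1) (tn L H \<one>\<^bsub>L\<^esub> h2)) (\<Delta> h))"
  unfolding bcomul_def ltensor_def lten_def Let_def Sreg_def bal_tensor_def
  by (simp add: bal_class_cong[of "with_act S _" S "with_act S _" S])

lemma LM_act_eq:
  "a \<in> carrier LH \<Longrightarrow> t \<in> carrier (LT M N) \<Longrightarrow> act (LM M N) a t = tlift (LT M N)
    (\<lambda>a1 a2. tlift (LT M N) (\<lambda>m n. lt M N (act M a1 m) (act N a2 n)) t) (bcomul k H R L a)"
  by (simp add: ltensor_mod_def smash_act_def)

lemma LM_simps [simp]:
  "carrier (LM M N) = carrier (LT M N)" "zero (LM M N) = zero (LT M N)" "add (LM M N) = add (LT M N)"
  "smult (LM M N) = smult (LT M N)"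
  by (simp_all add: ltensor_mod_def smash_act_def)

text \<open>In M \<otimes> N over \<open>L\<close>, letting t^+(l) a1 act on m agrees with letting
  s(l) a2 act on n. So the action factors through the tensor square of the smash product, and may be
  computed from any representative of the coproduct. The list of \<open>t\<close> stays fixed
  throughout.\<close>

lemma
  assumes M: "smod M" and N: "smod N" and t: "t \<in> carrier (LT M N)"
  shows LM_act_lin: "lin LH (LT M N) (\<lambda>a. act (LM M N) a t)"
    and LM_act_ten: "l \<in> carrier L \<Longrightarrow> h \<in> carrier H \<Longrightarrow> act (LM M N) (tn L H l h) t =
      tlift (LT M N) (\<lambda>h1 h2. tlift (LT M N)
        (\<lambda>m n. lt M N (act M (tn L H l h1) m) (act N (tn L H \<one>\<^bsub>L\<^esub> h2) n)) t) (\<Delta> h)"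
proof -
  let ?B = "LT Sreg Sreg" and ?P = "LT M N"
  let ?G = "\<lambda>a1 a2. tlift ?P (\<lambda>m n. lt M N (act M a1 m) (act N a2 n)) t"
  interpret M: amodule k S M by fact
  interpret N: amodule k S N by fact
  note [mlin] = smod_Sreg M N LT_mod[OF smod_Sreg smod_Sreg] LT_mod[OF M N] alg_mod[OF S_alg]
  have lS [mlin]: "lin Q Sreg f" if "lin Q LH f" for Q :: "('a univ, 'a univ) hopf" and f
    using that by (simp add: Sreg_def)
  have lS' [mlin]: "lin Q Sreg f" if "lin Q LH f" for Q :: "('a univ, 'a univ, 'a univ) amod" and f
    using that by (simp add: Sreg_def)
  have cS [mlin]: "x \<in> carrier Sreg" if "x \<in> carrier LH" for x using that by (simp add: Sreg_def)
  have b: "bil k L H ?B (\<lambda>l h. tlift ?B (\<lambda>h1 h2. lt Sreg Sreg (tn L H l h1) (tn L H \<one>\<^bsub>L\<^esub> h2)) (\<Delta> h))"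
    by (rule mlin | assumption)+
  have bG: "bil k S S ?P ?G"
  proof (rule bilI)
    show "lin S ?P (?G a)" if a [mlin]: "a \<in> carrier S" for a
      by (rule LT_lin_fun[OF t M N]) (rule mlin | assumption)+
    show "lin S ?P (\<lambda>a. ?G a b)" if b [mlin]: "b \<in> carrier S" for b
      by (rule LT_lin_fun[OF t M N]) (rule mlin | assumption)+
  qed
  have G: "lbil Sreg Sreg ?P ?G"
    unfolding lbil_def
  proof (intro conjI ballI)
    show "bil k Sreg Sreg ?P ?G" using bG by (simp add: bil_def Sreg_def)
    fix a l c assume "a \<in> carrier Sreg" and l [mlin]: "l \<in> carrier L" and "c \<in> carrier Sreg"
    then have a [mlin]: "a \<in> carrier S" and c [mlin]: "c \<in> carrier S" by (simp_all only: Sreg_simps)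
    show "?G (act Sreg (TP l) a) c = ?G a (act Sreg (SR l) c)"
      unfolding Sreg_simps
    proof (rule LT_cong[OF t M N])
      fix m n assume [mlin]: "m \<in> carrier M" "n \<in> carrier N"
      show "lt M N (act M (TP l \<otimes>\<^bsub>S\<^esub> a) m) (act N c n) = lt M N (act M a m) (act N (SR l \<otimes>\<^bsub>S\<^esub> c) n)"
        by (subst M.act_mult, (rule mlin)+, subst N.act_mult, (rule mlin)+, rule lt_balance) (rule mlin)+
    qed
  qed
  have lb: "lin LH ?B (bcomul k H R L)"
    unfolding bcomul_eq by (rule tlift_lin0[OF b]) (rule mlin)+
  have lG: "lin ?B ?P (tlift ?P ?G)" by (rule LT_tlift_lin0[OF smod_Sreg smod_Sreg _ G]) (rule mlin)
  show "lin LH ?P (\<lambda>a. act (LM M N) a t)"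
    by (rule lin_map_cong[OF lin_map_comp[OF lb lG]]) ((rule mlin)+, simp add: LM_act_eq t)
  assume [mlin]: "l \<in> carrier L" "h \<in> carrier H"
  have c: "tn L H l h \<in> carrier LH" by (rule mlin)+
  have "act (LM M N) (tn L H l h) t =
      tlift ?P ?G (tlift ?B (\<lambda>h1 h2. lt Sreg Sreg (tn L H l h1) (tn L H \<one>\<^bsub>L\<^esub> h2)) (\<Delta> h))"
    unfolding LM_act_eq[OF c t] bcomul_eq by (subst tlift_ten[OF b], (rule mlin)+) simp
  also have "\<dots> = tlift ?P (\<lambda>h1 h2. tlift ?P ?G (lt Sreg Sreg (tn L H l h1) (tn L H \<one>\<^bsub>L\<^esub> h2))) (\<Delta> h)"
    by (rule tlift_hom[OF lG]) (rule mlin | assumption)+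
  also have "\<dots> = tlift ?P (\<lambda>h1 h2. ?G (tn L H l h1) (tn L H \<one>\<^bsub>L\<^esub> h2)) (\<Delta> h)"
    by (rule tlift_cong[of _ H H], (rule mlin)+, rule LT_tlift[OF smod_Sreg smod_Sreg _ G]) (rule mlin | assumption)+
  finally show "act (LM M N) (tn L H l h) t = \<dots>" .
qed

text \<open>A left inverse makes \<open>J\<close> injective, so every module law for V may be
  checked after applying \<open>J\<close>, where it is a law of P.\<close>

lemma amodule_transport:
  assumes P: "amodule k A P" and V: "kmod V" and J: "lin V P J" and A: "assoc_algebra k A"
    and E: "\<And>t. t \<in> carrier V \<Longrightarrow> E (J t) = t"
    and c: "\<And>a t. a \<in> carrier A \<Longrightarrow> t \<in> carrier V \<Longrightarrow> act V a t \<in> carrier V"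
    and eq: "\<And>a t. a \<in> carrier A \<Longrightarrow> t \<in> carrier V \<Longrightarrow> J (act V a t) = act P a (J t)"
  shows "amodule k A V"
proof -
  interpret A: assoc_algebra k A by fact
  interpret P: amodule k A P by fact
  interpret V: module k V by fact
  have inj: "s = t" if "s \<in> carrier V" "t \<in> carrier V" "J s = J t" for s t
    using E that by metis
  note j = lin_map_closed[OF J] lin_map_add[OF J] lin_map_smult[OF J] eq c
  note pl = lin_map_add[OF P.act_lin] lin_map_smult[OF P.act_lin]
  show ?thesis
  proof (rule amoduleI[OF V])
    show "bil k A V V (act V)"
      unfolding bil_def
      by (intro conjI ballI lin_mapI; (rule c | rule inj))
        (simp_all add: j pl P.act_add P.act_smult A.M.smult_closed A.M.a_closed)
    show "act V (a \<otimes>\<^bsub>A\<^esub> b) x = act V a (act V b x)" if "a \<in> carrier A" "b \<in> carrier A" "x \<in> carrier V" for a b x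
      using that by (intro inj) (simp_all add: j P.act_mult)
    show "act V \<one>\<^bsub>A\<^esub> x = x" if "x \<in> carrier V" for x
      using that by (intro inj) (simp_all add: j P.act_one)
  qed
qed

subsection \<open>The monoidal structure of the functor\<close>

lemma XX_simps:
  "zero (XX X) = zero (free X)" "add (XX X) = add (free X)" "smult (XX X) = smult (free X)"
  by (simp_all add: Xi_SM)

lemma XX_lin [simp]: "lin_map k (XX X) M f = lin_map k (free X) M f" "lin_map k M (XX X) g = lin_map k M (free X) g"
  by (simp_all add: lin_map_def XX_simps)

lemma XX_smod: "hmod X \<Longrightarrow> smod (XX X)"
  using XX_Ob by (simp add: Ob_mod_cat)

lemma XX_src: "hmod X \<Longrightarrow> l \<in> carrier L \<Longrightarrow> v \<in> carrier (free X) \<Longrightarrow> act (XX X) (SR l) v = la X l v"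
  unfolding Xi_SM by (rule SM_src[OF compat_la]) simp_all

lemma XX_act_ten:
  assumes "hmod X" "l \<in> carrier L" "h \<in> carrier H" "v \<in> carrier (free X)"
  shows "act (XX X) (tn L H l h) v = la X l (act (htens X L) h v)"
  unfolding Xi_SM using assms by (simp add: SM_act ten_closed sact_ten[OF compat_la])

definition "JL X Y = tlift (X \<otimes>\<^sub>k Y \<otimes>\<^sub>k L) (jj X Y)"

text \<open>The inverse of \<open>JL\<close>. Since x \<otimes> l equals t^+(l) applied to x
  \<otimes> 1, balance over \<open>L\<close> allows every class to be written with the unit of
  \<open>L\<close> in the first factor.\<close>

definition "EL X Y = tlift (LT (XX X) (XX Y)) (\<lambda>u m. tlift (LT (XX X) (XX Y))
  (\<lambda>x y. lt (XX X) (XX Y) (tn X L x \<one>\<^bsub>L\<^esub>) (tn Y L y m)) u)"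

context
  fixes X Y :: "('a univ, 'a univ, 'a univ) amod"
  assumes X: "hmod X" and Y: "hmod Y"
begin

lemma sXY: "smod (XX X)" "smod (XX Y)" "smod (XX (htens X Y))"
  using X Y by (simp_all add: XX_smod hmod_htensor)

lemma lt_XX_lin [mlin]:
  "lin Q (free X) f \<Longrightarrow> n \<in> carrier (free Y) \<Longrightarrow> lin Q (LT (XX X) (XX Y)) (\<lambda>x. lt (XX X) (XX Y) (f x) n)"
  "m \<in> carrier (free X) \<Longrightarrow> lin Q (free Y) g \<Longrightarrow> lin Q (LT (XX X) (XX Y)) (\<lambda>x. lt (XX X) (XX Y) m (g x))"
  "m \<in> carrier (free X) \<Longrightarrow> n \<in> carrier (free Y) \<Longrightarrow> lt (XX X) (XX Y) m n \<in> carrier (LT (XX X) (XX Y))"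
  using lt_lin[OF sXY(1,2)] by simp_all

lemma LTXX_mod [mlin]: "kmod (LT (XX X) (XX Y))"
  by (rule LT_mod[OF sXY(1,2)])

lemma jj_lbil: "lbil (XX X) (XX Y) (X \<otimes>\<^sub>k Y \<otimes>\<^sub>k L) (jj X Y)"
proof -
  note [mlin] = X Y
  have "bil k (free X) (free Y) (X \<otimes>\<^sub>k Y \<otimes>\<^sub>k L) (jj X Y)" by (rule mlin | assumption)+
  then show ?thesis
    by (simp add: lbil_def bil_def Xi_tgt_plus XX_src X Y jj_rmul_left)
qed

lemma JL_lt: "s \<in> carrier (free X) \<Longrightarrow> t \<in> carrier (free Y) \<Longrightarrow> JL X Y (lt (XX X) (XX Y) s t) = jj X Y s t"
  unfolding JL_def
  by (rule LT_tlift[OF sXY(1,2) _ jj_lbil]) (simp_all add: tensor_mod hmod_mod X Y L_mod)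

lemma JL_lin: "lin (LT (XX X) (XX Y)) (X \<otimes>\<^sub>k Y \<otimes>\<^sub>k L) (JL X Y)"
  unfolding JL_def
  by (rule LT_tlift_lin0[OF sXY(1,2) _ jj_lbil]) (simp add: tensor_mod hmod_mod X Y L_mod)

lemma EL_lin: "lin (X \<otimes>\<^sub>k Y \<otimes>\<^sub>k L) (LT (XX X) (XX Y)) (EL X Y)"
proof -
  note [mlin] = X Y
  show ?thesis unfolding EL_def by (rule tlift_lin0) (rule mlin | assumption)+
qed

lemma EL_ten:
  assumes [mlin]: "x \<in> carrier X" "y \<in> carrier Y" "m \<in> carrier L"
  shows "EL X Y (tn (X \<otimes>\<^sub>k Y) L (tn X Y x y) m) = lt (XX X) (XX Y) (tn X L x \<one>\<^bsub>L\<^esub>) (tn Y L y m)"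
proof -
  note [mlin] = X Y
  show ?thesis unfolding EL_def
    by (subst tlift_ten, (rule mlin | assumption)+, rule tlift_ten) (rule mlin | assumption)+
qed

lemma JL_EL: "w \<in> carrier (X \<otimes>\<^sub>k Y \<otimes>\<^sub>k L) \<Longrightarrow> JL X Y (EL X Y w) = w"
proof (rule tensor_ext3[where g = "\<lambda>w. w" and P = "X \<otimes>\<^sub>k Y \<otimes>\<^sub>k L"])
  note [mlin] = X Y
  fix x y m assume [mlin]: "x \<in> carrier X" "y \<in> carrier Y" "m \<in> carrier L"
  show "JL X Y (EL X Y (tn (X \<otimes>\<^sub>k Y) L (tn X Y x y) m)) = tn (X \<otimes>\<^sub>k Y) L (tn X Y x y) m"
    by (subst EL_ten, (rule mlin)+, subst JL_lt, (rule mlin)+, subst jj_ten_one, (rule mlin)+, rule ins_ten)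
      (rule mlin)+
qed (simp_all add: X Y hmod_mod L_mod tensor_mod lin_id lin_map_comp[OF EL_lin JL_lin])

lemma EL_JL: "t \<in> carrier (LT (XX X) (XX Y)) \<Longrightarrow> EL X Y (JL X Y t) = t"
proof (rule LT_ext[OF _ sXY(1,2), where g = "\<lambda>t. t" and P = "LT (XX X) (XX Y)"])
  note [mlin] = X Y
  note [mlin] = lin_map_comp[OF _ EL_lin]
  fix s t assume "s \<in> carrier (XX X)" "t \<in> carrier (XX Y)"
  then have s: "s \<in> carrier (free X)" and t [mlin]: "t \<in> carrier (free Y)" by simp_all
  have i: "EL X Y (ins X Y x t) = lt (XX X) (XX Y) (tn X L x \<one>\<^bsub>L\<^esub>) t"
    if [mlin]: "x \<in> carrier X" and t: "t \<in> carrier (free Y)" for x t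
  proof (rule tensor_ext[OF t, of "LT (XX X) (XX Y)"])
    fix y m assume [mlin]: "y \<in> carrier Y" "m \<in> carrier L"
    show "EL X Y (ins X Y x (tn Y L y m)) = lt (XX X) (XX Y) (tn X L x \<one>\<^bsub>L\<^esub>) (tn Y L y m)"
      by (subst ins_ten, (rule mlin)+, rule EL_ten) (rule mlin)+
  qed (rule mlin | assumption)+
  have "EL X Y (jj X Y s t) = lt (XX X) (XX Y) s t"
  proof (rule tensor_ext[OF s, of "LT (XX X) (XX Y)"])
    fix x l assume xl [mlin]: "x \<in> carrier X" "l \<in> carrier L"
    have x1 [mlin]: "tn X L x \<one>\<^bsub>L\<^esub> \<in> carrier (free X)" by (rule mlin)+
    have "EL X Y (jj X Y (tn X L x l) t) = lt (XX X) (XX Y) (tn X L x \<one>\<^bsub>L\<^esub>) (la Y l t)"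
      by (subst jj_ten, (rule mlin)+, rule i) (rule mlin)+
    \<comment> \<open>Right multiplication by l is t^+(l), so this is the balancing
      relation.\<close>
    also have "\<dots> = lt (XX X) (XX Y) (rmul X (tn X L x \<one>\<^bsub>L\<^esub>) l) t"
      using lt_balance[OF sXY(1,2), of "tn X L x \<one>\<^bsub>L\<^esub>" l t] x1 xl t
      by (simp add: Xi_tgt_plus XX_src X Y)
    also have "rmul X (tn X L x \<one>\<^bsub>L\<^esub>) l = tn X L x l"
      by (simp add: rmul_ten hmod_mod X xl one_closed[OF L_alg] lmul_one)
    finally show "EL X Y (jj X Y (tn X L x l) t) = lt (XX X) (XX Y) (tn X L x l) t" .
  qed (rule mlin | assumption)+
  then show "EL X Y (JL X Y (lt (XX X) (XX Y) s t)) = lt (XX X) (XX Y) s t"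
    using JL_lt[OF s t] by simp
qed (simp_all add: LTXX_mod lin_id lin_map_comp[OF JL_lin EL_lin])

lemma LM_closed:
  "a \<in> carrier LH \<Longrightarrow> t \<in> carrier (LT (XX X) (XX Y)) \<Longrightarrow> act (LM (XX X) (XX Y)) a t \<in> carrier (LT (XX X) (XX Y))"
  by (rule lin_map_closed[OF LM_act_lin[OF sXY(1,2)]])

text \<open>On pairs the claim is \<open>jj_act\<close> for h and \<open>jj_la\<close> for l. At
  this stage the action on the tensor product is not known to be additive in \<open>t\<close>, so
  \<open>t\<close> cannot be reduced to pure tensors; its chosen list is kept, and the sums over it
  and over the coproduct of h are exchanged.\<close>

lemma JL_act:
  assumes a: "a \<in> carrier LH" and t: "t \<in> carrier (LT (XX X) (XX Y))"
  shows "JL X Y (act (LM (XX X) (XX Y)) a t) = act (XX (htens X Y)) a (JL X Y t)"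
proof (rule tensor_ext[OF a, of "X \<otimes>\<^sub>k Y \<otimes>\<^sub>k L"])
  let ?P = "X \<otimes>\<^sub>k Y \<otimes>\<^sub>k L" and ?T = "LT (XX X) (XX Y)"
  note [mlin] = X Y
  note jt = lin_map_closed[OF JL_lin t]
  show "lin LH ?P (\<lambda>a. JL X Y (act (LM (XX X) (XX Y)) a t))"
    by (rule lin_map_comp[OF LM_act_lin[OF sXY(1,2) t] JL_lin])
  show "lin LH ?P (\<lambda>a. act (XX (htens X Y)) a (JL X Y t))"
    using act_lin_left[OF sXY(3), of LH "\<lambda>a. a" "JL X Y t"] jt by (simp add: lin_id)
  fix l h assume lh [mlin]: "l \<in> carrier L" "h \<in> carrier H"
  have XYL: "hmod (htens X Y)" by (rule mlin)+
  have ac: "act (XX X) a m \<in> carrier (free X)" if "a \<in> carrier LH" "m \<in> carrier (free X)" for a m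
    using act_closed[OF sXY(1), of a m] that by simp
  have ac': "act (XX Y) a n \<in> carrier (free Y)" if "a \<in> carrier LH" "n \<in> carrier (free Y)" for a n
    using act_closed[OF sXY(2), of a n] that by simp
  have lal: "lin ?P ?P (\<lambda>v. la (htens X Y) l v)" by (rule mlin)+
  have actl: "lin ?P ?P (\<lambda>v. act (htens (htens X Y) L) h v)" by (rule mlin)+
  have "JL X Y (act (LM (XX X) (XX Y)) (tn L H l h) t) = tlift ?P (\<lambda>h1 h2. JL X Y (tlift ?T
      (\<lambda>m n. lt (XX X) (XX Y) (act (XX X) (tn L H l h1) m) (act (XX Y) (tn L H \<one>\<^bsub>L\<^esub> h2) n)) t)) (\<Delta> h)"
    unfolding LM_act_ten[OF sXY(1,2) t lh]
  proof (rule tlift_hom[OF JL_lin])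
    fix h1 h2 assume [mlin]: "h1 \<in> carrier H" "h2 \<in> carrier H"
    have c: "tn L H l h1 \<in> carrier S" "tn L H \<one>\<^bsub>L\<^esub> h2 \<in> carrier S" by (simp; (rule mlin)+)+
    show "tlift ?T (\<lambda>m n. lt (XX X) (XX Y) (act (XX X) (tn L H l h1) m) (act (XX Y) (tn L H \<one>\<^bsub>L\<^esub> h2) n)) t \<in> carrier ?T"
      unfolding tlift_lsum
      by (rule lsum_closed[OF mod_ab[OF LTXX_mod] LT_prs[OF t sXY(1,2)]])
        (rule lt_lin(3)[OF sXY(1,2)] act_closed[OF sXY(1)] act_closed[OF sXY(2)] c | assumption)+
  qed (rule mlin)+
  also have "\<dots> = tlift ?P (\<lambda>h1 h2. tlift ?P
      (\<lambda>m n. la (htens X Y) l (jj X Y (act (htens X L) h1 m) (act (htens Y L) h2 n))) t) (\<Delta> h)"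
  proof (rule tlift_cong[of _ H H], (rule mlin)+)
    fix h1 h2 assume h [mlin]: "h1 \<in> carrier H" "h2 \<in> carrier H"
    have c: "tn L H l h1 \<in> carrier LH" "tn L H \<one>\<^bsub>L\<^esub> h2 \<in> carrier LH" by (rule mlin)+
    have "JL X Y (tlift ?T (\<lambda>m n. lt (XX X) (XX Y) (act (XX X) (tn L H l h1) m) (act (XX Y) (tn L H \<one>\<^bsub>L\<^esub> h2) n)) t) =
        tlift ?P (\<lambda>m n. JL X Y (lt (XX X) (XX Y) (act (XX X) (tn L H l h1) m) (act (XX Y) (tn L H \<one>\<^bsub>L\<^esub> h2) n))) t"
      by (rule LT_hom[OF JL_lin t sXY(1,2)]) (simp_all add: LTXX_mod tensor_mod hmod_mod X Y L_mod lt_XX_lin(3) ac ac' c)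
    also have "\<dots> = tlift ?P (\<lambda>m n. la (htens X Y) l (jj X Y (act (htens X L) h1 m) (act (htens Y L) h2 n))) t"
    proof (rule LT_cong[OF t sXY(1,2)])
      fix m n assume "m \<in> carrier (XX X)" "n \<in> carrier (XX Y)"
      then have m [mlin]: "m \<in> carrier (free X)" and n [mlin]: "n \<in> carrier (free Y)" by simp_all
      have m' [mlin]: "act (htens X L) h1 m \<in> carrier (free X)" and n' [mlin]: "act (htens Y L) h2 n \<in> carrier (free Y)"
        by (rule mlin)+
      show "JL X Y (lt (XX X) (XX Y) (act (XX X) (tn L H l h1) m) (act (XX Y) (tn L H \<one>\<^bsub>L\<^esub> h2) n)) =
          la (htens X Y) l (jj X Y (act (htens X L) h1 m) (act (htens Y L) h2 n))"
        by (simp add: JL_lt ac ac' c m n) (simp add: XX_act_ten X Y lh h m n one_closed[OF L_alg] la_one n' jj_la m')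
    qed
    finally show "JL X Y (tlift ?T (\<lambda>m n. lt (XX X) (XX Y) (act (XX X) (tn L H l h1) m) (act (XX Y) (tn L H \<one>\<^bsub>L\<^esub> h2) n)) t) = \<dots>" .
  qed
  also have "\<dots> = tlift ?P (\<lambda>m n. tlift ?P
      (\<lambda>h1 h2. la (htens X Y) l (jj X Y (act (htens X L) h1 m) (act (htens Y L) h2 n))) (\<Delta> h)) t"
  proof (rule LT_swap[OF _ t _ _ sXY(1,2)])
    fix h1 h2 m n assume [mlin]: "h1 \<in> carrier H" "h2 \<in> carrier H" and "m \<in> carrier (XX X)" "n \<in> carrier (XX Y)"
    then have [mlin]: "m \<in> carrier (free X)" "n \<in> carrier (free Y)" by simp_all
    show "la (htens X Y) l (jj X Y (act (htens X L) h1 m) (act (htens Y L) h2 n)) \<in> carrier ?P"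
      by (rule lin_map_closed[OF lal]) (rule mlin)+
  qed (rule mlin)+
  also have "\<dots> = tlift ?P (\<lambda>m n. la (htens X Y) l (act (htens (htens X Y) L) h (jj X Y m n))) t"
  proof (rule LT_cong[OF t sXY(1,2)])
    fix m n assume "m \<in> carrier (XX X)" "n \<in> carrier (XX Y)"
    then have mn [mlin]: "m \<in> carrier (free X)" "n \<in> carrier (free Y)" by simp_all
    show "tlift ?P (\<lambda>h1 h2. la (htens X Y) l (jj X Y (act (htens X L) h1 m) (act (htens Y L) h2 n))) (\<Delta> h) =
        la (htens X Y) l (act (htens (htens X Y) L) h (jj X Y m n))"
      unfolding jj_act[OF X Y lh(2) mn] by (rule tlift_hom[symmetric, OF lal]) (rule mlin | assumption)+
  qed
  also have "\<dots> = la (htens X Y) l (act (htens (htens X Y) L) h (JL X Y t))"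
    unfolding JL_def
    by (rule LT_hom[symmetric, OF lin_map_comp[OF actl lal] t sXY(1,2)])
      (use bil_closed[of k "XX X" "XX Y" ?P "jj X Y"] jj_lbil in \<open>simp_all add: lbil_def tensor_mod hmod_mod X Y L_mod\<close>)
  also have "\<dots> = act (XX (htens X Y)) (tn L H l h) (JL X Y t)"
    using XX_act_ten[OF XYL lh, of "JL X Y t"] jt by simp
  finally show "JL X Y (act (LM (XX X) (XX Y)) (tn L H l h) t) = \<dots>" .
qed (rule mlin | simp add: X Y)+

lemma LM_smod: "smod (LM (XX X) (XX Y))"
proof (rule amodule_transport[OF sXY(3) _ _ S_alg, where E = "EL X Y"])
  show "kmod (LM (XX X) (XX Y))" by (rule module_cong[OF LTXX_mod]) simp_all
  show "lin (LM (XX X) (XX Y)) (XX (htens X Y)) (JL X Y)"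
    using JL_lin by (simp add: lin_map_def XX_simps)
qed (simp_all add: EL_JL LM_closed JL_act)

lemma LM_Ob: "LM (XX X) (XX Y) \<in> Ob (mod_cat k S)"
  using LM_smod by (auto simp: Ob_mod_cat ltensor_mod_def smash_act_def)

lemma JL_ahom: "restrict (JL X Y) (carrier (LT (XX X) (XX Y))) \<in> ahom k S (LM (XX X) (XX Y)) (XX (htens X Y))"
proof -
  have "lin (LT (XX X) (XX Y)) (X \<otimes>\<^sub>k Y \<otimes>\<^sub>k L) (restrict (JL X Y) (carrier (LT (XX X) (XX Y))))"
    by (rule lin_map_cong[OF JL_lin LTXX_mod]) simp
  then show ?thesis
    using lin_map_closed[OF JL_lin] LM_closed JL_act by (auto simp: ahom_def) (simp_all add: lin_map_def)
qed

text \<open>\<open>JL\<close> intertwines the actions and has the left inverse \<open>EL\<close>, so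
  the ideal acts by zero here because it does on \<Xi> (X \<otimes> Y).\<close>

lemma LM_killed: "htens X Y \<in> MP \<Longrightarrow> killed (LM (XX X) (XX Y))"
  unfolding killed_def
proof (intro ballI)
  fix a t assume XY: "htens X Y \<in> MP" and a: "a \<in> II" and "t \<in> carrier (LM (XX X) (XX Y))"
  then have t: "t \<in> carrier (LT (XX X) (XX Y))" by simp
  have aS: "a \<in> carrier LH" using II_carrier[OF a] by simp
  have m: "kmod (X \<otimes>\<^sub>k Y \<otimes>\<^sub>k L)" by (simp add: tensor_mod hmod_mod X Y L_mod)
  have "JL X Y (act (LM (XX X) (XX Y)) a t) = \<zero>\<^bsub>X \<otimes>\<^sub>k Y \<otimes>\<^sub>k L\<^esub>"
    using XX_killed[OF XY] a lin_map_closed[OF JL_lin t] by (simp add: JL_act[OF aS t] killed_def XX_simps)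
  also have "\<dots> = JL X Y \<zero>\<^bsub>LT (XX X) (XX Y)\<^esub>"
    by (rule lin_map_zero[OF JL_lin LTXX_mod m, symmetric])
  finally have "EL X Y (JL X Y (act (LM (XX X) (XX Y)) a t)) = EL X Y (JL X Y \<zero>\<^bsub>LT (XX X) (XX Y)\<^esub>)" by simp
  moreover have "\<zero>\<^bsub>LT (XX X) (XX Y)\<^esub> \<in> carrier (LT (XX X) (XX Y))"
    using LTXX_mod by (simp add: mod_ab abelian_group.axioms(1) abelian_monoid.zero_closed)
  ultimately show "act (LM (XX X) (XX Y)) a t = \<zero>\<^bsub>LM (XX X) (XX Y)\<^esub>"
    by (simp add: EL_JL LM_closed aS t)
qed

text \<open>Pulled back along \<open>JL\<close> from \<open>jj_la\<close>. That s(l) acts through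
  the first factor, and t^+(l) through the second (\<open>LM_tgt\<close>), is what makes the
  associativity constraint over \<open>L\<close> balanced.\<close>

lemma LM_src:
  assumes "l \<in> carrier L" "s \<in> carrier (free X)" "t \<in> carrier (free Y)"
  shows "act (LM (XX X) (XX Y)) (SR l) (lt (XX X) (XX Y) s t) = lt (XX X) (XX Y) (act (XX X) (SR l) s) t"
proof -
  note [mlin] = X Y assms
  have c: "lt (XX X) (XX Y) s t \<in> carrier (LT (XX X) (XX Y))" "jj X Y s t \<in> carrier (htens X Y \<otimes>\<^sub>k L)"
    "la X l s \<in> carrier (free X)"
    by (simp_all only: htensor_simps) (rule mlin)+
  have "JL X Y (act (LM (XX X) (XX Y)) (SR l) (lt (XX X) (XX Y) s t)) = jj X Y (la X l s) t"
    using XX_src[OF hmod_htensor[OF X Y] assms(1) c(2)]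
    by (simp add: JL_act src_closed assms c JL_lt X Y jj_la)
  also have "\<dots> = JL X Y (lt (XX X) (XX Y) (la X l s) t)"
    by (rule JL_lt[symmetric]) (rule c assms)+
  finally have "EL X Y (JL X Y (act (LM (XX X) (XX Y)) (SR l) (lt (XX X) (XX Y) s t))) =
    EL X Y (JL X Y (lt (XX X) (XX Y) (la X l s) t))" by simp
  then show ?thesis
    using c by (simp add: EL_JL LM_closed src_closed assms XX_src X lt_XX_lin)
qed

lemma LM_tgt:
  assumes "l \<in> carrier L" "s \<in> carrier (free X)" "t \<in> carrier (free Y)"
  shows "act (LM (XX X) (XX Y)) (TP l) (lt (XX X) (XX Y) s t) = lt (XX X) (XX Y) s (act (XX Y) (TP l) t)"
proof -
  note [mlin] = X Y assms
  have c: "lt (XX X) (XX Y) s t \<in> carrier (LT (XX X) (XX Y))" "jj X Y s t \<in> carrier (htens X Y \<otimes>\<^sub>k L)"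
    "rmul Y t l \<in> carrier (free Y)"
    by (simp_all only: htensor_simps) (rule mlin)+
  have "JL X Y (act (LM (XX X) (XX Y)) (TP l) (lt (XX X) (XX Y) s t)) = jj X Y s (rmul Y t l)"
    using Xi_tgt_plus[OF hmod_htensor[OF X Y] assms(1) c(2)]
    by (simp add: JL_act TP_closed assms c JL_lt X Y jj_rmul)
  also have "\<dots> = JL X Y (lt (XX X) (XX Y) s (rmul Y t l))"
    by (rule JL_lt[symmetric]) (rule c assms)+
  finally have "EL X Y (JL X Y (act (LM (XX X) (XX Y)) (TP l) (lt (XX X) (XX Y) s t))) =
    EL X Y (JL X Y (lt (XX X) (XX Y) s (rmul Y t l)))" by simp
  then show ?thesis
    using c by (simp add: EL_JL LM_closed TP_closed assms Xi_tgt_plus Y lt_XX_lin)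
qed

end

section \<open>The unit object of the modules over the quotient\<close>

abbreviation "LU \<equiv> lunit_mod k H L"

lemma LU_simps [simp]:
  "carrier LU = carrier L" "lin_map k LU M f = lin_map k L M f" "lin_map k M LU g = lin_map k M L g"
  by (simp_all add: lunit_SM lin_map_def)

lemma LU_smod: "smod LU"
  unfolding lunit_SM by (rule SM_amodule[OF compat_lmul])

lemma LU_src: "l \<in> carrier L \<Longrightarrow> m \<in> carrier L \<Longrightarrow> act LU (SR l) m = lmul l m"
  unfolding lunit_SM by (rule SM_src[OF compat_lmul])

text \<open>Multiplication in \<open>L\<close> absorbs the braiding and the inverse braiding alike,
  so both target maps act by right multiplication.\<close>

lemma LU_tgt: "l \<in> carrier L \<Longrightarrow> m \<in> carrier L \<Longrightarrow> act LU (TP l) m = lmul m l"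
  "l \<in> carrier L \<Longrightarrow> m \<in> carrier L \<Longrightarrow> act LU (TM l) m = lmul m l"
  unfolding lunit_SM
  by (simp_all add: SM_act TP_closed sact_tgt_plus sact_tgt_minus compat_lmul lmul_cb lmul_db)

lemma LU_Ob: "LU \<in> Ob (mod_cat k S)"
  unfolding lunit_SM by (rule SM_Ob[OF compat_lmul])

lemma LU_killed: "killed LU"
  by (rule killedI[OF LU_smod]) (simp add: LU_tgt)

definition "uu = (\<lambda>l\<in>carrier L. tn K L \<one>\<^bsub>k\<^esub> l)"

lemma uu_app: "l \<in> carrier L \<Longrightarrow> uu l = tn K L \<one>\<^bsub>k\<^esub> l"
  by (simp add: uu_def)

lemma uu_inverse: "l \<in> carrier L \<Longrightarrow> lu L (tn K L \<one>\<^bsub>k\<^esub> l) = l"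
  "t \<in> carrier (free K) \<Longrightarrow> tn K L \<one>\<^bsub>k\<^esub> (lu L t) = t"
  "t \<in> carrier (free K) \<Longrightarrow> lu L t \<in> carrier L"
proof -
  interpret L: module k L by (rule L_mod)
  have o [mlin]: "\<one>\<^bsub>k\<^esub> \<in> carrier K" using k_one by simp
  have lul: "lin (free K) L (lu L)" using lu_hlin[OF L_hmod] by (simp add: hlin_def)
  note [mlin] = lin_map_comp[OF _ lul]
  show "lu L (tn K L \<one>\<^bsub>k\<^esub> l) = l" if "l \<in> carrier L"
    using that by (simp add: lu_ten L_mod)
  show "lu L t \<in> carrier L" if "t \<in> carrier (free K)" by (rule lin_map_closed[OF lul that])
  show "tn K L \<one>\<^bsub>k\<^esub> (lu L t) = t" if t: "t \<in> carrier (free K)"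
  proof (rule tensor_ext[OF t, of "K \<otimes>\<^sub>k L", where g = "\<lambda>t. t"])
    fix r l assume rl: "r \<in> carrier K" "l \<in> carrier L"
    then have "tn K L \<one>\<^bsub>k\<^esub> (r \<odot>\<^bsub>L\<^esub> l) = tn K L (r \<otimes>\<^bsub>k\<^esub> \<one>\<^bsub>k\<^esub>) l"
      using ten_smult[of K L r "\<one>\<^bsub>k\<^esub>" l] by (simp add: base_module_mod L_mod)
    then show "tn K L \<one>\<^bsub>k\<^esub> (lu L (tn K L r l)) = tn K L r l"
      using rl by (simp add: lu_ten L_mod)
  qed (rule mlin | assumption)+
qed

text \<open>Equivariance comes for free, as this map is inverse to the left unit constraint
  \<open>lu L\<close> of \<open>H\<close>-modules. For \<open>L\<close>-linearity, l passes the unit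
  scalar by the flip.\<close>

lemma uu_ahom: "uu \<in> ahom k S LU (XX U)"
proof -
  have c: "tn K L \<one>\<^bsub>k\<^esub> l \<in> carrier (free U)" if "l \<in> carrier L" for l
    using that k_one by (simp add: ten_closed)
  have "hlin L (htens U L) (tn K L \<one>\<^bsub>k\<^esub>)"
    by (rule hlin_inverse[OF lu_hlin[OF L_hmod] hmod_htensor[OF hmod_U L_hmod] L_hmod])
      (use uu_inverse c in simp_all)
  then have "hlin L (htens U L) uu"
    unfolding uu_def by (rule hlin_cong[OF _ L_hmod]) simp
  moreover have "tn K L \<one>\<^bsub>k\<^esub> (lmul l m) = la U l (tn K L \<one>\<^bsub>k\<^esub> m)" if lm: "l \<in> carrier L" "m \<in> carrier L" for l m
  proof -
    have "la U l (tn K L \<one>\<^bsub>k\<^esub> m) = rmul U (tn K L \<one>\<^bsub>k\<^esub> l) m"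
      using la_ten[OF hmod_U lm(1), of "\<one>\<^bsub>k\<^esub>" m] db_trivial_left[OF hmod_U L_hmod lm(1) U_trivial[OF k_one]] lm k_one by simp
    also have "\<dots> = tn K L \<one>\<^bsub>k\<^esub> (lmul l m)"
      using rmul_ten[OF hmod_mod[OF hmod_U], of "\<one>\<^bsub>k\<^esub>" l m] lm k_one by simp
    finally show ?thesis by simp
  qed
  ultimately show ?thesis
    unfolding lunit_SM Xi_SM SM_ahom[OF compat_lmul compat_la[OF hmod_U]]
    by (simp add: uu_def mult_closed[OF L_alg])
qed

lemma MH_ten [simp]:
  "TenO MH M N = ds (LM (rs M) (rs N))"
  "TenM MH M M' N N' f g = restrict (tlift (LT (rs M') (rs N')) (\<lambda>m n. lt (rs M') (rs N') (f m) (g n)))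
     (carrier (LT (rs M) (rs N)))"
  "Unt MH = ds LU"
  "Assoc MH M N P = restrict (tlift (LT (rs M) (LM (rs N) (rs P))) (\<lambda>t p. tlift (LT (rs M) (LM (rs N) (rs P)))
     (\<lambda>m n. lt (rs M) (LM (rs N) (rs P)) m (lt (rs N) (rs P) n p)) t)) (carrier (LT (LM (rs M) (rs N)) (rs P)))"
  "LUnit MH M = restrict (tlift M (\<lambda>l m. act (rs M) (SR l) m)) (carrier (LT LU (rs M)))"
  "RUnit MH M = restrict (tlift M (\<lambda>m l. act (rs M) (TP l) m)) (carrier (LT (rs M) LU))"
  by (simp_all add: Mod_HL_def cat.defs moncat.defs Let_def)

lemma tlift_XH [simp]: "tlift (XH X) = tlift (free X)"
  by (simp add: tlift_def fun_eq_iff Xi_HL_def XX_simps)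

text \<open>Morphisms over the quotient are those over the smash product, so isomorphisms between
  descended modules are found by inverting maps upstairs.\<close>

lemma MH_iso:
  assumes M: "M \<in> Ob (mod_cat k S)" "killed M" and N: "N \<in> Ob (mod_cat k S)" "killed N"
    and f: "f \<in> ahom k S M N" and g: "\<And>y. y \<in> carrier N \<Longrightarrow> g y \<in> carrier M"
      "\<And>x. x \<in> carrier M \<Longrightarrow> g (f x) = x" "\<And>y. y \<in> carrier N \<Longrightarrow> f (g y) = y"
  shows "iso_in MH (ds M) (ds N) f"
proof -
  have "iso_in (mod_cat k QQ) (ds M) (ds N) f"
    by (rule mod_iso[OF ds_Ob[OF M] ds_Ob[OF N], where g = g]) (simp_all add: ahom_rs rs_ds M N f g)
  then show ?thesis by (simp add: iso_in_def inverses_in_def) (simp add: mod_cat_def)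
qed

definition "Jm X Y = restrict (JL X Y) (carrier (LT (XX X) (XX Y)))"

lemma Jm_app: "t \<in> carrier (LT (XX X) (XX Y)) \<Longrightarrow> Jm X Y t = JL X Y t"
  by (simp add: Jm_def)

lemma Jm_iso:
  assumes "X \<in> MP" "Y \<in> MP"
  shows "iso_in MH (ds (LM (XX X) (XX Y))) (XH (htens X Y)) (Jm X Y)"
proof -
  note h = MP_hmod[OF assms(1)] MP_hmod[OF assms(2)]
  note XY = MP_htensor[OF assms]
  show ?thesis
    unfolding Xi_HL_def
  proof (rule MH_iso[OF LM_Ob[OF h] LM_killed[OF h XY] XX_Ob[OF MP_hmod[OF XY]] XX_killed[OF XY], where g = "EL X Y"])
    show "Jm X Y \<in> ahom k S (LM (XX X) (XX Y)) (XX (htens X Y))"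
      unfolding Jm_def by (rule JL_ahom[OF h])
  qed (simp_all add: Jm_app EL_JL JL_EL h lin_map_closed[OF EL_lin[OF h]])
qed

definition "TT M N f g = tlift (LT M N) (\<lambda>m n. lt M N (f m) (g n))"

text \<open>Morphisms over the smash product commute with t^+(l) and s(l), so the tensor product of
  two of them respects the balancing over \<open>L\<close>.\<close>

lemma
  assumes s [mlin]: "smod M" "smod N" "smod M'" "smod N'" and f: "f \<in> ahom k S M M'" and g: "g \<in> ahom k S N N'"
  shows TT_lin: "lin (LT M N) (LT M' N') (TT M' N' f g)"
    and TT_lt: "m \<in> carrier M \<Longrightarrow> n \<in> carrier N \<Longrightarrow> TT M' N' f g (lt M N m n) = lt M' N' (f m) (g n)"
proof -
  have fl [mlin]: "lin M M' f" and gl [mlin]: "lin N N' g" using f g by (simp_all add: ahom_def)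
  note [mlin] = lin_map_closed[OF fl] lin_map_closed[OF gl]
  have e: "a \<in> carrier S \<Longrightarrow> m \<in> carrier M \<Longrightarrow> f (act M a m) = act M' a (f m)"
    "a \<in> carrier S \<Longrightarrow> n \<in> carrier N \<Longrightarrow> g (act N a n) = act N' a (g n)" for a m n
    using f g by (simp_all add: ahom_def)
  have "bil k M N (LT M' N') (\<lambda>m n. lt M' N' (f m) (g n))" by (rule mlin | assumption)+
  moreover have "lt M' N' (f (act M (TP l) m)) (g n) = lt M' N' (f m) (g (act N (SR l) n))"
    if [mlin]: "m \<in> carrier M" "l \<in> carrier L" "n \<in> carrier N" for m l n
    by (subst e(1), (rule mlin)+, subst e(2), (rule mlin)+, rule lt_balance) (rule mlin)+
  ultimately have b: "lbil M N (LT M' N') (\<lambda>m n. lt M' N' (f m) (g n))" by (simp add: lbil_def)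
  show "lin (LT M N) (LT M' N') (TT M' N' f g)"
    unfolding TT_def by (rule LT_tlift_lin0[OF s(1,2) LT_mod[OF s(3,4)] b])
  show "m \<in> carrier M \<Longrightarrow> n \<in> carrier N \<Longrightarrow> TT M' N' f g (lt M N m n) = lt M' N' (f m) (g n)"
    unfolding TT_def by (rule LT_tlift[OF s(1,2) LT_mod[OF s(3,4)] b])
qed

definition "ident M = restrict id (carrier M)"

lemma ident_app [simp]: "x \<in> carrier M \<Longrightarrow> ident M x = x"
  by (simp add: ident_def)

lemma id_ahom: "smod M \<Longrightarrow> ident M \<in> ahom k S M M"
proof -
  assume M: "smod M"
  interpret M: module k M by (rule amodule_mod[OF M])
  show ?thesis using act_closed[OF M] by (auto simp: ident_def ahom_def lin_map_def)
qed

text \<open>On pure tensors this is \<open>kl_jj\<close>.\<close>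

lemma JL_natural:
  assumes h [mlin]: "hmod X" "hmod X'" "hmod Y" "hmod Y'" and f: "f \<in> Hm X X'" and g: "g \<in> Hm Y Y'"
    and t: "t \<in> carrier (LT (XX X) (XX Y))"
  shows "JL X' Y' (TT (XX X') (XX Y') (Xi_mor k L X X' f) (Xi_mor k L Y Y' g) t) =
    kl (htens X Y) (htens X' Y') (TenM D X X' Y Y' f g) (JL X Y t)"
proof (rule LT_ext[OF t, where P = "X' \<otimes>\<^sub>k Y' \<otimes>\<^sub>k L"])
  note s = h[THEN XX_smod]
  note F = Xi_mor_Hom[OF h(1,2) f] Xi_mor_Hom[OF h(3,4) g]
  note T = TT_lin[OF s(1,3,2,4) F] TT_lt[OF s(1,3,2,4) F]
  have XY: "hmod (htens X Y)" "hmod (htens X' Y')" by (rule mlin)+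
  have kll: "lin (X \<otimes>\<^sub>k Y \<otimes>\<^sub>k L) (X' \<otimes>\<^sub>k Y' \<otimes>\<^sub>k L) (kl (htens X Y) (htens X' Y') (TenM D X X' Y Y' f g))"
    using kl_lin[OF Hm_lin[OF TenM_Hm[OF h(1,3,2,4) f g]] hmod_mod[OF XY(1)] hmod_mod[OF XY(2)] lin_id] by simp
  show "smod (XX X)" "smod (XX Y)" by (rule s)+
  show "lin (LT (XX X) (XX Y)) (X' \<otimes>\<^sub>k Y' \<otimes>\<^sub>k L)
      (\<lambda>t. JL X' Y' (TT (XX X') (XX Y') (Xi_mor k L X X' f) (Xi_mor k L Y Y' g) t))"
    by (rule lin_map_comp[OF T(1) JL_lin[OF h(2,4)]])
  show "lin (LT (XX X) (XX Y)) (X' \<otimes>\<^sub>k Y' \<otimes>\<^sub>k L) (\<lambda>t. kl (htens X Y) (htens X' Y') (TenM D X X' Y Y' f g) (JL X Y t))"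
    by (rule lin_map_comp[OF JL_lin[OF h(1,3)] kll])
  fix m n assume "m \<in> carrier (XX X)" "n \<in> carrier (XX Y)"
  then have mn [mlin]: "m \<in> carrier (free X)" "n \<in> carrier (free Y)" by simp_all
  note [mlin] = Hm_lin[OF f] Hm_lin[OF g]
  have k: "kl X X' f m \<in> carrier (free X')" "kl Y Y' g n \<in> carrier (free Y')" by (rule mlin)+
  have j: "jj X Y m n \<in> carrier (htens X Y \<otimes>\<^sub>k L)" by simp (rule mlin)+
  have "kl (htens X Y) (htens X' Y') (TenM D X X' Y Y' f g) (jj X Y m n) =
      kl (htens X Y) (htens X' Y') (tm X' Y' f g) (jj X Y m n)"
    by (rule kl_cong[OF j hmod_mod[OF XY(1)]]) (simp add: TenM_D h f g)
  also have "\<dots> = jj X' Y' (kl X X' f m) (kl Y Y' g n)"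
    using kl_jj[OF h(1,3,2,4) mn Hm_hlin[OF f] Hm_hlin[OF g]] by simp
  finally show "JL X' Y' (TT (XX X') (XX Y') (Xi_mor k L X X' f) (Xi_mor k L Y Y' g) (lt (XX X) (XX Y) m n)) =
      kl (htens X Y) (htens X' Y') (TenM D X X' Y Y' f g) (JL X Y (lt (XX X) (XX Y) m n))"
    using T(2)[of m n] mn k by (simp add: JL_lt h Xi_mor_eq f g)
qed (simp add: tensor_mod hmod_mod h L_mod)

definition "AA M N P = tlift (LT M (LM N P)) (\<lambda>t p. tlift (LT M (LM N P)) (\<lambda>m n. lt M (LM N P) m (lt N P n p)) t)"

text \<open>Balance is needed twice. Between m and n it holds because s(l) acts on n \<otimes> p
  through n (\<open>LM_src\<close>), between m \<otimes> n and p because t^+(l) acts on m \<otimes>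
  n through n (\<open>LM_tgt\<close>).\<close>

lemma
  assumes h: "hmod X" "hmod Y" "hmod Z"
  defines "M \<equiv> XX X" and "N \<equiv> XX Y" and "P \<equiv> XX Z"
  shows AA_lin: "lin (LT (LM M N) P) (LT M (LM N P)) (AA M N P)"
    and AA_lt: "m \<in> carrier (free X) \<Longrightarrow> n \<in> carrier (free Y) \<Longrightarrow> p \<in> carrier (free Z) \<Longrightarrow>
      AA M N P (lt (LM M N) P (lt M N m n) p) = lt M (LM N P) m (lt N P n p)"
proof -
  note s = XX_smod[OF h(1), folded M_def] XX_smod[OF h(2), folded N_def] XX_smod[OF h(3), folded P_def]
  have c: "carrier M = carrier (free X)" "carrier N = carrier (free Y)" "carrier P = carrier (free Z)"
    by (simp_all add: M_def N_def P_def)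
  have MN: "smod (LM M N)" and NP: "smod (LM N P)" unfolding M_def N_def P_def by (rule LM_smod h)+
  let ?Q = "LT M (LM N P)"
  have Q: "kmod ?Q" by (rule LT_mod[OF s(1) NP])
  have NPc: "lt N P n p \<in> carrier (LM N P)" if "n \<in> carrier N" "p \<in> carrier P" for n p
    using lt_lin(3)[OF s(2,3) that] by simp
  have lNP1: "lin N (LM N P) (\<lambda>n. lt N P n p)" if "p \<in> carrier P" for p
    using lt_lin(1)[OF s(2,3) lin_id that] by (simp add: lin_map_def)
  have lNP2: "lin P (LM N P) (\<lambda>p. lt N P n p)" if "n \<in> carrier N" for n
    using lt_lin(2)[OF s(2,3) that lin_id] by (simp add: lin_map_def)
  let ?A = "\<lambda>p m n. lt M (LM N P) m (lt N P n p)"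
  have A: "lbil M N ?Q (?A p)" if p: "p \<in> carrier P" for p
    unfolding lbil_def
  proof (intro conjI ballI bilI)
    show "lin N ?Q (\<lambda>n. ?A p m n)" if "m \<in> carrier M" for m
      by (rule lt_lin(2)[OF s(1) NP that lNP1[OF p]])
    show "lin M ?Q (\<lambda>m. ?A p m n)" if "n \<in> carrier N" for n
      by (rule lt_lin(1)[OF s(1) NP lin_id NPc[OF that p]])
    fix m l n assume mln: "m \<in> carrier M" "l \<in> carrier L" "n \<in> carrier N"
    have "?A p (act M (TP l) m) n = lt M (LM N P) m (act (LM N P) (SR l) (lt N P n p))"
      by (rule lt_balance[OF s(1) NP mln(1,2) NPc[OF mln(3) p]])
    then show "?A p (act M (TP l) m) n = ?A p m (act N (SR l) n)"
      using LM_src[OF h(2,3) mln(2), of n p] mln p c by (simp add: N_def P_def)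
  qed
  let ?B = "\<lambda>t p. tlift ?Q (?A p) t"
  have ev: "?B (lt M N m n) p = ?A p m n" if "m \<in> carrier M" "n \<in> carrier N" "p \<in> carrier P" for m n p
    by (rule LT_tlift[OF s(1,2) Q A[OF that(3)] that(1,2)])
  have lB: "lin (LT M N) ?Q (\<lambda>t. ?B t p)" if "p \<in> carrier P" for p
    by (rule LT_tlift_lin0[OF s(1,2) Q A[OF that]])
  have B: "lbil (LM M N) P ?Q ?B"
    unfolding lbil_def
  proof (intro conjI ballI bilI)
    show "lin P ?Q (?B t)" if "t \<in> carrier (LM M N)" for t
      using that by (intro LT_lin_fun[OF _ s(1,2) amodule_mod[OF s(3)] Q] lt_lin(2)[OF s(1) NP _ lNP2]) simp_all
    show "lin (LM M N) ?Q (\<lambda>t. ?B t p)" if "p \<in> carrier P" for p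
      using lB[OF that] by (simp add: lin_map_def)
    fix t l p assume t: "t \<in> carrier (LM M N)" and l [mlin]: "l \<in> carrier L" and p: "p \<in> carrier P"
    have t': "t \<in> carrier (LT M N)" using t by simp
    have a: "act P (SR l) p \<in> carrier P" by (rule act_closed[OF s(3) _ p]) (rule mlin)+
    have "lin (LT M N) (LT M N) (\<lambda>t. act (LM M N) (TP l) t)"
      using act_lin_right[OF MN S_closed(1)[OF l] lin_id] by (simp add: lin_map_def)
    from lin_map_comp[OF this lB[OF p]]
    show "?B (act (LM M N) (TP l) t) p = ?B t (act P (SR l) p)"
    proof (rule LT_ext[OF t' s(1,2) Q _ lB[OF a]])
      fix m n assume mn: "m \<in> carrier M" "n \<in> carrier N"
      have an: "act N (TP l) n \<in> carrier N" by (rule act_closed[OF s(2) _ mn(2)]) (rule mlin)+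
      have "act (LM M N) (TP l) (lt M N m n) = lt M N m (act N (TP l) n)"
        using LM_tgt[OF h(1,2) l, of m n] mn c by (simp add: M_def N_def)
      then show "?B (act (LM M N) (TP l) (lt M N m n)) p = ?B (lt M N m n) (act P (SR l) p)"
        using lt_balance[OF s(2,3) mn(2) l p] by (simp add: ev mn an p a)
    qed
  qed
  show "lin (LT (LM M N) P) ?Q (AA M N P)"
    unfolding AA_def by (rule LT_tlift_lin0[OF MN s(3) Q B])
  assume mnp: "m \<in> carrier (free X)" "n \<in> carrier (free Y)" "p \<in> carrier (free Z)"
  have "lt M N m n \<in> carrier (LM M N)" using lt_lin(3)[OF s(1,2)] mnp c by simp
  then have "AA M N P (lt (LM M N) P (lt M N m n) p) = ?B (lt M N m n) p"
    unfolding AA_def using mnp c by (intro LT_tlift[OF MN s(3) Q B]) simp_all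
  then show "AA M N P (lt (LM M N) P (lt M N m n) p) = lt M (LM N P) m (lt N P n p)"
    using ev mnp c by simp
qed

text \<open>On pure tensors both sides are iterated \<open>jj\<close> with the two bracketings, so
  the claim is \<open>jj_assoc\<close>.\<close>

lemma JL_assoc:
  assumes h [mlin]: "hmod X" "hmod Y" "hmod Z" and w: "w \<in> carrier (LT (LM (XX X) (XX Y)) (XX Z))"
  shows "tmap k (X \<otimes>\<^sub>k (Y \<otimes>\<^sub>k Z)) L (assoc k X Y Z) (\<lambda>m. m) (JL (htens X Y) Z
      (TT (XX (htens X Y)) (XX Z) (Jm X Y) (ident (XX Z)) w)) =
    JL X (htens Y Z) (TT (XX X) (XX (htens Y Z)) (ident (XX X)) (Jm Y Z) (AA (XX X) (XX Y) (XX Z) w))"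
    (is "?l w = ?r w")
proof -
  let ?Q = "X \<otimes>\<^sub>k (Y \<otimes>\<^sub>k Z) \<otimes>\<^sub>k L" and ?MN = "LM (XX X) (XX Y)"
  have XY: "hmod (htens X Y)" "hmod (htens Y Z)" by (rule mlin)+
  note s = h[THEN XX_smod] XY[THEN XX_smod]
  note sm = LM_smod[OF h(1,2)] LM_smod[OF h(2,3)]
  have Q: "kmod ?Q" by (rule mlin)+
  have Ja: "Jm X Y \<in> ahom k S (LM (XX X) (XX Y)) (XX (htens X Y))" "Jm Y Z \<in> ahom k S (LM (XX Y) (XX Z)) (XX (htens Y Z))"
    unfolding Jm_def by (rule JL_ahom h)+
  note T1 = TT_lin[OF sm(1) s(3,4,3) Ja(1) id_ahom[OF s(3)]] TT_lt[OF sm(1) s(3,4,3) Ja(1) id_ahom[OF s(3)]]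
  note T2 = TT_lin[OF s(1) sm(2) s(1,5) id_ahom[OF s(1)] Ja(2)] TT_lt[OF s(1) sm(2) s(1,5) id_ahom[OF s(1)] Ja(2)]
  have al [mlin]: "lin (X \<otimes>\<^sub>k Y \<otimes>\<^sub>k Z) (X \<otimes>\<^sub>k (Y \<otimes>\<^sub>k Z)) (assoc k X Y Z)" by (rule mlin)+
  have "lin (X \<otimes>\<^sub>k Y \<otimes>\<^sub>k Z \<otimes>\<^sub>k L) ?Q (tmap k (X \<otimes>\<^sub>k (Y \<otimes>\<^sub>k Z)) L (assoc k X Y Z) (\<lambda>m. m))"
    by (rule mlin)+
  then have ll: "lin (LT ?MN (XX Z)) ?Q ?l"
    by (rule lin_map_comp[OF lin_map_comp[OF T1(1) JL_lin[OF XY(1) h(3), unfolded htensor_simps]]])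
  have lr: "lin (LT ?MN (XX Z)) ?Q ?r"
    by (rule lin_map_comp[OF lin_map_comp[OF AA_lin[OF h] T2(1)] JL_lin[OF h(1) XY(2), unfolded htensor_simps]])
  show ?thesis
  proof (rule LT_ext[OF w sm(1) s(3) Q ll lr])
    fix t p assume "t \<in> carrier ?MN" and "p \<in> carrier (XX Z)"
    then have t: "t \<in> carrier (LT (XX X) (XX Y))" and p [mlin]: "p \<in> carrier (free Z)" by simp_all
    have "lin (LT (XX X) (XX Y)) (LT ?MN (XX Z)) (\<lambda>t. lt ?MN (XX Z) t p)"
      using lt_lin(1)[OF sm(1) s(3) lin_id, of p] p by (simp add: lin_map_def)
    note lp = lin_map_comp[OF this ll] lin_map_comp[OF this lr]
    show "?l (lt ?MN (XX Z) t p) = ?r (lt ?MN (XX Z) t p)"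
    proof (rule LT_ext[OF t s(1,2) Q lp])
      fix m n assume "m \<in> carrier (XX X)" "n \<in> carrier (XX Y)"
      then have mn [mlin]: "m \<in> carrier (free X)" "n \<in> carrier (free Y)" by simp_all
      have c: "lt (XX X) (XX Y) m n \<in> carrier (LT (XX X) (XX Y))" "lt (XX Y) (XX Z) n p \<in> carrier (LT (XX Y) (XX Z))"
        by (rule lt_XX_lin h mn p)+
      have j: "jj X Y m n \<in> carrier (htens X Y \<otimes>\<^sub>k L)" "jj Y Z n p \<in> carrier (htens Y Z \<otimes>\<^sub>k L)"
        by (simp_all only: htensor_simps) (rule mlin)+
      have "?l (lt ?MN (XX Z) (lt (XX X) (XX Y) m n) p) =
          tmap k (X \<otimes>\<^sub>k (Y \<otimes>\<^sub>k Z)) L (assoc k X Y Z) (\<lambda>m. m) (jj (htens X Y) Z (jj X Y m n) p)"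
        using T1(2)[of "lt (XX X) (XX Y) m n" p] c p j by (simp add: Jm_app JL_lt h XY mn del: jj_htensor)
      also have "\<dots> = jj X (htens Y Z) m (jj Y Z n p)"
        using jj_assoc[OF h mn p] by simp
      also have "\<dots> = ?r (lt ?MN (XX Z) (lt (XX X) (XX Y) m n) p)"
        using T2(2)[of m "lt (XX Y) (XX Z) n p"] c p j mn by (simp add: AA_lt h Jm_app JL_lt XY)
      finally show "?l (lt ?MN (XX Z) (lt (XX X) (XX Y) m n) p) = \<dots>" .
    qed
  qed
qed

lemma bil_cong:
  assumes "bil k M N P f" "kmod M" "kmod N"
    "\<And>m n. m \<in> carrier M \<Longrightarrow> n \<in> carrier N \<Longrightarrow> f m n = g m n"
  shows "bil k M N P g"
proof (rule bilI)
  show "lin N P (g m)" if "m \<in> carrier M" for m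
    by (rule lin_map_cong[OF _ assms(3), of _ "f m"]) (use assms(1,4) that in \<open>auto simp: bil_def\<close>)
  show "lin M P (\<lambda>m. g m n)" if "n \<in> carrier N" for n
    by (rule lin_map_cong[OF _ assms(2), of _ "\<lambda>m. f m n"]) (use assms(1,4) that in \<open>auto simp: bil_def\<close>)
qed

text \<open>The tensor 1 \<otimes> l in the image of \<open>uu\<close> is (1 \<otimes> 1) multiplied
  by l. Balance moves l to the other factor, where it acts as s(l), and \<open>jj_U_left\<close>
  removes what is left.\<close>

lemma JL_LUnit:
  assumes h [mlin]: "hmod X" and w: "w \<in> carrier (LT LU (XX X))"
  shows "tmap k X L (lu X) (\<lambda>m. m) (JL U X (TT (XX U) (XX X) uu (ident (XX X)) w)) =
    tlift (free X) (\<lambda>l m. act (XX X) (SR l) m) w" (is "?l w = ?r w")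
proof -
  have XL: "kmod (free X)" by (rule mlin)+
  have [mlin]: "lin (K \<otimes>\<^sub>k X) X (lu X)" using lu_hlin[OF h] by (simp add: hlin_def)
  note s = LU_smod XX_smod[OF h] XX_smod[OF hmod_U]
  note T = TT_lin[OF s(1,2,3,2) uu_ahom id_ahom[OF s(2)]] TT_lt[OF s(1,2,3,2) uu_ahom id_ahom[OF s(2)]]
  have "lin (K \<otimes>\<^sub>k X \<otimes>\<^sub>k L) (free X) (tmap k X L (lu X) (\<lambda>m. m))" by (rule mlin)+
  then have ll: "lin (LT LU (XX X)) (free X) ?l"
    by (rule lin_map_comp[OF lin_map_comp[OF T(1) JL_lin[OF hmod_U h, unfolded hunit_simps]]])
  have "bil k L (free X) (free X) (la X)" by (rule mlin | assumption)+
  then have b: "lbil LU (XX X) (free X) (\<lambda>l m. act (XX X) (SR l) m)"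
    unfolding lbil_def
  proof (intro conjI ballI)
    assume "bil k L (free X) (free X) (la X)"
    then have "bil k L (free X) (free X) (\<lambda>l m. act (XX X) (SR l) m)"
      by (rule bil_cong[OF _ L_mod XL]) (simp add: XX_src h)
    then show "bil k LU (XX X) (free X) (\<lambda>l m. act (XX X) (SR l) m)" by (simp add: bil_def)
    fix l m v assume "l \<in> carrier LU" "m \<in> carrier L" "v \<in> carrier (XX X)"
    then show "act (XX X) (SR (act LU (TP m) l)) v = act (XX X) (SR l) (act (XX X) (SR m) v)"
      using la_lin(3)[OF h, of m v] by (simp add: LU_tgt XX_src h mult_closed[OF L_alg] la_mult)
  qed
  show ?thesis
  proof (rule LT_ext[OF w s(1,2) XL ll LT_tlift_lin0[OF s(1,2) XL b]])
    fix l n assume "l \<in> carrier LU" "n \<in> carrier (XX X)"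
    then have l [mlin]: "l \<in> carrier L" and n [mlin]: "n \<in> carrier (free X)" by simp_all
    have o: "tn K L \<one>\<^bsub>k\<^esub> \<one>\<^bsub>L\<^esub> \<in> carrier (free U)" "tn K L \<one>\<^bsub>k\<^esub> l \<in> carrier (free U)"
      using k_one l by (simp_all add: ten_closed one_closed[OF L_alg])
    have la: "la X l n \<in> carrier (free X)" by (rule mlin)+
    have "rmul U (tn K L \<one>\<^bsub>k\<^esub> \<one>\<^bsub>L\<^esub>) l = tn K L \<one>\<^bsub>k\<^esub> l"
      using rmul_ten[OF hmod_mod[OF hmod_U], of "\<one>\<^bsub>k\<^esub>" "\<one>\<^bsub>L\<^esub>" l] k_one l by (simp add: one_closed[OF L_alg] lmul_one)
    then have "jj U X (tn K L \<one>\<^bsub>k\<^esub> l) n = jj U X (tn K L \<one>\<^bsub>k\<^esub> \<one>\<^bsub>L\<^esub>) (la X l n)"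
      using jj_rmul_left[OF hmod_U h l o(1) n] by simp
    also have "tmap k X L (lu X) (\<lambda>m. m) \<dots> = \<one>\<^bsub>k\<^esub> \<odot>\<^bsub>X \<otimes>\<^sub>k L\<^esub> la X l n"
      by (rule jj_U_left[OF h k_one la])
    finally show "?l (lt LU (XX X) l n) = ?r (lt LU (XX X) l n)"
      using T(2)[of l n] l n o la by (simp add: uu_app JL_lt hmod_U h LT_tlift[OF s(1,2) XL b] XX_src module.smult_one[OF XL])
  qed
qed

text \<open>Again 1 \<otimes> l is (1 \<otimes> 1) multiplied by l, now in the second factor. By
  right linearity l comes out as right multiplication, which is t^+(l), and
  \<open>jj_U_right\<close> removes the rest.\<close>

lemma JL_RUnit:
  assumes h [mlin]: "hmod X" and w: "w \<in> carrier (LT (XX X) LU)"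
  shows "tmap k X L (ru X) (\<lambda>m. m) (JL X U (TT (XX X) (XX U) (ident (XX X)) uu w)) =
    tlift (free X) (\<lambda>m l. act (XX X) (TP l) m) w" (is "?l w = ?r w")
proof -
  have XL: "kmod (free X)" by (rule mlin)+
  have ru [mlin]: "lin (X \<otimes>\<^sub>k K) X (ru X)" using ru_hlin[OF h] by (simp add: hlin_def)
  note s = LU_smod XX_smod[OF h] XX_smod[OF hmod_U]
  note T = TT_lin[OF s(2,1,2,3) id_ahom[OF s(2)] uu_ahom] TT_lt[OF s(2,1,2,3) id_ahom[OF s(2)] uu_ahom]
  have "lin (X \<otimes>\<^sub>k K \<otimes>\<^sub>k L) (free X) (tmap k X L (ru X) (\<lambda>m. m))" by (rule mlin)+
  then have ll: "lin (LT (XX X) LU) (free X) ?l"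
    by (rule lin_map_comp[OF lin_map_comp[OF T(1) JL_lin[OF h hmod_U, unfolded hunit_simps]]])
  have "bil k (free X) L (free X) (rmul X)" by (rule mlin | assumption)+
  then have b: "lbil (XX X) LU (free X) (\<lambda>m l. act (XX X) (TP l) m)"
    unfolding lbil_def
  proof (intro conjI ballI)
    assume "bil k (free X) L (free X) (rmul X)"
    then have "bil k (free X) L (free X) (\<lambda>m l. act (XX X) (TP l) m)"
      by (rule bil_cong[OF _ XL L_mod]) (simp add: Xi_tgt_plus h)
    then show "bil k (XX X) LU (free X) (\<lambda>m l. act (XX X) (TP l) m)" by (simp add: bil_def)
    fix v m l assume "v \<in> carrier (XX X)" "m \<in> carrier L" "l \<in> carrier LU"
    then show "act (XX X) (TP l) (act (XX X) (TP m) v) = act (XX X) (TP (act LU (SR m) l)) v"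
      using rmul_lin(3)[OF hmod_mod[OF h], of v m]
      by (simp add: LU_src Xi_tgt_plus h mult_closed[OF L_alg] rmul_rmul hmod_mod)
  qed
  show ?thesis
  proof (rule LT_ext[OF w s(2,1) XL ll LT_tlift_lin0[OF s(2,1) XL b]])
    fix n l assume "n \<in> carrier (XX X)" "l \<in> carrier LU"
    then have l [mlin]: "l \<in> carrier L" and n [mlin]: "n \<in> carrier (free X)" by simp_all
    let ?t = "tn K L \<one>\<^bsub>k\<^esub> \<one>\<^bsub>L\<^esub>"
    have o: "?t \<in> carrier (free U)" "tn K L \<one>\<^bsub>k\<^esub> l \<in> carrier (free U)"
      using k_one l by (simp_all add: ten_closed one_closed[OF L_alg])
    have jn: "jj X U n ?t \<in> carrier (htens X U \<otimes>\<^sub>k L)"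
      using jj_lin(3)[OF hmod_mod[OF h] hmod_U n o(1)] by simp
    have XU: "hmod (htens X U)" by (rule mlin)+
    have "rmul U ?t l = tn K L \<one>\<^bsub>k\<^esub> l"
      using rmul_ten[OF hmod_mod[OF hmod_U], of "\<one>\<^bsub>k\<^esub>" "\<one>\<^bsub>L\<^esub>" l] k_one l by (simp add: one_closed[OF L_alg] lmul_one)
    then have j: "jj X U n (tn K L \<one>\<^bsub>k\<^esub> l) = rmul (htens X U) (jj X U n ?t) l"
      using jj_rmul[OF h hmod_U l n o(1)] by simp
    \<comment> \<open>The map \<open>ru X \<otimes> id\<close> is recognised as the extension of a
      dynamical morphism, and so commutes with right multiplication by
      \<open>kl_rmul\<close>.\<close>
    have "tmap k X L (ru X) (\<lambda>m. m) (rmul (htens X U) (jj X U n ?t) l) =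
        kl (htens X U) X (dh (htens X U) X (ru X)) (rmul (htens X U) (jj X U n ?t) l)"
      by (rule kl_dh[OF XU h ru_hlin[OF h], symmetric])
        (use rmul_lin(3)[OF hmod_mod[OF XU] jn l] in simp)
    also have "\<dots> = rmul X (kl (htens X U) X (dh (htens X U) X (ru X)) (jj X U n ?t)) l"
      by (rule kl_rmul[OF Hm_lin[OF dh_Hm[OF XU h ru_hlin[OF h]]] hmod_mod[OF XU] hmod_mod[OF h] l jn])
    also have "\<dots> = rmul X n l"
      using kl_dh[OF XU h ru_hlin[OF h] jn] jj_U_right[OF h k_one n] n by (simp add: module.smult_one[OF XL])
    finally show "?l (lt (XX X) LU n l) = ?r (lt (XX X) LU n l)"
      using T(2)[of n l] l n o by (simp only: j[symmetric]) (simp add: uu_app JL_lt hmod_U h LT_tlift[OF s(2,1) XL b] Xi_tgt_plus)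
  qed
qed

lemma Xi_mor_dh_app:
  assumes "hmod X" "hmod Y" "hlin X Y f" "t \<in> carrier (free X)"
  shows "Xi_mor k L X Y (dh X Y f) t = tmap k Y L f (\<lambda>m. m) t"
  using Xi_mor_dh[OF assms(1-3)] assms(4) by simp

theorem Xi_monoidal: "monoidal_functor D MH XH (Xi_mor k L) Jm uu"
proof (intro monoidal_functor.intro Xi_functor monoidal_functor_axioms.intro, goal_cases)
  case (1 X Y)
  then show ?case using Jm_iso by (simp add: rs_XH)
next
  case 2
  have "iso_in MH (ds LU) (ds (XX U)) uu"
    by (rule MH_iso[OF LU_Ob LU_killed XX_Ob[OF hmod_U] XX_killed[OF MP_U] uu_ahom, where g = "lu L"])
      (simp_all add: uu_inverse uu_app)
  then show ?case by (simp add: Xi_HL_def)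
next
  case (3 X X' Y Y' f g)
  then have ob: "X \<in> MP" "X' \<in> MP" "Y \<in> MP" "Y' \<in> MP" and f: "f \<in> Hm X X'" and g: "g \<in> Hm Y Y'" by simp_all
  note h = ob[THEN MP_hmod]
  have c: "TT (XX X') (XX Y') (Xi_mor k L X X' f) (Xi_mor k L Y Y' g) t \<in> carrier (LT (XX X') (XX Y'))"
    if "t \<in> carrier (LT (XX X) (XX Y))" for t
    by (rule lin_map_closed[OF TT_lin[OF XX_smod XX_smod XX_smod XX_smod] that]) (rule h Xi_mor_Hom f g)+
  show ?case
    using lin_map_closed[OF JL_lin[OF h(1,3)]]
    by (auto simp: compose_def rs_XH ob TT_def[symmetric] Jm_app c JL_natural[OF h f g]
      Xi_mor_eq[OF hmod_htensor[OF h(1,3)] hmod_htensor[OF h(2,4)] TenM_Hm[OF h(1,3,2,4) f g]] intro!: restrict_ext)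
next
  case (4 X Y Z)
  then have ob: "X \<in> MP" "Y \<in> MP" "Z \<in> MP" by simp_all
  note h = ob[THEN MP_hmod]
  note ob2 = MP_htensor[OF ob(1,2)] MP_htensor[OF ob(2,3)]
  note h2 = ob2[THEN MP_hmod]
  note r = rs_ds[OF LM_Ob[OF h(1,2)] LM_killed[OF h(1,2) ob2(1)]] rs_ds[OF LM_Ob[OF h(2,3)] LM_killed[OF h(2,3) ob2(2)]]
  note sm = LM_smod[OF h(1,2)] LM_smod[OF h(2,3)]
  note s = h[THEN XX_smod] h2[THEN XX_smod]
  have Ja: "Jm X Y \<in> ahom k S (LM (XX X) (XX Y)) (XX (htens X Y))" "Jm Y Z \<in> ahom k S (LM (XX Y) (XX Z)) (XX (htens Y Z))"
    unfolding Jm_def by (rule JL_ahom h)+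
  note c1 = lin_map_closed[OF TT_lin[OF sm(1) s(3,4,3) Ja(1) id_ahom[OF s(3)]]]
  note c2 = lin_map_closed[OF AA_lin[OF h]]
  note c3 = lin_map_closed[OF TT_lin[OF s(1) sm(2) s(1,5) id_ahom[OF s(1)] Ja(2)]]
  note c4 = lin_map_closed[OF JL_lin[OF h2(1) h(3)], unfolded htensor_simps]
  let ?w = "LT (LM (XX X) (XX Y)) (XX Z)"
  have id: "Idt MH (XH X) = ident (XX X)" for X by (simp add: ident_def)
  \<comment> \<open>Arrows of the target category are restricted to carriers. \<open>T1\<close>,
    \<open>T2\<close> and \<open>A\<close> expose the unrestricted maps \<open>TT\<close> and
    \<open>AA\<close>, to which \<open>JL_assoc\<close> refers.\<close>
  have T1: "TenM MH (TenO MH (XH X) (XH Y)) (XH (htens X Y)) (XH Z) (XH Z) (Jm X Y) (Idt MH (XH Z)) =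
      restrict (TT (XX (htens X Y)) (XX Z) (Jm X Y) (ident (XX Z))) (carrier ?w)"
    unfolding id by (simp add: rs_XH ob ob2 r TT_def)
  have T2: "TenM MH (XH X) (XH X) (TenO MH (XH Y) (XH Z)) (XH (htens Y Z)) (Idt MH (XH X)) (Jm Y Z) =
      restrict (TT (XX X) (XX (htens Y Z)) (ident (XX X)) (Jm Y Z)) (carrier (LT (XX X) (LM (XX Y) (XX Z))))"
    unfolding id by (simp add: rs_XH ob ob2 r TT_def)
  have A: "Assoc MH (XH X) (XH Y) (XH Z) = restrict (AA (XX X) (XX Y) (XX Z)) (carrier ?w)"
    by (simp add: rs_XH ob AA_def)
  have O: "carrier (TenO MH (TenO MH (XH X) (XH Y)) (XH Z)) = carrier ?w"
    "carrier (TenO MH (XH X) (XH Y)) = carrier (LT (XX X) (XX Y))"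
    by (simp_all add: rs_XH ob r)
  have "compose (carrier ?w) (Xi_mor k L (htens (htens X Y) Z) (htens X (htens Y Z)) (Assoc D X Y Z))
      (compose (carrier ?w) (Jm (htens X Y) Z) (restrict (TT (XX (htens X Y)) (XX Z) (Jm X Y) (ident (XX Z))) (carrier ?w))) =
    compose (carrier ?w) (Jm X (htens Y Z)) (compose (carrier ?w)
      (restrict (TT (XX X) (XX (htens Y Z)) (ident (XX X)) (Jm Y Z)) (carrier (LT (XX X) (LM (XX Y) (XX Z)))))
      (restrict (AA (XX X) (XX Y) (XX Z)) (carrier ?w)))"
    unfolding compose_def
  proof (rule restrict_ext)
    fix w assume w: "w \<in> carrier ?w"
    note c = c1[OF w] c2[OF w] c3[OF c2[OF w]]
    have "Xi_mor k L (htens (htens X Y) Z) (htens X (htens Y Z)) (Assoc D X Y Z)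
        (JL (htens X Y) Z (TT (XX (htens X Y)) (XX Z) (Jm X Y) (ident (XX Z)) w)) =
      tmap k (X \<otimes>\<^sub>k (Y \<otimes>\<^sub>k Z)) L (assoc k X Y Z) (\<lambda>m. m)
        (JL (htens X Y) Z (TT (XX (htens X Y)) (XX Z) (Jm X Y) (ident (XX Z)) w))"
      using Xi_mor_dh_app[OF hmod_htensor[OF h2(1) h(3)] hmod_htensor[OF h(1) h2(2)] assoc_hlin[OF h]] c4[OF c(1)] by simp
    then show "Xi_mor k L (htens (htens X Y) Z) (htens X (htens Y Z)) (Assoc D X Y Z)
        ((\<lambda>x\<in>carrier ?w. Jm (htens X Y) Z (restrict (TT (XX (htens X Y)) (XX Z) (Jm X Y) (ident (XX Z))) (carrier ?w) x)) w) =
      Jm X (htens Y Z) ((\<lambda>x\<in>carrier ?w. restrict (TT (XX X) (XX (htens Y Z)) (ident (XX X)) (Jm Y Z))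
        (carrier (LT (XX X) (LM (XX Y) (XX Z)))) (restrict (AA (XX X) (XX Y) (XX Z)) (carrier ?w) x)) w)"
      using JL_assoc[OF h w] c w by (simp add: Jm_app)
  qed
  then show ?case
    unfolding D_simps(4) T1 T2 A MH_simps(4) O .
next
  case (5 X)
  then have ob: "X \<in> MP" by simp
  note h = MP_hmod[OF ob]
  note s = LU_smod XX_smod[OF h] XX_smod[OF hmod_U]
  note r = rs_ds[OF LU_Ob LU_killed] rs_XH[OF ob] rs_XH[OF MP_U]
  have id: "Idt MH (XH X) = ident (XX X)" by (simp add: ident_def)
  let ?w = "LT LU (XX X)"
  note c = lin_map_closed[OF TT_lin[OF s(1,2,3,2) uu_ahom id_ahom[OF s(2)]]]
  note c' = lin_map_closed[OF JL_lin[OF hmod_U h], unfolded hunit_simps]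
  have T: "TenM MH (Unt MH) (XH U) (XH X) (XH X) uu (Idt MH (XH X)) =
      restrict (TT (XX U) (XX X) uu (ident (XX X))) (carrier ?w)"
    unfolding id by (simp add: r TT_def)
  have O: "carrier (TenO MH (Unt MH) (XH X)) = carrier ?w" by (simp add: r)
  have "compose (carrier ?w) (Xi_mor k L (htens U X) X (LUnit D X)) (compose (carrier ?w) (Jm U X)
      (restrict (TT (XX U) (XX X) uu (ident (XX X))) (carrier ?w))) = LUnit MH (XH X)"
    unfolding compose_def MH_ten(5) r
  proof (rule restrict_ext)
    fix w assume w: "w \<in> carrier ?w"
    have "Xi_mor k L (htens U X) X (LUnit D X) (JL U X (TT (XX U) (XX X) uu (ident (XX X)) w)) =
        tmap k X L (lu X) (\<lambda>m. m) (JL U X (TT (XX U) (XX X) uu (ident (XX X)) w))"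
      using Xi_mor_dh_app[OF hmod_htensor[OF hmod_U h] h lu_hlin[OF h]] c'[OF c[OF w]] by simp
    then show "Xi_mor k L (htens U X) X (LUnit D X)
        ((\<lambda>x\<in>carrier ?w. Jm U X (restrict (TT (XX U) (XX X) uu (ident (XX X))) (carrier ?w) x)) w) =
      tlift (XH X) (\<lambda>l m. act (XX X) (SR l) m) w"
      using JL_LUnit[OF h w] c[OF w] w by (simp add: Jm_app)
  qed
  then show ?case
    unfolding D_simps(4,5) T MH_simps(4) O .
next
  case (6 X)
  then have ob: "X \<in> MP" by simp
  note h = MP_hmod[OF ob]
  note s = LU_smod XX_smod[OF h] XX_smod[OF hmod_U]
  note r = rs_ds[OF LU_Ob LU_killed] rs_XH[OF ob] rs_XH[OF MP_U]
  have id: "Idt MH (XH X) = ident (XX X)" by (simp add: ident_def)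
  let ?w = "LT (XX X) LU"
  note c = lin_map_closed[OF TT_lin[OF s(2,1,2,3) id_ahom[OF s(2)] uu_ahom]]
  note c' = lin_map_closed[OF JL_lin[OF h hmod_U], unfolded hunit_simps]
  have T: "TenM MH (XH X) (XH X) (Unt MH) (XH U) (Idt MH (XH X)) uu =
      restrict (TT (XX X) (XX U) (ident (XX X)) uu) (carrier ?w)"
    unfolding id by (simp add: r TT_def)
  have O: "carrier (TenO MH (XH X) (Unt MH)) = carrier ?w" by (simp add: r)
  have "compose (carrier ?w) (Xi_mor k L (htens X U) X (RUnit D X)) (compose (carrier ?w) (Jm X U)
      (restrict (TT (XX X) (XX U) (ident (XX X)) uu) (carrier ?w))) = RUnit MH (XH X)"
    unfolding compose_def MH_ten(6) r
  proof (rule restrict_ext)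
    fix w assume w: "w \<in> carrier ?w"
    have "Xi_mor k L (htens X U) X (RUnit D X) (JL X U (TT (XX X) (XX U) (ident (XX X)) uu w)) =
        tmap k X L (ru X) (\<lambda>m. m) (JL X U (TT (XX X) (XX U) (ident (XX X)) uu w))"
      using Xi_mor_dh_app[OF hmod_htensor[OF h hmod_U] h ru_hlin[OF h]] c'[OF c[OF w]] by simp
    then show "Xi_mor k L (htens X U) X (RUnit D X)
        ((\<lambda>x\<in>carrier ?w. Jm X U (restrict (TT (XX X) (XX U) (ident (XX X)) uu) (carrier ?w) x)) w) =
      tlift (XH X) (\<lambda>m l. act (XX X) (TP l) m) w"
      using JL_RUnit[OF h w] c[OF w] w by (simp add: Jm_app)
  qed
  then show ?case
    unfolding D_simps(4,5) T MH_simps(4) O .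
qed

end

theorem proposition7p3:
  fixes k :: "'a univ ring" and H :: "('a univ, 'a univ) hopf" and R :: "'a univ"
    and L :: "('a univ, 'a univ, 'a univ) amod"
  assumes "base_ring k"
    and "quasitriangular_hopf_algebra k H R"
    and "module_algebra k H L"
    and "H_commutative R L"
  shows "braided_monoidal_category (dyn_cat_prime k H R L) (dyn_braiding k H R L) \<and>
    (\<forall>X\<in>M_prime k H R L. Xi k H R L X \<in> Ob (mod_cat k (smash k H L)) \<and>
       Xi_HL k H R L X \<in> Ob (Mod_HL k H R L) \<and>
       restr k H R L (Xi_HL k H R L X) = Xi k H R L X) \<and>
    category_isomorphism (dyn_cat_prime k H R L) (Mod0_HL k H R L)
      (\<lambda>X. (X, Xi_HL k H R L X)) (Xi_mor k L) \<and>
    (\<exists>J u. monoidal_functor (dyn_cat_prime k H R L) (Mod_HL k H R L)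
       (Xi_HL k H R L) (Xi_mor k L) J u) \<and>
    full_embedding (Mod_HL k H R L) (mod_cat k (smash k H L)) (restr k H R L) (\<lambda>M N f. f) \<and>
    fully_faithful_functor (Mod0_HL k H R L) (mod_cat k (smash k H L))
      (\<lambda>(X, M). restr k H R L M) (\<lambda>P Q f. f)"
proof -
  have k: "cring k" using assms(1) by (simp add: base_ring_def)
  interpret dynamical k H R L
    by (intro dynamical.intro qt_hopf.intro base.intro qt_hopf_axioms.intro dynamical_axioms.intro; fact)
  have "\<forall>X\<in>MP. XX X \<in> Ob (mod_cat k S) \<and> XH X \<in> Ob MH \<and> rs (XH X) = XX X"
    by (simp add: XX_Ob MP_hmod XH_Ob rs_XH)
  \<comment> \<open>The monoidal structure of the functor is witnessed by \<open>Jm\<close> and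
    \<open>uu\<close>.\<close>
  with braided_D Xi_isomorphism Xi_monoidal full_embedding_rs Mod0_full show ?thesis
    by blast
qed

end
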